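(* Let $\mathbb{K}\in\{\mathbb{R},\mathbb{C}\}$, let $\mathfrak{g}=\bigoplus_{i\in\mathbb{Z}}\mathfrak{g}_i$ be a finite dimensional $\mathbb{Z}$-graded $\mathbb{K}$-Lie superalgebra, $\mathfrak{g}_{\pm}=\bigoplus_{\pm i>0}\mathfrak{g}_i$, $\mathfrak{k}=\mathfrak{g}_0\oplus\mathfrak{g}_+$, and let $X_1,\dots,X_{r+s}$ be a homogeneous basis of $\mathfrak{g}_-$ with $X_i$ even for $i\le r$ and odd for $i>r$. For any character $\lambda:\mathfrak{g}_0\to\mathbb{K}$, the action $\pi$ of $\mathfrak{g}$ on $S(\mathfrak{g}_-)$ defined by $$\pi(X)Y:=\mu\left((\sigma^{-1}\otimes\mathrm{id})\,(X(\sigma(Y)\otimes1))\right),\qquad X\in\mathfrak{g},\ Y\in S(\mathfrak{g}_-),$$ where $X(\sigma(Y)\otimes 1)$ is computed in the $\mathfrak{g}$-module $U(\mathfrak{g})\otimes_{U(\mathfrak{k})}\mathbb{K}_\lambda\cong U(\mathfrak{g}_-)\otimes\mathbb{K}$, is given as follows. For $X\in\mathfrak{g}_-$: $$\pi(X)=X+\sum_{K>0}\frac{(-1)^{|K|}B_{|K|}}{K!}\,s^K_{\mathfrak{g}_-}(X)\,\partial^K .$$ For $X\in\mathfrak{g}_0$: $$\pi(X)=\lambda(X)+\sum_{i=1}^{r+s}[X,X_i]\,\partial^i .$$ For $X\in\mathfrak{g}_+$: $$\pi(X)=\sum_{i=1}^{r+s}\sum_{j=0}^{l}\sum_{K_1>0}\cdots\sum_{K_j>0}W_{i,K_1,\dots,K_j}(X)\,\partial^{K_j}\cdots\partial^{K_1}\partial^i+\sum_{i=1}^{r+s}\sum_{j=0}^{l-1}\sum_{K_1>0}\cdots\sum_{K_j>0}\lambda\left(H_{i,K_1,\dots,K_j}(X)\right)\partial^{K_j}\cdots\partial^{K_1}\partial^i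 .$$ Here all multi-indices $K,K_1,\dots,K_j$ run over $\mathbb{N}^{r|s}\setminus\{0\}$, and $l\geq 1$ is an integer such that $H_{i,K_1,\dots,K_l}(X)=0$ for all $i$ and all $K_1,\dots,K_l\in\mathbb{N}^{r|s}\setminus\{0\}$.
   Context: A $\mathbb{Z}$-grading of $\mathfrak{g}$ is a decomposition into super vector subspaces with $[\mathfrak{g}_i,\mathfrak{g}_j]\subset\mathfrak{g}_{i+j}$. A character is an even Lie superalgebra morphism to $\mathbb{K}$; $\lambda$ is extended to $\mathfrak{k}$ by $\lambda(\mathfrak{g}_+)=0$, and $\mathbb{K}_\lambda$ is the 1-dimensional $\mathfrak{k}$-module with $Xv=\lambda(X)v$. The isomorphism $U(\mathfrak{g}_-)\otimes\mathbb{K}\cong U(\mathfrak{g})\otimes_{U(\mathfrak{k})}\mathbb{K}_\lambda$ is the natural (PBW) one, and $\mu:S(\mathfrak{g}_-)\otimes\mathbb{K}\to S(\mathfrak{g}_-)$ is $Y\otimes a\mapsto aY$. In the formulas, elements of $\mathfrak{g}_-$ act on $S(\mathfrak{g}_-)$ by left multiplication. $\mathbb{N}=\{0,1,2,\dots\}$, $\mathbb{N}^{r|s}=\mathbb{N}^r\times\{0,1\}^s$; for $K=(k_1,\dots,k_r|k_{r+1},\dots,k_{r+s})$, $|K|=\sum_ik_i$, $K!=k_1!\cdots k_r!$, and $K>0$ means $K\neq0$. $\partial^i$ is the unique super derivation of the supersymmetric algebra $S(\mathfrak{g}_-)$ with $\partial^iX_j=\delta_{ij}$, and $\partial^K=(\partial^1)^{k_1}\cdots(\partial^{r+s})^{k_{r+s}}$.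 Bernoulli numbers: $B_0=1$, $B_1=-1/2$, $B_i=-\sum_{j=0}^{i-1}\binom{i}{j}\frac{B_j}{i-j+1}$ for $i>1$. Put $C_1=B_1=-1/2$ and $C_i=-B_i$ for $i\ge2$. Symmetrisation: for an associative superalgebra $A$, with product in $S(A)$ denoted $\bullet$, $\sigma:S(A)\to A$ is the linear map given, for homogeneous $a_i\in A$ with $a_i$ even for $i\le p$ and odd for $p<i\le p+q$, by $\sigma(a_1\bullet\cdots\bullet a_{p+q})=\frac{1}{(p+q)!}\sum_{\tau\in S_{p+q}}(-1)^{|\tau|}a_{\tau(1)}\cdots a_{\tau(p+q)}$, where $|\tau|$ is the number of pairs $(i,j)$ with $p<i<j\le p+q$ and $\tau^{-1}(i)>\tau^{-1}(j)$. Restricting from $S(U(\mathfrak{g}_-))$ to $S(\mathfrak{g}_-)$ gives the vector space isomorphism $\sigma:S(\mathfrak{g}_-)\to U(\mathfrak{g}_-)$. For $Z\in\mathfrak{g}$ let $\widetilde{\mathrm{ad}}_Z\in\mathrm{End}(\mathfrak{g})$, $\widetilde{\mathrm{ad}}_Z(Y)=[Y,Z]$. For $K\in\mathbb{N}^{r|s}$ and $X\in\mathfrak{g}$, $$s^K_{\mathfrak{g}_-}(X)=\sigma\left(\widetilde{\mathrm{ad}}_{X_1}^{\bullet k_1}\bullet\cdots\bullet\widetilde{\mathrm{ad}}_{X_{r+s}}^{\bullet k_{r+s}}\right)X,$$ with $\sigma$ the symmetrisation map for $A=\mathrm{End}(\mathfrak{g})$. For $X\in\mathfrak{k}$ and $1\le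 i\le r+s$ define $W_i(X)\in\mathfrak{g}_-$ and $H_i(X)\in\mathfrak{k}$ by $W_i(X)+H_i(X)=[X,X_i]$. Recursively, for $K_1,\dots,K_j\in\mathbb{N}^{r|s}\setminus\{0\}$, $j\ge1$, define $W_{i,K_1,\dots,K_j}(X)\in\mathfrak{g}_-$ and $H_{i,K_1,\dots,K_j}(X)\in\mathfrak{k}$ by $$W_{i,K_1,\dots,K_j}(X)+H_{i,K_1,\dots,K_j}(X)=\frac{(-1)^{|K_j|}C_{|K_j|}}{K_j!}\,s^{K_j}_{\mathfrak{g}_-}\left(H_{i,K_1,\dots,K_{j-1}}(X)\right)$$ (for $j=1$ the argument on the right is $H_i(X)$). The $j=0$ terms in the formula for $\pi(X)$ are $W_i(X)\partial^i$ and $\lambda(H_i(X))\partial^i$. Since $\mathfrak{g}$ is finite dimensional only finitely many gradation components are nonzero, so all sums are finite and an $l$ as in the statement exists. *)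

theory Defs
  imports
    Complex_Main
    "HOL-Library.Poly_Mapping"
    "HOL-Library.Set_Algebras"
    "HOL-Library.Z2"
    "HOL-Combinatorics.Permutations"
    "HOL-Algebra.Module"
    "HOL-Algebra.QuotRing"
begin

class real_or_complex = field_char_0 +
  assumes real_or_complex:
    "(\<exists>f :: real \<Rightarrow> 'a. bij f \<and> (\<forall>x y. f (x + y) = f x + f y) \<and> (\<forall>x y. f (x * y) = f x * f y)) \<or>
     (\<exists>f :: complex \<Rightarrow> 'a. bij f \<and> (\<forall>x y. f (x + y) = f x + f y) \<and> (\<forall>x y. f (x * y) = f x * f y))"

instance real :: real_or_complex
  by standard (rule disjI1, rule exI[of _ id], simp)

instance complex :: real_or_complex
  by standard (rule disjI2, rule exI[of _ id], simp)

text \<open>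
  The underlying vector space is a whole type. \<open>parity L\<close> is the super vector space structure,
  indexed by the two-element field \<^typ>\<open>bit\<close>; \<open>grade L\<close> is the grading by the integers.
\<close>

record ('k, 'g) lsa =
  lscale :: "'k \<Rightarrow> 'g \<Rightarrow> 'g"
  lbracket :: "'g \<Rightarrow> 'g \<Rightarrow> 'g"
  parity :: "bit \<Rightarrow> 'g set"
  grade :: "int \<Rightarrow> 'g set"

definition koszul :: "bit \<Rightarrow> bit \<Rightarrow> 'k::ring_1" where
  "koszul p q = (if p = 1 \<and> q = 1 then - 1 else 1)"

definition decomposes :: "('i \<Rightarrow> 'g::ab_group_add set) \<Rightarrow> 'g \<Rightarrow> ('i \<Rightarrow> 'g) \<Rightarrow> bool" where
  "decomposes V x f \<longleftrightarrow>
     (\<forall>i. f i \<in> V i) \<and> finite {i. f i \<noteq> 0} \<and> x = (\<Sum>i | f i \<noteq> 0. f i)"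

definition component :: "('i \<Rightarrow> 'g::ab_group_add set) \<Rightarrow> 'i \<Rightarrow> 'g \<Rightarrow> 'g" where
  "component V i x = (THE f. decomposes V x f) i"

definition direct_sum_decomposition ::
    "('k::field \<Rightarrow> 'g::ab_group_add \<Rightarrow> 'g) \<Rightarrow> ('i \<Rightarrow> 'g set) \<Rightarrow> bool" where
  "direct_sum_decomposition sc V \<longleftrightarrow>
     (\<forall>i. Modules.module.subspace sc (V i)) \<and> (\<forall>x. \<exists>!f. decomposes V x f)"

definition lie_superalgebra :: "('k::field, 'g::ab_group_add, 'm) lsa_scheme \<Rightarrow> bool" where
  "lie_superalgebra L \<longleftrightarrow>
     vector_space (lscale L) \<and>
     direct_sum_decomposition (lscale L) (parity L) \<and>
     (\<forall>x. Vector_Spaces.linear (lscale L) (lscale L) (\<lambda>y. lbracket L x y)) \<and>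
     (\<forall>y. Vector_Spaces.linear (lscale L) (lscale L) (\<lambda>x. lbracket L x y)) \<and>
     (\<forall>p q. \<forall>x\<in>parity L p. \<forall>y\<in>parity L q. lbracket L x y \<in> parity L (p + q)) \<and>
     (\<forall>p q. \<forall>x\<in>parity L p. \<forall>y\<in>parity L q.
        lbracket L x y = - lscale L (koszul p q) (lbracket L y x)) \<and>
     (\<forall>p q. \<forall>x\<in>parity L p. \<forall>y\<in>parity L q. \<forall>z.
        lbracket L x (lbracket L y z) =
          lbracket L (lbracket L x y) z + lscale L (koszul p q) (lbracket L y (lbracket L x z)))"

definition graded_lie_superalgebra :: "('k::field, 'g::ab_group_add, 'm) lsa_scheme \<Rightarrow> bool" where
  "graded_lie_superalgebra L \<longleftrightarrow>
     lie_superalgebra L \<and>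
     direct_sum_decomposition (lscale L) (grade L) \<and>
     (\<forall>i. \<forall>x\<in>grade L i. \<forall>p. component (parity L) p x \<in> grade L i) \<and>
     (\<forall>i j. \<forall>x\<in>grade L i. \<forall>y\<in>grade L j. lbracket L x y \<in> grade L (i + j))"

definition finite_dimensional :: "('k::field, 'g::ab_group_add, 'm) lsa_scheme \<Rightarrow> bool" where
  "finite_dimensional L \<longleftrightarrow> (\<exists>B. finite B \<and> Modules.module.span (lscale L) B = UNIV)"

definition g_minus :: "('k::field, 'g::ab_group_add, 'm) lsa_scheme \<Rightarrow> 'g set" where
  "g_minus L = Modules.module.span (lscale L) (\<Union>i\<in>{..<0}. grade L i)"

definition g_plus :: "('k::field, 'g::ab_group_add, 'm) lsa_scheme \<Rightarrow> 'g set" where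
  "g_plus L = Modules.module.span (lscale L) (\<Union>i\<in>{0<..}. grade L i)"

definition g_k :: "('k::field, 'g::ab_group_add, 'm) lsa_scheme \<Rightarrow> 'g set" where
  "g_k L = Modules.module.span (lscale L) (grade L 0 \<union> g_plus L)"

text \<open>The target is the abelian, purely even Lie superalgebra given by the field.\<close>

definition lsa_character :: "('k::field, 'g::ab_group_add, 'm) lsa_scheme \<Rightarrow> ('g \<Rightarrow> 'k) \<Rightarrow> bool" where
  "lsa_character L lam \<longleftrightarrow>
     (\<forall>x\<in>grade L 0. \<forall>y\<in>grade L 0. lam (x + y) = lam x + lam y) \<and>
     (\<forall>c. \<forall>x\<in>grade L 0. lam (lscale L c x) = c * lam x) \<and>
     (\<forall>x\<in>grade L 0. \<forall>y\<in>grade L 0. lam (lbracket L x y) = 0) \<and>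
     (\<forall>x\<in>grade L 0 \<inter> parity L 1. lam x = 0)"

definition extend_character ::
    "('k::field, 'g::ab_group_add, 'm) lsa_scheme \<Rightarrow> ('g \<Rightarrow> 'k) \<Rightarrow> 'g \<Rightarrow> 'k" where
  "extend_character L lam x = lam (component (grade L) 0 x)"

text \<open>Bases of \<open>g_minus\<close> are indexed from 0: even for \<open>i < r\<close>, odd for \<open>r \<le> i < r + s\<close>.\<close>

definition homogeneous_basis ::
    "('k::field, 'g::ab_group_add, 'm) lsa_scheme \<Rightarrow> nat \<Rightarrow> nat \<Rightarrow> (nat \<Rightarrow> 'g) \<Rightarrow> bool" where
  "homogeneous_basis L r s X \<longleftrightarrow>
     inj_on X {..<r + s} \<and>
     \<not> Modules.module.dependent (lscale L) (X ` {..<r + s}) \<and>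
     Modules.module.span (lscale L) (X ` {..<r + s}) = g_minus L \<and>
     (\<forall>i<r. X i \<in> parity L 0) \<and>
     (\<forall>i. r \<le> i \<and> i < r + s \<longrightarrow> X i \<in> parity L 1)"

text \<open>
  With concatenation as addition of lists, \<open>'g list \<Rightarrow>\<^sub>0 'k\<close> with its convolution product is the free
  associative algebra on \<open>'g\<close>; \<open>single [x] 1\<close> is the generator \<open>x\<close> and \<open>single [] c\<close> the scalar \<open>c\<close>.
\<close>

instantiation list :: (type) monoid_add
begin
definition zero_list :: "'a list" where "zero_list = []"
definition plus_list :: "'a list \<Rightarrow> 'a list \<Rightarrow> 'a list" where "plus_list = (@)"
instance by standard (simp_all add: zero_list_def plus_list_def)
end

definition free_algebra :: "'g set \<Rightarrow> ('g list \<Rightarrow>\<^sub>0 'k::field) ring" where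
  "free_algebra V =
     \<lparr>carrier = {p. Poly_Mapping.keys p \<subseteq> lists V}, mult = (*), one = 1, zero = 0, add = (+)\<rparr>"

definition pclass :: "'g set \<Rightarrow> ('g list \<Rightarrow>\<^sub>0 'k::field) set \<Rightarrow> ('g list \<Rightarrow>\<^sub>0 'k) \<Rightarrow> ('g list \<Rightarrow>\<^sub>0 'k) set" where
  "pclass V R p = genideal (free_algebra V) R +>\<^bsub>free_algebra V\<^esub> p"

definition presented_algebra ::
    "'g set \<Rightarrow> ('g list \<Rightarrow>\<^sub>0 'k::field) set \<Rightarrow> ('k, ('g list \<Rightarrow>\<^sub>0 'k) set) module" where
  "presented_algebra V R =
     (let Q = free_algebra V Quot genideal (free_algebra V) R in
      \<lparr>carrier = carrier Q, mult = mult Q, one = one Q, zero = zero Q, add = add Q,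
       smult = (\<lambda>c a. pclass V R (Poly_Mapping.single [] c) \<otimes>\<^bsub>Q\<^esub> a)\<rparr>)"

text \<open>Modulo \<open>linear_relations\<close> the free algebra on the set \<open>V\<close> becomes the tensor algebra of the
  vector space \<open>V\<close>.\<close>

definition linear_relations ::
    "('k::field, 'g::ab_group_add, 'm) lsa_scheme \<Rightarrow> 'g set \<Rightarrow> ('g list \<Rightarrow>\<^sub>0 'k) set" where
  "linear_relations L V =
     {Poly_Mapping.single [x + y] 1 - Poly_Mapping.single [x] 1 - Poly_Mapping.single [y] 1
        | x y. x \<in> V \<and> y \<in> V} \<union>
     {Poly_Mapping.single [lscale L c x] 1 - Poly_Mapping.single [x] c | c x. x \<in> V}"

definition sym_relations ::
    "('k::field, 'g::ab_group_add, 'm) lsa_scheme \<Rightarrow> 'g set \<Rightarrow> ('g list \<Rightarrow>\<^sub>0 'k) set" where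
  "sym_relations L V = linear_relations L V \<union>
     {Poly_Mapping.single [x, y] 1 - Poly_Mapping.single [y, x] (koszul p q)
        | x y p q. x \<in> V \<inter> parity L p \<and> y \<in> V \<inter> parity L q}"

definition env_relations ::
    "('k::field, 'g::ab_group_add, 'm) lsa_scheme \<Rightarrow> 'g set \<Rightarrow> ('g list \<Rightarrow>\<^sub>0 'k) set" where
  "env_relations L V = linear_relations L V \<union>
     {Poly_Mapping.single [x, y] 1 - Poly_Mapping.single [y, x] (koszul p q)
         - Poly_Mapping.single [lbracket L x y] 1
        | x y p q. x \<in> V \<inter> parity L p \<and> y \<in> V \<inter> parity L q}"

definition Sym ::
    "('k::field, 'g::ab_group_add, 'm) lsa_scheme \<Rightarrow> 'g set \<Rightarrow> ('k, ('g list \<Rightarrow>\<^sub>0 'k) set) module" where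
  "Sym L V = presented_algebra V (sym_relations L V)"

definition Env ::
    "('k::field, 'g::ab_group_add, 'm) lsa_scheme \<Rightarrow> 'g set \<Rightarrow> ('k, ('g list \<Rightarrow>\<^sub>0 'k) set) module" where
  "Env L V = presented_algebra V (env_relations L V)"

definition sgen :: "('k::field, 'g::ab_group_add, 'm) lsa_scheme \<Rightarrow> 'g set \<Rightarrow> 'g \<Rightarrow> ('g list \<Rightarrow>\<^sub>0 'k) set" where
  "sgen L V x = pclass V (sym_relations L V) (Poly_Mapping.single [x] 1)"

definition ugen :: "('k::field, 'g::ab_group_add, 'm) lsa_scheme \<Rightarrow> 'g set \<Rightarrow> 'g \<Rightarrow> ('g list \<Rightarrow>\<^sub>0 'k) set" where
  "ugen L V x = pclass V (env_relations L V) (Poly_Mapping.single [x] 1)"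

text \<open>The map into \<open>Env L UNIV\<close>, the enveloping algebra of the whole Lie superalgebra, induced by
  the inclusion of a subalgebra.\<close>

definition env_incl ::
    "('k::field, 'g::ab_group_add, 'm) lsa_scheme \<Rightarrow> ('g list \<Rightarrow>\<^sub>0 'k) set \<Rightarrow> ('g list \<Rightarrow>\<^sub>0 'k) set" where
  "env_incl L A = (\<Union>p\<in>A. pclass UNIV (env_relations L UNIV) p)"

definition linear_map :: "('k, 'a) module \<Rightarrow> ('k, 'b) module \<Rightarrow> ('a \<Rightarrow> 'b) \<Rightarrow> bool" where
  "linear_map A B f \<longleftrightarrow>
     f \<in> carrier A \<rightarrow>\<^sub>E carrier B \<and>
     (\<forall>a\<in>carrier A. \<forall>b\<in>carrier A. f (a \<oplus>\<^bsub>A\<^esub> b) = f a \<oplus>\<^bsub>B\<^esub> f b) \<and>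
     (\<forall>c. \<forall>a\<in>carrier A. f (c \<odot>\<^bsub>A\<^esub> a) = c \<odot>\<^bsub>B\<^esub> f a)"

definition list_prod :: "('a, 'm) monoid_scheme \<Rightarrow> 'a list \<Rightarrow> 'a" where
  "list_prod A as = foldr (mult A) as (one A)"

definition odd_inversions :: "nat \<Rightarrow> nat \<Rightarrow> (nat \<Rightarrow> nat) \<Rightarrow> nat" where
  "odd_inversions p n \<tau> = card {(i, j). p \<le> i \<and> i < j \<and> j < n \<and> inv_into UNIV \<tau> i > inv_into UNIV \<tau> j}"

text \<open>The value of the symmetrisation map of \<open>A\<close> on the product of the list \<open>as\<close>, whose first \<open>p\<close>
  entries are even and whose other entries are odd.\<close>

definition symmetrise :: "('k::field_char_0, 'a) module \<Rightarrow> nat \<Rightarrow> 'a list \<Rightarrow> 'a" where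
  "symmetrise A p as =
     (let n = length as in
      (1 / fact n) \<odot>\<^bsub>A\<^esub>
        finsum A (\<lambda>\<tau>. (- 1) ^ odd_inversions p n \<tau> \<odot>\<^bsub>A\<^esub> list_prod A (map (\<lambda>i. as ! \<tau> i) [0..<n]))
          {\<tau>. \<tau> permutes {..<n}})"

definition sigma ::
    "('k::field_char_0, 'g::ab_group_add, 'm) lsa_scheme \<Rightarrow> ('g list \<Rightarrow>\<^sub>0 'k) set \<Rightarrow> ('g list \<Rightarrow>\<^sub>0 'k) set" where
  "sigma L = (let V = g_minus L in
     THE f. linear_map (Sym L V) (Env L V) f \<and>
       (\<forall>es\<in>lists (V \<inter> parity L 0). \<forall>os\<in>lists (V \<inter> parity L 1).
          f (list_prod (Sym L V) (map (sgen L V) (es @ os))) =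
            symmetrise (Env L V) (length es) (map (ugen L V) (es @ os))))"

definition End_algebra :: "('k::field, 'g::ab_group_add, 'm) lsa_scheme \<Rightarrow> ('k, 'g \<Rightarrow> 'g) module" where
  "End_algebra L =
     \<lparr>carrier = {f. Vector_Spaces.linear (lscale L) (lscale L) f}, mult = (\<circ>), one = id,
      zero = (\<lambda>x. 0), add = (\<lambda>f h x. f x + h x), smult = (\<lambda>c f x. lscale L c (f x))\<rparr>"

text \<open>
  Tensor products with the one-dimensional space \<open>'k\<close>, as quotients of the free vector space on pairs.
  Each \<open>(\<rho>, \<phi>) \<in> T\<close> stands for one ring element, acting by \<open>\<rho>\<close> from the right on \<open>M\<close> and by \<open>\<phi>\<close> from
  the left on \<open>'k\<close>. Bilinearity over \<open>'k\<close> is always imposed, so \<open>T = {}\<close> gives the tensor product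
  over the ground field.
\<close>

definition tensor_null ::
    "('k::field, 'a) module \<Rightarrow> (('a \<Rightarrow> 'a) \<times> ('k \<Rightarrow> 'k)) set \<Rightarrow> (('a \<times> 'k) \<Rightarrow>\<^sub>0 'k) set" where
  "tensor_null M T = Modules.module.span (\<lambda>c. Poly_Mapping.map ((*) c))
     ({Poly_Mapping.single (u \<oplus>\<^bsub>M\<^esub> u', a) 1 - Poly_Mapping.single (u, a) 1 - Poly_Mapping.single (u', a) 1
         | u u' a. u \<in> carrier M \<and> u' \<in> carrier M} \<union>
      {Poly_Mapping.single (u, a + a') 1 - Poly_Mapping.single (u, a) 1 - Poly_Mapping.single (u, a') 1
         | u a a'. u \<in> carrier M} \<union>
      {Poly_Mapping.single (c \<odot>\<^bsub>M\<^esub> u, a) 1 - Poly_Mapping.single (u, a) c | c u a. u \<in> carrier M} \<union>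
      {Poly_Mapping.single (u, c * a) 1 - Poly_Mapping.single (u, a) c | c u a. u \<in> carrier M} \<union>
      {Poly_Mapping.single (\<rho> u, a) 1 - Poly_Mapping.single (u, \<phi> a) 1
         | \<rho> \<phi> u a. (\<rho>, \<phi>) \<in> T \<and> u \<in> carrier M})"

definition tensor_carrier ::
    "('k::field, 'a) module \<Rightarrow> (('a \<Rightarrow> 'a) \<times> ('k \<Rightarrow> 'k)) set \<Rightarrow> (('a \<times> 'k) \<Rightarrow>\<^sub>0 'k) set set" where
  "tensor_carrier M T = {p +o tensor_null M T | p. Poly_Mapping.keys p \<subseteq> carrier M \<times> UNIV}"

definition pure_tensor ::
    "('k::field, 'a) module \<Rightarrow> (('a \<Rightarrow> 'a) \<times> ('k \<Rightarrow> 'k)) set \<Rightarrow> 'a \<Rightarrow> 'k \<Rightarrow> (('a \<times> 'k) \<Rightarrow>\<^sub>0 'k) set" where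
  "pure_tensor M T u a = Poly_Mapping.single (u, a) 1 +o tensor_null M T"

text \<open>The map \<open>f \<otimes> id\<close> with values in the tensor product determined by \<open>M\<close> and \<open>T\<close>.\<close>

definition tensor_map ::
    "('k::field, 'b) module \<Rightarrow> (('b \<Rightarrow> 'b) \<times> ('k \<Rightarrow> 'k)) set \<Rightarrow> ('a \<Rightarrow> 'b) \<Rightarrow>
     (('a \<times> 'k) \<Rightarrow>\<^sub>0 'k) set \<Rightarrow> (('b \<times> 'k) \<Rightarrow>\<^sub>0 'k) set" where
  "tensor_map M T f C =
     (\<Union>p\<in>C. (\<Sum>(u, a)\<in>Poly_Mapping.keys p. Poly_Mapping.single (f u, a) (Poly_Mapping.lookup p (u, a)))
               +o tensor_null M T)"

text \<open>The map \<open>Y \<otimes> a \<mapsto> a Y\<close>.\<close>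

definition tensor_mu :: "('k::field, 'a) module \<Rightarrow> (('a \<times> 'k) \<Rightarrow>\<^sub>0 'k) set \<Rightarrow> 'a" where
  "tensor_mu M C = (THE y. \<exists>p\<in>C. y =
     finsum M (\<lambda>(u, a). (Poly_Mapping.lookup p (u, a) * a) \<odot>\<^bsub>M\<^esub> u) (Poly_Mapping.keys p))"

text \<open>The scalar by which an element of the enveloping algebra of \<open>g_k L\<close> acts on the
  one-dimensional module given by the (extended) character.\<close>

definition env_character ::
    "('k::field, 'g::ab_group_add, 'm) lsa_scheme \<Rightarrow> ('g \<Rightarrow> 'k) \<Rightarrow> ('g list \<Rightarrow>\<^sub>0 'k) set \<Rightarrow> 'k" where
  "env_character L lam h = (THE c. \<exists>p\<in>h. c =
     (\<Sum>w\<in>Poly_Mapping.keys p. Poly_Mapping.lookup p w * prod_list (map (extend_character L lam) w)))"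

definition k_balance ::
    "('k::field, 'g::ab_group_add, 'm) lsa_scheme \<Rightarrow> ('g \<Rightarrow> 'k) \<Rightarrow>
     ((('g list \<Rightarrow>\<^sub>0 'k) set \<Rightarrow> ('g list \<Rightarrow>\<^sub>0 'k) set) \<times> ('k \<Rightarrow> 'k)) set" where
  "k_balance L lam =
     {(\<lambda>u. u \<otimes>\<^bsub>Env L UNIV\<^esub> env_incl L h, \<lambda>a. env_character L lam h * a) | h. h \<in> carrier (Env L (g_k L))}"

definition natural_iso ::
    "('k::field, 'g::ab_group_add, 'm) lsa_scheme \<Rightarrow> ('g \<Rightarrow> 'k) \<Rightarrow>
     ((('g list \<Rightarrow>\<^sub>0 'k) set \<times> 'k) \<Rightarrow>\<^sub>0 'k) set \<Rightarrow> ((('g list \<Rightarrow>\<^sub>0 'k) set \<times> 'k) \<Rightarrow>\<^sub>0 'k) set" where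
  "natural_iso L lam = tensor_map (Env L UNIV) (k_balance L lam) (env_incl L)"

definition induced_action ::
    "('k::field, 'g::ab_group_add, 'm) lsa_scheme \<Rightarrow> ('g \<Rightarrow> 'k) \<Rightarrow> 'g \<Rightarrow>
     ((('g list \<Rightarrow>\<^sub>0 'k) set \<times> 'k) \<Rightarrow>\<^sub>0 'k) set \<Rightarrow> ((('g list \<Rightarrow>\<^sub>0 'k) set \<times> 'k) \<Rightarrow>\<^sub>0 'k) set" where
  "induced_action L lam x =
     tensor_map (Env L UNIV) (k_balance L lam) (\<lambda>u. ugen L UNIV x \<otimes>\<^bsub>Env L UNIV\<^esub> u)"

definition pi_action ::
    "('k::field_char_0, 'g::ab_group_add, 'm) lsa_scheme \<Rightarrow> ('g \<Rightarrow> 'k) \<Rightarrow> 'g \<Rightarrow>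
     ('g list \<Rightarrow>\<^sub>0 'k) set \<Rightarrow> ('g list \<Rightarrow>\<^sub>0 'k) set" where
  "pi_action L lam x Y =
     (let S = Sym L (g_minus L);
          U = Env L (g_minus L);
          \<Phi> = natural_iso L lam;
          \<sigma>_inv = inv_into (carrier S) (sigma L)
      in tensor_mu S (tensor_map S {} \<sigma>_inv
           (inv_into (tensor_carrier U {}) \<Phi>
             (induced_action L lam x (\<Phi> (pure_tensor U {} (sigma L Y) 1))))))"

definition sym_parity ::
    "('k::field, 'g::ab_group_add, 'm) lsa_scheme \<Rightarrow> 'g set \<Rightarrow> bit \<Rightarrow> ('g list \<Rightarrow>\<^sub>0 'k) set set" where
  "sym_parity L V q = {pclass V (sym_relations L V) p | p.
     p \<in> carrier (free_algebra V) \<and>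
     (\<forall>w\<in>Poly_Mapping.keys p. \<exists>ps. list_all2 (\<lambda>x d. x \<in> parity L d) w ps \<and> sum_list ps = q)}"

definition super_derivation ::
    "('k::field, 'a) module \<Rightarrow> (bit \<Rightarrow> 'a set) \<Rightarrow> bit \<Rightarrow> ('a \<Rightarrow> 'a) \<Rightarrow> bool" where
  "super_derivation A P d D \<longleftrightarrow>
     linear_map A A D \<and>
     (\<forall>q. \<forall>a\<in>P q. D a \<in> P (d + q)) \<and>
     (\<forall>q. \<forall>a\<in>P q. \<forall>b\<in>carrier A.
        D (a \<otimes>\<^bsub>A\<^esub> b) = D a \<otimes>\<^bsub>A\<^esub> b \<oplus>\<^bsub>A\<^esub> koszul d q \<odot>\<^bsub>A\<^esub> (a \<otimes>\<^bsub>A\<^esub> D b))"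

definition partial ::
    "('k::field, 'g::ab_group_add, 'm) lsa_scheme \<Rightarrow> nat \<Rightarrow> nat \<Rightarrow> (nat \<Rightarrow> 'g) \<Rightarrow> nat \<Rightarrow>
     ('g list \<Rightarrow>\<^sub>0 'k) set \<Rightarrow> ('g list \<Rightarrow>\<^sub>0 'k) set" where
  "partial L r s X i = (let V = g_minus L; S = Sym L V in
     THE D. super_derivation S (sym_parity L V) (if i < r then 0 else 1) D \<and>
       (\<forall>j<r + s. D (sgen L V (X j)) = (if i = j then \<one>\<^bsub>S\<^esub> else \<zero>\<^bsub>S\<^esub>)))"

definition multi_indices :: "nat \<Rightarrow> nat \<Rightarrow> (nat \<Rightarrow> nat) set" where
  "multi_indices r s =
     {K. (\<forall>i. r \<le> i \<and> i < r + s \<longrightarrow> K i \<le> 1) \<and> (\<forall>i\<ge>r + s. K i = 0)}"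

definition pos_indices :: "nat \<Rightarrow> nat \<Rightarrow> (nat \<Rightarrow> nat) set" where
  "pos_indices r s = multi_indices r s - {\<lambda>_. 0}"

definition mi_size :: "nat \<Rightarrow> nat \<Rightarrow> (nat \<Rightarrow> nat) \<Rightarrow> nat" where
  "mi_size r s K = (\<Sum>i<r + s. K i)"

definition mi_fact :: "nat \<Rightarrow> (nat \<Rightarrow> nat) \<Rightarrow> 'k::field_char_0" where
  "mi_fact r K = (\<Prod>i<r. fact (K i))"

definition partial_pow ::
    "('k::field, 'g::ab_group_add, 'm) lsa_scheme \<Rightarrow> nat \<Rightarrow> nat \<Rightarrow> (nat \<Rightarrow> 'g) \<Rightarrow> (nat \<Rightarrow> nat) \<Rightarrow>
     ('g list \<Rightarrow>\<^sub>0 'k) set \<Rightarrow> ('g list \<Rightarrow>\<^sub>0 'k) set" where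
  "partial_pow L r s X K = foldr (\<lambda>i f. (partial L r s X i ^^ K i) \<circ> f) [0..<r + s] id"

fun bernoulli :: "nat \<Rightarrow> 'k::field_char_0" where
  "bernoulli 0 = 1"
| "bernoulli (Suc 0) = - 1 / 2"
| "bernoulli (Suc (Suc n)) =
     - (\<Sum>j<n + 2. of_nat ((n + 2) choose j) * (bernoulli j / of_nat (n + 2 - j + 1)))"

text \<open>Only used for \<open>n \<ge> 1\<close>.\<close>

definition C_coeff :: "nat \<Rightarrow> 'k::field_char_0" where
  "C_coeff n = (if n = 1 then bernoulli 1 else - bernoulli n)"

definition ad_tilde :: "('k, 'g, 'm) lsa_scheme \<Rightarrow> 'g \<Rightarrow> 'g \<Rightarrow> 'g" where
  "ad_tilde L z = (\<lambda>y. lbracket L y z)"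

definition s_map ::
    "('k::field_char_0, 'g::ab_group_add, 'm) lsa_scheme \<Rightarrow> nat \<Rightarrow> nat \<Rightarrow> (nat \<Rightarrow> 'g) \<Rightarrow> (nat \<Rightarrow> nat) \<Rightarrow>
     'g \<Rightarrow> 'g" where
  "s_map L r s X K =
     symmetrise (End_algebra L) (\<Sum>i<r. K i)
       (concat (map (\<lambda>i. replicate (K i) (ad_tilde L (X i))) [0..<r + s]))"

definition minus_part :: "('k::field, 'g::ab_group_add, 'm) lsa_scheme \<Rightarrow> 'g \<Rightarrow> 'g" where
  "minus_part L v = (THE w. w \<in> g_minus L \<and> v - w \<in> g_k L)"

definition k_part :: "('k::field, 'g::ab_group_add, 'm) lsa_scheme \<Rightarrow> 'g \<Rightarrow> 'g" where
  "k_part L v = (THE h. h \<in> g_k L \<and> v - h \<in> g_minus L)"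

definition WH_step ::
    "('k::field_char_0, 'g::ab_group_add, 'm) lsa_scheme \<Rightarrow> nat \<Rightarrow> nat \<Rightarrow> (nat \<Rightarrow> 'g) \<Rightarrow> (nat \<Rightarrow> nat) \<Rightarrow>
     'g \<Rightarrow> 'g" where
  "WH_step L r s X K h =
     lscale L ((- 1) ^ mi_size r s K * C_coeff (mi_size r s K) / mi_fact r K) (s_map L r s X K h)"

text \<open>The list \<open>Ks\<close> is \<open>[K_1, ..., K_j]\<close>; the empty list gives the case \<open>j = 0\<close>.\<close>

definition H_coeff ::
    "('k::field_char_0, 'g::ab_group_add, 'm) lsa_scheme \<Rightarrow> nat \<Rightarrow> nat \<Rightarrow> (nat \<Rightarrow> 'g) \<Rightarrow> nat \<Rightarrow>
     (nat \<Rightarrow> nat) list \<Rightarrow> 'g \<Rightarrow> 'g" where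
  "H_coeff L r s X i Ks x =
     foldl (\<lambda>h K. k_part L (WH_step L r s X K h)) (k_part L (lbracket L x (X i))) Ks"

definition W_coeff ::
    "('k::field_char_0, 'g::ab_group_add, 'm) lsa_scheme \<Rightarrow> nat \<Rightarrow> nat \<Rightarrow> (nat \<Rightarrow> 'g) \<Rightarrow> nat \<Rightarrow>
     (nat \<Rightarrow> nat) list \<Rightarrow> 'g \<Rightarrow> 'g" where
  "W_coeff L r s X i Ks x = minus_part L
     (if Ks = [] then lbracket L x (X i)
      else WH_step L r s X (last Ks) (H_coeff L r s X i (butlast Ks) x))"

definition index_lists :: "nat \<Rightarrow> nat \<Rightarrow> nat \<Rightarrow> (nat \<Rightarrow> nat) list set" where
  "index_lists r s j = {Ks. length Ks = j \<and> set Ks \<subseteq> pos_indices r s}"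

text \<open>The operator \<open>\<partial>^K_j ... \<partial>^K_1 \<partial>^i\<close>: the head of the list acts directly after \<open>\<partial>^i\<close>.\<close>

definition partial_list ::
    "('k::field, 'g::ab_group_add, 'm) lsa_scheme \<Rightarrow> nat \<Rightarrow> nat \<Rightarrow> (nat \<Rightarrow> 'g) \<Rightarrow> nat \<Rightarrow>
     (nat \<Rightarrow> nat) list \<Rightarrow> ('g list \<Rightarrow>\<^sub>0 'k) set \<Rightarrow> ('g list \<Rightarrow>\<^sub>0 'k) set" where
  "partial_list L r s X i Ks Y = fold (partial_pow L r s X) Ks (partial L r s X i Y)"

definition H_vanish ::
    "('k::field_char_0, 'g::ab_group_add, 'm) lsa_scheme \<Rightarrow> nat \<Rightarrow> nat \<Rightarrow> (nat \<Rightarrow> 'g) \<Rightarrow> 'g \<Rightarrow> nat \<Rightarrow> bool" where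
  "H_vanish L r s X x l \<longleftrightarrow> (\<forall>i<r + s. \<forall>Ks\<in>index_lists r s l. H_coeff L r s X i Ks x = 0)"

text \<open>Sums over infinite index sets with finitely many nonzero terms (\<^const>\<open>finsum\<close> alone returns
  zero on an infinite index set).\<close>

definition supp_finsum :: "('k, 'a) module \<Rightarrow> ('i \<Rightarrow> 'a) \<Rightarrow> 'i set \<Rightarrow> 'a" where
  "supp_finsum M f I = finsum M f {i \<in> I. f i \<noteq> \<zero>\<^bsub>M\<^esub>}"

end

theory Submission
  imports Defs
begin

text \<open>
  Let \<open>S\<^sub>n(p)\<close> be the degree \<open>n\<close> part of the symmetrisation of \<open>p\<close>, applied to a vector of a module over the
  Lie superalgebra. It satisfies \<open>n S\<^sub>n(p) = \<Sum> X\<^sub>i S\<^sub>n\<^sub>-\<^sub>1(\<partial>\<^sup>i p)\<close>. Put \<open>A\<^sub>n(h, p) = h S\<^sub>n(p)\<close>, and let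
  \<open>B\<^sub>n(h, p)\<close> be the symmetrisation of the product of \<open>h\<close> with the degree \<open>n\<close> part of \<open>p\<close>. Both obey a first
  order recursion in \<open>n\<close>, and with \<open>(D f)(h, p) = \<Sum> f([h, X\<^sub>i], \<partial>\<^sup>i p)\<close> the recursions give
  \<open>B\<^sub>n = \<Sum> (-1)\<^sup>k / (k + 1)! D\<^sup>k A\<^sub>n\<^sub>-\<^sub>k\<close>, a series in \<open>D\<close> whose inverse has the Bernoulli numbers as coefficients.
  Powers of \<open>D\<close> unfold to the maps \<open>s\<^sup>K\<close> and the operators \<open>\<partial>\<^sup>K\<close>. For \<open>h\<close> in the negative part
  \<open>B\<^sub>n(h, p)\<close> is the symmetrisation of \<open>h p\<close>, which yields the first formula. If \<open>g_k L\<close> acts on the vector by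
  the character, then \<open>h S(p) = \<lambda>(h) S(p) + D B(h, p)\<close>; this yields the second formula, and substituting the
  expansion of \<open>B\<close> into itself on the components in \<open>g_k L\<close> yields the third.

  The theorems of Poincare, Birkhoff and Witt that make the action well defined have a direct proof here. The negative
  part carries the pre-Lie product \<open>E\<^sup>-\<^sup>1 [x, E y]\<close>, where \<open>E\<close> is the degree derivation; it makes the symmetric
  algebra a module in which the symmetrisation of \<open>p\<close> sends \<open>1\<close> to \<open>p\<close> plus terms of lower degree, so
  that the symmetrisation is injective. The map from the enveloping algebra of the negative part to the induced module is
  injective because the action of the whole algebra on the former can be written down explicitly.
\<close>

section \<open>Free algebras and algebras given by relations\<close>

text \<open>The definitions consist of cosets, definite descriptions and inverse images, so nothing
  can be computed before \<open>sigma L\<close> and the \<open>partial\<close> operators are known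
  to exist uniquely and \<open>sigma L\<close> and the natural map are known to be injective. The
  remedy is to work with representatives in the free algebra on the whole Lie superalgebra, where
  words have a length, and to replace each quotient map by a linear projection with the right
  kernel; identities of classes become equations of vectors.

  Symmetrisation is defined by its recursion for an arbitrary family of operators. One definition
  then serves five times: in the free algebra itself, for the pre-Lie operators, for the brackets
  behind \<open>s_map\<close>, in the model on the negative part and in the induced module. Linear
  maps that intertwine the operators carry one symmetrisation to another.

  The series in D is (1 - exp(-D)) / D. Its inverse D / (1 - exp(-D)) is the generating function of
  (-1)^k B_k / k!, which is how the Bernoulli numbers and their signs enter.\<close>

abbreviation scl :: "'k::field \<Rightarrow> ('a \<Rightarrow>\<^sub>0 'k) \<Rightarrow> ('a \<Rightarrow>\<^sub>0 'k)" where
  "scl c \<equiv> Poly_Mapping.map ((*) c)"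

lemma lookup_scl [simp]: "Poly_Mapping.lookup (scl c p) x = c * Poly_Mapping.lookup p x"
  by transfer (simp add: when_def)

interpretation pm: vector_space "\<lambda>c. scl c :: ('a \<Rightarrow>\<^sub>0 'k::field) \<Rightarrow> ('a \<Rightarrow>\<^sub>0 'k)"
  by standard (auto intro!: poly_mapping_eqI simp: lookup_add algebra_simps)

text \<open>Unlike \<open>Vector_Spaces.linear\<close>, this carries no claim that \<open>s\<close>
  and \<open>t\<close> are vector space structures, so that compositions can be formed without
  interpreting a locale.\<close>

definition lin :: "('k \<Rightarrow> 'a \<Rightarrow> 'a) \<Rightarrow> ('k \<Rightarrow> 'b \<Rightarrow> 'b) \<Rightarrow> ('a::ab_group_add \<Rightarrow> 'b::ab_group_add) \<Rightarrow> bool" where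
  "lin s t f \<longleftrightarrow> (\<forall>x y. f (x + y) = f x + f y) \<and> (\<forall>c x. f (s c x) = t c (f x))"

lemma lin_add: "lin s t f \<Longrightarrow> f (x + y) = f x + f y"
  and lin_scale: "lin s t f \<Longrightarrow> f (s c x) = t c (f x)"
  by (auto simp: lin_def)

lemma lin_zero: "lin s t f \<Longrightarrow> f 0 = 0"
  using lin_add[of s t f 0 0] by simp

lemma lin_neg: "lin s t f \<Longrightarrow> f (- x) = - f x"
  using lin_add[of s t f x "- x"] lin_zero[of s t f] by (simp add: eq_neg_iff_add_eq_0 add.commute)

lemma lin_diff: "lin s t f \<Longrightarrow> f (x - y) = f x - f y"
  using lin_add[of s t f x "- y"] lin_neg[of s t f y] by simp

lemma lin_sum: "lin s t f \<Longrightarrow> f (sum g A) = (\<Sum>a\<in>A. f (g a))"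
  by (induction A rule: infinite_finite_induct) (auto simp: lin_zero lin_add)

lemmas lin_simps = lin_add lin_scale lin_zero lin_neg lin_diff lin_sum

lemma lin_compose: "lin s t f \<Longrightarrow> lin t u g \<Longrightarrow> lin s u (\<lambda>x. g (f x))"
  by (simp add: lin_def)

lemma lin_linear: "vector_space s \<Longrightarrow> vector_space t \<Longrightarrow> Vector_Spaces.linear s t f \<longleftrightarrow> lin s t f"
  by (auto simp: lin_def Vector_Spaces.linear_def module_hom_def module_hom_axioms_def module_iff_vector_space)

definition ext :: "('k::field \<Rightarrow> 'b \<Rightarrow> 'b) \<Rightarrow> ('a \<Rightarrow> 'b::ab_group_add) \<Rightarrow> ('a \<Rightarrow>\<^sub>0 'k) \<Rightarrow> 'b" where
  "ext t f p = (\<Sum>w\<in>Poly_Mapping.keys p. t (Poly_Mapping.lookup p w) (f w))"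

lemma ext_superset:
  assumes "vector_space t" "finite A" "Poly_Mapping.keys p \<subseteq> A"
  shows "ext t f p = (\<Sum>w\<in>A. t (Poly_Mapping.lookup p w) (f w))"
proof -
  interpret vector_space t by fact
  show ?thesis unfolding ext_def
    by (rule sum.mono_neutral_left) (use assms in \<open>auto simp: in_keys_iff\<close>)
qed

lemma lin_ext: assumes "vector_space t" shows "lin scl t (ext t f)"
proof -
  interpret vector_space t by fact
  have "ext t f (p + q) = ext t f p + ext t f q" for p q
  proof -
    have k: "Poly_Mapping.keys (p + q) \<subseteq> Poly_Mapping.keys p \<union> Poly_Mapping.keys q"
      by (rule keys_add)
    show ?thesis
      by (subst (1 2 3) ext_superset[OF assms, of "Poly_Mapping.keys p \<union> Poly_Mapping.keys q"])
        (use k in \<open>auto simp: lookup_add scale_left_distrib sum.distrib\<close>)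
  qed
  moreover have "ext t f (scl c p) = t c (ext t f p)" for c p
  proof -
    have k: "Poly_Mapping.keys (scl c p) \<subseteq> Poly_Mapping.keys p"
      by (auto simp: in_keys_iff)
    show ?thesis
      by (subst (1 2) ext_superset[OF assms, of "Poly_Mapping.keys p"])
        (use k in \<open>auto simp: scale_sum_right\<close>)
  qed
  ultimately show ?thesis by (simp add: lin_def)
qed

lemma ext_single: assumes "vector_space t" shows "ext t f (Poly_Mapping.single w c) = t c (f w)"
proof -
  interpret vector_space t by fact
  show ?thesis by (simp add: ext_def)
qed

lemma scl_single [simp]: "scl c (Poly_Mapping.single w d) = Poly_Mapping.single w (c * d)"
  by (rule poly_mapping_eqI) (simp add: lookup_single when_def)

lemma poly_mapping_single_sum:
  "p = (\<Sum>w\<in>Poly_Mapping.keys p. Poly_Mapping.single w (Poly_Mapping.lookup p w))"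
proof (rule poly_mapping_eqI)
  fix k
  show "Poly_Mapping.lookup p k =
     Poly_Mapping.lookup (\<Sum>w\<in>Poly_Mapping.keys p. Poly_Mapping.single w (Poly_Mapping.lookup p w)) k"
  proof (cases "k \<in> Poly_Mapping.keys p")
    case True
    then show ?thesis by (simp add: lookup_sum lookup_single when_def sum.delta')
  next
    case False
    then show ?thesis
      by (auto simp: lookup_sum lookup_single when_def in_keys_iff intro!: sum.neutral[symmetric])
  qed
qed

lemma lin_eq_ext:
  fixes p :: "'a \<Rightarrow>\<^sub>0 'k::field"
  assumes "lin scl t f" shows "f p = ext t (\<lambda>w. f (Poly_Mapping.single w 1)) p"
proof -
  have "f p = (\<Sum>w\<in>Poly_Mapping.keys p. f (scl (Poly_Mapping.lookup p w) (Poly_Mapping.single w 1)))"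
    by (subst poly_mapping_single_sum[of p]) (simp add: lin_sum[OF assms])
  then show ?thesis by (simp only: ext_def lin_scale[OF assms])
qed

lemma lin_eqI:
  fixes p :: "'a \<Rightarrow>\<^sub>0 'k::field"
  assumes "lin scl t f" "lin scl t g"
    and "\<And>w. w \<in> Poly_Mapping.keys p \<Longrightarrow> f (Poly_Mapping.single w 1) = g (Poly_Mapping.single w 1)"
  shows "f p = g p"
  by (simp only: lin_eq_ext[OF assms(1), of p] lin_eq_ext[OF assms(2), of p])
    (simp add: ext_def assms(3))

lemma subspace_single_induct:
  fixes p :: "'a \<Rightarrow>\<^sub>0 'k::field"
  assumes "pm.subspace W" "\<And>w. w \<in> Poly_Mapping.keys p \<Longrightarrow> Poly_Mapping.single w 1 \<in> W"
  shows "p \<in> W"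
proof -
  have "(\<Sum>w\<in>Poly_Mapping.keys p. scl (Poly_Mapping.lookup p w) (Poly_Mapping.single w 1)) \<in> W"
    by (intro pm.subspace_sum pm.subspace_scale assms)
  then show ?thesis by (simp flip: poly_mapping_single_sum)
qed

text \<open>A basis of \<open>J\<close> is extended to a basis of the whole space; \<open>q\<close>
  kills the former and fixes the added vectors. Such a \<open>q\<close> serves as a normal form
  modulo \<open>J\<close>: equality of classes turns into equality of values of
  \<open>q\<close>.\<close>

lemma exists_projection_with_kernel:
  fixes J :: "('a \<Rightarrow>\<^sub>0 'k::field) set"
  assumes "pm.subspace J"
  shows "\<exists>q. lin scl scl q \<and> (\<forall>p. q p = 0 \<longleftrightarrow> p \<in> J) \<and> (\<forall>p. p - q p \<in> J)"
proof -
  interpret vp: vector_space_pair "\<lambda>c. scl c :: ('a \<Rightarrow>\<^sub>0 'k) \<Rightarrow> _" "\<lambda>c. scl c :: ('a \<Rightarrow>\<^sub>0 'k) \<Rightarrow> _"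
    by unfold_locales
  obtain B where B: "B \<subseteq> J" "pm.independent B" "J \<subseteq> pm.span B" by (rule pm.basis_exists[of J])
  obtain C where C: "B \<subseteq> C" "pm.independent C" "UNIV \<subseteq> pm.span C"
    by (rule pm.maximal_independent_subset_extend[OF subset_UNIV B(2)])
  obtain q where q: "Vector_Spaces.linear (\<lambda>c. scl c) (\<lambda>c. scl c) q"
    and qC: "\<forall>x\<in>C. q x = (if x \<in> B then 0 else x)"
    using vp.linear_independent_extend[OF C(2), of "\<lambda>x. if x \<in> B then 0 else x"] by blast
  have l: "lin scl scl q" using q by (simp add: lin_linear pm.vector_space_axioms)
  have "pm.subspace {p. p - q p \<in> J}"
    unfolding pm.subspace_def
  proof (intro conjI ballI allI)
    show "0 \<in> {p. p - q p \<in> J}" using pm.subspace_0[OF assms] by (simp add: lin_zero[OF l])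
  next
    fix x y assume "x \<in> {p. p - q p \<in> J}" "y \<in> {p. p - q p \<in> J}"
    then have "(x - q x) + (y - q y) \<in> J" by (simp add: pm.subspace_add[OF assms])
    then show "x + y \<in> {p. p - q p \<in> J}" by (simp add: lin_add[OF l] algebra_simps)
  next
    fix c x assume "x \<in> {p. p - q p \<in> J}"
    then have "scl c (x - q x) \<in> J" by (simp add: pm.subspace_scale[OF assms])
    then show "scl c x \<in> {p. p - q p \<in> J}"
      by (simp add: lin_scale[OF l] pm.scale_right_diff_distrib)
  qed
  moreover have "C \<subseteq> {p. p - q p \<in> J}"
  proof
    fix x assume x: "x \<in> C"
    show "x \<in> {p. p - q p \<in> J}"
      using bspec[OF qC x] B(1) pm.subspace_0[OF assms] by (cases "x \<in> B") auto
  qed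
  ultimately have 1: "p - q p \<in> J" for p
    using pm.span_minimal[of C "{p. p - q p \<in> J}"] C(3) by auto
  have "pm.subspace {p. q p = 0}"
    by (simp add: pm.subspace_def lin_zero[OF l] lin_add[OF l] lin_scale[OF l])
  moreover have "B \<subseteq> {p. q p = 0}" using qC C(1) by (metis (mono_tags) mem_Collect_eq subset_iff)
  ultimately have 2: "q p = 0" if "p \<in> J" for p
    using pm.span_minimal[of B "{p. q p = 0}"] that B(3) by auto
  have "q p = 0 \<longleftrightarrow> p \<in> J" for p
  proof
    assume "q p = 0"
    then show "p \<in> J" using 1[of p] by simp
  qed (rule 2)
  with 1 l show ?thesis by blast
qed

section \<open>Words and multiplication in the free algebra\<close>

abbreviation wd :: "'g list \<Rightarrow> ('g list \<Rightarrow>\<^sub>0 'k::field)" where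
  "wd w \<equiv> Poly_Mapping.single w 1"

abbreviation gen :: "'g \<Rightarrow> ('g list \<Rightarrow>\<^sub>0 'k::field)" where
  "gen x \<equiv> Poly_Mapping.single [x] 1"

lemma wd_append: "wd (u @ v) = (wd u * wd v :: 'g list \<Rightarrow>\<^sub>0 'k::field)"
  by (simp add: mult_single plus_list_def)

lemma wd_Cons: "wd (x # v) = (gen x * wd v :: 'g list \<Rightarrow>\<^sub>0 'k::field)"
  by (simp add: mult_single plus_list_def)

lemma wd_Nil: "wd [] = (1 :: 'g list \<Rightarrow>\<^sub>0 'k::field)"
  using single_one[where 'a="'g list" and 'b='k] by (simp add: zero_list_def)

lemma scl_conv_mult: "scl c (p :: 'g list \<Rightarrow>\<^sub>0 'k::field) = Poly_Mapping.single [] c * p"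
  using mult_map_scale_conv_mult[of c p] by (simp add: zero_list_def)

lemma scl_mult_left: "scl c p * q = scl c (p * q :: 'g list \<Rightarrow>\<^sub>0 'k::field)"
  by (simp add: scl_conv_mult mult.assoc)

lemma scl_mult_right: "p * scl c q = scl c (p * q :: 'g list \<Rightarrow>\<^sub>0 'k::field)"
proof -
  have "lin scl scl (\<lambda>p. p * scl c q)" "lin scl scl (\<lambda>p. scl c (p * q))"
    by (auto simp: lin_def algebra_simps scl_mult_left pm.scale_right_distrib)
  then show ?thesis
  proof (rule lin_eqI)
    fix w
    have "lin scl scl (\<lambda>q. wd w * scl c q)" "lin scl scl (\<lambda>q. scl c (wd w * q))"
      if "\<And>d (q::'g list \<Rightarrow>\<^sub>0 'k). wd w * scl d q = scl d (wd w * q)"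
      by (auto simp: lin_def algebra_simps that pm.scale_right_distrib)
    have "Poly_Mapping.single w 1 * Poly_Mapping.single [] c = Poly_Mapping.single [] c * wd w"
      by (simp add: mult_single plus_list_def)
    then show "wd w * scl c q = scl c (wd w * q)"
      by (simp add: scl_conv_mult mult.assoc[symmetric])
  qed
qed

lemma lin_mult_left: "lin scl scl (\<lambda>q. p * q :: 'g list \<Rightarrow>\<^sub>0 'k::field)"
  by (simp add: lin_def distrib_left scl_mult_right)

lemma lin_mult_right: "lin scl scl (\<lambda>q. q * p :: 'g list \<Rightarrow>\<^sub>0 'k::field)"
  by (simp add: lin_def distrib_right scl_mult_left)

lemma lin_scl: "lin scl scl (\<lambda>p. scl c p)"
  by (simp add: lin_def pm.scale_right_distrib mult.commute)

lemma lin_id: "lin s s (\<lambda>p. p)"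
  by (simp add: lin_def)

lemma lin_plus:
  "vector_space t \<Longrightarrow> lin s t f \<Longrightarrow> lin s t g \<Longrightarrow> lin s t (\<lambda>x. f x + g x)"
  by (simp add: lin_def vector_space.vector_space_assms)

lemma lin_minus:
  assumes "vector_space t" "lin s t f" "lin s t g" shows "lin s t (\<lambda>x. f x - g x)"
proof -
  interpret vector_space t by fact
  show ?thesis using assms(2,3) by (simp add: lin_def scale_right_diff_distrib)
qed

lemma lin_summation:
  assumes "vector_space t" "\<And>i. i \<in> A \<Longrightarrow> lin s t (f i)"
  shows "lin s t (\<lambda>x. \<Sum>i\<in>A. f i x)"
proof -
  interpret vector_space t by fact
  show ?thesis using assms(2) by (simp add: lin_def sum.distrib scale_sum_right)
qed

lemma lin_scaled:
  assumes "vector_space t" "lin s t f" shows "lin s t (\<lambda>x. t c (f x))"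
proof -
  interpret vector_space t by fact
  show ?thesis using assms(2) by (simp add: lin_def scale_right_distrib mult.commute)
qed

definition lists_span :: "'g set \<Rightarrow> ('g list \<Rightarrow>\<^sub>0 'k::field) set" where
  "lists_span V = {p. Poly_Mapping.keys p \<subseteq> lists V}"

lemma subspace_lists_span: "pm.subspace (lists_span V :: ('g list \<Rightarrow>\<^sub>0 'k::field) set)"
proof -
  have "Poly_Mapping.keys (p + q) \<subseteq> lists V" if "Poly_Mapping.keys p \<subseteq> lists V" "Poly_Mapping.keys q \<subseteq> lists V" for p q :: "'g list \<Rightarrow>\<^sub>0 'k"
    using keys_add[of p q] that by blast
  moreover have "Poly_Mapping.keys (scl c p) \<subseteq> Poly_Mapping.keys p" for c and p :: "'g list \<Rightarrow>\<^sub>0 'k"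
    by (auto simp: in_keys_iff)
  ultimately show ?thesis
    by (intro pm.subspaceI; unfold lists_span_def mem_Collect_eq) (simp, blast, meson subset_trans)
qed

lemma wd_lists_span [simp]: "wd w \<in> lists_span V \<longleftrightarrow> w \<in> lists V"
  by (simp add: lists_span_def)

lemma lists_span_mult: "p \<in> lists_span V \<Longrightarrow> q \<in> lists_span V \<Longrightarrow> p * q \<in> lists_span V"
  using keys_mult[of p q] by (fastforce simp: lists_span_def plus_list_def)

lemma one_lists_span [simp]: "1 \<in> lists_span V"
  using wd_lists_span[of "[]" V] by (simp add: wd_Nil)

lemma lin_lists_span:
  assumes "lin scl scl f" "pm.subspace W" "\<And>w. w \<in> lists V \<Longrightarrow> f (wd w) \<in> W" "p \<in> lists_span V"
  shows "f p \<in> W"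
proof -
  have "pm.subspace {p. f p \<in> W}"
    using assms(2) by (auto simp: pm.subspace_def lin_simps[OF assms(1)])
  then show ?thesis using subspace_single_induct[of "{p. f p \<in> W}" p] assms(3,4)
    by (auto simp: lists_span_def)
qed

lemma free_algebra_simps:
  "carrier (free_algebra V) = lists_span V" "mult (free_algebra V) = (*)"
  "one (free_algebra V) = 1" "zero (free_algebra V) = 0" "add (free_algebra V) = (+)"
  by (auto simp: free_algebra_def lists_span_def)

lemma ring_free_algebra: "ring (free_algebra V :: ('g list \<Rightarrow>\<^sub>0 'k::field) ring)"
proof (rule ringI)
  show "abelian_group (free_algebra V :: ('g list \<Rightarrow>\<^sub>0 'k) ring)"
  proof (rule abelian_groupI, goal_cases)
    case (6 x)
    then show ?case
      using pm.subspace_neg[OF subspace_lists_span, of x V]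
      by (auto simp: free_algebra_simps intro!: bexI[of _ "- x"])
  qed (auto simp: free_algebra_simps add_ac pm.subspace_add[OF subspace_lists_span]
      pm.subspace_0[OF subspace_lists_span])
  show "Group.monoid (free_algebra V :: ('g list \<Rightarrow>\<^sub>0 'k) ring)"
    by (rule monoidI) (auto simp: free_algebra_simps lists_span_mult mult.assoc)
qed (auto simp: free_algebra_simps algebra_simps)

section \<open>Ideals of relations and their quotient algebras\<close>

locale presentation =
  fixes V :: "'g set" and R :: "('g list \<Rightarrow>\<^sub>0 'k::field) set"
  assumes relations: "R \<subseteq> lists_span V"
begin

abbreviation "F \<equiv> free_algebra V :: ('g list \<Rightarrow>\<^sub>0 'k) ring"

definition "I = genideal F R"

abbreviation "cls \<equiv> pclass V R"

abbreviation "A \<equiv> presented_algebra V R"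

sublocale free: ring F by (rule ring_free_algebra)

sublocale id: ideal I F
  unfolding I_def by (rule free.genideal_ideal) (simp add: relations free_algebra_simps)

lemma I_sub: "p \<in> I \<Longrightarrow> p \<in> lists_span V"
  using id.Icarr by (simp add: free_algebra_simps)

lemma R_sub_I: "R \<subseteq> I"
  unfolding I_def by (rule free.genideal_self) (simp add: relations free_algebra_simps)

lemma I_zero: "0 \<in> I" using id.zero_closed by (simp add: free_algebra_simps)

lemma I_add: "p \<in> I \<Longrightarrow> q \<in> I \<Longrightarrow> p + q \<in> I"
  using id.a_closed by (simp add: free_algebra_simps)

lemma I_left: "p \<in> I \<Longrightarrow> q \<in> lists_span V \<Longrightarrow> q * p \<in> I"
  using id.I_l_closed by (simp add: free_algebra_simps)

lemma I_right: "p \<in> I \<Longrightarrow> q \<in> lists_span V \<Longrightarrow> p * q \<in> I"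
  using id.I_r_closed by (simp add: free_algebra_simps)

lemma I_scl: "p \<in> I \<Longrightarrow> scl c p \<in> I"
  using I_left[of p "Poly_Mapping.single [] c"] by (simp add: scl_conv_mult lists_span_def)

lemma subspace_I: "pm.subspace I"
  by (auto simp: pm.subspace_def I_zero I_add I_scl)

lemma I_neg: "p \<in> I \<Longrightarrow> - p \<in> I"
  using pm.subspace_neg[OF subspace_I] .

lemma I_diff: "p \<in> I \<Longrightarrow> q \<in> I \<Longrightarrow> p - q \<in> I"
  using pm.subspace_diff[OF subspace_I] .

text \<open>As an intersection of ideals, \<open>genideal\<close> gives no access to its members.
  But the \<open>p\<close> for which \<open>\<phi>\<close> vanishes on all \<open>a * p * b\<close>
  form an ideal; it contains the relations, by linearity already if words \<open>a\<close>,
  \<open>b\<close> are tested, and \<open>a = b = 1\<close> gives the claim.\<close>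

lemma I_induct:
  assumes "lin scl t \<phi>" "\<And>a b r. a \<in> lists V \<Longrightarrow> b \<in> lists V \<Longrightarrow> r \<in> R \<Longrightarrow> \<phi> (wd a * r * wd b) = 0"
    and "p \<in> I"
  shows "\<phi> p = 0"
proof -
  let ?K = "{p \<in> lists_span V. \<forall>a\<in>lists_span V. \<forall>b\<in>lists_span V. \<phi> (a * p * b) = 0}"
  have "R \<subseteq> ?K"
  proof (intro subsetI CollectI conjI ballI)
    fix r assume r: "r \<in> R"
    then show "r \<in> lists_span V" using relations by blast
    fix a b :: "'g list \<Rightarrow>\<^sub>0 'k" assume a: "a \<in> lists_span V" and b: "b \<in> lists_span V"
    have s: "pm.subspace {b. \<phi> (a * r * b) = 0}" for a
      by (auto simp: pm.subspace_def lin_simps[OF assms(1)] distrib_left scl_mult_right)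
        (use lin_scale[OF assms(1), of 0 0] lin_scale[OF assms(1), of _ 0] in \<open>auto simp: lin_zero[OF assms(1)]\<close>)
    have s': "pm.subspace {a. \<phi> (a * r * b) = 0}" for b
      by (auto simp: pm.subspace_def lin_simps[OF assms(1)] distrib_right scl_mult_left)
        (use lin_scale[OF assms(1), of 0 0] lin_scale[OF assms(1), of _ 0] in \<open>auto simp: lin_zero[OF assms(1)]\<close>)
    have *: "a \<in> {a. \<phi> (a * r * wd w) = 0}" if "w \<in> lists V" for w
      by (rule subspace_single_induct[OF s']) (use a r that in \<open>auto simp: lists_span_def intro!: assms(2)\<close>)
    have "b \<in> {b. \<phi> (a * r * b) = 0}"
      by (rule subspace_single_induct[OF s]) (use b * in \<open>unfold lists_span_def, blast\<close>)
    then show "\<phi> (a * r * b) = 0" by simp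
  qed
  moreover have "ideal ?K F"
  proof (rule idealI)
    show "ring F" by (rule free.ring_axioms)
    show "subgroup ?K (add_monoid F)"
    proof (rule free.add.subgroupI, goal_cases)
      case 2
      have "0 \<in> ?K" using lin_zero[OF assms(1)] pm.subspace_0[OF subspace_lists_span] by simp
      then show ?case by blast
    next
      case (3 p)
      then have p: "p \<in> lists_span V" by simp
      have "\<ominus>\<^bsub>F\<^esub> p = - p"
        by (rule free.minus_equality)
          (use p pm.subspace_neg[OF subspace_lists_span] in \<open>auto simp: free_algebra_simps\<close>)
      with 3 pm.subspace_neg[OF subspace_lists_span p] show ?case
        by (simp add: a_inv_def lin_neg[OF assms(1)])
    next
      case (4 p q)
      then show ?case
        by (simp add: free_algebra_simps distrib_left distrib_right lin_add[OF assms(1)] pm.subspace_add[OF subspace_lists_span])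
    qed (auto simp: free_algebra_simps)
  next
    fix p x assume "p \<in> ?K" "x \<in> carrier F"
    then have x: "x \<in> lists_span V" and p: "p \<in> lists_span V"
      and K: "\<And>a b. a \<in> lists_span V \<Longrightarrow> b \<in> lists_span V \<Longrightarrow> \<phi> (a * p * b) = 0"
      by (simp_all add: free_algebra_simps)
    show "x \<otimes>\<^bsub>F\<^esub> p \<in> ?K"
      using K[OF lists_span_mult[OF _ x]] by (simp add: free_algebra_simps lists_span_mult x p mult.assoc)
    show "p \<otimes>\<^bsub>F\<^esub> x \<in> ?K"
      using K[OF _ lists_span_mult[OF x]] by (simp add: free_algebra_simps lists_span_mult x p mult.assoc)
  qed
  ultimately have "I \<subseteq> ?K" unfolding I_def by (rule free.genideal_minimal[rotated])
  then have "\<phi> (1 * p * 1) = 0" using assms(3) one_lists_span by blast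
  then show ?thesis by simp
qed

lemma cls_def': "cls p = {i + p | i. i \<in> I}"
  by (auto simp: pclass_def I_def a_r_coset_def' free_algebra_simps)

lemma cls_mem: "q \<in> cls p \<longleftrightarrow> q - p \<in> I"
  by (auto simp: cls_def') (metis diff_add_cancel)

lemma cls_eq: "cls p = cls q \<longleftrightarrow> p - q \<in> I"
proof
  assume "cls p = cls q"
  then show "p - q \<in> I" using cls_mem[of p p] cls_mem[of p q] I_zero by auto
next
  assume h: "p - q \<in> I"
  show "cls p = cls q"
  proof (rule Set.set_eqI)
    fix x
    have "x - q = (x - p) + (p - q)" "x - p = (x - q) - (p - q)" by auto
    then show "x \<in> cls p \<longleftrightarrow> x \<in> cls q" using h I_add I_diff by (metis cls_mem)
  qed
qed

lemma carrier_A: "carrier A = cls ` lists_span V"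
  by (auto simp: presented_algebra_def Let_def FactRing_def A_RCOSETS_def' pclass_def free_algebra_simps)

lemma cls_carrier [simp, intro]: "p \<in> lists_span V \<Longrightarrow> cls p \<in> carrier A"
  by (simp add: carrier_A)

lemma mult_A: "p \<in> lists_span V \<Longrightarrow> q \<in> lists_span V \<Longrightarrow> cls p \<otimes>\<^bsub>A\<^esub> cls q = cls (p * q)"
  using id.rcoset_mult_add[of p q]
  by (simp add: presented_algebra_def Let_def FactRing_def pclass_def I_def[symmetric] free_algebra_simps)

lemma add_A: "p \<in> lists_span V \<Longrightarrow> q \<in> lists_span V \<Longrightarrow> cls p \<oplus>\<^bsub>A\<^esub> cls q = cls (p + q)"
  using id.a_rcos_sum[of p q]
  by (simp add: presented_algebra_def Let_def FactRing_def pclass_def I_def[symmetric] free_algebra_simps)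

lemma zero_A: "\<zero>\<^bsub>A\<^esub> = cls 0"
  using cls_def'[of 0]
  by (simp add: presented_algebra_def Let_def FactRing_def I_def[symmetric])

lemma one_A: "\<one>\<^bsub>A\<^esub> = cls 1"
  by (simp add: presented_algebra_def Let_def FactRing_def I_def[symmetric] pclass_def free_algebra_simps)

lemma smult_A: "p \<in> lists_span V \<Longrightarrow> c \<odot>\<^bsub>A\<^esub> cls p = cls (scl c p)"
proof -
  assume p: "p \<in> lists_span V"
  have "c \<odot>\<^bsub>A\<^esub> cls p = cls (Poly_Mapping.single [] c) \<otimes>\<^bsub>A\<^esub> cls p"
    by (simp add: presented_algebra_def Let_def)
  then show ?thesis using mult_A[of "Poly_Mapping.single [] c" p] p
    by (simp add: scl_conv_mult lists_span_def)
qed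

lemma ring_A: "ring A"
proof -
  interpret Q: ring "F Quot I" by (rule id.quotient_is_ring)
  have eq: "carrier A = carrier (F Quot I)" "mult A = mult (F Quot I)" "one A = one (F Quot I)"
    "zero A = zero (F Quot I)" "add A = add (F Quot I)"
    by (simp_all add: presented_algebra_def Let_def I_def)
  show ?thesis
  proof (rule ringI)
    show "abelian_group A"
      by (rule abelian_groupI) (use Q.l_neg in \<open>auto simp: eq Q.a_ac intro: Q.a_inv_closed\<close>)
    show "Group.monoid A" by (rule monoidI) (auto simp: eq Q.m_assoc)
  qed (auto simp: eq Q.l_distr Q.r_distr)
qed

sublocale qr: ring A by (rule ring_A)

lemma finsum_A:
  "(\<And>i. i \<in> J \<Longrightarrow> f i \<in> lists_span V) \<Longrightarrow> finsum A (\<lambda>i. cls (f i)) J = cls (\<Sum>i\<in>J. f i)"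
proof (induction J rule: infinite_finite_induct)
  case (insert x J)
  then have "(\<Sum>i\<in>J. f i) \<in> lists_span V" by (intro pm.subspace_sum[OF subspace_lists_span]) auto
  with insert show ?case by (subst qr.finsum_insert) (auto simp: add_A)
qed (auto simp: zero_A qr.finsum_infinite)

lemma finsum_eq_cls:
  assumes "\<And>i. i \<in> J \<Longrightarrow> f i \<in> lists_span V" "\<And>i. i \<in> J \<Longrightarrow> g i = cls (f i)"
  shows "finsum A g J = cls (\<Sum>i\<in>J. f i)"
proof -
  have "finsum A g J = finsum A (\<lambda>i. cls (f i)) J"
    by (rule qr.finsum_cong') (use assms in auto)
  then show ?thesis using finsum_A[OF assms(1)] by simp
qed

text \<open>\<open>supp_finsum\<close> runs over the indices whose class is nonzero, a set that is
  hardly ever known explicitly. Any finite \<open>J'\<close> containing it may be used, because the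
  additional representatives lie in \<open>I\<close> and do not change the class of the sum.\<close>

lemma supp_finsum_A:
  assumes "\<And>i. i \<in> J \<Longrightarrow> f i \<in> lists_span V" "\<And>i. i \<in> J \<Longrightarrow> g i = cls (f i)" "finite J'"
    "J' \<subseteq> J" "\<And>i. i \<in> J \<Longrightarrow> i \<notin> J' \<Longrightarrow> f i \<in> I"
  shows "supp_finsum A g J = cls (\<Sum>i\<in>J'. f i)"
proof -
  let ?S = "{i \<in> J. g i \<noteq> \<zero>\<^bsub>A\<^esub>}"
  have S: "i \<in> ?S \<longleftrightarrow> i \<in> J \<and> f i \<notin> I" for i
    using assms(2)[of i] cls_eq[of "f i" 0] by (auto simp: zero_A)
  then have sub: "?S \<subseteq> J'" using assms(5) by blast
  have "supp_finsum A g J = finsum A (\<lambda>i. cls (f i)) ?S"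
    unfolding supp_finsum_def by (rule qr.finsum_cong') (use assms in auto)
  also have "\<dots> = cls (\<Sum>i\<in>?S. f i)" by (rule finsum_A) (use assms in auto)
  also have "\<dots> = cls (\<Sum>i\<in>J'. f i)"
  proof -
    have "(\<Sum>i\<in>J'. f i) = (\<Sum>i\<in>?S. f i) + (\<Sum>i\<in>J' - ?S. f i)"
      using sum.subset_diff[OF sub assms(3), of f] by (simp add: add.commute)
    moreover have "(\<Sum>i\<in>J' - ?S. f i) \<in> I"
      by (rule pm.subspace_sum[OF subspace_I]) (use S assms(4) in blast)
    ultimately show ?thesis using I_neg by (force simp: cls_eq)
  qed
  finally show ?thesis .
qed

lemma list_prod_A: "w \<in> lists V \<Longrightarrow> list_prod A (map (\<lambda>x. cls (gen x)) w) = cls (wd w)"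
proof (induction w)
  case Nil
  then show ?case by (simp add: list_prod_def one_A wd_Nil)
next
  case (Cons x w)
  then have "list_prod A (map (\<lambda>x. cls (gen x)) w) = cls (wd w)" by simp
  moreover have "cls (gen x) \<otimes>\<^bsub>A\<^esub> cls (wd w) = cls (gen x * wd w)"
    by (rule mult_A) (use Cons.prems in auto)
  ultimately show ?case using wd_Cons[of x w, where 'k='k] by (simp add: list_prod_def)
qed

end

section \<open>Graded Lie superalgebras\<close>

lemma bit_cases: "(p::bit) = 0 \<or> p = 1" by (cases p) auto

lemma koszul_simps [simp]: "koszul 0 q = 1" "koszul q 0 = 1" "koszul 1 1 = - 1"
  by (auto simp: koszul_def)

lemma koszul_commute: "koszul p q = koszul q p"
  by (auto simp: koszul_def)

lemma koszul_add_right: "koszul p (q + q') = (koszul p q * koszul p q' :: 'k::ring_1)"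
  using bit_cases[of p] bit_cases[of q] bit_cases[of q'] by auto

lemma koszul_square [simp]: "koszul p q * koszul p q = (1 :: 'k::ring_1)"
  by (auto simp: koszul_def)

lemma koszul_square' [simp]: "koszul p q * (koszul p q * a) = (a :: 'k::ring_1)"
  by (auto simp: koszul_def)

context
  fixes sc :: "'k::field \<Rightarrow> 'g::ab_group_add \<Rightarrow> 'g" and W :: "'i \<Rightarrow> 'g set"
  assumes vs: "vector_space sc" and ds: "direct_sum_decomposition sc W"
begin

interpretation vector_space sc by (rule vs)

lemma component_decomposes: "decomposes W x (\<lambda>i. component W i x)"
proof -
  have "\<exists>!f. decomposes W x f" using ds by (auto simp: direct_sum_decomposition_def)
  then show ?thesis unfolding component_def by (rule theI')
qed

lemma component_mem: "component W i x \<in> W i"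
  and component_finite: "finite {i. component W i x \<noteq> 0}"
  and component_sum: "x = (\<Sum>i | component W i x \<noteq> 0. component W i x)"
  using component_decomposes by (auto simp: decomposes_def)

lemma component_unique: "decomposes W x f \<Longrightarrow> component W i x = f i"
  using ds component_decomposes unfolding direct_sum_decomposition_def by metis

lemma subspace_summand: "subspace (W i)"
  using ds by (auto simp: direct_sum_decomposition_def)

lemma component_sum': "finite A \<Longrightarrow> {i. component W i x \<noteq> 0} \<subseteq> A \<Longrightarrow> x = (\<Sum>i\<in>A. component W i x)"
  by (subst component_sum) (rule sum.mono_neutral_left, auto)

lemma component_eqI:
  assumes "\<And>i. f i \<in> W i" "finite A" "\<And>i. i \<notin> A \<Longrightarrow> f i = 0" "x = (\<Sum>i\<in>A. f i)"
  shows "component W i x = f i"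
proof (rule component_unique)
  have "{i. f i \<noteq> 0} \<subseteq> A" using assms(3) by auto
  moreover from this have "(\<Sum>i\<in>A. f i) = (\<Sum>i | f i \<noteq> 0. f i)"
    using assms(2) by (intro sum.mono_neutral_right) auto
  ultimately show "decomposes W x f"
    using assms finite_subset by (auto simp: decomposes_def)
qed

lemma component_lin: "lin sc sc (component W i)"
  unfolding lin_def
proof (intro conjI allI)
  fix x y
  let ?A = "{i. component W i x \<noteq> 0} \<union> {i. component W i y \<noteq> 0}"
  show "component W i (x + y) = component W i x + component W i y"
  proof (rule component_eqI[where A = ?A])
    show "x + y = (\<Sum>i\<in>?A. component W i x + component W i y)"
      unfolding sum.distrib
      using component_sum'[of ?A x] component_sum'[of ?A y] component_finite by auto
  qed (use component_finite component_mem subspace_add[OF subspace_summand] in auto)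
next
  fix c x
  let ?A = "{i. component W i x \<noteq> 0}"
  show "component W i (sc c x) = sc c (component W i x)"
  proof (rule component_eqI[where A = ?A])
    show "sc c x = (\<Sum>i\<in>?A. sc c (component W i x))"
      unfolding scale_sum_right[symmetric] using component_sum[of x] by simp
  qed (use component_finite component_mem subspace_scale[OF subspace_summand] in auto)
qed

lemma component_hom: "x \<in> W j \<Longrightarrow> component W i x = (if i = j then x else 0)"
  by (rule component_eqI[where A = "{j}"]) (auto simp: subspace_0[OF subspace_summand])

end

locale graded_data =
  fixes L :: "('k::field_char_0, 'g::ab_group_add) lsa"
    and lam :: "'g \<Rightarrow> 'k"
    and X :: "nat \<Rightarrow> 'g"
    and r s :: nat
  assumes graded: "graded_lie_superalgebra L"
    and fin_dim: "finite_dimensional L"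
    and basis: "homogeneous_basis L r s X"
    and char: "lsa_character L lam"
begin

abbreviation "sc \<equiv> lscale L"
abbreviation "br \<equiv> lbracket L"
abbreviation "V \<equiv> g_minus L"
abbreviation "m \<equiv> r + s"
abbreviation "par \<equiv> component (parity L)"
abbreviation "gr \<equiv> component (grade L)"
abbreviation "lamx \<equiv> extend_character L lam"

lemma lie: "lie_superalgebra L"
  using graded by (simp add: graded_lie_superalgebra_def)

sublocale gs: vector_space sc
  using lie by (simp add: lie_superalgebra_def)

lemma lin_br_right: "lin sc sc (\<lambda>y. br x y)"
  and lin_br_left: "lin sc sc (\<lambda>x. br x y)"
  using lie by (simp_all add: lie_superalgebra_def lin_linear gs.vector_space_axioms)

lemmas br_simps = lin_add[OF lin_br_right] lin_scale[OF lin_br_right] lin_zero[OF lin_br_right]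
  lin_neg[OF lin_br_right] lin_diff[OF lin_br_right] lin_sum[OF lin_br_right]
  lin_add[OF lin_br_left] lin_scale[OF lin_br_left] lin_zero[OF lin_br_left]
  lin_neg[OF lin_br_left] lin_diff[OF lin_br_left] lin_sum[OF lin_br_left]

lemma parity_sum: "direct_sum_decomposition sc (parity L)"
  and br_parity: "x \<in> parity L p \<Longrightarrow> y \<in> parity L q \<Longrightarrow> br x y \<in> parity L (p + q)"
  and br_anti: "x \<in> parity L p \<Longrightarrow> y \<in> parity L q \<Longrightarrow> br x y = - sc (koszul p q) (br y x)"
  and br_jacobi: "x \<in> parity L p \<Longrightarrow> y \<in> parity L q \<Longrightarrow>
        br x (br y z) = br (br x y) z + sc (koszul p q) (br y (br x z))"
  using lie unfolding lie_superalgebra_def by blast+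

lemma grade_sum: "direct_sum_decomposition sc (grade L)"
  and par_grade: "x \<in> grade L i \<Longrightarrow> par p x \<in> grade L i"
  and br_grade: "x \<in> grade L i \<Longrightarrow> y \<in> grade L j \<Longrightarrow> br x y \<in> grade L (i + j)"
  using graded unfolding graded_lie_superalgebra_def by blast+

lemmas par_mem = component_mem[OF gs.vector_space_axioms parity_sum]
lemmas par_lin = component_lin[OF gs.vector_space_axioms parity_sum]
lemmas par_hom = component_hom[OF gs.vector_space_axioms parity_sum]
lemmas par_simps = lin_simps[OF par_lin]
lemmas subspace_parity = subspace_summand[OF gs.vector_space_axioms parity_sum]
lemmas gr_mem = component_mem[OF gs.vector_space_axioms grade_sum]
lemmas gr_lin = component_lin[OF gs.vector_space_axioms grade_sum]
lemmas gr_hom = component_hom[OF gs.vector_space_axioms grade_sum]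
lemmas gr_simps = lin_simps[OF gr_lin]
lemmas subspace_grade = subspace_summand[OF gs.vector_space_axioms grade_sum]

lemma par_split: "x = par 0 x + par 1 x"
proof -
  have "x = (\<Sum>i\<in>{0, 1}. par i x)"
    by (rule component_sum'[OF gs.vector_space_axioms parity_sum]) (use bit_cases in auto)
  then show ?thesis by simp
qed

lemma par_induct:
  assumes "\<And>x y. P x \<Longrightarrow> P y \<Longrightarrow> P (x + y)" "\<And>x p. x \<in> parity L p \<Longrightarrow> P x"
  shows "P x"
  by (subst par_split[of x]) (rule assms(1)[OF assms(2)[OF par_mem] assms(2)[OF par_mem]])

definition "eps x = par 0 x - par 1 x"

lemma eps_lin: "lin sc sc eps"
  unfolding eps_def[abs_def] by (intro lin_minus gs.vector_space_axioms par_lin)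

lemmas eps_simps = lin_simps[OF eps_lin]

lemma eps_hom: "x \<in> parity L p \<Longrightarrow> eps x = sc (koszul 1 p) x"
  using bit_cases[of p] by (auto simp: eps_def par_hom)

lemma eps_eps [simp]: "eps (eps x) = x"
proof (induction x rule: par_induct)
  case (2 x p)
  then show ?case by (simp add: eps_hom eps_simps)
qed (simp add: eps_simps)

text \<open>Moving the odd or even operator with index \<open>i\<close> past \<open>x\<close> turns \<open>x\<close> into \<open>e i x\<close>.\<close>

definition "e i x = (if i < r then x else eps x)"

definition pi :: "nat \<Rightarrow> bit" where "pi i = (if i < r then 0 else 1)"

lemma e_lin: "lin sc sc (e i)"
  using eps_lin lin_id by (auto simp: e_def[abs_def] lin_def)

lemmas e_simps = lin_simps[OF e_lin]

lemma e_hom: "x \<in> parity L p \<Longrightarrow> e i x = sc (koszul (pi i) p) x"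
  by (simp add: e_def pi_def eps_hom)

lemma e_hom_add: "x \<in> parity L (p + q) \<Longrightarrow> e i x = sc (koszul (pi i) p * koszul (pi i) q) x"
  by (simp only: e_hom koszul_add_right)

lemma e_parity: "x \<in> parity L p \<Longrightarrow> e i x \<in> parity L p"
  by (simp add: e_hom gs.subspace_scale[OF subspace_parity])

lemma e_commute: "e i (e j x) = e j (e i x)"
  by (simp add: e_def)

definition "D = {i. \<exists>x. gr i x \<noteq> 0}"

text \<open>A degree in which all vectors of a finite spanning set have zero component is a degree
  in which every vector does; each spanning vector has only finitely many others.\<close>

lemma finite_D: "finite D"
proof -
  obtain B where B: "finite B" "gs.span B = UNIV" using fin_dim by (auto simp: finite_dimensional_def)
  have "D \<subseteq> (\<Union>b\<in>B. {i. gr i b \<noteq> 0})"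
  proof
    fix i assume "i \<in> D"
    show "i \<in> (\<Union>b\<in>B. {i. gr i b \<noteq> 0})"
    proof (rule ccontr)
      assume "i \<notin> (\<Union>b\<in>B. {i. gr i b \<noteq> 0})"
      then have "B \<subseteq> {x. gr i x = 0}" by auto
      moreover have "gs.subspace {x. gr i x = 0}"
        by (simp add: gs.subspace_def gr_simps)
      ultimately have "gs.span B \<subseteq> {x. gr i x = 0}" by (rule gs.span_minimal)
      with B \<open>i \<in> D\<close> show False by (auto simp: D_def)
    qed
  qed
  then show ?thesis
    by (rule finite_subset) (use B component_finite[OF gs.vector_space_axioms grade_sum] in auto)
qed

lemma gr_sum: "x = (\<Sum>i\<in>D. gr i x)"
  by (rule component_sum'[OF gs.vector_space_axioms grade_sum finite_D]) (auto simp: D_def)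

lemma gr_outside: "i \<notin> D \<Longrightarrow> gr i x = 0"
  by (auto simp: D_def)

lemma gr_ext: "(\<And>i. gr i x = gr i y) \<Longrightarrow> x = y"
  by (subst gr_sum[of x], subst gr_sum[of y]) simp

lemma gr_of_sum:
  assumes "finite A" "\<And>i. i \<in> A \<Longrightarrow> f i \<in> grade L i"
  shows "gr j (\<Sum>i\<in>A. f i) = (if j \<in> A then f j else 0)"
proof -
  have "gr j (\<Sum>i\<in>A. f i) = (\<Sum>i\<in>A. if j = i then f i else 0)"
    using assms(2) by (auto simp: gr_simps gr_hom intro!: sum.cong)
  then show ?thesis using assms(1) by simp
qed

lemma gr_par: "gr i (par p x) = par p (gr i x)"
proof -
  have "par p x = (\<Sum>j\<in>D. par p (gr j x))" by (subst gr_sum[of x]) (simp add: par_simps)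
  then have "gr i (par p x) = gr i (\<Sum>j\<in>D. par p (gr j x))" by simp
  also have "\<dots> = (if i \<in> D then par p (gr i x) else 0)"
    by (rule gr_of_sum[OF finite_D]) (auto intro: par_grade gr_mem)
  finally show ?thesis by (auto simp: gr_outside par_simps)
qed

lemma gr_parity: "x \<in> parity L p \<Longrightarrow> gr i x \<in> parity L p"
  using gr_par[of i p x] par_mem[of p "gr i x"] by (simp add: par_hom)

lemma br_expand: "br x y = (\<Sum>i\<in>D. \<Sum>j\<in>D. br (gr i x) (gr j y))"
  by (subst gr_sum[of x], subst gr_sum[of y]) (simp add: br_simps, rule sum.swap)

lemma gr_br: "gr k (br x y) = (\<Sum>i\<in>D. \<Sum>j\<in>D. if k = i + j then br (gr i x) (gr j y) else 0)"
  by (subst br_expand) (auto simp: gr_simps gr_hom[OF br_grade[OF gr_mem gr_mem]] intro!: sum.cong)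

text \<open>All closure properties under the bracket (for the negative part, for
  \<open>g_k L\<close>, for bounds on the top degree) are obtained from this by contradiction on
  degrees.\<close>

lemma gr_br_nonzero:
  assumes "gr k (br x y) \<noteq> 0" obtains i j where "gr i x \<noteq> 0" "gr j y \<noteq> 0" "k = i + j"
proof (rule ccontr)
  assume c: "\<not> thesis"
  have "(if k = i + j then br (gr i x) (gr j y) else 0) = 0" for i j
    using that[of i j] c by (cases "gr i x = 0"; cases "gr j y = 0") (auto simp: br_simps)
  then have "gr k (br x y) = 0" by (subst gr_br) simp
  with assms show False by simp
qed

lemma span_grade: "gs.span (\<Union>i\<in>A. grade L i) = {x. \<forall>i. i \<notin> A \<longrightarrow> gr i x = 0}" (is "?l = ?r")
proof
  have "gs.subspace ?r" by (auto simp: gs.subspace_def gr_simps)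
  moreover have "(\<Union>i\<in>A. grade L i) \<subseteq> ?r" by (auto simp: gr_hom)
  ultimately show "?l \<subseteq> ?r" by (intro gs.span_minimal)
next
  show "?r \<subseteq> ?l"
  proof
    fix x assume x: "x \<in> ?r"
    have "(\<Sum>i\<in>D. gr i x) \<in> ?l"
    proof (rule gs.span_sum)
      fix i show "gr i x \<in> ?l"
        using x gr_mem[of i x] gs.span_zero gs.span_base[of "gr i x" "\<Union>i\<in>A. grade L i"] by (cases "i \<in> A") auto
    qed
    then show "x \<in> ?l" using gr_sum[of x] by simp
  qed
qed

lemma g_minus_iff: "x \<in> V \<longleftrightarrow> (\<forall>i\<ge>0. gr i x = 0)"
  and g_plus_iff: "x \<in> g_plus L \<longleftrightarrow> (\<forall>i\<le>0. gr i x = 0)"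
  by (auto simp: g_minus_def g_plus_def span_grade not_less)

lemma g_k_iff: "x \<in> g_k L \<longleftrightarrow> (\<forall>i<0. gr i x = 0)"
proof -
  have "gs.span (grade L 0 \<union> g_plus L) = gs.span (\<Union>i\<in>{0..}. grade L i)" (is "?l = ?r")
  proof
    have "grade L 0 \<union> g_plus L \<subseteq> ?r" by (auto simp: span_grade g_plus_iff gr_hom)
    then show "?l \<subseteq> ?r" by (intro gs.span_minimal gs.subspace_span)
    have "(\<Union>i\<in>{0..}. grade L i) \<subseteq> ?l"
    proof safe
      fix i :: int and x assume "i \<ge> 0" "x \<in> grade L i"
      then have "x \<in> grade L 0 \<union> g_plus L" by (cases "i = 0") (auto simp: g_plus_iff gr_hom)
      then show "x \<in> ?l" by (rule gs.span_base)
    qed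
    then show "?r \<subseteq> ?l" by (intro gs.span_minimal gs.subspace_span)
  qed
  then show ?thesis by (auto simp: g_k_def span_grade not_less)
qed

lemma subspace_V: "gs.subspace V" and subspace_k: "gs.subspace (g_k L)"
  by (simp_all add: g_minus_def g_k_def)

lemma grade_0_k: "x \<in> grade L 0 \<Longrightarrow> x \<in> g_k L" and g_plus_k: "x \<in> g_plus L \<Longrightarrow> x \<in> g_k L"
  by (auto simp: g_k_iff gr_hom g_plus_iff)

lemma br_V: "x \<in> V \<Longrightarrow> y \<in> V \<Longrightarrow> br x y \<in> V"
proof (unfold g_minus_iff[of "br x y"], intro allI impI, rule ccontr)
  fix k :: int assume xy: "x \<in> V" "y \<in> V" and "0 \<le> k" "gr k (br x y) \<noteq> 0"
  from this(4) obtain i j where "gr i x \<noteq> 0" "gr j y \<noteq> 0" "k = i + j" by (rule gr_br_nonzero)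
  with xy have "i < 0" "j < 0" unfolding g_minus_iff by (meson not_le)+
  with \<open>0 \<le> k\<close> \<open>k = i + j\<close> show False by simp
qed

lemma br_k: "x \<in> g_k L \<Longrightarrow> y \<in> g_k L \<Longrightarrow> br x y \<in> g_k L"
proof (unfold g_k_iff[of "br x y"], intro allI impI, rule ccontr)
  fix k :: int assume xy: "x \<in> g_k L" "y \<in> g_k L" and "k < 0" "gr k (br x y) \<noteq> 0"
  from this(4) obtain i j where "gr i x \<noteq> 0" "gr j y \<noteq> 0" "k = i + j" by (rule gr_br_nonzero)
  with xy have "0 \<le> i" "0 \<le> j" unfolding g_k_iff by (meson not_le)+
  with \<open>k < 0\<close> \<open>k = i + j\<close> show False by simp
qed

abbreviation "mp \<equiv> minus_part L"
abbreviation "kp \<equiv> k_part L"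

lemma V_k_zero: "x \<in> V \<Longrightarrow> x \<in> g_k L \<Longrightarrow> x = 0"
proof (rule gr_ext)
  fix i assume "x \<in> V" "x \<in> g_k L"
  then show "gr i x = gr i 0" by (cases "i < 0") (simp_all add: g_minus_iff g_k_iff gr_simps)
qed

lemma mp_exists: "\<exists>!w. w \<in> V \<and> v - w \<in> g_k L"
proof (rule ex_ex1I)
  let ?w = "\<Sum>i\<in>D. if i < 0 then gr i v else 0"
  have "gr j ?w = (if j \<in> D then if j < 0 then gr j v else 0 else 0)" for j
    by (rule gr_of_sum[OF finite_D]) (auto intro: gr_mem gs.subspace_0[OF subspace_grade])
  then have "gr j ?w = (if j < 0 then gr j v else 0)" for j by (auto simp: gr_outside)
  then have "?w \<in> V \<and> v - ?w \<in> g_k L" by (auto simp: g_minus_iff g_k_iff gr_simps)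
  then show "\<exists>w. w \<in> V \<and> v - w \<in> g_k L" by blast
next
  fix w w' assume a: "w \<in> V \<and> v - w \<in> g_k L" "w' \<in> V \<and> v - w' \<in> g_k L"
  then have "(v - w') - (v - w) \<in> g_k L" "w - w' \<in> V"
    using gs.subspace_diff[OF subspace_k] gs.subspace_diff[OF subspace_V] by blast+
  then show "w = w'" using V_k_zero[of "w - w'"] by simp
qed

lemma mp_V [simp]: "mp v \<in> V" and mp_rest: "v - mp v \<in> g_k L"
  using theI'[OF mp_exists[of v]] by (auto simp: minus_part_def)

lemma mp_eqI: "w \<in> V \<Longrightarrow> v - w \<in> g_k L \<Longrightarrow> mp v = w"
  using mp_exists[of v] mp_V[of v] mp_rest[of v] by blast

lemma kp_eq: "kp v = v - mp v"
  unfolding k_part_def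
proof (rule the_equality)
  fix h assume "h \<in> g_k L \<and> v - h \<in> V"
  then have "mp v = v - h" by (intro mp_eqI) auto
  then show "h = v - mp v" by simp
qed (use mp_rest in auto)

lemma kp_k [simp]: "kp v \<in> g_k L" by (simp add: kp_eq mp_rest)

lemma mp_kp: "mp v + kp v = v" by (simp add: kp_eq)

lemma mp_lin: "lin sc sc mp"
  unfolding lin_def
proof (intro conjI allI)
  fix x y
  have "(x - mp x) + (y - mp y) \<in> g_k L" by (intro gs.subspace_add[OF subspace_k] mp_rest)
  then show "mp (x + y) = mp x + mp y"
    by (intro mp_eqI gs.subspace_add[OF subspace_V]) (auto simp: algebra_simps)
next
  fix c x
  have "sc c (x - mp x) \<in> g_k L" by (intro gs.subspace_scale[OF subspace_k] mp_rest)
  then show "mp (sc c x) = sc c (mp x)"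
    by (intro mp_eqI gs.subspace_scale[OF subspace_V]) (auto simp: gs.scale_right_diff_distrib)
qed

lemma kp_lin: "lin sc sc kp"
proof -
  have "kp = (\<lambda>v. v - mp v)" by (auto simp: kp_eq)
  then show ?thesis by (simp add: lin_minus[OF gs.vector_space_axioms lin_id mp_lin])
qed

lemmas mp_simps = lin_simps[OF mp_lin]
lemmas kp_simps = lin_simps[OF kp_lin]

lemma mp_of_V [simp]: "v \<in> V \<Longrightarrow> mp v = v"
  by (rule mp_eqI) (auto simp: gs.subspace_0[OF subspace_k])

lemma mp_of_k [simp]: "v \<in> g_k L \<Longrightarrow> mp v = 0"
  by (rule mp_eqI) (auto simp: gs.subspace_0[OF subspace_V])

lemma kp_of_V [simp]: "v \<in> V \<Longrightarrow> kp v = 0" and kp_of_k [simp]: "v \<in> g_k L \<Longrightarrow> kp v = v"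
  by (simp_all add: kp_eq)

lemma par_V: "x \<in> V \<Longrightarrow> par p x \<in> V" and par_k: "x \<in> g_k L \<Longrightarrow> par p x \<in> g_k L"
  by (simp_all add: g_minus_iff g_k_iff gr_par par_simps)

lemma mp_par: "mp (par p x) = par p (mp x)"
  using par_k[OF mp_rest, of p x] by (intro mp_eqI par_V) (simp_all add: par_simps)

lemma kp_par: "kp (par p x) = par p (kp x)"
  by (simp add: kp_eq mp_par par_simps)

lemma mp_parity: "x \<in> parity L p \<Longrightarrow> mp x \<in> parity L p"
  using par_mem[of p "mp x"] mp_par[of p x] by (simp add: par_hom)

lemma kp_parity: "x \<in> parity L p \<Longrightarrow> kp x \<in> parity L p"
  by (simp add: kp_eq mp_parity gs.subspace_diff[OF subspace_parity])

lemma mp_eps: "mp (eps x) = eps (mp x)" and kp_eps: "kp (eps x) = eps (kp x)"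
  by (simp_all add: eps_def mp_par kp_par mp_simps kp_simps)

lemma mp_e: "mp (e i x) = e i (mp x)"
  by (simp add: e_def mp_eps)

lemma e_V: "x \<in> V \<Longrightarrow> e i x \<in> V" and e_k: "x \<in> g_k L \<Longrightarrow> e i x \<in> g_k L"
  using mp_eps[of x] mp_V[of "eps x"] kp_eps[of x] kp_k[of "eps x"]
  by (auto simp: e_def simp del: mp_V kp_k)

section \<open>Coordinates with respect to the basis of the negative part\<close>

lemma X_V: "i < m \<Longrightarrow> X i \<in> V"
  using basis gs.span_base[of "X i" "X ` {..<m}"] by (auto simp: homogeneous_basis_def)

lemma X_parity: "i < m \<Longrightarrow> X i \<in> parity L (pi i)"
  using basis by (auto simp: homogeneous_basis_def pi_def not_less)

text \<open>The coordinate functional of \<open>X i\<close>, extended by zero to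
  \<open>g_k L\<close>. The extension allows the derivations below to be defined on words with
  letters from the whole Lie superalgebra.\<close>

definition "xi i x = gs.representation (X ` {..<m}) (mp x) (X i)"

lemma X_basis: "inj_on X {..<m}" "gs.independent (X ` {..<m})" "gs.span (X ` {..<m}) = V"
  using basis by (auto simp: homogeneous_basis_def)

lemma xi_lin: "lin sc (*) (xi i)"
  unfolding lin_def xi_def
  using X_basis mp_V by (simp add: mp_simps gs.representation_add gs.representation_scale)

lemmas xi_simps = lin_simps[OF xi_lin]

lemma xi_mp [simp]: "xi i (mp x) = xi i x"
  by (simp add: xi_def)

lemma xi_X: "i < m \<Longrightarrow> j < m \<Longrightarrow> xi i (X j) = (if i = j then 1 else 0)"
  using X_basis(1) gs.representation_basis[OF X_basis(2), of "X j"]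
  by (auto simp: xi_def X_V inj_on_eq_iff)

lemma xi_expand: "(\<Sum>i<m. sc (xi i x) (X i)) = mp x"
proof -
  have "(\<Sum>b\<in>X ` {..<m}. sc (gs.representation (X ` {..<m}) (mp x) b) b) = mp x"
    by (rule gs.sum_representation_eq) (use X_basis in auto)
  then show ?thesis using X_basis(1) by (simp add: sum.reindex xi_def)
qed

lemma xi_independent: "(\<Sum>i<m. sc (c i) (X i)) = 0 \<Longrightarrow> i < m \<Longrightarrow> c i = 0"
proof -
  assume a: "(\<Sum>i<m. sc (c i) (X i)) = 0" and i: "i < m"
  have "xi i (\<Sum>i<m. sc (c i) (X i)) = (\<Sum>j<m. c j * xi i (X j))" by (simp add: xi_simps)
  also have "\<dots> = (\<Sum>j<m. if j = i then c j else 0)"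
    by (rule sum.cong) (use i in \<open>auto simp: xi_X\<close>)
  also have "\<dots> = c i" using i by simp
  finally show "c i = 0" using a by (simp add: xi_simps)
qed

text \<open>The component of \<open>mp x\<close> of parity \<open>pi i\<close> is zero, and its
  expansion in the basis has \<open>xi i x\<close> as coefficient of \<open>X i\<close>.\<close>

lemma xi_parity:
  assumes x: "x \<in> parity L q" and i: "i < m" and n: "pi i \<noteq> q" shows "xi i x = 0"
proof -
  have "0 = par (pi i) (mp x)" using mp_parity[OF x] n by (simp add: par_hom)
  also have "\<dots> = (\<Sum>j<m. sc (xi j x) (par (pi i) (X j)))"
    by (subst xi_expand[symmetric]) (simp add: par_simps)
  also have "\<dots> = (\<Sum>j<m. sc (if pi i = pi j then xi j x else 0) (X j))"
    by (rule sum.cong) (auto simp: par_hom[OF X_parity])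
  finally show ?thesis using xi_independent[of "\<lambda>j. if pi i = pi j then xi j x else 0" i] i by simp
qed

lemma xi_e: "i < m \<Longrightarrow> xi i (e j x) = koszul (pi i) (pi j) * xi i x"
proof (induction x rule: par_induct)
  case (2 x p)
  then show ?case
    by (cases "pi i = p") (simp_all add: e_hom xi_simps xi_parity koszul_commute)
qed (simp add: e_simps xi_simps algebra_simps)

text \<open>The sign of passing \<open>[h, X j]\<close> is that of \<open>h\<close> times that of
  \<open>X j\<close>. The second factor is the one that later cancels against the commutation sign
  of \<open>pd i\<close> and \<open>pd j\<close>.\<close>

lemma br_e_X: "j < m \<Longrightarrow> e i (br h (X j)) = sc (koszul (pi i) (pi j)) (br (e i h) (X j))"
proof (induction h rule: par_induct)
  case (2 h p)
  then show ?case
    by (simp add: e_hom_add[OF br_parity[OF 2(1) X_parity[OF 2(2)]]] e_hom[OF 2(1)] br_simps mult.commute)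
qed (simp add: br_simps e_simps gs.scale_right_distrib)

section \<open>The character and its extension to \<open>g_k L\<close>\<close>

lemma lam_add: "x \<in> grade L 0 \<Longrightarrow> y \<in> grade L 0 \<Longrightarrow> lam (x + y) = lam x + lam y"
  and lam_scale: "x \<in> grade L 0 \<Longrightarrow> lam (sc c x) = c * lam x"
  and lam_br: "x \<in> grade L 0 \<Longrightarrow> y \<in> grade L 0 \<Longrightarrow> lam (br x y) = 0"
  and lam_odd: "x \<in> grade L 0 \<Longrightarrow> x \<in> parity L 1 \<Longrightarrow> lam x = 0"
  using char by (auto simp: lsa_character_def)

lemma lamx_lin: "lin sc (*) lamx"
  by (simp add: lin_def extend_character_def gr_simps lam_add lam_scale gr_mem)

lemmas lamx_simps = lin_simps[OF lamx_lin]

lemma lam_zero: "lam 0 = 0"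
  using lamx_simps(3) by (simp add: extend_character_def gr_simps)

lemma lamx_grade_0: "x \<in> grade L 0 \<Longrightarrow> lamx x = lam x"
  and lamx_plus: "x \<in> g_plus L \<Longrightarrow> lamx x = 0"
  by (simp_all add: extend_character_def gr_hom g_plus_iff lam_zero)

lemma lamx_odd: "x \<in> parity L 1 \<Longrightarrow> lamx x = 0"
  by (simp add: extend_character_def lam_odd gr_mem gr_parity)

lemma lamx_koszul: "x \<in> parity L p \<Longrightarrow> koszul p q * lamx x = lamx x"
  using bit_cases[of p] lamx_odd by auto

lemma lamx_eps: "lamx (eps x) = lamx x"
  by (induction x rule: par_induct)
    (auto simp: eps_simps lamx_simps eps_hom lamx_koszul koszul_commute[of 1])

lemma lamx_e: "lamx (e i x) = lamx x"
  by (simp add: e_def lamx_eps)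

text \<open>Degrees in \<open>g_k L\<close> are nonnegative, so the degree zero part of the bracket
  is the bracket of the degree zero parts, on which the character vanishes.\<close>

lemma lamx_br:
  assumes "x \<in> g_k L" "y \<in> g_k L" shows "lamx (br x y) = 0"
proof -
  have "gr 0 (br x y) = (\<Sum>i\<in>D. \<Sum>j\<in>D. if i = 0 \<and> j = 0 then br (gr i x) (gr j y) else 0)"
    unfolding gr_br
  proof (intro sum.cong refl)
    fix i j
    show "(if 0 = i + j then br (gr i x) (gr j y) else 0) = (if i = 0 \<and> j = 0 then br (gr i x) (gr j y) else 0)"
      using assms by (cases "i < 0"; cases "j < 0") (auto simp: g_k_iff br_simps)
  qed
  also have "\<dots> = (\<Sum>i\<in>D. if i = 0 then (\<Sum>j\<in>D. if j = 0 then br (gr 0 x) (gr 0 y) else 0) else 0)"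
    by (intro sum.cong refl) (auto intro!: sum.cong)
  also have "\<dots> = (if 0 \<in> D then br (gr 0 x) (gr 0 y) else 0)"
    using finite_D by auto
  finally have "gr 0 (br x y) = br (gr 0 x) (gr 0 y)"
    by (auto simp: gr_outside br_simps)
  then show ?thesis by (simp add: extend_character_def lam_br gr_mem)
qed

text \<open>\<open>E\<close> is the degree derivation. It is invertible on the negative part, which makes \<open>beta\<close> below a
  pre-Lie product there.\<close>

definition "E x = (\<Sum>i\<in>D. sc (of_int i) (gr i x))"

definition "Einv x = (\<Sum>i\<in>D. sc (if i < 0 then 1 / of_int i else 0) (gr i x))"

lemma E_lin: "lin sc sc E" and Einv_lin: "lin sc sc Einv"
  unfolding E_def[abs_def] Einv_def[abs_def]
  by (intro lin_summation lin_scaled gs.vector_space_axioms gr_lin)+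

lemmas Einv_simps = lin_simps[OF Einv_lin]

lemma gr_E: "gr j (E x) = sc (of_int j) (gr j x)"
proof -
  have "gr j (E x) = (if j \<in> D then sc (of_int j) (gr j x) else 0)"
    unfolding E_def by (rule gr_of_sum[OF finite_D]) (intro gs.subspace_scale[OF subspace_grade] gr_mem)
  then show ?thesis by (simp add: gr_outside)
qed

lemma gr_Einv: "gr j (Einv x) = sc (if j < 0 then 1 / of_int j else 0) (gr j x)"
proof -
  have "gr j (Einv x) = (if j \<in> D then sc (if j < 0 then 1 / of_int j else 0) (gr j x) else 0)"
    unfolding Einv_def by (rule gr_of_sum[OF finite_D]) (intro gs.subspace_scale[OF subspace_grade] gr_mem)
  then show ?thesis by (simp add: gr_outside)
qed

lemma E_V: "x \<in> V \<Longrightarrow> E x \<in> V" by (simp add: g_minus_iff gr_E)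

lemma Einv_V: "Einv x \<in> V" by (simp add: g_minus_iff gr_Einv)

lemma Einv_E: "x \<in> V \<Longrightarrow> Einv (E x) = x"
  by (rule gr_ext) (auto simp: gr_E gr_Einv g_minus_iff)

lemma E_Einv: "x \<in> V \<Longrightarrow> E (Einv x) = x"
  by (rule gr_ext) (auto simp: gr_E gr_Einv g_minus_iff)

lemma E_br: "E (br x y) = br (E x) y + br x (E y)"
proof (rule gr_ext)
  fix k
  have "gr k (E (br x y)) = (\<Sum>i\<in>D. \<Sum>j\<in>D. if k = i + j then sc (of_int k) (br (gr i x) (gr j y)) else 0)"
    by (auto simp: gr_E gr_br gs.scale_sum_right if_distrib intro!: sum.cong)
  also have "\<dots> = (\<Sum>i\<in>D. \<Sum>j\<in>D. (if k = i + j then br (gr i (E x)) (gr j y) else 0)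
       + (if k = i + j then br (gr i x) (gr j (E y)) else 0))"
    by (intro sum.cong refl) (auto simp: gr_E br_simps gs.scale_left_distrib)
  also have "\<dots> = gr k (br (E x) y + br x (E y))"
    by (simp add: gr_simps gr_br sum.distrib)
  finally show "gr k (E (br x y)) = gr k (br (E x) y + br x (E y))" .
qed

lemma E_parity: "x \<in> parity L p \<Longrightarrow> E x \<in> parity L p"
  and Einv_parity: "x \<in> parity L p \<Longrightarrow> Einv x \<in> parity L p"
  unfolding E_def Einv_def
  by (intro gs.subspace_sum[OF subspace_parity] gs.subspace_scale[OF subspace_parity] gr_parity; simp)+

definition "beta x y = Einv (br x (E y))"

lemma beta_lin_left: "lin sc sc (\<lambda>x. beta x y)"
  unfolding beta_def by (rule lin_compose[OF lin_br_left Einv_lin])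

lemma beta_lin_right: "lin sc sc (\<lambda>y. beta x y)"
  unfolding beta_def by (rule lin_compose[OF E_lin lin_compose[OF lin_br_right Einv_lin]])

lemma beta_V [simp]: "beta x y \<in> V" by (simp add: beta_def Einv_V)

lemma beta_parity: "x \<in> parity L p \<Longrightarrow> y \<in> parity L q \<Longrightarrow> beta x y \<in> parity L (p + q)"
  unfolding beta_def by (intro Einv_parity br_parity E_parity)

text \<open>Antisymmetry turns the second term into \<open>Einv (br (E x) y)\<close>; as
  \<open>E\<close> is a derivation, the two terms add up to
  \<open>Einv (E (br x y))\<close>.\<close>

lemma beta_torsion_free:
  assumes "x \<in> V" "y \<in> V" "x \<in> parity L p" "y \<in> parity L q"
  shows "beta x y - sc (koszul p q) (beta y x) = br x y"
proof -
  have "sc (koszul p q) (br y (E x)) = - br (E x) y"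
    using br_anti[OF E_parity[OF assms(3)] assms(4)] by simp
  then have "beta x y - sc (koszul p q) (beta y x) = Einv (E (br x y))"
    by (simp add: beta_def E_br add.commute flip: Einv_simps)
  then show ?thesis by (simp add: Einv_E br_V assms)
qed

text \<open>On the negative part \<open>beta x\<close> is the adjoint action of \<open>x\<close>
  conjugated by \<open>E\<close>; this is the Jacobi identity after conjugation.\<close>

lemma beta_flat:
  assumes "x \<in> V" "y \<in> V" "z \<in> V" "x \<in> parity L p" "y \<in> parity L q"
  shows "beta x (beta y z) - sc (koszul p q) (beta y (beta x z)) = beta (br x y) z"
  using br_jacobi[OF assms(4,5), of "E z"] assms
  by (simp add: beta_def E_Einv br_V E_V flip: Einv_simps)

end

section \<open>Super derivations of the symmetric algebra\<close>

declare scl_single [simp del] Poly_Mapping.map_single [simp del]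

text \<open>Stated for left ideals because the induced module is a quotient by a left ideal only.
  The two-sided case, for the symmetric and enveloping algebras, is \<open>quotient\<close>
  below.\<close>

locale left_quotient =
  fixes nf :: "('g list \<Rightarrow>\<^sub>0 'k::field) \<Rightarrow> ('g list \<Rightarrow>\<^sub>0 'k)" and J :: "('g list \<Rightarrow>\<^sub>0 'k) set"
  assumes nf_lin: "lin scl scl nf"
    and nf_zero_iff: "nf p = 0 \<longleftrightarrow> p \<in> J"
    and nf_diff_J: "p - nf p \<in> J"
    and J_left: "p \<in> J \<Longrightarrow> q * p \<in> J"
begin

lemmas nf_simps = lin_simps[OF nf_lin]

lemma nf_eq_iff: "nf p = nf q \<longleftrightarrow> p - q \<in> J"
  by (simp add: nf_zero_iff[symmetric] nf_simps)

lemma nf_mult_nf [simp]: "nf (q * nf p) = nf (q * p)"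
  using J_left[OF nf_diff_J[of p], of q] by (simp add: nf_zero_iff[symmetric] nf_simps right_diff_distrib)

lemma nf_cong_left: "nf p = nf p' \<Longrightarrow> nf (q * p) = nf (q * p')"
  by (metis nf_mult_nf)

lemma J_subspace: "pm.subspace J"
  using lin_zero[OF nf_lin] lin_add[OF nf_lin] lin_scale[OF nf_lin]
  by (simp add: pm.subspace_def flip: nf_zero_iff)

end

locale quotient = left_quotient +
  assumes J_right: "p \<in> J \<Longrightarrow> p * q \<in> J"
begin

lemma nf_nf_mult [simp]: "nf (nf p * q) = nf (p * q)"
  using J_right[OF nf_diff_J[of p], of q] by (simp add: nf_zero_iff[symmetric] nf_simps left_diff_distrib)

lemma nf_cong: "nf p = nf p' \<Longrightarrow> nf q = nf q' \<Longrightarrow> nf (p * q) = nf (p' * q')"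
  by (metis nf_mult_nf nf_nf_mult)

lemma nf_lin_gen:
  assumes "lin t scl (\<lambda>x. nf (f x))" shows "lin t scl (\<lambda>x. nf (p * f x * q))"
proof -
  have "nf (p * f x * q) = nf (p * nf (f x) * q)" for x
    by (rule nf_cong) simp_all
  then show ?thesis using assms
    by (simp add: lin_def distrib_left distrib_right nf_simps scl_mult_left scl_mult_right)
qed

lemma nf_lin_gen_left:
  assumes "lin t scl (\<lambda>x. nf (f x))" shows "lin t scl (\<lambda>x. nf (f x * q))"
  using nf_lin_gen[OF assms, of 1 q] by simp

end

definition nf_of :: "('g list \<Rightarrow>\<^sub>0 'k::field) set \<Rightarrow> ('g list \<Rightarrow>\<^sub>0 'k) \<Rightarrow> ('g list \<Rightarrow>\<^sub>0 'k)" where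
  "nf_of J = (SOME q. lin scl scl q \<and> (\<forall>p. q p = 0 \<longleftrightarrow> p \<in> J) \<and> (\<forall>p. p - q p \<in> J))"

lemma left_quotient_nf_of:
  assumes "pm.subspace J" "\<And>p q. p \<in> J \<Longrightarrow> q * p \<in> J"
  shows "left_quotient (nf_of J) J"
  using someI_ex[OF exists_projection_with_kernel[OF assms(1)], folded nf_of_def] assms(2)
  by unfold_locales blast+

lemma quotient_nf_of:
  assumes "pm.subspace J" "\<And>p q. p \<in> J \<Longrightarrow> q * p \<in> J" "\<And>p q. p \<in> J \<Longrightarrow> p * q \<in> J"
  shows "quotient (nf_of J) J"
  unfolding quotient_def quotient_axioms_def
  using left_quotient_nf_of[OF assms(1,2)] assms(3) by blast

definition word_map :: "('g \<Rightarrow> 'g) \<Rightarrow> ('g list \<Rightarrow>\<^sub>0 'k::field) \<Rightarrow> ('g list \<Rightarrow>\<^sub>0 'k)" where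
  "word_map f = ext scl (\<lambda>w. wd (map f w))"

lemma word_map_lin: "lin scl scl (word_map f)"
  unfolding word_map_def by (rule lin_ext[OF pm.vector_space_axioms])

lemma word_map_wd [simp]: "word_map f (Poly_Mapping.single w c) = Poly_Mapping.single (map f w) c"
  by (simp add: scl_single word_map_def ext_single[OF pm.vector_space_axioms])

lemma word_map_mult: "word_map f (p * q) = word_map f p * word_map f q"
proof (rule lin_eqI[where f = "\<lambda>p. word_map f (p * q)" and g = "\<lambda>p. word_map f p * word_map f q"])
  fix w
  show "word_map f (wd w * q) = word_map f (wd w) * word_map f q"
  proof (rule lin_eqI[where f = "\<lambda>q. word_map f (wd w * q)" and g = "\<lambda>q. word_map f (wd w) * word_map f q"])
    fix v show "word_map f (wd w * wd v) = word_map f (wd w) * word_map f (wd v)"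
      by (simp add: mult_single plus_list_def)
  qed (rule lin_compose[OF lin_mult_left word_map_lin] lin_compose[OF word_map_lin lin_mult_left])+
qed (rule lin_compose[OF lin_mult_right word_map_lin] lin_compose[OF word_map_lin lin_mult_right])+

lemma word_map_one [simp]: "word_map f 1 = 1"
  using word_map_wd[of f "[]" 1] by (simp add: wd_Nil)

lemma word_map_lists_span: "(\<And>x. x \<in> W \<Longrightarrow> f x \<in> W') \<Longrightarrow> p \<in> lists_span W \<Longrightarrow> word_map f p \<in> lists_span W'"
  by (rule lin_lists_span[OF word_map_lin subspace_lists_span]) auto

lemma word_map_id_on:
  assumes "\<And>x. x \<in> W \<Longrightarrow> f x = x" "p \<in> lists_span W" shows "word_map f p = p"
proof (rule lin_eqI[OF word_map_lin lin_id])
  fix w assume "w \<in> Poly_Mapping.keys p"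
  then have "w \<in> lists W" using assms(2) by (auto simp: lists_span_def)
  then show "word_map f (wd w) = wd w" using assms(1) by (simp add: map_idI lists_eq_set subset_iff)
qed

lemma lists_span_UNIV [simp]: "p \<in> lists_span UNIV"
  by (simp add: lists_span_def)

definition cnt :: "('g list \<Rightarrow>\<^sub>0 'k::field) \<Rightarrow> 'k" where "cnt p = Poly_Mapping.lookup p []"

lemma cnt_lin: "lin scl (*) cnt"
  by (simp add: lin_def cnt_def lookup_add)

lemma cnt_wd: "cnt (Poly_Mapping.single w c) = (if w = [] then c else 0)"
  by (simp add: cnt_def lookup_single when_def)

lemma cnt_one [simp]: "cnt 1 = 1"
  using cnt_wd[of "[]" 1] by (simp add: wd_Nil)

lemma vector_space_field: "vector_space ((*) :: 'k::field \<Rightarrow> 'k \<Rightarrow> 'k)"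
  by standard (auto simp: algebra_simps)

lemma cnt_mult: "cnt (p * q) = cnt p * cnt (q :: 'g list \<Rightarrow>\<^sub>0 'k::field)"
proof (rule lin_eqI[where f = "\<lambda>p. cnt (p * q)" and g = "\<lambda>p. cnt p * cnt q"])
  show "lin scl (*) (\<lambda>p. cnt p * cnt q)"
    by (simp add: lin_def lin_add[OF cnt_lin] lin_scale[OF cnt_lin] distrib_right mult.assoc)
  fix w :: "'g list"
  show "cnt (wd w * q) = cnt (wd w) * cnt q"
  proof (rule lin_eqI[where f = "\<lambda>q. cnt (wd w * q)" and g = "\<lambda>q. cnt (wd w) * cnt q"])
    show "lin scl (*) (\<lambda>q. cnt (wd w) * cnt q :: 'k)"
      by (simp add: lin_def lin_add[OF cnt_lin] lin_scale[OF cnt_lin] distrib_left mult.left_commute)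
    fix v :: "'g list" show "cnt (wd w * wd v) = (cnt (wd w) * cnt (wd v) :: 'k)"
      by (simp add: mult_single plus_list_def cnt_wd)
  qed (rule lin_compose[OF lin_mult_left cnt_lin])
qed (rule lin_compose[OF lin_mult_right cnt_lin])

section \<open>Symmetric and enveloping algebras read off one free algebra\<close>

context graded_data begin

abbreviation "FV \<equiv> lists_span V :: ('g list \<Rightarrow>\<^sub>0 'k) set"

abbreviation "Pr \<equiv> word_map mp :: ('g list \<Rightarrow>\<^sub>0 'k) \<Rightarrow> _"

lemma Pr_FV [simp]: "Pr p \<in> FV"
  by (rule word_map_lists_span[where W = UNIV]) auto

lemma Pr_id: "p \<in> FV \<Longrightarrow> Pr p = p"
  by (rule word_map_id_on) auto

lemma wd_span2: "Poly_Mapping.single w c \<in> lists_span W \<longleftrightarrow> c = 0 \<or> w \<in> lists W"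
  by (auto simp: lists_span_def)

lemma linear_relations_span: "gs.subspace W \<Longrightarrow> linear_relations L W \<subseteq> lists_span W"
  by (auto simp: linear_relations_def wd_span2 gs.subspace_def
      intro!: pm.subspace_diff[OF subspace_lists_span])

lemma sym_relations_span: "gs.subspace W \<Longrightarrow> sym_relations L W \<subseteq> lists_span W"
  using linear_relations_span[of W]
  by (auto simp: sym_relations_def wd_span2 intro!: pm.subspace_diff[OF subspace_lists_span])

lemma env_relations_span:
  "gs.subspace W \<Longrightarrow> (\<And>x y. x \<in> W \<Longrightarrow> y \<in> W \<Longrightarrow> br x y \<in> W) \<Longrightarrow> env_relations L W \<subseteq> lists_span W"
  using linear_relations_span[of W]
  by (auto simp: env_relations_def wd_span2 intro!: pm.subspace_diff[OF subspace_lists_span])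

sublocale S: presentation V "sym_relations L V"
  by unfold_locales (rule sym_relations_span[OF subspace_V])

sublocale U: presentation V "env_relations L V"
  by unfold_locales (rule env_relations_span[OF subspace_V br_V])

sublocale G: presentation UNIV "env_relations L UNIV"
  by unfold_locales auto

sublocale K: presentation "g_k L" "env_relations L (g_k L)"
  by unfold_locales (rule env_relations_span[OF subspace_k br_k])

text \<open>The presented algebras are replaced by linear projections of the free algebra on the whole Lie
  superalgebra: \<open>nfS\<close> and \<open>nfU\<close> first project all letters to the negative part and then reduce modulo the
  relations.\<close>

definition "JS = {p. Pr p \<in> S.I}"
definition "JU = {p. Pr p \<in> U.I}"

definition "nfS = nf_of JS"
definition "nfU = nf_of JU"

sublocale qS: quotient nfS JS
  unfolding nfS_def
proof (rule quotient_nf_of)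
  show "pm.subspace JS"
    by (auto simp: pm.subspace_def JS_def lin_simps[OF word_map_lin] S.I_zero S.I_add S.I_scl)
qed (auto simp: JS_def word_map_mult intro: S.I_left S.I_right)

sublocale qU: quotient nfU JU
  unfolding nfU_def
proof (rule quotient_nf_of)
  show "pm.subspace JU"
    by (auto simp: pm.subspace_def JU_def lin_simps[OF word_map_lin] U.I_zero U.I_add U.I_scl)
qed (auto simp: JU_def word_map_mult intro: U.I_left U.I_right)

lemma JS_FV: "p \<in> FV \<Longrightarrow> p \<in> JS \<longleftrightarrow> p \<in> S.I" and JU_FV: "p \<in> FV \<Longrightarrow> p \<in> JU \<longleftrightarrow> p \<in> U.I"
  by (simp_all add: JS_def JU_def Pr_id)

lemma I_JS: "p \<in> S.I \<Longrightarrow> p \<in> JS" and I_JU: "p \<in> U.I \<Longrightarrow> p \<in> JU"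
  using S.I_sub U.I_sub JS_FV JU_FV by auto

lemma Pr_Pr [simp]: "Pr (Pr p) = Pr p" by (rule Pr_id) simp

lemma nfS_Pr: "nfS (Pr p) = nfS p" and nfU_Pr: "nfU (Pr p) = nfU p"
  by (simp_all add: qS.nf_eq_iff qU.nf_eq_iff JS_def JU_def lin_diff[OF word_map_lin] S.I_zero U.I_zero)

lemma linear_relations_mem:
  assumes "W \<subseteq> W'"
  shows "x \<in> W \<Longrightarrow> y \<in> W \<Longrightarrow> gen (x + y) - gen x - gen y \<in> linear_relations L W'"
    and "x \<in> W \<Longrightarrow> gen (sc c x) - Poly_Mapping.single [x] c \<in> linear_relations L W'"
  using assms by (auto simp: linear_relations_def)

lemma linear_in_SI: "linear_relations L V \<subseteq> S.I" and linear_in_UI: "linear_relations L V \<subseteq> U.I"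
  and linear_in_GI: "linear_relations L UNIV \<subseteq> G.I"
  using S.R_sub_I U.R_sub_I G.R_sub_I by (auto simp: sym_relations_def env_relations_def)

lemma Pr_gen: "Pr (gen x) = gen (mp x)" by simp

text \<open>In the free algebra \<open>gen (x + y)\<close> and \<open>gen x + gen y\<close> are
  different elements. Linearity in the letter exists only after reduction, where the linear
  relations lie in the kernel.\<close>

lemma genS_lin: "lin sc scl (\<lambda>x. nfS (gen x))"
proof -
  have "gen (mp x + mp y) - gen (mp x) - gen (mp y) \<in> S.I" for x y
    using linear_relations_mem(1)[of V V "mp x" "mp y"] linear_in_SI by auto
  then have "gen (x + y) - gen x - gen y \<in> JS" for x y
    by (simp add: JS_def lin_simps[OF word_map_lin] mp_simps)
  moreover have "gen (sc c (mp x)) - Poly_Mapping.single [mp x] c \<in> S.I" for c x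
    using linear_relations_mem(2)[of V V "mp x"] linear_in_SI by auto
  then have "gen (sc c x) - scl c (gen x) \<in> JS" for c x
    by (simp add: JS_def lin_simps[OF word_map_lin] mp_simps scl_single)
  ultimately show ?thesis
    unfolding lin_def qS.nf_simps(1,2)[symmetric] qS.nf_eq_iff by (simp add: diff_diff_eq)
qed

lemma genU_lin: "lin sc scl (\<lambda>x. nfU (gen x))"
proof -
  have "gen (mp x + mp y) - gen (mp x) - gen (mp y) \<in> U.I" for x y
    using linear_relations_mem(1)[of V V "mp x" "mp y"] linear_in_UI by auto
  then have "gen (x + y) - gen x - gen y \<in> JU" for x y
    by (simp add: JU_def lin_simps[OF word_map_lin] mp_simps)
  moreover have "gen (sc c (mp x)) - Poly_Mapping.single [mp x] c \<in> U.I" for c x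
    using linear_relations_mem(2)[of V V "mp x"] linear_in_UI by auto
  then have "gen (sc c x) - scl c (gen x) \<in> JU" for c x
    by (simp add: JU_def lin_simps[OF word_map_lin] mp_simps scl_single)
  ultimately show ?thesis
    unfolding lin_def qU.nf_simps(1,2)[symmetric] qU.nf_eq_iff by (simp add: diff_diff_eq)
qed

lemma genS_comm:
  assumes "x \<in> parity L p" "y \<in> parity L q"
  shows "gen x * gen y - scl (koszul p q) (gen y * gen x) \<in> JS"
proof -
  have "wd [mp x, mp y] - Poly_Mapping.single [mp y, mp x] (koszul p q) \<in> sym_relations L V"
    unfolding sym_relations_def using assms mp_parity by fastforce
  then show ?thesis using S.R_sub_I by (auto simp: JS_def lin_simps[OF word_map_lin] mult_single plus_list_def scl_single)
qed

lemma genS_swap: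
  assumes "x \<in> parity L p" "y \<in> parity L q"
  shows "nfS (a * gen x * gen y * b) = scl (koszul p q) (nfS (a * gen y * gen x * b))"
proof -
  have "a * (gen x * gen y - scl (koszul p q) (gen y * gen x)) * b \<in> JS"
    by (intro qS.J_left qS.J_right genS_comm assms)
  then show ?thesis
    by (simp add: qS.nf_zero_iff[symmetric] qS.nf_simps algebra_simps scl_mult_left scl_mult_right)
qed

lemma genU_comm:
  assumes "x \<in> parity L p" "y \<in> parity L q" "x \<in> V" "y \<in> V"
  shows "gen x * gen y - scl (koszul p q) (gen y * gen x) - gen (br x y) \<in> JU"
proof -
  have "wd [x, y] - Poly_Mapping.single [y, x] (koszul p q) - gen (br x y) \<in> env_relations L V"
    unfolding env_relations_def using assms by fastforce
  then show ?thesis using U.R_sub_I I_JU by (auto simp: mult_single plus_list_def scl_single)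
qed

text \<open>The derivation dual to \<open>X i\<close>, lifted to words. Replacing the passed letter
  \<open>x\<close> by \<open>e i x\<close> encodes the sign in a way that also makes sense for
  letters of mixed parity.\<close>

primrec pdw :: "nat \<Rightarrow> 'g list \<Rightarrow> ('g list \<Rightarrow>\<^sub>0 'k)" where
  "pdw i [] = 0"
| "pdw i (x # w) = scl (xi i x) (wd w) + gen (e i x) * pdw i w"

definition "pd i = ext scl (pdw i)"

abbreviation "em i \<equiv> word_map (e i) :: ('g list \<Rightarrow>\<^sub>0 'k) \<Rightarrow> _"

lemma pd_lin: "lin scl scl (pd i)"
  unfolding pd_def by (rule lin_ext[OF pm.vector_space_axioms])

lemmas pd_simps = lin_simps[OF pd_lin]

lemma pd_wd: "pd i (wd w) = pdw i w"
  by (simp add: pd_def ext_single[OF pm.vector_space_axioms])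

lemma pd_one [simp]: "pd i 1 = 0"
  using pd_wd[of i "[]"] by (simp add: wd_Nil)

lemma pd_gen: "pd i (gen x * p) = scl (xi i x) p + gen (e i x) * pd i p"
proof (rule lin_eqI[where f = "\<lambda>p. pd i (gen x * p)" and g = "\<lambda>p. scl (xi i x) p + gen (e i x) * pd i p"])
  show "lin scl scl (\<lambda>p. pd i (gen x * p))" by (rule lin_compose[OF lin_mult_left pd_lin])
  show "lin scl scl (\<lambda>p. scl (xi i x) p + gen (e i x) * pd i p)"
    by (intro lin_plus pm.vector_space_axioms lin_scl lin_compose[OF pd_lin lin_mult_left])
  fix w
  show "pd i (gen x * wd w) = scl (xi i x) (wd w) + gen (e i x) * pd i (wd w)"
    using pd_wd[of i "x # w"] by (simp only: pd_wd wd_Cons[of x w, symmetric] pdw.simps)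
qed

lemma pd_gen_one: "pd i (gen x) = scl (xi i x) 1"
  using pd_gen[of i x 1] by simp

lemma pd_mult: "pd i (p * q) = pd i p * q + em i p * pd i q"
proof (rule lin_eqI[where f = "\<lambda>p. pd i (p * q)" and g = "\<lambda>p. pd i p * q + em i p * pd i q"])
  show "lin scl scl (\<lambda>p. pd i (p * q))" by (rule lin_compose[OF lin_mult_right pd_lin])
  show "lin scl scl (\<lambda>p. pd i p * q + em i p * pd i q)"
    by (intro lin_plus pm.vector_space_axioms lin_compose[OF pd_lin lin_mult_right]
        lin_compose[OF word_map_lin lin_mult_right])
  fix w
  show "pd i (wd w * q) = pd i (wd w) * q + em i (wd w) * pd i q"
  proof (induction w)
    case (Cons x w)
    have 1: "wd (x # w) = gen x * wd w" using wd_Cons[of x w] by simp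
    show ?case
      unfolding 1 mult.assoc pd_gen Cons word_map_mult
      by (simp add: distrib_left distrib_right scl_mult_left mult.assoc add.assoc)
  qed (simp add: wd_Nil)
qed

lemma pd_FV: "p \<in> FV \<Longrightarrow> pd i p \<in> FV"
proof (erule lin_lists_span[OF pd_lin subspace_lists_span, rotated])
  fix w assume "w \<in> lists V"
  then show "pd i (wd w) \<in> FV"
    unfolding pd_wd
    by (induction w) (auto simp: pm.subspace_0[OF subspace_lists_span] e_V wd_span2
        intro!: pm.subspace_add[OF subspace_lists_span] pm.subspace_scale[OF subspace_lists_span] lists_span_mult)
qed

text \<open>Holds for words exactly, without passing to the symmetric algebra: the two terms in
  which one derivation hits the first letter and the other the rest are exchanged, and
  \<open>xi_e\<close> supplies the sign.\<close>

lemma pd_comm: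
  assumes ij: "i < m" "j < m"
  shows "pd i (pd j p) = scl (koszul (pi i) (pi j)) (pd j (pd i p))"
proof (rule lin_eqI[where f = "\<lambda>p. pd i (pd j p)" and g = "\<lambda>p. scl (koszul (pi i) (pi j)) (pd j (pd i p))"])
  show "lin scl scl (\<lambda>p. pd i (pd j p))" by (rule lin_compose[OF pd_lin pd_lin])
  show "lin scl scl (\<lambda>p. scl (koszul (pi i) (pi j)) (pd j (pd i p)))"
    by (intro lin_scaled pm.vector_space_axioms lin_compose[OF pd_lin pd_lin])
  fix w
  show "pd i (pd j (wd w)) = scl (koszul (pi i) (pi j)) (pd j (pd i (wd w)))"
  proof (induction w)
    case (Cons x w)
    have 1: "wd (x # w) = gen x * wd w" using wd_Cons[of x w] by simp
    show ?case
      unfolding 1 pd_gen pd_simps Cons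
      by (simp add: xi_e ij pm.scale_right_distrib scl_mult_left scl_mult_right e_commute[of i j]
          koszul_commute[of "pi j"] mult.assoc[symmetric] add_ac)
  qed (simp add: wd_Nil pd_simps)
qed

lemma pd_Pr: "pd i (Pr p) = Pr (pd i p)"
proof (rule lin_eqI[where f = "\<lambda>p. pd i (Pr p)" and g = "\<lambda>p. Pr (pd i p)"])
  fix w
  show "pd i (Pr (wd w)) = Pr (pd i (wd w))"
  proof (induction w)
    case (Cons x w)
    have 1: "wd (x # w) = gen x * wd w" using wd_Cons[of x w] by simp
    show ?case
      unfolding 1 word_map_mult pd_gen Pr_gen Cons
      by (simp add: lin_simps[OF word_map_lin] word_map_mult mp_e)
  qed (simp add: wd_Nil lin_simps[OF word_map_lin])
qed (rule lin_compose[OF word_map_lin pd_lin] lin_compose[OF pd_lin word_map_lin])+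

text \<open>In the commutation relation the derivative is a combination of \<open>gen x\<close> and
  \<open>gen y\<close> with signs depending on the parities. The signs cancel because
  \<open>xi i x\<close> vanishes unless \<open>x\<close> has the parity of
  \<open>X i\<close>.\<close>

lemma pd_relation:
  assumes "\<rho> \<in> sym_relations L V" "i < m"
  shows "pd i \<rho> \<in> JS" "em i \<rho> \<in> JS"
proof -
  from assms(1) consider
    (add) x y where "x \<in> V" "y \<in> V" "\<rho> = gen (x + y) - gen x - gen y"
  | (scale) c x where "x \<in> V" "\<rho> = gen (sc c x) - scl c (gen x)"
  | (comm) x y p q where "x \<in> V" "y \<in> V" "x \<in> parity L p" "y \<in> parity L q"
      "\<rho> = gen x * gen y - scl (koszul p q) (gen y * gen x)"
    unfolding sym_relations_def linear_relations_def
    by (auto simp: mult_single plus_list_def scl_single)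
  then have "pd i \<rho> \<in> JS \<and> em i \<rho> \<in> JS"
  proof cases
    case add
    have "nfS (em i \<rho>) = 0"
      unfolding add lin_simps[OF word_map_lin] word_map_wd
      by (simp add: qS.nf_simps e_simps lin_add[OF genS_lin])
    moreover have "pd i \<rho> = 0"
      by (simp add: add pd_simps pd_gen_one xi_simps pm.scale_left_distrib)
    ultimately show ?thesis by (simp flip: qS.nf_zero_iff add: qS.nf_simps)
  next
    case scale
    have "nfS (em i \<rho>) = 0"
      unfolding scale lin_simps[OF word_map_lin] word_map_wd
      by (simp add: qS.nf_simps e_simps lin_scale[OF genS_lin])
    moreover have "pd i \<rho> = 0"
      by (simp add: scale pd_simps pd_gen_one xi_simps)
    ultimately show ?thesis by (simp flip: qS.nf_zero_iff add: qS.nf_simps)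
  next
    case comm
    have "em i \<rho> = gen (e i x) * gen (e i y) - scl (koszul p q) (gen (e i y) * gen (e i x))"
      unfolding comm lin_simps[OF word_map_lin] word_map_mult word_map_wd by simp
    then have 1: "em i \<rho> \<in> JS" using genS_comm[of "e i x" p "e i y" q] comm e_parity by simp
    have "nfS (pd i \<rho>) = scl (xi i x) (nfS (gen y)) + scl (xi i y * koszul (pi i) p) (nfS (gen x))
      - scl (koszul p q * xi i y) (nfS (gen x)) - scl (koszul p q * xi i x * koszul (pi i) q) (nfS (gen y))"
      unfolding comm pd_simps pd_gen pd_gen_one qS.nf_simps
      by (simp add: e_hom[OF comm(3)] e_hom[OF comm(4)] scl_mult_right qS.nf_simps lin_scale[OF genS_lin]
          pm.scale_right_distrib mult.assoc)
    moreover have "xi i x = koszul p q * xi i x * koszul (pi i) q"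
      using xi_parity[OF comm(3) assms(2)] by (cases "pi i = p") (simp_all add: mult.assoc mult.commute)
    moreover have "xi i y * koszul (pi i) p = koszul p q * xi i y"
      using xi_parity[OF comm(4) assms(2)] by (cases "pi i = q") (simp_all add: mult.commute koszul_commute)
    ultimately have "nfS (pd i \<rho>) = 0" by simp
    with 1 show ?thesis by (simp flip: qS.nf_zero_iff)
  qed
  then show "pd i \<rho> \<in> JS" "em i \<rho> \<in> JS" by auto
qed

text \<open>By the twisted product rule, every term of the derivative of
  \<open>a * \<rho> * b\<close> contains \<open>\<rho>\<close>, \<open>pd i \<rho>\<close> or
  \<open>em i \<rho>\<close> as a factor, and all three lie in \<open>JS\<close>. Hence the
  derivation descends to the symmetric algebra.\<close>

lemma pd_JS:
  assumes "p \<in> JS" "i < m" shows "pd i p \<in> JS"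
proof -
  have "nfS (pd i (Pr p)) = 0"
  proof (rule S.I_induct[where t = "\<lambda>c. scl c" and \<phi> = "\<lambda>p. nfS (pd i p)"])
    show "lin scl scl (\<lambda>p. nfS (pd i p))" by (rule lin_compose[OF pd_lin qS.nf_lin])
    show "Pr p \<in> S.I" using assms by (simp add: JS_def)
    fix a b \<rho> assume r: "\<rho> \<in> sym_relations L V"
    then have "\<rho> \<in> JS" using S.R_sub_I I_JS by blast
    then have "pd i (wd a * \<rho> * wd b) \<in> JS"
      unfolding pd_mult word_map_mult
      by (intro pm.subspace_add[OF qS.J_subspace] qS.J_left qS.J_right
          pm.subspace_add[OF qS.J_subspace, THEN qS.J_right] pd_relation[OF r assms(2)])
    then show "nfS (pd i (wd a * \<rho> * wd b)) = 0" by (simp add: qS.nf_zero_iff)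
  qed
  then show ?thesis by (simp add: pd_Pr nfS_Pr flip: qS.nf_zero_iff)
qed

text \<open>The relations of the symmetric algebra have no constant term and \<open>cnt\<close> is
  multiplicative. Together with \<open>pd_JS\<close> this makes the recursion for the symmetrisation
  independent of representatives.\<close>

lemma cnt_JS: "p \<in> JS \<Longrightarrow> cnt p = 0"
proof -
  assume "p \<in> JS"
  have "cnt (Pr p) = 0"
  proof (rule S.I_induct[where t = "(*)" and \<phi> = cnt])
    show "Pr p \<in> S.I" using \<open>p \<in> JS\<close> by (simp add: JS_def)
    fix a b \<rho> assume "\<rho> \<in> sym_relations L V"
    then have "cnt \<rho> = 0"
      by (auto simp: sym_relations_def linear_relations_def lin_simps[OF cnt_lin] cnt_wd)
    then show "cnt (wd a * \<rho> * wd b) = 0" by (simp add: cnt_mult)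
  qed (rule cnt_lin)
  moreover have "cnt (Pr p) = cnt p"
    by (rule lin_eqI[OF lin_compose[OF word_map_lin cnt_lin] cnt_lin]) (simp add: cnt_wd)
  ultimately show ?thesis by simp
qed

end

section \<open>Commuting an element past a symmetrised product\<close>

definition len_span :: "nat \<Rightarrow> ('g list \<Rightarrow>\<^sub>0 'k::field) set" where
  "len_span n = {p. \<forall>w\<in>Poly_Mapping.keys p. length w = n}"

definition len_le :: "nat \<Rightarrow> ('g list \<Rightarrow>\<^sub>0 'k::field) set" where
  "len_le n = {p. \<forall>w\<in>Poly_Mapping.keys p. length w \<le> n}"

lemma subspace_keys: "pm.subspace {p :: 'a \<Rightarrow>\<^sub>0 'k::field. \<forall>w\<in>Poly_Mapping.keys p. P w}"
proof (rule pm.subspaceI)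
  fix p q :: "'a \<Rightarrow>\<^sub>0 'k" and c
  show "p + q \<in> {p. \<forall>w\<in>Poly_Mapping.keys p. P w}"
    if "p \<in> {p. \<forall>w\<in>Poly_Mapping.keys p. P w}" "q \<in> {p. \<forall>w\<in>Poly_Mapping.keys p. P w}"
    using keys_add[of p q] that by blast
  show "scl c p \<in> {p. \<forall>w\<in>Poly_Mapping.keys p. P w}" if "p \<in> {p. \<forall>w\<in>Poly_Mapping.keys p. P w}"
    using that by (simp add: in_keys_iff)
qed simp

lemma subspace_len_span: "pm.subspace (len_span n)" and subspace_len_le: "pm.subspace (len_le n)"
  unfolding len_span_def len_le_def by (rule subspace_keys)+

lemma gen_len_span: "p \<in> len_span n \<Longrightarrow> gen x * p \<in> len_span (Suc n)"
  using keys_mult[of "gen x" p] by (fastforce simp: len_span_def plus_list_def)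

lemma gen_len_le: "p \<in> len_le n \<Longrightarrow> gen x * p \<in> len_le (Suc n)"
  using keys_mult[of "gen x" p] by (fastforce simp: len_le_def plus_list_def)

lemma wd_len_span: "wd w \<in> len_span (length w)"
  by (simp add: len_span_def)

lemma len_span_le: "p \<in> len_span n \<Longrightarrow> n \<le> k \<Longrightarrow> p \<in> len_le k"
  by (simp add: len_le_def len_span_def)

lemma len_le_mono: "p \<in> len_le n \<Longrightarrow> n \<le> k \<Longrightarrow> p \<in> len_le k"
  by (fastforce simp: len_le_def)

lemma len_le_exists: "\<exists>N. p \<in> len_le N"
proof
  show "p \<in> len_le (\<Sum>w\<in>Poly_Mapping.keys p. length w)"
    by (auto simp: len_le_def intro: member_le_sum)
qed

lemma lin_vanish_len_le:
  fixes p :: "'g list \<Rightarrow>\<^sub>0 'k::field"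
  assumes "lin scl t f" "lin scl t g" "\<And>w. length w \<le> N \<Longrightarrow> f (wd w) = g (wd w)" "p \<in> len_le N"
  shows "f p = g p"
  by (rule lin_eqI[OF assms(1,2)]) (use assms(3,4) in \<open>auto simp: len_le_def\<close>)

context graded_data begin

lemma pdw_len: "pdw i w \<in> len_span (length w - 1)" and pdw_Nil_len: "pdw i [] = 0"
proof -
  show "pdw i w \<in> len_span (length w - 1)"
  proof (induction w)
    case (Cons x w)
    have "gen (e i x) * pdw i w \<in> len_span (length w)"
      using gen_len_span[OF Cons, of "e i x"] by (cases w) (auto simp: pm.subspace_0[OF subspace_len_span])
    then show ?case
      using pm.subspace_add[OF subspace_len_span pm.subspace_scale[OF subspace_len_span wd_len_span[of w]]] by simp
  qed (simp add: pm.subspace_0[OF subspace_len_span])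
qed simp

lemma pd_len_span: "p \<in> len_span (Suc n) \<Longrightarrow> pd i p \<in> len_span n"
proof -
  assume p: "p \<in> len_span (Suc n)"
  have "pm.subspace {p. pd i p \<in> len_span n}"
    by (auto intro!: pm.subspaceI simp: pd_simps pm.subspace_0[OF subspace_len_span]
        pm.subspace_add[OF subspace_len_span] pm.subspace_scale[OF subspace_len_span])
  then have "p \<in> {p. pd i p \<in> len_span n}"
  proof (rule subspace_single_induct)
    fix w assume "w \<in> Poly_Mapping.keys p"
    then have "length w = Suc n" using p by (simp add: len_span_def)
    then show "wd w \<in> {p. pd i p \<in> len_span n}" using pdw_len[of i w] by (simp add: pd_wd)
  qed
  then show ?thesis by simp
qed

lemma pd_len_span_0: "p \<in> len_span 0 \<Longrightarrow> pd i p = 0"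
proof (rule lin_eqI[OF pd_lin, where g = "\<lambda>p. 0"])
  show "lin scl scl (\<lambda>p. 0 :: 'g list \<Rightarrow>\<^sub>0 'k)" by (simp add: lin_def)
  fix w assume "p \<in> len_span 0" "w \<in> Poly_Mapping.keys p"
  then have "w = []" by (simp add: len_span_def)
  then show "pd i (wd w) = 0" by (simp add: pd_wd)
qed

lemma pd_len_le: "p \<in> len_le n \<Longrightarrow> pd i p \<in> len_le (n - 1)"
proof -
  assume p: "p \<in> len_le n"
  have "pm.subspace {p. pd i p \<in> len_le (n - 1)}"
    by (auto intro!: pm.subspaceI simp: pd_simps pm.subspace_0[OF subspace_len_le]
        pm.subspace_add[OF subspace_len_le] pm.subspace_scale[OF subspace_len_le])
  then have "p \<in> {p. pd i p \<in> len_le (n - 1)}"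
  proof (rule subspace_single_induct)
    fix w assume "w \<in> Poly_Mapping.keys p"
    then have "length w \<le> n" using p by (simp add: len_le_def)
    then show "wd w \<in> {p. pd i p \<in> len_le (n - 1)}"
      using len_span_le[OF pdw_len[of i w], of "n - 1"] by (simp add: pd_wd)
  qed
  then show ?thesis by simp
qed

context
  fixes sm :: "'k \<Rightarrow> 'm::ab_group_add \<Rightarrow> 'm" and act :: "'g \<Rightarrow> 'm \<Rightarrow> 'm" and v :: 'm
begin

text \<open>\<open>Sn n p\<close> is the symmetrisation of the degree \<open>n\<close> part of \<open>p\<close>, applied to \<open>v\<close>.\<close>

primrec Sn :: "nat \<Rightarrow> ('g list \<Rightarrow>\<^sub>0 'k) \<Rightarrow> 'm" where
  "Sn 0 p = sm (cnt p) v"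
| "Sn (Suc n) p = sm (1 / of_nat (Suc n)) (\<Sum>i<m. act (X i) (Sn n (pd i p)))"

definition Sg :: "('g list \<Rightarrow>\<^sub>0 'k) \<Rightarrow> 'm" where
  "Sg = ext sm (\<lambda>w. Sn (length w) (wd w))"

end

lemma Sn_lin:
  assumes "vector_space sm" "\<And>x. lin sm sm (act x)"
  shows "lin scl sm (Sn sm act v n)"
proof -
  interpret vector_space sm by fact
  show ?thesis
  proof (induction n)
    case 0
    then show ?case by (simp add: lin_def lin_add[OF cnt_lin] lin_scale[OF cnt_lin] scale_left_distrib)
  next
    case (Suc n)
    show ?case unfolding Sn.simps(2)
      by (intro lin_scaled lin_summation assms lin_compose[OF lin_compose[OF pd_lin Suc] assms(2)])
  qed
qed

lemma Sg_lin: "vector_space sm \<Longrightarrow> lin scl sm (Sg sm act v)"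
  unfolding Sg_def by (rule lin_ext)

text \<open>Every step of the recursion shortens words by one letter, and the last one reads off the
  coefficient of the empty word.\<close>

lemma Sn_len:
  assumes "vector_space sm" "\<And>x. lin sm sm (act x)"
  shows "p \<in> len_span n' \<Longrightarrow> n' \<noteq> n \<Longrightarrow> Sn sm act v n p = 0"
proof (induction n arbitrary: p n')
  case 0
  interpret vector_space sm by fact
  from 0 have "[] \<notin> Poly_Mapping.keys p" by (auto simp: len_span_def)
  then show ?case by (simp add: cnt_def in_keys_iff)
next
  case (Suc n)
  interpret vector_space sm by fact
  have "act (X i) (Sn sm act v n (pd i p)) = 0" for i
  proof (cases n')
    case 0
    then show ?thesis using pd_len_span_0 Suc.prems lin_zero[OF Sn_lin[OF assms]] lin_zero[OF assms(2)] by simp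
  next
    case (Suc k)
    then have "Sn sm act v n (pd i p) = 0" using Suc.prems by (intro Suc.IH[of _ k] pd_len_span) auto
    then show ?thesis using lin_zero[OF assms(2)] by simp
  qed
  then show ?case by simp
qed

lemma Sg_len:
  assumes "vector_space sm" "\<And>x. lin sm sm (act x)" "p \<in> len_span n"
  shows "Sg sm act v p = Sn sm act v n p"
proof (rule lin_eqI[OF Sg_lin[OF assms(1)] Sn_lin[OF assms(1,2)]])
  interpret vector_space sm by fact
  fix w assume "w \<in> Poly_Mapping.keys p"
  then show "Sg sm act v (wd w) = Sn sm act v n (wd w)"
    using assms(3) by (simp add: Sg_def ext_single[OF assms(1)] len_span_def)
qed

text \<open>An intertwining map commutes with symmetrisation. Through this a symmetrisation computed
  once in the free algebra is evaluated in each of the modules below.\<close>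

lemma Sn_transfer:
  assumes "lin sm sm' f" "\<And>i u. i < m \<Longrightarrow> f (act (X i) u) = act' (X i) (f u)"
  shows "f (Sn sm act v n p) = Sn sm' act' (f v) n p"
proof (induction n arbitrary: p)
  case (Suc n)
  then show ?case by (simp add: lin_scale[OF assms(1)] lin_sum[OF assms(1)] assms(2) cong: sum.cong_simp)
qed (simp add: lin_scale[OF assms(1)])

lemma Sg_transfer:
  assumes "lin sm sm' f" "\<And>i u. i < m \<Longrightarrow> f (act (X i) u) = act' (X i) (f u)"
  shows "f (Sg sm act v p) = Sg sm' act' (f v) p"
  by (simp add: Sg_def ext_def lin_sum[OF assms(1)] lin_scale[OF assms(1)] Sn_transfer[of sm sm' f act act' v, OF assms])

end

text \<open>The coefficients of \<open>(1 - exp (- t)) / t\<close> and of its inverse.\<close>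

definition bt :: "nat \<Rightarrow> 'k::field_char_0" where "bt k = (- 1) ^ k / fact (Suc k)"

definition gm :: "nat \<Rightarrow> 'k::field_char_0" where "gm k = (- 1) ^ k * bernoulli k / fact k"

lemma bt_Suc: "of_nat (k + 2) * bt (Suc k) = - (bt k :: 'k::field_char_0)"
proof -
  have "fact (Suc (Suc k)) = of_nat (k + 2) * (fact (Suc k) :: 'k)" by simp
  moreover have "of_nat (k + 2) \<noteq> (0 :: 'k)" by (simp only: of_nat_eq_0_iff)
  ultimately show ?thesis by (simp add: bt_def del: fact_Suc of_nat_add)
qed

lemma bernoulli_recursion: "(\<Sum>j\<le>n. of_nat (n choose j) * (bernoulli j / of_nat (n - j + 1))) =
  (if n = 0 then 1 else (0 :: 'k::field_char_0))"
proof (cases n)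
  case (Suc n')
  show ?thesis
  proof (cases n')
    case (Suc n'')
    with \<open>n = Suc n'\<close> have n: "n = n'' + 2" by simp
    have "(\<Sum>j\<le>n. of_nat (n choose j) * (bernoulli j / of_nat (n - j + 1) :: 'k)) =
      (\<Sum>j<n. of_nat (n choose j) * (bernoulli j / of_nat (n - j + 1))) + bernoulli n"
      by (simp add: lessThan_Suc_atMost[symmetric])
    also have "bernoulli n = - (\<Sum>j<n. of_nat (n choose j) * (bernoulli j / of_nat (n - j + 1) :: 'k))"
      using n by simp
    finally show ?thesis using n by simp
  qed (simp add: Suc)
qed simp

text \<open>The Cauchy product of the two series. Extracting \<open>(- 1) ^ n / fact n\<close> turns
  the factorials into a binomial coefficient and leaves the defining recursion of the Bernoulli
  numbers.\<close>

lemma gm_bt: "(\<Sum>k\<le>n. gm k * bt (n - k)) = (if n = 0 then 1 else (0 :: 'k::field_char_0))"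
proof -
  have "gm k * bt (n - k) = (- 1) ^ n / fact n * (of_nat (n choose k) * (bernoulli k / of_nat (n - k + 1) :: 'k))"
    if "k \<le> n" for k
  proof -
    have "(- 1) ^ n = (- 1) ^ k * ((- 1) ^ (n - k) :: 'k)" using that by (simp flip: power_add)
    moreover have "of_nat (n choose k) = (fact n / (fact k * fact (n - k)) :: 'k)"
      using that by (rule binomial_fact)
    moreover define c where "c = (of_nat (n - k + 1) :: 'k)"
    moreover have "fact (Suc (n - k)) = c * fact (n - k)" by (simp add: c_def)
    moreover have "c \<noteq> 0" unfolding c_def by (simp only: of_nat_eq_0_iff)
    ultimately show ?thesis by (simp add: gm_def bt_def mult_ac del: fact_Suc of_nat_add)
  qed
  then have "(\<Sum>k\<le>n. gm k * bt (n - k)) = (- 1) ^ n / fact n * (\<Sum>k\<le>n. of_nat (n choose k) * (bernoulli k / of_nat (n - k + 1) :: 'k))"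
    by (simp add: sum_distrib_left)
  then show ?thesis by (simp only: bernoulli_recursion) simp
qed

section \<open>Products of an element with a symmetrised product, in a module\<close>

locale graded_module = graded_data L lam X r s + vm: vector_space sm
  for L :: "('k::field_char_0, 'g::ab_group_add) lsa" and lam X r s
    and sm :: "'k \<Rightarrow> 'm::ab_group_add \<Rightarrow> 'm" +
  fixes act :: "'g \<Rightarrow> 'm \<Rightarrow> 'm" and v :: 'm
  assumes act_left: "lin sc sm (\<lambda>x. act x u)"
    and act_right: "lin sm sm (act x)"
    and act_rep: "x \<in> parity L p \<Longrightarrow> y \<in> parity L q \<Longrightarrow>
      act x (act y u) = sm (koszul p q) (act y (act x u)) + act (br x y) u"
begin

lemmas left_simps = lin_simps[OF act_left]
lemmas right_simps = lin_simps[OF act_right]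

lemma act_X: "i < m \<Longrightarrow> act h (act (X i) u) = act (X i) (act (e i h) u) + act (br h (X i)) u"
proof (induction h rule: par_induct)
  case (2 h p)
  then show ?case
    using act_rep[OF 2(1) X_parity[OF 2(2)], of u]
    by (simp add: e_hom left_simps right_simps koszul_commute)
qed (simp add: left_simps right_simps e_simps br_simps)

abbreviation "S \<equiv> Sn sm act v"
abbreviation "SG \<equiv> Sg sm act v"

lemmas S_lin = Sn_lin[OF vm.vector_space_axioms act_right]
lemmas S_simps = lin_simps[OF S_lin]

text \<open>\<open>B n h p\<close> symmetrises the product of \<open>h\<close> with the degree \<open>n\<close> part of \<open>p\<close>, also for \<open>h\<close> outside the
  negative part.\<close>

definition "A n h p = act h (S n p)"

primrec B :: "nat \<Rightarrow> 'g \<Rightarrow> ('g list \<Rightarrow>\<^sub>0 'k) \<Rightarrow> 'm" where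
  "B 0 h p = sm (cnt p) (act h v)"
| "B (Suc n) h p = sm (1 / of_nat (n + 2)) (act h (S (Suc n) p) + (\<Sum>i<m. act (X i) (B n (e i h) (pd i p))))"

definition DD :: "('g \<Rightarrow> ('g list \<Rightarrow>\<^sub>0 'k) \<Rightarrow> 'm) \<Rightarrow> 'g \<Rightarrow> ('g list \<Rightarrow>\<^sub>0 'k) \<Rightarrow> 'm" where
  "DD f h p = (\<Sum>i<m. f (br h (X i)) (pd i p))"

lemma DD_apply: "DD f h p = (\<Sum>i<m. f (br h (X i)) (pd i p))"
  by (simp add: DD_def)

text \<open>The share of a symmetrised product that has some \<open>X i\<close> as its first factor;
  \<open>e i h\<close> accounts for moving this \<open>X i\<close> to the front of
  \<open>h\<close>.\<close>

definition LL :: "('g \<Rightarrow> ('g list \<Rightarrow>\<^sub>0 'k) \<Rightarrow> 'm) \<Rightarrow> 'g \<Rightarrow> ('g list \<Rightarrow>\<^sub>0 'k) \<Rightarrow> 'm" where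
  "LL f h p = (\<Sum>i<m. act (X i) (f (e i h) (pd i p)))"

definition bilin :: "('g \<Rightarrow> ('g list \<Rightarrow>\<^sub>0 'k) \<Rightarrow> 'm) \<Rightarrow> bool" where
  "bilin f \<longleftrightarrow> (\<forall>p. lin sc sm (\<lambda>h. f h p)) \<and> (\<forall>h. lin scl sm (f h))"

lemma bilin_A: "bilin (A n)"
  unfolding bilin_def A_def[abs_def] by (intro conjI allI act_left lin_compose[OF S_lin act_right])

lemma bilin_LL: "bilin f \<Longrightarrow> bilin (LL f)"
  unfolding bilin_def LL_def[abs_def]
  by (intro conjI allI lin_summation vm.vector_space_axioms)
    (rule lin_compose[OF e_lin lin_compose[OF _ act_right]] lin_compose[OF pd_lin lin_compose[OF _ act_right]]; simp)+

lemma bilin_DD: "bilin f \<Longrightarrow> bilin (DD f)"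
  unfolding bilin_def DD_def[abs_def]
  by (intro conjI allI lin_summation vm.vector_space_axioms)
    (rule lin_compose[OF lin_br_left] lin_compose[OF pd_lin]; simp)+

lemma bilin_DDk: "bilin f \<Longrightarrow> bilin ((DD ^^ k) f)"
  by (induction k) (auto intro: bilin_DD)

lemma bilin_B: "bilin (B n)"
proof (induction n)
  case 0
  show ?case
    unfolding bilin_def B.simps(1)[abs_def]
    by (auto simp: lin_def left_simps lin_simps[OF cnt_lin] vm.scale_left_distrib vm.scale_right_distrib mult.commute)
next
  case (Suc n)
  have 1: "B (Suc n) h p = sm (1 / of_nat (n + 2)) (A (Suc n) h p + LL (B n) h p)" for h p
    by (simp add: A_def LL_def)
  show ?case
    using bilin_A[of "Suc n"] bilin_LL[OF Suc] unfolding bilin_def 1[abs_def]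
    by (intro conjI allI lin_scaled lin_plus vm.vector_space_axioms) auto
qed

lemma bilinD:
  assumes "bilin f"
  shows "f (sc c h) p = sm c (f h p)" "f h (scl c p) = sm c (f h p)"
    "f (h + h') p = f h p + f h' p" "f h 0 = 0" "f 0 p = 0"
    "f h (p + p') = f h p + f h p'"
  using assms by (auto simp: bilin_def lin_def dest: spec intro: lin_zero)

text \<open>The recursion for \<open>S\<close> puts some \<open>X i\<close> first; moving
  \<open>h\<close> past it leaves \<open>X i\<close> in front of \<open>e i h\<close> and, in
  addition, the bracket of \<open>h\<close> with \<open>X i\<close>.\<close>

lemma A_rec: "sm (of_nat (Suc n)) (A (Suc n) h p) = LL (A n) h p + DD (A n) h p"
proof -
  have "sm (of_nat (Suc n)) (A (Suc n) h p) = act h (\<Sum>i<m. act (X i) (S n (pd i p)))"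
    by (simp add: A_def right_simps del: of_nat_Suc)
  also have "\<dots> = LL (A n) h p + DD (A n) h p"
    by (simp add: right_simps LL_def DD_def A_def act_X sum.distrib cong: sum.cong_simp)
  finally show ?thesis .
qed

text \<open>Expansion along the first of \<open>n + 2\<close> factors: it is \<open>h\<close>,
  followed by a symmetrised product of the letters alone, or it is some \<open>X i\<close>, followed
  by a symmetrised product that still contains \<open>h\<close>.\<close>

lemma B_rec: "sm (of_nat (n + 2)) (B (Suc n) h p) = A (Suc n) h p + LL (B n) h p"
proof -
  have "of_nat (n + 2) \<noteq> (0 :: 'k)" by (simp only: of_nat_eq_0_iff)
  then show ?thesis by (simp add: A_def LL_def del: of_nat_add of_nat_Suc)
qed

text \<open>The signs in \<open>br_e_X\<close> and \<open>pd_comm\<close> are equal and square to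
  one.\<close>

lemma LL_DD: assumes "bilin f" shows "LL (DD f) h p = DD (LL f) h p"
proof -
  have "LL (DD f) h p = (\<Sum>i<m. \<Sum>j<m. act (X i) (f (br (e i h) (X j)) (pd j (pd i p))))"
    by (simp add: LL_def DD_apply right_simps)
  also have "\<dots> = (\<Sum>i<m. \<Sum>j<m. act (X i) (f (e i (br h (X j))) (pd i (pd j p))))"
  proof (intro sum.cong refl)
    fix i j assume "i \<in> {..<m}" "j \<in> {..<m}"
    then have "f (e i (br h (X j))) (pd i (pd j p)) = f (br (e i h) (X j)) (pd j (pd i p))"
      by (subst pd_comm[of i j]) (simp_all add: br_e_X bilinD[OF assms])
    then show "act (X i) (f (br (e i h) (X j)) (pd j (pd i p))) = act (X i) (f (e i (br h (X j))) (pd i (pd j p)))"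
      by simp
  qed
  also have "\<dots> = DD (LL f) h p"
    by (simp add: LL_def DD_apply) (rule sum.swap)
  finally show ?thesis .
qed

lemma DDk_add: "(DD ^^ k) (\<lambda>h p. f h p + g h p) h p = (DD ^^ k) f h p + (DD ^^ k) g h p"
proof (induction k arbitrary: h p)
  case (Suc k)
  then show ?case by (simp add: DD_apply sum.distrib)
qed simp

lemma DDk_scale: "(DD ^^ k) (\<lambda>h p. sm c (f h p)) h p = sm c ((DD ^^ k) f h p)"
proof (induction k arbitrary: h p)
  case (Suc k)
  then show ?case by (simp add: DD_apply vm.scale_sum_right)
qed simp

lemma DDk_sum: "(DD ^^ k) (\<lambda>h p. \<Sum>a\<in>T. f a h p) h p = (\<Sum>a\<in>T. (DD ^^ k) (f a) h p)"
proof (induction k arbitrary: h p)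
  case (Suc k)
  then show ?case by (simp add: DD_apply) (rule sum.swap)
qed simp

lemma LL_DDk: "bilin f \<Longrightarrow> LL ((DD ^^ k) f) h p = (DD ^^ k) (LL f) h p"
proof (induction k arbitrary: h p)
  case (Suc k)
  have "LL ((DD ^^ Suc k) f) h p = DD (LL ((DD ^^ k) f)) h p"
    using LL_DD[OF bilin_DDk[OF Suc.prems]] by simp
  also have "LL ((DD ^^ k) f) = (DD ^^ k) (LL f)" by (intro ext Suc.IH Suc.prems)
  finally show ?case by simp
qed simp

lemma LL_sum: "LL (\<lambda>h p. \<Sum>a\<in>T. sm (c a) (f a h p)) h p = (\<Sum>a\<in>T. sm (c a) (LL (f a) h p))"
  by (simp add: LL_def right_simps vm.scale_sum_right) (rule sum.swap)

lemma LL_A: "LL (A n) h p = sm (of_nat (Suc n)) (A (Suc n) h p) + sm (- 1) (DD (A n) h p)"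
  by (simp add: A_rec del: of_nat_Suc)

text \<open>Induction on \<open>n\<close>: in \<open>B_rec\<close> the expansion of
  \<open>B n\<close> is inserted, \<open>LL\<close> is moved inside the powers of \<open>DD\<close>,
  and \<open>A_rec\<close> eliminates \<open>LL (A j)\<close>. Each term then contributes to the
  powers \<open>k\<close> and \<open>k + 1\<close> of \<open>DD\<close>.\<close>

lemma B_expand: "B n h p = (\<Sum>k\<le>n. sm (bt k) ((DD ^^ k) (A (n - k)) h p))"
proof (induction n arbitrary: h p)
  case 0
  then show ?case by (simp add: A_def bt_def right_simps)
next
  case (Suc n)
  define T where "T k = (DD ^^ k) (A (Suc n - k)) h p" for k
  have Bn: "B n = (\<lambda>h p. \<Sum>k\<le>n. sm (bt k) ((DD ^^ k) (A (n - k)) h p))"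
    by (intro ext) (rule Suc)
  have "LL (B n) h p = (\<Sum>k\<le>n. sm (bt k) ((DD ^^ k) (LL (A (n - k))) h p))"
    unfolding Bn by (simp add: LL_sum LL_DDk bilin_A)
  also have "\<dots> = (\<Sum>k\<le>n. sm (bt k * of_nat (Suc n - k)) (T k) - sm (bt k) (T (Suc k)))"
  proof (intro sum.cong refl)
    fix k assume "k \<in> {..n}"
    then have k: "Suc (n - k) = Suc n - k" by auto
    have "LL (A (n - k)) = (\<lambda>h p. sm (of_nat (Suc (n - k))) (A (Suc (n - k)) h p) + sm (- 1) (DD (A (n - k)) h p))"
      by (intro ext) (rule LL_A)
    then have "(DD ^^ k) (LL (A (n - k))) h p = sm (of_nat (Suc n - k)) (T k) - T (Suc k)"
      by (simp only: DDk_add DDk_scale k) (simp add: T_def funpow_swap1)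
    then show "sm (bt k) ((DD ^^ k) (LL (A (n - k))) h p) = sm (bt k * of_nat (Suc n - k)) (T k) - sm (bt k) (T (Suc k))"
      by (simp add: vm.scale_right_diff_distrib)
  qed
  also have "\<dots> = (\<Sum>k\<le>n. sm (bt k * of_nat (Suc n - k)) (T k)) + (\<Sum>k\<le>n. sm (of_nat (k + 2) * bt (Suc k)) (T (Suc k)))"
    by (simp only: sum_subtractf bt_Suc vm.scale_minus_left sum_negf) simp
  \<comment> \<open>Both sums are extended to the range up to \<open>Suc n\<close>: the first gains
    a term with coefficient zero, the second, after the shift of its index, gains
    \<open>T 0\<close>, which is subtracted and later cancels \<open>A (Suc n) h p\<close>.\<close>
  also have "\<dots> = (\<Sum>k\<le>Suc n. sm (bt k * of_nat (Suc n - k)) (T k)) + (\<Sum>k\<le>Suc n. sm (of_nat (Suc k) * bt k) (T k)) - T 0"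
    by (subst (2) sum.atMost_Suc_shift) (simp add: bt_def del: of_nat_Suc)
  also have "\<dots> = (\<Sum>k\<le>Suc n. sm (of_nat (n + 2) * bt k) (T k)) - T 0"
  proof -
    have *: "sm (bt k * of_nat (Suc n - k)) (T k) + sm (of_nat (Suc k) * bt k) (T k) = sm (of_nat (n + 2) * bt k) (T k)"
      if "k \<le> Suc n" for k
    proof -
      have "bt k * of_nat (Suc n - k) + of_nat (Suc k) * bt k = (of_nat (Suc n - k) + of_nat (Suc k)) * (bt k :: 'k)"
        by (simp only: mult.commute[of _ "bt k"] distrib_left)
      also have "\<dots> = of_nat (n + 2) * bt k"
        using that by (simp only: of_nat_add[symmetric]) simp
      finally show ?thesis by (simp only: vm.scale_left_distrib[symmetric])
    qed
    show ?thesis unfolding sum.distrib[symmetric]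
      by (intro arg_cong2[where f = minus] sum.cong refl) (use * in auto)
  qed
  finally have "sm (of_nat (n + 2)) (B (Suc n) h p) = (\<Sum>k\<le>Suc n. sm (of_nat (n + 2) * bt k) (T k))"
    unfolding B_rec by (simp add: T_def)
  also have "\<dots> = sm (of_nat (n + 2)) (\<Sum>k\<le>Suc n. sm (bt k) (T k))"
    by (simp add: vm.scale_sum_right del: sum.atMost_Suc)
  finally have "B (Suc n) h p = (\<Sum>k\<le>Suc n. sm (bt k) (T k))"
    by (subst (asm) vm.scale_cancel_left) (simp only: of_nat_eq_0_iff, simp)
  then show ?case by (simp only: T_def)
qed

text \<open>Inversion of \<open>B_expand\<close>. Ordering the double sum by the total power of
  \<open>DD\<close> produces the coefficients of \<open>gm_bt\<close>, of which only the one for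
  power zero survives.\<close>

lemma A_expand: "A n h p = (\<Sum>k\<le>n. sm (gm k) ((DD ^^ k) (B (n - k)) h p))"
proof -
  define T where "T k = (DD ^^ k) (A (n - k)) h p" for k
  have Bn: "B j = (\<lambda>h p. \<Sum>k\<le>j. sm (bt k) ((DD ^^ k) (A (j - k)) h p))" for j
    by (intro ext) (rule B_expand)
  have "(DD ^^ k) (B (n - k)) h p = (\<Sum>j\<le>n - k. sm (bt j) (T (k + j)))" for k
  proof -
    have "(DD ^^ k) (\<lambda>h p. (DD ^^ j) (A (n - k - j)) h p) h p = T (k + j)" for j
      by (simp add: T_def funpow_add diff_diff_left)
    then show ?thesis by (subst Bn) (simp add: DDk_sum DDk_scale)
  qed
  then have "(\<Sum>k\<le>n. sm (gm k) ((DD ^^ k) (B (n - k)) h p)) = (\<Sum>k\<le>n. \<Sum>j\<le>n - k. sm (gm k * bt j) (T (k + j)))"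
    by (simp add: vm.scale_sum_right)
  also have "\<dots> = (\<Sum>(k, j)\<in>(SIGMA k:{..n}. {..n - k}). sm (gm k * bt j) (T (k + j)))"
    by (simp add: sum.Sigma)
  also have "\<dots> = (\<Sum>(k, j)\<in>{(i, j). i + j \<le> n}. sm (gm k * bt j) (T (k + j)))"
    by (rule sum.cong) auto
  also have "\<dots> = (\<Sum>d\<le>n. \<Sum>k\<le>d. sm (gm k * bt (d - k)) (T (k + (d - k))))"
    by (rule sum.triangle_reindex_eq)
  also have "\<dots> = (\<Sum>d\<le>n. sm (\<Sum>k\<le>d. gm k * bt (d - k)) (T d))"
    by (simp add: vm.scale_sum_left cong: sum.cong_simp)
  also have "\<dots> = (\<Sum>d\<le>n. if d = 0 then T 0 else 0)"
    by (rule sum.cong) (simp_all add: gm_bt)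
  finally show ?thesis by (simp add: T_def)
qed

text \<open>Pushed through a product of letters, \<open>h\<close> is inserted as
  \<open>[h, X i]\<close> at every position and finally meets \<open>v\<close>, where it acts by the
  character. Averaged over all orderings, the insertions form the symmetrised products of
  \<open>[h, X i]\<close> with the remaining letters. In the induction \<open>h\<close> becomes
  \<open>e i h\<close>, which the character does not distinguish from \<open>h\<close>.\<close>

lemma weight_expand:
  assumes "\<And>h. h \<in> g_k L \<Longrightarrow> act h v = sm (lamx h) v" "h \<in> g_k L"
  shows "A (Suc n) h p = sm (lamx h) (S (Suc n) p) + DD (B n) h p"
  using assms(2)
proof (induction n arbitrary: h p)
  case 0
  have A0: "A 0 (e i h) q = sm (lamx h) (S 0 q)" for i q
    using assms(1)[OF e_k[OF 0]] by (simp add: A_def right_simps lamx_e mult.commute)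
  have "A (Suc 0) h p = LL (A 0) h p + DD (A 0) h p" using A_rec[of 0 h p] by simp
  also have "LL (A 0) h p = sm (lamx h) (S (Suc 0) p)"
    unfolding LL_def A0 by (simp add: right_simps vm.scale_sum_right)
  also have "DD (A 0) h p = DD (B 0) h p"
    by (simp add: DD_apply A_def right_simps)
  finally show ?case .
next
  case (Suc n)
  have "LL (A (Suc n)) h p = (\<Sum>i<m. act (X i) (sm (lamx h) (S (Suc n) (pd i p)) + DD (B n) (e i h) (pd i p)))"
    unfolding LL_def by (simp only: Suc.IH[OF e_k[OF Suc.prems]] lamx_e)
  also have "\<dots> = sm (lamx h) (\<Sum>i<m. act (X i) (S (Suc n) (pd i p))) + LL (DD (B n)) h p"
    by (simp only: LL_def right_simps sum.distrib vm.scale_sum_right)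
  also have "(\<Sum>i<m. act (X i) (S (Suc n) (pd i p))) = sm (of_nat (n + 2)) (S (Suc (Suc n)) p)"
  proof -
    have "of_nat (n + 2) * (1 / of_nat (Suc (Suc n))) = (1 :: 'k)"
      using of_nat_neq_0[of "Suc n", where 'a='k] by (simp del: of_nat_Suc)
    then show ?thesis by (simp only: Sn.simps(2)[of _ _ _ "Suc n"] vm.scale_scale vm.scale_one)
  qed
  also have "LL (DD (B n)) h p = DD (LL (B n)) h p" by (rule LL_DD[OF bilin_B])
  also have "LL (B n) = (\<lambda>h p. sm (of_nat (n + 2)) (B (Suc n) h p) + sm (- 1) (A (Suc n) h p))"
    by (intro ext) (simp only: B_rec, simp)
  also have "DD \<dots> h p = sm (of_nat (n + 2)) (DD (B (Suc n)) h p) - DD (A (Suc n)) h p"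
    by (simp add: DD_apply sum_subtractf vm.scale_sum_right)
  finally have "sm (of_nat (Suc (Suc n))) (A (Suc (Suc n)) h p) =
      sm (of_nat (n + 2)) (sm (lamx h) (S (Suc (Suc n)) p) + DD (B (Suc n)) h p)"
    unfolding A_rec by (simp only: vm.scale_right_distrib vm.scale_left_commute[of "lamx h"]) simp
  then have "sm (of_nat (n + 2)) (A (Suc (Suc n)) h p) =
      sm (of_nat (n + 2)) (sm (lamx h) (S (Suc (Suc n)) p) + DD (B (Suc n)) h p)" by simp
  then show ?case
    by (rule vm.scale_left_imp_eq[rotated]) (simp only: of_nat_eq_0_iff)
qed

text \<open>Applying \<open>pd i\<close> to \<open>gen w * p\<close> either removes
  \<open>w\<close>, with coefficient \<open>xi i w\<close>, or passes it. The first kind of terms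
  reassembles \<open>w\<close> as first factor, the second is the recursion for
  \<open>B\<close>.\<close>

lemma B_of_V:
  assumes "w \<in> V" shows "B n w p = S (Suc n) (gen w * p)"
  using assms
proof (induction n arbitrary: w p)
  case 0
  have "S (Suc 0) (gen w * p) = (\<Sum>i<m. act (X i) (sm (xi i w * cnt p) v))"
    by (simp add: pd_gen lin_simps[OF cnt_lin] cnt_mult cnt_wd)
  also have "\<dots> = sm (cnt p) (act (\<Sum>i<m. sc (xi i w) (X i)) v)"
    by (simp add: right_simps left_simps vm.scale_sum_right mult.commute)
  finally show ?case using 0 by (simp add: xi_expand)
next
  case (Suc n)
  have "S (Suc (Suc n)) (gen w * p) =
      sm (1 / of_nat (n + 2)) (\<Sum>i<m. act (X i) (S (Suc n) (scl (xi i w) p + gen (e i w) * pd i p)))"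
    by (simp only: Sn.simps(2)[of _ _ _ "Suc n"] pd_gen) simp
  also have "(\<Sum>i<m. act (X i) (S (Suc n) (scl (xi i w) p + gen (e i w) * pd i p))) =
      (\<Sum>i<m. sm (xi i w) (act (X i) (S (Suc n) p))) + (\<Sum>i<m. act (X i) (B n (e i w) (pd i p)))"
    by (simp only: S_simps right_simps sum.distrib Suc.IH[OF e_V[OF Suc.prems]])
  also have "(\<Sum>i<m. sm (xi i w) (act (X i) (S (Suc n) p))) = act (\<Sum>i<m. sc (xi i w) (X i)) (S (Suc n) p)"
    by (simp only: left_simps)
  also have "\<dots> = act w (S (Suc n) p)" using Suc.prems by (simp only: xi_expand mp_of_V)
  finally show ?case by (simp only: B.simps)
qed

definition "BG h = ext sm (\<lambda>w. B (length w) h (wd w))"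

lemma bilin_BG: "bilin BG"
  unfolding bilin_def
proof (intro conjI allI)
  fix p
  show "lin sc sm (\<lambda>h. BG h p)"
    unfolding BG_def ext_def using bilin_B
    by (intro lin_summation lin_scaled vm.vector_space_axioms) (auto simp: bilin_def)
  fix h show "lin scl sm (BG h)" unfolding BG_def by (rule lin_ext[OF vm.vector_space_axioms])
qed

lemma BG_len: "p \<in> len_span n \<Longrightarrow> BG h p = B n h p"
proof (rule lin_eqI[where f = "BG h" and g = "B n h"])
  show "lin scl sm (BG h)" "lin scl sm (B n h)" using bilin_BG bilin_B by (auto simp: bilin_def)
  fix w assume "p \<in> len_span n" "w \<in> Poly_Mapping.keys p"
  then show "BG h (wd w) = B n h (wd w)"
    by (simp add: BG_def ext_single[OF vm.vector_space_axioms] len_span_def)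
qed

lemma DDk_BG_len: "p \<in> len_span (n + k) \<Longrightarrow> (DD ^^ k) BG h p = (DD ^^ k) (B n) h p"
proof (induction k arbitrary: h p)
  case (Suc k)
  then have "pd i p \<in> len_span (n + k)" for i using pd_len_span by simp
  then show ?case using Suc.IH by (simp add: DD_apply)
qed (simp add: BG_len)

text \<open>Each \<open>DD\<close> removes a letter, so the series in \<open>DD\<close> are finite
  on every element of the free algebra.\<close>

lemma DDk_len_zero: "bilin f \<Longrightarrow> p \<in> len_span n \<Longrightarrow> n < k \<Longrightarrow> (DD ^^ k) f h p = 0"
proof (induction k arbitrary: h p n)
  case (Suc k)
  show ?case
  proof (cases n)
    case 0
    then have "pd i p = 0" for i using Suc.prems pd_len_span_0 by simp
    then show ?thesis
      using DD_apply[of "(DD ^^ k) f" h p] bilinD(4)[OF bilin_DDk[OF Suc.prems(1)]] by simp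
  next
    case (Suc n')
    then have "(DD ^^ k) f h' (pd i p) = 0" for h' i
      using Suc.prems by (intro Suc.IH[of _ n'] pd_len_span) auto
    then show ?thesis using DD_apply[of "(DD ^^ k) f" h p] by simp
  qed
qed simp

lemma SG_wd: "SG (wd w) = S (length w) (wd w)"
  by (rule Sg_len[OF vm.vector_space_axioms act_right wd_len_span])

lemmas SG_lin = Sg_lin[OF vm.vector_space_axioms, of act v]
lemmas SG_simps = lin_simps[OF SG_lin]

lemma lin_DDk_BG: "lin scl sm ((DD ^^ k) BG h)"
  using bilin_DDk[OF bilin_BG] by (auto simp: bilin_def)

lemma act_SG:
  assumes "p \<in> len_le N"
  shows "act h (SG p) = (\<Sum>k\<le>N. sm (gm k) ((DD ^^ k) BG h p))"
proof (rule lin_vanish_len_le[where f = "\<lambda>p. act h (SG p)" and g = "\<lambda>p. \<Sum>k\<le>N. sm (gm k) ((DD ^^ k) BG h p)"])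
  show "lin scl sm (\<lambda>p. act h (SG p))" by (rule lin_compose[OF SG_lin act_right])
  show "lin scl sm (\<lambda>p. \<Sum>k\<le>N. sm (gm k) ((DD ^^ k) BG h p))"
    by (intro lin_summation lin_scaled lin_DDk_BG vm.vector_space_axioms)
  fix w :: "'g list" assume w: "length w \<le> N"
  have "act h (SG (wd w)) = (\<Sum>k\<le>length w. sm (gm k) ((DD ^^ k) (B (length w - k)) h (wd w)))"
    using A_expand[of "length w" h "wd w"] by (simp add: SG_wd A_def)
  also have "\<dots> = (\<Sum>k\<le>length w. sm (gm k) ((DD ^^ k) BG h (wd w)))"
    by (intro sum.cong refl) (subst DDk_BG_len, use wd_len_span[of w] in auto)
  also have "\<dots> = (\<Sum>k\<le>N. sm (gm k) ((DD ^^ k) BG h (wd w)))"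
    using w by (intro sum.mono_neutral_left) (auto simp: DDk_len_zero[OF bilin_BG wd_len_span])
  finally show "act h (SG (wd w)) = (\<Sum>k\<le>N. sm (gm k) ((DD ^^ k) BG h (wd w)))" .
qed (rule assms)

lemma BG_of_V: "w \<in> V \<Longrightarrow> BG w p = SG (gen w * p)"
proof (rule lin_eqI[where f = "BG w" and g = "\<lambda>p. SG (gen w * p)"])
  show "lin scl sm (BG w)" using bilin_BG by (auto simp: bilin_def)
  show "lin scl sm (\<lambda>p. SG (gen w * p))" by (rule lin_compose[OF lin_mult_left SG_lin])
  fix u assume w: "w \<in> V"
  show "BG w (wd u) = SG (gen w * wd u)"
    using BG_len[OF wd_len_span, of w u] Sg_len[OF vm.vector_space_axioms act_right gen_len_span[OF wd_len_span]]
    by (simp add: B_of_V[OF w])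
qed

lemma act_SG_weight:
  assumes "\<And>h. h \<in> g_k L \<Longrightarrow> act h v = sm (lamx h) v" "h \<in> g_k L"
  shows "act h (SG p) = sm (lamx h) (SG p) + DD BG h p"
proof (rule lin_eqI[where f = "\<lambda>p. act h (SG p)" and g = "\<lambda>p. sm (lamx h) (SG p) + DD BG h p"])
  show "lin scl sm (\<lambda>p. act h (SG p))" by (rule lin_compose[OF SG_lin act_right])
  show "lin scl sm (\<lambda>p. sm (lamx h) (SG p) + DD BG h p)"
    using lin_DDk_BG[of 1] by (intro lin_plus lin_scaled SG_lin vm.vector_space_axioms) simp
  fix w :: "'g list"
  show "act h (SG (wd w)) = sm (lamx h) (SG (wd w)) + DD BG h (wd w)"
  proof (cases "length w")
    case 0
    then have "DD BG h (wd w) = 0" using DDk_len_zero[OF bilin_BG wd_len_span, of w 1 h] by simp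
    then show ?thesis using 0 assms by (simp add: SG_wd right_simps mult.commute)
  next
    case (Suc n)
    have "DD BG h (wd w) = DD (B n) h (wd w)"
      using DDk_BG_len[of "wd w" n 1 h] wd_len_span[of w] Suc by simp
    then show ?thesis using weight_expand[OF assms, of n "wd w"] Suc by (simp add: SG_wd A_def)
  qed
qed

text \<open>The two expressions for \<open>act h (SG p)\<close> are equated and solved for
  \<open>BG h p\<close>. The coefficients of the powers 0 and 1 of \<open>DD\<close> are 1 and 1/2
  in \<open>act_SG\<close>, and \<open>act_SG_weight\<close> has \<open>DD\<close> with coefficient
  1. Thus 1 - 1/2 = 1/2 remains at power 1, which equals (-1) C_1 for C_1 = B_1, whereas all higher
  terms change sides, whence C_k = - B_k.\<close>

lemma BG_weight:
  assumes "\<And>h. h \<in> g_k L \<Longrightarrow> act h v = sm (lamx h) v" "h \<in> g_k L" "p \<in> len_le N"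
  shows "BG h p = sm (lamx h) (SG p) + (\<Sum>k=1..N. sm ((- 1) ^ k * C_coeff k / fact k) ((DD ^^ k) BG h p))"
proof -
  \<comment> \<open>The bound is raised by one so that the term \<open>k = 1\<close> can be split
    off also for \<open>N = 0\<close>; \<open>z\<close> removes the additional summand at the
    end.\<close>
  have N: "p \<in> len_le (Suc N)" using assms(3) len_le_mono by fastforce
  have z: "(DD ^^ Suc N) BG h p = 0"
  proof (rule lin_vanish_len_le[where f = "(DD ^^ Suc N) BG h" and g = "\<lambda>p. 0"])
    show "lin scl sm (\<lambda>p :: 'g list \<Rightarrow>\<^sub>0 'k. 0)" by (simp add: lin_def)
    show "(DD ^^ Suc N) BG h (wd w) = 0" if "length w \<le> N" for w
      using that by (intro DDk_len_zero[OF bilin_BG wd_len_span]) simp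
  qed (rule lin_DDk_BG assms)+
  let ?T = "\<lambda>k. (DD ^^ k) BG h p"
  have "sm (lamx h) (SG p) + ?T 1 = (\<Sum>k\<le>Suc N. sm (gm k) (?T k))"
    using act_SG[OF N, of h] act_SG_weight[OF assms(1,2), of p] by simp
  also have "\<dots> = ?T 0 + sm (1 / 2) (?T 1) + (\<Sum>k=2..Suc N. sm (gm k) (?T k))"
    by (simp only: sum.atMost_shift atLeast0AtMost[symmetric] sum.atLeast_Suc_atMost[of 0] sum.atLeast_Suc_atMost[of "Suc 0"])
      (simp add: gm_def numeral_2_eq_2)
  finally have 1: "BG h p = sm (lamx h) (SG p) + (?T 1 - sm (1 / 2) (?T 1)) - (\<Sum>k=2..Suc N. sm (gm k) (?T k))"
    by (simp add: algebra_simps)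
  have 2: "?T 1 - sm (1 / 2) (?T 1) = sm (1 / 2) (?T 1)"
    using vm.scale_left_diff_distrib[of 1 "1 / 2" "?T 1"] by simp
  have "(\<Sum>k=1..Suc N. sm ((- 1) ^ k * C_coeff k / fact k) (?T k)) =
    sm (1 / 2) (?T 1) - (\<Sum>k=2..Suc N. sm (gm k) (?T k))"
    by (simp only: sum.atLeast_Suc_atMost[of 1 "Suc N"])
      (simp add: C_coeff_def gm_def numeral_2_eq_2 sum_negf[symmetric])
  also have "(\<Sum>k=1..Suc N. sm ((- 1) ^ k * C_coeff k / fact k) (?T k)) =
    (\<Sum>k=1..N. sm ((- 1) ^ k * C_coeff k / fact k) (?T k))"
    using z by simp
  finally show ?thesis using 1 2 by simp
qed

end

section \<open>Expansion of the symmetrisation along its first factor\<close>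

lemma map_ident_poly [simp]: "Poly_Mapping.map (\<lambda>a. a) p = p"
  by (rule poly_mapping_eqI) (simp add: Poly_Mapping.map.rep_eq when_def)

section \<open>Permutations split according to their first value\<close>

definition skip :: "nat \<Rightarrow> nat \<Rightarrow> nat" where "skip j a = (if a < j then a else Suc a)"

definition del :: "nat \<Rightarrow> 'a list \<Rightarrow> 'a list" where "del j w = take j w @ drop (Suc j) w"

lemma skip_inj: "skip j a = skip j b \<longleftrightarrow> a = b"
  by (auto simp: skip_def)

lemma skip_neq [simp]: "skip j a \<noteq> j" "j \<noteq> skip j a"
  by (auto simp: skip_def)

lemma skip_less: "skip j a < skip j b \<longleftrightarrow> a < b"
  by (auto simp: skip_def)

lemma skip_bound: "j < Suc n \<Longrightarrow> skip j a < Suc n \<longleftrightarrow> a < n"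
  by (auto simp: skip_def)

lemma skip_exists: "i \<noteq> j \<Longrightarrow> \<exists>a. i = skip j a"
proof (cases "i < j")
  case True
  then show ?thesis by (intro exI[of _ i]) (simp add: skip_def)
next
  case False
  assume "i \<noteq> j"
  with False show ?thesis by (intro exI[of _ "i - 1"]) (simp add: skip_def)
qed

definition perm_cons :: "nat \<Rightarrow> nat \<Rightarrow> (nat \<Rightarrow> nat) \<Rightarrow> nat \<Rightarrow> nat" where
  "perm_cons n j \<tau> i = (case i of 0 \<Rightarrow> j | Suc i' \<Rightarrow> if i' < n then skip j (\<tau> i') else i)"

lemma perm_cons_permutes:
  assumes "\<tau> permutes {..<n}" "j < Suc n" shows "perm_cons n j \<tau> permutes {..<Suc n}"
proof (rule bij_imp_permutes)
  have lt: "\<tau> i < n" if "i < n" for i using permutes_in_image[OF assms(1), of i] that by simp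
  have inj: "inj_on (perm_cons n j \<tau>) {..<Suc n}"
  proof (rule inj_onI)
    fix x y assume "x \<in> {..<Suc n}" "y \<in> {..<Suc n}" "perm_cons n j \<tau> x = perm_cons n j \<tau> y"
    then show "x = y"
      using permutes_inj[OF assms(1)]
      by (cases x; cases y) (auto simp: perm_cons_def skip_inj inj_eq)
  qed
  have "perm_cons n j \<tau> ` {..<Suc n} \<subseteq> {..<Suc n}"
  proof (rule image_subsetI)
    fix x assume "x \<in> {..<Suc n}"
    then show "perm_cons n j \<tau> x \<in> {..<Suc n}"
      using lt assms(2) skip_bound[OF assms(2)] by (cases x) (auto simp: perm_cons_def)
  qed
  with inj show "bij_betw (perm_cons n j \<tau>) {..<Suc n} {..<Suc n}"
    by (simp add: bij_betw_def endo_inj_surj)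
  show "perm_cons n j \<tau> x = x" if "x \<notin> {..<Suc n}" for x
    using that by (cases x) (auto simp: perm_cons_def)
qed

text \<open>Surjectivity by counting: both sides have \<open>fact (Suc n)\<close> elements.\<close>

lemma perm_cons_bij:
  "bij_betw (\<lambda>(j, \<tau>). perm_cons n j \<tau>) ({..<Suc n} \<times> {\<tau>. \<tau> permutes {..<n}}) {\<tau>. \<tau> permutes {..<Suc n}}"
proof -
  let ?f = "\<lambda>(j, \<tau>). perm_cons n j \<tau>"
  let ?D = "{..<Suc n} \<times> {\<tau>. \<tau> permutes {..<n}}"
  have inj: "inj_on ?f ?D"
  proof (rule inj_onI, clarify)
    fix j \<tau> j' \<tau>'
    assume a: "\<tau> permutes {..<n}" "\<tau>' permutes {..<n}" "perm_cons n j \<tau> = perm_cons n j' \<tau>'"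
    have j: "j = j'" using fun_cong[OF a(3), of 0] by (simp add: perm_cons_def)
    have "\<tau> i = \<tau>' i" for i
    proof (cases "i < n")
      case True
      then show ?thesis using fun_cong[OF a(3), of "Suc i"] by (simp add: perm_cons_def j skip_inj)
    next
      case False
      then show ?thesis using a(1,2) by (simp add: permutes_def)
    qed
    then show "j = j' \<and> \<tau> = \<tau>'" using j by auto
  qed
  have sub: "?f ` ?D \<subseteq> {\<tau>. \<tau> permutes {..<Suc n}}"
    using perm_cons_permutes by auto
  have "card (?f ` ?D) = fact (Suc n)"
    using card_image[OF inj] card_permutations[of "{..<n}" n] by (simp add: card_cartesian_product)
  moreover have "card {\<tau>. \<tau> permutes {..<Suc n}} = fact (Suc n)"
    using card_permutations[of "{..<Suc n}" "Suc n"] by simp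
  ultimately have "?f ` ?D = {\<tau>. \<tau> permutes {..<Suc n}}"
    by (intro card_subset_eq sub finite_permutations) simp_all
  with inj show ?thesis by (simp add: bij_betw_def)
qed

text \<open>Inversions without the letter \<open>j\<close> are those of \<open>\<tau>\<close>,
  relabelled; removing an even letter lowers the number of even letters by one. Since
  \<open>j\<close> stands first, it is inverted with exactly the odd letters of smaller index,
  \<open>j - p\<close> in number, which is zero by truncation if \<open>j\<close> is even.\<close>

lemma odd_inversions_perm_cons:
  assumes "\<tau> permutes {..<n}" "j < Suc n"
  shows "odd_inversions p (Suc n) (perm_cons n j \<tau>) =
    odd_inversions (if j < p then p - 1 else p) n \<tau> + (j - p)"
proof -
  let ?s = "perm_cons n j \<tau>"
  let ?p = "if j < p then p - 1 else p"
  define q where "q = inv_into UNIV ?s"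
  define t where "t = inv_into UNIV \<tau>"
  have s: "?s permutes {..<Suc n}" by (rule perm_cons_permutes[OF assms])
  have qj: "q j = 0"
    unfolding q_def by (rule inv_f_eq[OF permutes_inj[OF s]]) (simp add: perm_cons_def)
  have qs: "q (skip j a) = Suc (t a)" if "a < n" for a
    unfolding q_def
  proof (rule inv_f_eq[OF permutes_inj[OF s]])
    have "t a < n" using permutes_in_image[OF permutes_inv[OF assms(1)], of a] that by (simp add: t_def)
    then show "?s (Suc (t a)) = skip j a"
      by (simp add: perm_cons_def t_def permutes_inverses[OF assms(1)])
  qed
  have qpos: "q i \<noteq> 0" if "i \<noteq> j" "i < Suc n" for i
  proof -
    obtain a where "i = skip j a" using skip_exists[OF \<open>i \<noteq> j\<close>] by blast
    with qs[of a] skip_bound[OF assms(2), of a] that show ?thesis by simp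
  qed
  let ?T = "{(i, k). ?p \<le> i \<and> i < k \<and> k < n \<and> t i > t k}"
  let ?U = "(\<lambda>i. (i, j)) ` {p..<j}"
  have p_le: "p \<le> skip j a \<longleftrightarrow> ?p \<le> a" for a
    by (auto simp: skip_def)
  have "{(i, k). p \<le> i \<and> i < k \<and> k < Suc n \<and> q i > q k} = ?U \<union> map_prod (skip j) (skip j) ` ?T" (is "?l = ?r")
  proof (intro subset_antisym subsetI)
    fix x assume "x \<in> ?l"
    then obtain i k where x: "x = (i, k)" "p \<le> i" "i < k" "k < Suc n" "q i > q k" by blast
    show "x \<in> ?r"
    proof (cases "k = j")
      case True
      then show ?thesis using x by auto
    next
      case False
      moreover have "i \<noteq> j" using x(5) qj by auto
      ultimately obtain a b where ab: "i = skip j a" "k = skip j b" using skip_exists by metis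
      then have "b < n" "a < b" using x skip_bound[OF assms(2)] by (simp_all add: skip_less)
      then have "(a, b) \<in> ?T" using x(2,5) ab p_le[of a] qs[of a] qs[of b] by simp
      then have "map_prod (skip j) (skip j) (a, b) \<in> map_prod (skip j) (skip j) ` ?T" by (rule imageI)
      then show ?thesis using x(1) ab by simp
    qed
  next
    fix x assume "x \<in> ?r"
    then show "x \<in> ?l"
    proof
      assume "x \<in> ?U"
      then obtain i where i: "x = (i, j)" "p \<le> i" "i < j" by auto
      then show ?thesis using qpos[of i] qj assms(2) by simp
    next
      assume "x \<in> map_prod (skip j) (skip j) ` ?T"
      then obtain a b where ab: "x = (skip j a, skip j b)" "?p \<le> a" "a < b" "b < n" "t a > t b"
        by blast
      then show ?thesis using p_le[of a] qs[of a] qs[of b] skip_bound[OF assms(2)] by (simp add: skip_less)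
    qed
  qed
  moreover have "?U \<inter> map_prod (skip j) (skip j) ` ?T = {}" by auto
  moreover have fT: "finite ?T"
    by (rule finite_subset[of _ "{..<n} \<times> {..<n}"]) auto
  moreover have "card ?U = j - p" by (subst card_image) (auto simp: inj_on_def)
  moreover have "card (map_prod (skip j) (skip j) ` ?T) = card ?T"
    by (rule card_image) (auto simp: inj_on_def skip_inj)
  ultimately show ?thesis
    by (simp add: odd_inversions_def q_def[symmetric] t_def[symmetric] card_Un_disjoint)
qed

definition perm_word :: "'a list \<Rightarrow> (nat \<Rightarrow> nat) \<Rightarrow> 'a list" where
  "perm_word w \<tau> = map (\<lambda>i. w ! \<tau> i) [0..<length w]"

lemma del_nth: "j < length w \<Longrightarrow> a < length w - 1 \<Longrightarrow> del j w ! a = w ! skip j a"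
  by (auto simp: del_def skip_def nth_append min_def)

lemma length_del: "j < length w \<Longrightarrow> length (del j w) = length w - 1"
  by (simp add: del_def min_def)

lemma perm_word_cons:
  assumes "\<tau> permutes {..<n}" "j < Suc n" "length w = Suc n"
  shows "perm_word w (perm_cons n j \<tau>) = w ! j # perm_word (del j w) \<tau>"
proof (rule nth_equalityI)
  show "length (perm_word w (perm_cons n j \<tau>)) = length (w ! j # perm_word (del j w) \<tau>)"
    using assms by (simp add: perm_word_def length_del)
  fix i assume "i < length (perm_word w (perm_cons n j \<tau>))"
  then have i: "i < Suc n" using assms by (simp add: perm_word_def)
  show "perm_word w (perm_cons n j \<tau>) ! i = (w ! j # perm_word (del j w) \<tau>) ! i"
  proof (cases i)
    case 0
    then show ?thesis using assms by (simp add: perm_word_def perm_cons_def del: upt_Suc)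
  next
    case (Suc i')
    have "\<tau> i' < n" using permutes_in_image[OF assms(1), of i'] i Suc by simp
    then show ?thesis using i Suc assms
      by (simp add: perm_word_def perm_cons_def length_del del_nth del: upt_Suc)
  qed
qed

lemma perm_sum_laplace:
  fixes f :: "'a list \<Rightarrow> nat \<Rightarrow> 'm::comm_monoid_add"
  assumes "length w = Suc n"
  shows "(\<Sum>\<tau> | \<tau> permutes {..<Suc n}. f (perm_word w \<tau>) (odd_inversions p (Suc n) \<tau>)) =
    (\<Sum>j<Suc n. \<Sum>\<tau> | \<tau> permutes {..<n}. f (w ! j # perm_word (del j w) \<tau>)
       (odd_inversions (if j < p then p - 1 else p) n \<tau> + (j - p)))"
proof -
  have "(\<Sum>\<tau> | \<tau> permutes {..<Suc n}. f (perm_word w \<tau>) (odd_inversions p (Suc n) \<tau>)) =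
    (\<Sum>x\<in>{..<Suc n} \<times> {\<tau>. \<tau> permutes {..<n}}. f (perm_word w ((\<lambda>(j, \<tau>). perm_cons n j \<tau>) x))
       (odd_inversions p (Suc n) ((\<lambda>(j, \<tau>). perm_cons n j \<tau>) x)))"
    by (rule sum.reindex_bij_betw[OF perm_cons_bij, symmetric])
  also have "\<dots> = (\<Sum>(j, \<tau>)\<in>{..<Suc n} \<times> {\<tau>. \<tau> permutes {..<n}}. f (w ! j # perm_word (del j w) \<tau>)
       (odd_inversions (if j < p then p - 1 else p) n \<tau> + (j - p)))"
  proof (rule sum.cong[OF refl])
    fix x :: "nat \<times> (nat \<Rightarrow> nat)" assume x: "x \<in> {..<Suc n} \<times> {\<tau>. \<tau> permutes {..<n}}"
    obtain j \<tau> where j: "x = (j, \<tau>)" by (cases x)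
    with x have 1: "\<tau> permutes {..<n}" "j < Suc n" by auto
    show "f (perm_word w ((\<lambda>(j, \<tau>). perm_cons n j \<tau>) x)) (odd_inversions p (Suc n) ((\<lambda>(j, \<tau>). perm_cons n j \<tau>) x)) =
        (case x of (j, \<tau>) \<Rightarrow> f (w ! j # perm_word (del j w) \<tau>) (odd_inversions (if j < p then p - 1 else p) n \<tau> + (j - p)))"
      by (simp add: j perm_word_cons[OF 1 assms] odd_inversions_perm_cons[OF 1])
  qed
  also have "\<dots> = (\<Sum>j<Suc n. \<Sum>\<tau> | \<tau> permutes {..<n}. f (w ! j # perm_word (del j w) \<tau>)
       (odd_inversions (if j < p then p - 1 else p) n \<tau> + (j - p)))"
    by (rule sum.cartesian_product[symmetric])
  finally show ?thesis .
qed

section \<open>The recursive symmetrisation as a sum over permutations\<close>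

context graded_data begin

lemma Sn_JS:
  assumes "vector_space sm" "\<And>x. lin sm sm (act x)" "p \<in> JS"
  shows "Sn sm act v n p = 0"
  using assms(3)
proof (induction n arbitrary: p)
  case 0
  interpret vector_space sm by fact
  from 0 show ?case by (simp add: cnt_JS)
next
  case (Suc n)
  interpret vector_space sm by fact
  have "Sn sm act v n (pd i p) = 0" if "i < m" for i using Suc that by (intro Suc.IH pd_JS)
  then show ?case by (simp add: lin_zero[OF assms(2)])
qed

lemma Sn_nfS:
  assumes "vector_space sm" "\<And>x. lin sm sm (act x)"
  shows "Sn sm act v n (nfS p) = Sn sm act v n p"
  using Sn_JS[where act = act and v = v and n = n, OF assms qS.nf_diff_J[of p]]
  by (simp add: lin_diff[OF Sn_lin[where act = act, OF assms]])

lemma gen_e_mult: "x \<in> parity L p \<Longrightarrow> nfS (gen (e i x) * q) = scl (koszul (pi i) p) (nfS (gen x * q))"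
  using lin_scale[OF qS.nf_lin_gen_left[OF genS_lin], of "koszul (pi i) p" x q] by (simp add: e_hom)

lemma pd_odd_word:
  assumes "i < m"
  shows "os \<in> lists (parity L 1) \<Longrightarrow> nfS (pd i (wd os)) =
    (\<Sum>j<length os. scl ((- 1) ^ j * xi i (os ! j)) (nfS (wd (del j os))))"
proof (induction os)
  case (Cons x os)
  have x: "x \<in> parity L 1" and os: "os \<in> lists (parity L 1)" using Cons.prems by auto
  have "nfS (pd i (wd (x # os))) = scl (xi i x) (nfS (wd os)) + nfS (gen (e i x) * nfS (pd i (wd os)))"
    by (simp add: pd_wd qS.nf_simps)
  also have "nfS (gen (e i x) * nfS (pd i (wd os))) =
    (\<Sum>j<length os. scl ((- 1) ^ j * xi i (os ! j)) (nfS (gen (e i x) * wd (del j os))))"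
    by (simp add: Cons.IH[OF os] sum_distrib_left scl_mult_right qS.nf_simps del: qS.nf_mult_nf) simp
  also have "\<dots> = (\<Sum>j<length os. scl ((- 1) ^ Suc j * xi i (os ! j)) (nfS (wd (x # del j os))))"
  proof (intro sum.cong refl)
    fix j assume "j \<in> {..<length os}"
    then have o: "os ! j \<in> parity L 1" using os by (auto simp: lists_eq_set)
    show "scl ((- 1) ^ j * xi i (os ! j)) (nfS (gen (e i x) * wd (del j os))) =
       scl ((- 1) ^ Suc j * xi i (os ! j)) (nfS (wd (x # del j os)))"
      using xi_parity[OF o assms] wd_Cons[of x "del j os", where 'k='k]
      by (cases "pi i = 1") (simp_all add: gen_e_mult[OF x])
  qed
  finally show ?case
    by (simp only: length_Cons sum.lessThan_Suc_shift) (simp add: del_def)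
qed (simp add: pd_wd qS.nf_simps)

text \<open>With the even letters in front, only odd letters before position \<open>j\<close> can
  produce a sign. Their number is \<open>j - length es\<close>, truncated to zero when position
  \<open>j\<close> carries an even letter.\<close>

lemma pd_sorted_word:
  assumes "i < m" "os \<in> lists (parity L 1)"
  shows "es \<in> lists (parity L 0) \<Longrightarrow> nfS (pd i (wd (es @ os))) =
    (\<Sum>j<length (es @ os). scl ((- 1) ^ (j - length es) * xi i ((es @ os) ! j)) (nfS (wd (del j (es @ os)))))"
proof (induction es)
  case (Cons x es)
  let ?w = "es @ os"
  have x: "x \<in> parity L 0" and es: "es \<in> lists (parity L 0)" using Cons.prems by auto
  have ex: "e i x = x" using e_hom[OF x, of i] by simp
  have "nfS (pd i (wd (x # ?w))) = scl (xi i x) (nfS (wd ?w)) + nfS (gen x * nfS (pd i (wd ?w)))"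
    by (simp add: pd_wd qS.nf_simps ex)
  also have "nfS (gen x * nfS (pd i (wd ?w))) =
    (\<Sum>j<length ?w. scl ((- 1) ^ (j - length es) * xi i (?w ! j)) (nfS (gen x * wd (del j ?w))))"
    by (simp add: Cons.IH[OF es] sum_distrib_left scl_mult_right qS.nf_simps del: qS.nf_mult_nf) simp
  also have "\<dots> = (\<Sum>j<length ?w. scl ((- 1) ^ (j - length es) * xi i (?w ! j)) (nfS (wd (x # del j ?w))))"
    using wd_Cons[of x "del _ ?w", where 'k='k] by (intro sum.cong refl) simp
  finally show ?case
    by (simp only: length_Cons append_Cons sum.lessThan_Suc_shift) (simp add: del_def)
qed (use pd_odd_word[OF assms] in simp)

lemma del_append_left: "j < length es \<Longrightarrow> del j (es @ os) = del j es @ os"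
  by (simp add: del_def)

lemma del_append_right: "\<not> j < length es \<Longrightarrow> del j (es @ os) = es @ del (j - length es) os"
  by (simp add: del_def Suc_diff_le)

lemma del_lists: "w \<in> lists T \<Longrightarrow> del j w \<in> lists T"
  by (auto simp: del_def lists_eq_set dest: in_set_takeD in_set_dropD)

text \<open>Identifies the recursion with the signed sum in \<open>symmetrise\<close>: splitting off
  the first factor on one side corresponds to splitting permutations by their first value on the
  other. Only linearity of the operators and linear dependence on the letter enter, so it applies to
  brackets as well as to modules.\<close>

lemma Sn_sorted_word:
  assumes vs: "vector_space sm" and left: "\<And>u. lin sc sm (\<lambda>x. act x u)" and right: "\<And>x. lin sm sm (act x)"
  shows "es \<in> lists (V \<inter> parity L 0) \<Longrightarrow> os \<in> lists (V \<inter> parity L 1) \<Longrightarrow> length (es @ os) = n \<Longrightarrow>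
    Sn sm act v n (wd (es @ os)) = sm (1 / fact n) (\<Sum>\<tau> | \<tau> permutes {..<n}.
      sm ((- 1) ^ odd_inversions (length es) n \<tau>) (foldr act (perm_word (es @ os) \<tau>) v))"
proof (induction n arbitrary: es os)
  case 0
  interpret vector_space sm by (rule vs)
  show ?case using 0 by (simp add: cnt_wd perm_word_def odd_inversions_def)
next
  case (Suc n)
  interpret vector_space sm by (rule vs)
  let ?w = "es @ os" and ?p = "length es"
  let ?S = "Sn sm act v n"
  have es: "es \<in> lists (parity L 0)" and os: "os \<in> lists (parity L 1)" using Suc.prems by auto
  have w: "?w ! j \<in> V" if "j < Suc n" for j
    using Suc.prems nth_mem[of j ?w] that by (auto simp: lists_eq_set)
  note Sl = Sn_lin[where act = act and v = v and n = n, OF vs right]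
  note Snf = Sn_nfS[where act = act and v = v and n = n, OF vs right]
  have 1: "?S (pd i (wd ?w)) = (\<Sum>j<Suc n. sm ((- 1) ^ (j - ?p) * xi i (?w ! j)) (?S (wd (del j ?w))))"
    if "i < m" for i
    using Snf[of "pd i (wd ?w)"] pd_sorted_word[OF that os es] Suc.prems(3)
    by (simp add: lin_sum[OF Sl] lin_scale[OF Sl] Snf del: sum.lessThan_Suc)
  have "(\<Sum>i<m. act (X i) (?S (pd i (wd ?w)))) =
     (\<Sum>i<m. \<Sum>j<Suc n. sm ((- 1) ^ (j - ?p)) (act (sc (xi i (?w ! j)) (X i)) (?S (wd (del j ?w)))))"
    by (rule sum.cong[OF refl])
      (simp add: 1 lin_sum[OF right] lin_scale[OF right] lin_scale[OF left] del: sum.lessThan_Suc)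
  \<comment> \<open>The sum over the basis is carried out first: the coordinates of the removed
    letter, attached to the \<open>X i\<close>, give the letter back.\<close>
  also have "\<dots> = (\<Sum>j<Suc n. sm ((- 1) ^ (j - ?p)) (act (\<Sum>i<m. sc (xi i (?w ! j)) (X i)) (?S (wd (del j ?w)))))"
    by (subst sum.swap) (simp add: lin_sum[OF left] scale_sum_right del: sum.lessThan_Suc)
  also have "\<dots> = (\<Sum>j<Suc n. sm ((- 1) ^ (j - ?p)) (act (?w ! j) (?S (wd (del j ?w)))))"
    by (rule sum.cong[OF refl]) (simp add: xi_expand w)
  also have "\<dots> = (\<Sum>j<Suc n. sm ((- 1) ^ (j - ?p)) (act (?w ! j) (sm (1 / fact n) (\<Sum>\<tau> | \<tau> permutes {..<n}.
      sm ((- 1) ^ odd_inversions (if j < ?p then ?p - 1 else ?p) n \<tau>) (foldr act (perm_word (del j ?w) \<tau>) v)))))"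
  proof (rule sum.cong[OF refl])
    fix j assume j: "j \<in> {..<Suc n}"
    have "?S (wd (del j ?w)) = sm (1 / fact n) (\<Sum>\<tau> | \<tau> permutes {..<n}.
      sm ((- 1) ^ odd_inversions (if j < ?p then ?p - 1 else ?p) n \<tau>) (foldr act (perm_word (del j ?w) \<tau>) v))"
    proof (cases "j < ?p")
      case True
      then show ?thesis
        using Suc.IH[of "del j es" os] Suc.prems del_lists[of es _ j]
        by (simp add: del_append_left length_del)
    next
      case False
      then show ?thesis
        using Suc.IH[of es "del (j - ?p) os"] Suc.prems del_lists[of os _ "j - ?p"] j
        by (simp add: del_append_right length_del)
    qed
    then show "sm ((- 1) ^ (j - ?p)) (act (?w ! j) (?S (wd (del j ?w)))) =
      sm ((- 1) ^ (j - ?p)) (act (?w ! j) (sm (1 / fact n) (\<Sum>\<tau> | \<tau> permutes {..<n}.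
        sm ((- 1) ^ odd_inversions (if j < ?p then ?p - 1 else ?p) n \<tau>) (foldr act (perm_word (del j ?w) \<tau>) v))))"
      by simp
  qed
  also have "\<dots> = sm (1 / fact n) (\<Sum>j<Suc n. \<Sum>\<tau> | \<tau> permutes {..<n}.
      sm ((- 1) ^ (odd_inversions (if j < ?p then ?p - 1 else ?p) n \<tau> + (j - ?p)))
        (foldr act (?w ! j # perm_word (del j ?w) \<tau>) v))"
    by (simp add: lin_sum[OF right] lin_scale[OF right] scale_sum_right power_add mult_ac del: sum.lessThan_Suc)
  also have "\<dots> = sm (1 / fact n) (\<Sum>\<tau> | \<tau> permutes {..<Suc n}.
      sm ((- 1) ^ odd_inversions ?p (Suc n) \<tau>) (foldr act (perm_word ?w \<tau>) v))"
    by (rule arg_cong[where f = "sm (1 / fact n)"], rule perm_sum_laplace[OF Suc.prems(3), of "\<lambda>w k. sm ((- 1) ^ k) (foldr act w v)" ?p, symmetric])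
  finally show ?case by simp
qed

section \<open>Symmetrised brackets and derivatives indexed by multi-indices\<close>

definition blocks :: "(nat \<Rightarrow> nat) \<Rightarrow> nat list \<Rightarrow> 'g list" where
  "blocks K l = concat (map (\<lambda>i. replicate (K i) (X i)) l)"

definition dec :: "nat \<Rightarrow> (nat \<Rightarrow> nat) \<Rightarrow> nat \<Rightarrow> nat" where "dec i K = K(i := K i - 1)"

lemma blocks_Cons: "wd (blocks K (j # l)) = (wd (replicate (K j) (X j)) * wd (blocks K l) :: 'g list \<Rightarrow>\<^sub>0 'k)"
  by (simp add: blocks_def wd_append[symmetric])

lemma blocks_dec: "i \<notin> set l \<Longrightarrow> blocks (dec i K) l = blocks K l"
  unfolding blocks_def dec_def by (intro arg_cong[where f = concat] map_cong refl) auto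

lemma pd_replicate_other: "i < m \<Longrightarrow> j < m \<Longrightarrow> i \<noteq> j \<Longrightarrow> pd i (wd (replicate k (X j))) = 0"
  by (induction k) (simp_all add: pd_wd xi_X)

lemma pd_replicate_self:
  assumes "i < m" "i < r \<or> k \<le> 1"
  shows "pd i (wd (replicate k (X i))) = scl (of_nat k) (wd (replicate (k - 1) (X i)))"
  using assms(2)
proof (induction k)
  case (Suc k)
  show ?case
  proof (cases "k = 0")
    case True
    then show ?thesis using assms by (simp add: pd_wd xi_X)
  next
    case False
    then have ir: "i < r" and e: "e i (X i) = X i" using Suc.prems by (auto simp: e_def)
    obtain k' where k: "k = Suc k'" using False by (cases k) auto
    have w: "wd (replicate (Suc j) (X i)) = (gen (X i) * wd (replicate j (X i)) :: 'g list \<Rightarrow>\<^sub>0 'k)" for j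
      using wd_Cons[of "X i" "replicate j (X i)"] by simp
    have "pd i (wd (replicate (Suc k) (X i))) =
        wd (replicate k (X i)) + gen (X i) * scl (of_nat k) (wd (replicate k' (X i)))"
      unfolding w[of k] pd_gen e using Suc.IH ir assms(1) k by (simp add: xi_X del: replicate_Suc)
    also have "\<dots> = scl (1 + of_nat k) (wd (replicate k (X i)))"
      using w[of k'] k by (simp only: scl_mult_right pm.scale_left_distrib pm.scale_one)
    finally show ?thesis by simp
  qed
qed (simp add: pd_wd)

lemma em_replicate:
  assumes "j < m"
  shows "nfS (em i (wd (replicate k (X j))) * q) = scl (koszul (pi i) (pi j) ^ k) (nfS (wd (replicate k (X j)) * q))"
proof (induction k)
  case (Suc k)
  have "em i (wd (replicate (Suc k) (X j))) * q = gen (e i (X j)) * (em i (wd (replicate k (X j))) * q)"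
    using wd_Cons[of "e i (X j)" "replicate k (e i (X j))", where 'k='k] by (simp add: mult.assoc)
  then have "nfS (em i (wd (replicate (Suc k) (X j))) * q) =
      scl (koszul (pi i) (pi j)) (nfS (gen (X j) * nfS (em i (wd (replicate k (X j))) * q)))"
    by (simp only: gen_e_mult[OF X_parity[OF assms]] qS.nf_mult_nf)
  also have "\<dots> = scl (koszul (pi i) (pi j) ^ Suc k) (nfS (gen (X j) * (wd (replicate k (X j)) * q)))"
    by (simp only: Suc scl_mult_right lin_scale[OF qS.nf_lin] qS.nf_mult_nf pm.scale_scale power_Suc)
  also have "gen (X j) * (wd (replicate k (X j)) * q) = wd (replicate (Suc k) (X j)) * q"
    using wd_Cons[of "X j" "replicate k (X j)", where 'k='k] by (simp add: mult.assoc)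
  finally show ?case .
qed (simp add: wd_Nil)

lemma pd_blocks_other: "i < m \<Longrightarrow> set l \<subseteq> {..<m} \<Longrightarrow> i \<notin> set l \<Longrightarrow> pd i (wd (blocks K l)) = 0"
proof (induction l)
  case (Cons j l)
  then show ?case
    by (simp only: blocks_Cons pd_mult) (simp add: pd_replicate_other)
qed (simp add: blocks_def pd_wd)

text \<open>The sign of moving \<open>X i\<close> from its own block to the front of the blocks with
  indices from \<open>a\<close> on.\<close>

definition sg :: "nat \<Rightarrow> (nat \<Rightarrow> nat) \<Rightarrow> nat \<Rightarrow> 'k" where
  "sg i K a = (\<Prod>j\<in>{a..<i}. koszul (pi i) (pi j) ^ K j)"

lemma sg_self [simp]: "sg i K i = 1" by (simp add: sg_def)

lemma sg_step: "a < i \<Longrightarrow> sg i K a = koszul (pi i) (pi a) ^ K a * sg i K (Suc a)"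
  by (simp add: sg_def prod.atLeast_Suc_lessThan)

lemma sg_square: "sg i K a * sg i K a = 1"
proof -
  have "koszul (pi i) (pi j) ^ k * koszul (pi i) (pi j) ^ k = (1 :: 'k)" for j k
    by (simp add: power_mult_distrib[symmetric])
  then show ?thesis by (simp add: sg_def prod.distrib[symmetric])
qed

lemma pd_blocks:
  assumes i: "i < m" and K: "i < r \<or> K i \<le> 1"
  shows "a \<le> i \<Longrightarrow> nfS (pd i (wd (blocks K [a..<m]))) = scl (of_nat (K i) * sg i K a) (nfS (wd (blocks (dec i K) [a..<m])))"
proof (induction a rule: inc_induct)
  case base
  have u: "[i..<m] = i # [Suc i..<m]" using i by (simp add: upt_conv_Cons)
  have "pd i (wd (blocks K [i..<m])) = scl (of_nat (K i)) (wd (replicate (K i - 1) (X i))) * wd (blocks K [Suc i..<m])"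
    unfolding u blocks_Cons pd_mult
    by (subst pd_blocks_other) (use i in \<open>auto simp: pd_replicate_self[OF i K]\<close>)
  also have "\<dots> = scl (of_nat (K i)) (wd (blocks (dec i K) [i..<m]))"
  proof -
    have "blocks (dec i K) [Suc i..<m] = blocks K [Suc i..<m]" by (rule blocks_dec) simp
    moreover have "dec i K i = K i - 1" by (simp add: dec_def)
    ultimately show ?thesis unfolding u blocks_Cons by (simp only: scl_mult_left)
  qed
  finally show ?case by (simp add: qS.nf_simps)
next
  case (step a)
  have u: "[a..<m] = a # [Suc a..<m]" using step i by (simp add: upt_conv_Cons)
  have "pd i (wd (blocks K [a..<m])) = em i (wd (replicate (K a) (X a))) * pd i (wd (blocks K [Suc a..<m]))"
    unfolding u blocks_Cons pd_mult by (subst pd_replicate_other) (use i step in auto)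
  then have "nfS (pd i (wd (blocks K [a..<m]))) =
     scl (koszul (pi i) (pi a) ^ K a) (nfS (wd (replicate (K a) (X a)) * nfS (pd i (wd (blocks K [Suc a..<m])))))"
    using step.hyps i by (simp only: em_replicate[of a] qS.nf_mult_nf less_trans[of a i])
  also have "\<dots> = scl (of_nat (K i) * sg i K a) (nfS (wd (blocks (dec i K) [a..<m])))"
  proof -
    have "dec i K a = K a" using step by (simp add: dec_def)
    moreover have "koszul (pi i) (pi a) ^ K a * (of_nat (K i) * sg i K (Suc a)) = of_nat (K i) * sg i K a"
      using step by (simp add: sg_step)
    ultimately show ?thesis unfolding step.IH u blocks_Cons
      by (simp only: scl_mult_right lin_scale[OF qS.nf_lin] qS.nf_mult_nf pm.scale_scale)
  qed
  finally show ?case .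
qed

definition pdK :: "(nat \<Rightarrow> nat) \<Rightarrow> nat list \<Rightarrow> ('g list \<Rightarrow>\<^sub>0 'k) \<Rightarrow> ('g list \<Rightarrow>\<^sub>0 'k)" where
  "pdK K l = foldr (\<lambda>i f. (pd i ^^ K i) \<circ> f) l id"

lemma pdK_Cons: "pdK K (j # l) p = (pd j ^^ K j) (pdK K l p)"
  by (simp add: pdK_def)

lemma pdK_dec: "i \<notin> set l \<Longrightarrow> pdK (dec i K) l = pdK K l"
proof (induction l)
  case (Cons j l)
  then show ?case by (auto simp: fun_eq_iff pdK_Cons dec_def)
qed (simp add: pdK_def)

lemma pd_pow_lin: "lin scl scl (pd i ^^ k)"
proof (induction k)
  case (Suc k)
  then show ?case using lin_compose[OF Suc pd_lin] by (simp add: comp_def)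
qed (simp add: lin_def)

lemma pdK_lin: "lin scl scl (pdK K l)"
proof (induction l)
  case (Cons j l)
  then show ?case using lin_compose[OF Cons pd_pow_lin[where i = j and k = "K j"]] by (simp add: pdK_Cons[abs_def])
qed (simp add: pdK_def lin_def)

lemma pd_pow_comm:
  "i < m \<Longrightarrow> j < m \<Longrightarrow> (pd j ^^ k) (pd i p) = scl (koszul (pi i) (pi j) ^ k) (pd i ((pd j ^^ k) p))"
proof (induction k)
  case (Suc k)
  then have "(pd j ^^ Suc k) (pd i p) = scl (koszul (pi i) (pi j) ^ k) (pd j (pd i ((pd j ^^ k) p)))"
    by (simp add: pd_simps)
  also have "pd j (pd i ((pd j ^^ k) p)) = scl (koszul (pi i) (pi j)) (pd i (pd j ((pd j ^^ k) p)))"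
    using Suc.prems by (subst pd_comm) (simp_all add: koszul_commute)
  finally show ?case by (simp only: pm.scale_scale power_Suc2 funpow.simps comp_apply)
qed simp

text \<open>The sign is the same as in \<open>pd_blocks\<close>. In \<open>s_map_step\<close> the
  two occur together and cancel by \<open>sg_square\<close>.\<close>

lemma pdK_extract:
  assumes i: "i < m" and K: "K i > 0"
  shows "a \<le> i \<Longrightarrow> pdK K [a..<m] p = scl (sg i K a) (pd i (pdK (dec i K) [a..<m] p))"
proof (induction a rule: inc_induct)
  case base
  have u: "[i..<m] = i # [Suc i..<m]" using i by (simp add: upt_conv_Cons)
  obtain k where k: "K i = Suc k" using K by (cases "K i") auto
  have "pdK (dec i K) [Suc i..<m] = pdK K [Suc i..<m]" by (rule pdK_dec) simp
  then show ?case unfolding u pdK_Cons by (simp add: k dec_def)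
next
  case (step a)
  have u: "[a..<m] = a # [Suc a..<m]" using step i by (simp add: upt_conv_Cons)
  have "(pd a ^^ K a) (scl c (pd i q)) = scl (koszul (pi i) (pi a) ^ K a * c) (pd i ((pd a ^^ K a) q))" for c q
    using step i by (simp only: lin_scale[OF pd_pow_lin] pd_pow_comm pm.scale_scale mult.commute)
  moreover have "dec i K a = K a" using step by (simp add: dec_def)
  ultimately show ?case unfolding u pdK_Cons step.IH using step by (simp only: sg_step)
qed

text \<open>An odd derivation anticommutes with itself, and 2 is invertible in characteristic
  zero.\<close>

lemma pd_odd_square: "i < m \<Longrightarrow> \<not> i < r \<Longrightarrow> pd i (pd i p) = 0"
proof -
  assume i: "i < m" "\<not> i < r"
  have "pd i (pd i p) = scl (- 1) (pd i (pd i p))"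
    using pd_comm[OF i(1) i(1), of p] i(2) by (simp add: pi_def)
  then have "pd i (pd i p) + pd i (pd i p) = 0" by (metis add.right_inverse pm.scale_minus_left pm.scale_one)
  then have "scl 2 (pd i (pd i p)) = 0"
    using pm.scale_left_distrib[of 1 1 "pd i (pd i p)"] by simp
  then show ?thesis by simp
qed

lemma pd_pdK_zero:
  assumes "i < m" "\<not> i < r" "K i > 0" shows "pd i (pdK K [0..<m] p) = 0"
  by (subst pdK_extract[of i K 0 p, OF assms(1,3)]) (simp_all add: pd_simps pd_odd_square assms)

definition "MI k = {K \<in> multi_indices r s. mi_size r s K = k}"

lemma finite_MI: "finite (MI k)"
proof (rule finite_subset)
  show "finite {K :: nat \<Rightarrow> nat. \<forall>i. (i \<in> {..<m} \<longrightarrow> K i \<in> {..k}) \<and> (i \<notin> {..<m} \<longrightarrow> K i = 0)}"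
    by (rule finite_set_of_finite_funs) simp_all
  show "MI k \<subseteq> {K. \<forall>i. (i \<in> {..<m} \<longrightarrow> K i \<in> {..k}) \<and> (i \<notin> {..<m} \<longrightarrow> K i = 0)}"
    by (auto simp: MI_def multi_indices_def mi_size_def intro: member_le_sum)
qed

lemma MI_0: "MI 0 = {\<lambda>_. 0}"
  by (auto simp: MI_def multi_indices_def mi_size_def fun_eq_iff) (metis lessThan_iff not_le)

text \<open>Basis vectors are ordered with the even ones first, so the word of blocks is of the form
  required by \<open>Sn_sorted_word\<close>, applied to the operators \<open>ad_tilde L x\<close> on
  the Lie superalgebra. The rest translates sums in \<open>End_algebra\<close> into pointwise
  sums.\<close>

lemma s_map_conv:
  assumes "K \<in> multi_indices r s"
  shows "s_map L r s X K h = Sn sc (ad_tilde L) h (mi_size r s K) (wd (blocks K [0..<m]))"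
proof -
  let ?E = "End_algebra L"
  have E_carrier: "carrier ?E = {f. lin sc sc f}"
    by (simp add: End_algebra_def lin_linear gs.vector_space_axioms)
  have ad: "lin sc sc (ad_tilde L x)" for x
    unfolding ad_tilde_def by (rule lin_br_left)
  interpret E: abelian_monoid ?E
  proof (rule abelian_monoidI)
    show "\<zero>\<^bsub>?E\<^esub> \<in> carrier ?E" unfolding E_carrier by (simp add: End_algebra_def lin_def)
    fix f g assume "f \<in> carrier ?E" "g \<in> carrier ?E"
    then show "f \<oplus>\<^bsub>?E\<^esub> g \<in> carrier ?E"
      unfolding E_carrier by (simp add: End_algebra_def lin_plus[OF gs.vector_space_axioms])
  qed (auto simp: End_algebra_def fun_eq_iff add_ac)
  have fs: "finsum ?E f A = (\<lambda>x. \<Sum>a\<in>A. f a x)" if "\<And>a. a \<in> A \<Longrightarrow> lin sc sc (f a)" "finite A"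
    for f :: "(nat \<Rightarrow> nat) \<Rightarrow> 'g \<Rightarrow> 'g" and A
    using that(2,1)
  proof (induction A rule: finite_induct)
    case (insert a A)
    then have "finsum ?E f (insert a A) = f a \<oplus>\<^bsub>?E\<^esub> finsum ?E f A"
      by (intro E.finsum_insert) (auto simp: E_carrier)
    then show ?case using insert by (simp add: End_algebra_def)
  next
    case empty
    have "zero ?E = (\<lambda>x. 0)" by (simp add: End_algebra_def)
    then show ?case by simp
  qed
  let ?n = "mi_size r s K"
  let ?es = "blocks K [0..<r]" and ?os = "blocks K [r..<m]"
  have m: "[0..<m] = [0..<r] @ [r..<m]"
    using upt_add_eq_append[of 0 r s] by simp
  have w: "blocks K [0..<m] = ?es @ ?os" unfolding m by (simp add: blocks_def)
  have len: "length (blocks K l) = (\<Sum>i\<leftarrow>l. K i)" for l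
    by (simp add: blocks_def length_concat comp_def)
  have lenp: "length ?es = (\<Sum>i<r. K i)"
    by (simp add: len interv_sum_list_conv_sum_set_nat atLeast0LessThan)
  have lenw: "length (blocks K [0..<m]) = ?n"
    by (simp add: len interv_sum_list_conv_sum_set_nat atLeast0LessThan mi_size_def)
  have es: "?es \<in> lists (V \<inter> parity L 0)" and os: "?os \<in> lists (V \<inter> parity L 1)"
    using X_V X_parity by (auto simp: blocks_def lists_eq_set pi_def)
      (metis add.commute trans_less_add2 pi_def, metis pi_def not_le)
  have lp: "list_prod ?E (map (ad_tilde L) u) = foldr (ad_tilde L) u" for u
    by (induction u) (simp_all add: list_prod_def End_algebra_def fun_eq_iff)
  have lf: "lin sc sc (foldr (ad_tilde L) u)" for u
  proof (induction u)
    case (Cons x u)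
    then show ?case using lin_compose[OF Cons ad[of x]] by (simp add: comp_def)
  qed (simp add: lin_def)
  have c: "concat (map (\<lambda>i. replicate (K i) (ad_tilde L (X i))) [0..<r + s]) = map (ad_tilde L) (blocks K [0..<m])"
    by (simp add: blocks_def map_concat comp_def)
  have mp: "map (\<lambda>i. map (ad_tilde L) (blocks K [0..<m]) ! \<tau> i) [0..<?n] = map (ad_tilde L) (perm_word (blocks K [0..<m]) \<tau>)"
    if "\<tau> permutes {..<?n}" for \<tau>
    using permutes_in_image[OF that] by (simp add: perm_word_def lenw)
  let ?F = "\<lambda>\<tau>. (- 1) ^ odd_inversions (\<Sum>i<r. K i) ?n \<tau> \<odot>\<^bsub>?E\<^esub> list_prod ?E (map (\<lambda>i. map (ad_tilde L) (blocks K [0..<m]) ! \<tau> i) [0..<?n])"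
  have F: "?F \<tau> = (\<lambda>x. sc ((- 1) ^ odd_inversions (\<Sum>i<r. K i) ?n \<tau>) (foldr (ad_tilde L) (perm_word (blocks K [0..<m]) \<tau>) x))"
    if "\<tau> permutes {..<?n}" for \<tau>
    by (simp add: mp[OF that] lp) (simp add: End_algebra_def)
  have "s_map L r s X K h = sc (1 / fact ?n) ((finsum ?E ?F {\<tau>. \<tau> permutes {..<?n}}) h)"
    unfolding s_map_def symmetrise_def c Let_def length_map lenw
    by (simp add: End_algebra_def)
  also have "finsum ?E ?F {\<tau>. \<tau> permutes {..<?n}} = (\<lambda>x. \<Sum>\<tau> | \<tau> permutes {..<?n}. ?F \<tau> x)"
    by (rule fs) (simp_all add: F lin_scaled[OF gs.vector_space_axioms lf] finite_permutations)
  also have "(\<Sum>\<tau> | \<tau> permutes {..<?n}. ?F \<tau> h) = (\<Sum>\<tau> | \<tau> permutes {..<?n}.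
     sc ((- 1) ^ odd_inversions (\<Sum>i<r. K i) ?n \<tau>) (foldr (ad_tilde L) (perm_word (blocks K [0..<m]) \<tau>) h))"
    by (rule sum.cong[OF refl]) (simp add: F)
  also have "sc (1 / fact ?n) \<dots> = Sn sc (ad_tilde L) h ?n (wd (blocks K [0..<m]))"
    unfolding w using lenw[unfolded w]
    by (subst Sn_sorted_word[where act = "ad_tilde L", OF gs.vector_space_axioms _ ad es os]) (simp_all add: ad_tilde_def lin_br_right lenp)
  finally show ?thesis .
qed

lemma dec_MI: "K \<in> MI (Suc k) \<Longrightarrow> i < m \<Longrightarrow> K i > 0 \<Longrightarrow> dec i K \<in> MI k"
proof -
  assume K: "K \<in> MI (Suc k)" and i: "i < m" "K i > 0"
  have "(\<Sum>j<m. K j) = K i + (\<Sum>j\<in>{..<m} - {i}. K j)"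
    using i by (intro sum.remove) auto
  moreover have "(\<Sum>j<m. dec i K j) = dec i K i + (\<Sum>j\<in>{..<m} - {i}. dec i K j)"
    using i by (intro sum.remove) auto
  moreover have "(\<Sum>j\<in>{..<m} - {i}. dec i K j) = (\<Sum>j\<in>{..<m} - {i}. K j)"
    by (rule sum.cong) (auto simp: dec_def)
  moreover have "dec i K \<in> multi_indices r s"
    using K by (auto simp: MI_def multi_indices_def dec_def le_diff_conv)
  ultimately show ?thesis using K i by (simp add: MI_def mi_size_def dec_def)
qed

text \<open>Expansion along the first factor of the symmetrised product, which is the outermost
  bracket. The index \<open>i\<close> can be chosen in \<open>K i\<close> ways, and
  \<open>sg\<close> brings the chosen letter to the front.\<close>

lemma s_map_rec:
  assumes "K \<in> MI (Suc k)"
  shows "sc (of_nat (Suc k)) (s_map L r s X K h) =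
    (\<Sum>i | i < m \<and> K i > 0. sc (of_nat (K i) * sg i K 0) (br (s_map L r s X (dec i K) h) (X i)))"
proof -
  have K: "K \<in> multi_indices r s" "mi_size r s K = Suc k" using assms by (auto simp: MI_def)
  have ad: "lin sc sc (ad_tilde L x)" for x unfolding ad_tilde_def by (rule lin_br_left)
  note Sl = Sn_lin[where act = "ad_tilde L" and v = h and n = k, OF gs.vector_space_axioms ad]
  note Snf = Sn_nfS[where act = "ad_tilde L" and v = h and n = k, OF gs.vector_space_axioms ad]
  have 1: "sc (of_nat (Suc k)) (s_map L r s X K h) =
    (\<Sum>i<m. br (Sn sc (ad_tilde L) h k (pd i (wd (blocks K [0..<m])))) (X i))"
    unfolding s_map_conv[OF K(1)] K(2) Sn.simps(2)
    by (simp add: ad_tilde_def del: of_nat_Suc)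
  have 2: "Sn sc (ad_tilde L) h k (pd i (wd (blocks K [0..<m]))) =
      sc (of_nat (K i) * sg i K 0) (Sn sc (ad_tilde L) h k (wd (blocks (dec i K) [0..<m])))" if "i < m" for i
  proof -
    have "i < r \<or> K i \<le> 1" using K(1) that by (auto simp: multi_indices_def not_less)
    from pd_blocks[of i K 0, OF that this] show ?thesis
      using Snf[of "pd i (wd (blocks K [0..<m]))"] by (simp add: lin_scale[OF Sl] Snf)
  qed
  have "sc (of_nat (Suc k)) (s_map L r s X K h) = (\<Sum>i<m. sc (of_nat (K i) * sg i K 0)
      (br (Sn sc (ad_tilde L) h k (wd (blocks (dec i K) [0..<m]))) (X i)))"
    unfolding 1 by (rule sum.cong[OF refl]) (simp add: 2 br_simps)
  also have "\<dots> = (\<Sum>i | i < m \<and> K i > 0. sc (of_nat (K i) * sg i K 0)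
      (br (Sn sc (ad_tilde L) h k (wd (blocks (dec i K) [0..<m]))) (X i)))"
    by (rule sum.mono_neutral_right) auto
  also have "\<dots> = (\<Sum>i | i < m \<and> K i > 0. sc (of_nat (K i) * sg i K 0) (br (s_map L r s X (dec i K) h) (X i)))"
  proof (rule sum.cong[OF refl])
    fix i assume "i \<in> {i. i < m \<and> K i > 0}"
    then have "dec i K \<in> MI k" using dec_MI[OF assms] by simp
    then show "sc (of_nat (K i) * sg i K 0) (br (Sn sc (ad_tilde L) h k (wd (blocks (dec i K) [0..<m]))) (X i)) =
      sc (of_nat (K i) * sg i K 0) (br (s_map L r s X (dec i K) h) (X i))"
      by (simp add: s_map_conv MI_def)
  qed
  finally show ?thesis .
qed

text \<open>For an even index this is a quotient of factorials. For an odd one the entry is 1, and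
  \<open>mi_fact\<close> has no factor for it.\<close>

lemma mi_fact_dec:
  assumes "K \<in> multi_indices r s" "i < m" "K i > 0"
  shows "of_nat (K i) / mi_fact r K = (1 / mi_fact r (dec i K) :: 'k)"
proof (cases "i < r")
  case True
  have "(\<Prod>j<r. fact (K j)) = fact (K i) * (\<Prod>j\<in>{..<r} - {i}. fact (K j) :: 'k)"
    using True by (intro prod.remove) auto
  moreover have "(\<Prod>j<r. fact (dec i K j)) = fact (dec i K i) * (\<Prod>j\<in>{..<r} - {i}. fact (dec i K j) :: 'k)"
    using True by (intro prod.remove) auto
  moreover have "(\<Prod>j\<in>{..<r} - {i}. fact (dec i K j)) = (\<Prod>j\<in>{..<r} - {i}. fact (K j) :: 'k)"
    by (rule prod.cong) (auto simp: dec_def)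
  moreover have "fact (K i) = of_nat (K i) * (fact (dec i K i) :: 'k)"
    using assms(3) by (cases "K i") (simp_all add: dec_def)
  ultimately show ?thesis using assms(3) by (simp add: mi_fact_def)
next
  case False
  then have "K i = 1" using assms by (auto simp: multi_indices_def not_less dest!: spec[of _ i])
  moreover have "mi_fact r (dec i K) = (mi_fact r K :: 'k)"
    unfolding mi_fact_def by (rule prod.cong) (use False in \<open>auto simp: dec_def\<close>)
  ultimately show ?thesis by simp
qed

end

section \<open>Injectivity of the symmetrisation\<close>

lemma map_zero_poly [simp]: "Poly_Mapping.map (\<lambda>a. 0) p = 0"
  by (rule poly_mapping_eqI) (simp add: Poly_Mapping.map.rep_eq when_def)

context graded_data begin

section \<open>Powers of D in terms of \<open>s_map\<close>\<close>

definition inc :: "nat \<Rightarrow> (nat \<Rightarrow> nat) \<Rightarrow> nat \<Rightarrow> nat" where "inc i K = K(i := Suc (K i))"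

lemma inc_dec: "K i > 0 \<Longrightarrow> inc i (dec i K) = K" and dec_inc: "dec i (inc i K) = K"
  by (auto simp: inc_def dec_def)

lemma inc_MI: "K \<in> MI k \<Longrightarrow> i < m \<Longrightarrow> i < r \<or> K i = 0 \<Longrightarrow> inc i K \<in> MI (Suc k)"
proof -
  assume K: "K \<in> MI k" and i: "i < m" "i < r \<or> K i = 0"
  have "(\<Sum>j<m. K j) = K i + (\<Sum>j\<in>{..<m} - {i}. K j)"
    using i by (intro sum.remove) auto
  moreover have "(\<Sum>j<m. inc i K j) = inc i K i + (\<Sum>j\<in>{..<m} - {i}. inc i K j)"
    using i by (intro sum.remove) auto
  moreover have "(\<Sum>j\<in>{..<m} - {i}. inc i K j) = (\<Sum>j\<in>{..<m} - {i}. K j)"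
    by (rule sum.cong) (auto simp: inc_def)
  moreover have "inc i K \<in> multi_indices r s"
    using K i by (auto simp: MI_def multi_indices_def inc_def)
  ultimately show ?thesis using K by (simp add: MI_def mi_size_def inc_def)
qed

lemma pdK_zero: "pdK (\<lambda>_. 0) l p = p"
  by (induction l) (simp_all add: pdK_Cons, simp add: pdK_def)

lemma s_map_zero: "s_map L r s X (\<lambda>_. 0) h = h"
proof -
  have "(\<lambda>_. 0) \<in> multi_indices r s" by (simp add: multi_indices_def)
  moreover have "blocks (\<lambda>_. 0) l = []" for l by (simp add: blocks_def)
  ultimately show ?thesis by (simp add: s_map_conv mi_size_def cnt_wd)
qed

end

context graded_module begin

lemma bilin_sum_left: "bilin f \<Longrightarrow> f (\<Sum>a\<in>T. h a) p = (\<Sum>a\<in>T. f (h a) p)"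
  by (rule lin_sum[of sc sm "\<lambda>h. f h p"]) (simp add: bilin_def)

lemma s_map_step:
  assumes f: "bilin f" and K: "K \<in> MI (Suc k)"
  shows "sm (of_nat (Suc k)) (sm (1 / mi_fact r K) (f (s_map L r s X K h) (pdK K [0..<m] p))) =
    (\<Sum>i | i < m \<and> K i > 0. sm (1 / mi_fact r (dec i K))
       (f (br (s_map L r s X (dec i K) h) (X i)) (pd i (pdK (dec i K) [0..<m] p))))"
proof -
  have "sm (of_nat (Suc k)) (sm (1 / mi_fact r K) (f (s_map L r s X K h) (pdK K [0..<m] p))) =
      sm (1 / mi_fact r K) (f (sc (of_nat (Suc k)) (s_map L r s X K h)) (pdK K [0..<m] p))"
    by (simp only: bilinD(1)[OF f] vm.scale_scale mult.commute)
  also have "\<dots> = (\<Sum>i | i < m \<and> K i > 0. sm (1 / mi_fact r K) (f (sc (of_nat (K i) * sg i K 0) (br (s_map L r s X (dec i K) h) (X i))) (pdK K [0..<m] p)))"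
    by (simp only: s_map_rec[OF K] bilin_sum_left[OF f] vm.scale_sum_right)
  also have "\<dots> = (\<Sum>i | i < m \<and> K i > 0. sm (1 / mi_fact r (dec i K))
       (f (br (s_map L r s X (dec i K) h) (X i)) (pd i (pdK (dec i K) [0..<m] p))))"
  proof (rule sum.cong[OF refl])
    fix i assume "i \<in> {i. i < m \<and> K i > 0}"
    then have i: "i < m" "K i > 0" by auto
    have Km: "K \<in> multi_indices r s" using K by (simp add: MI_def)
    have "sm (1 / mi_fact r K) (f (sc (of_nat (K i) * sg i K 0) (br (s_map L r s X (dec i K) h) (X i))) (pdK K [0..<m] p)) =
      sm (1 / mi_fact r K * (of_nat (K i) * sg i K 0 * sg i K 0))
       (f (br (s_map L r s X (dec i K) h) (X i)) (pd i (pdK (dec i K) [0..<m] p)))"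
      by (subst pdK_extract[of i K 0 p, OF i]) (simp_all only: bilinD[OF f] vm.scale_scale mult_ac le0)
    also have "1 / mi_fact r K * (of_nat (K i) * sg i K 0 * sg i K 0) = 1 / mi_fact r (dec i K)"
      using mi_fact_dec[OF Km i] sg_square[of i K 0] by (simp add: mult.assoc)
    finally show "sm (1 / mi_fact r K) (f (sc (of_nat (K i) * sg i K 0) (br (s_map L r s X (dec i K) h) (X i))) (pdK K [0..<m] p)) =
      sm (1 / mi_fact r (dec i K)) (f (br (s_map L r s X (dec i K) h) (X i)) (pd i (pdK (dec i K) [0..<m] p)))" .
  qed
  finally show ?thesis .
qed

text \<open>Unfolding the power gives \<open>k\<close>-fold brackets along all sequences of
  \<open>k\<close> indices, paired with the derivatives along the same sequence. Supercommutativity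
  of the derivatives lets sequences with the same multi-index be collected; they contribute
  \<open>fact k\<close> over the factorial of \<open>K\<close> times the symmetrised bracket. In the
  induction the inner \<open>DD\<close> is absorbed into \<open>f\<close>.\<close>

lemma DDk_s_map:
  "bilin f \<Longrightarrow> (DD ^^ k) f h p =
    sm (fact k) (\<Sum>K\<in>MI k. sm (1 / mi_fact r K) (f (s_map L r s X K h) (pdK K [0..<m] p)))"
proof (induction k arbitrary: f)
  case 0
  then show ?case by (simp add: MI_0 s_map_zero pdK_zero mi_fact_def)
next
  case (Suc k)
  define G where "G = (\<lambda>(K, i). sm (1 / mi_fact r K)
       (f (br (s_map L r s X K h) (X i)) (pd i (pdK K [0..<m] p))))"
  have "(DD ^^ Suc k) f h p = (DD ^^ k) (DD f) h p" by (simp add: funpow_swap1)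
  also have "\<dots> = sm (fact k) (\<Sum>K\<in>MI k. sm (1 / mi_fact r K) (DD f (s_map L r s X K h) (pdK K [0..<m] p)))"
    by (rule Suc.IH[OF bilin_DD[OF Suc.prems]])
  also have "(\<Sum>K\<in>MI k. sm (1 / mi_fact r K) (DD f (s_map L r s X K h) (pdK K [0..<m] p))) =
      (\<Sum>K\<in>MI k. \<Sum>i<m. G (K, i))"
    by (simp add: G_def DD_apply vm.scale_sum_right)
  also have "\<dots> = (\<Sum>x\<in>MI k \<times> {..<m}. G x)" by (simp add: sum.cartesian_product)
  \<comment> \<open>Raising an odd entry that is already 1 would leave the multi-indices. These
    pairs contribute nothing because an odd derivation squares to zero. The remaining pairs
    correspond to multi-indices of size \<open>Suc k\<close> with a marked positive entry.\<close>
  also have "\<dots> = (\<Sum>x\<in>{(K, i). K \<in> MI k \<and> i < m \<and> (i < r \<or> K i = 0)}. G x)"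
  proof (rule sum.mono_neutral_right)
    show "\<forall>x\<in>MI k \<times> {..<m} - {(K, i). K \<in> MI k \<and> i < m \<and> (i < r \<or> K i = 0)}. G x = 0"
    proof
      fix x assume "x \<in> MI k \<times> {..<m} - {(K, i). K \<in> MI k \<and> i < m \<and> (i < r \<or> K i = 0)}"
      then obtain K i where x: "x = (K, i)" "i < m" "\<not> i < r" "K i > 0" by auto
      show "G x = 0" unfolding x(1) by (simp add: G_def pd_pdK_zero[of i K, OF x(2-4)] bilinD(4)[OF Suc.prems])
    qed
  qed (auto simp: finite_MI)
  also have "\<dots> = (\<Sum>x\<in>(SIGMA K:MI (Suc k). {i. i < m \<and> K i > 0}). G (dec (snd x) (fst x), snd x))"
  proof (rule sum.reindex_bij_witness[where i = "\<lambda>x. (dec (snd x) (fst x), snd x)" and j = "\<lambda>x. (inc (snd x) (fst x), snd x)"])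
    fix x assume "x \<in> {(K, i). K \<in> MI k \<and> i < m \<and> (i < r \<or> K i = 0)}"
    then obtain K i where x: "x = (K, i)" "K \<in> MI k" "i < m" "i < r \<or> K i = 0" by blast
    have "inc i K i > 0" by (simp add: inc_def)
    then show "(inc (snd x) (fst x), snd x) \<in> (SIGMA K:MI (Suc k). {i. i < m \<and> K i > 0})"
      using inc_MI[OF x(2-4)] x by simp
    show "(dec (snd (inc (snd x) (fst x), snd x)) (fst (inc (snd x) (fst x), snd x)), snd (inc (snd x) (fst x), snd x)) = x"
      by (simp add: x dec_inc)
    show "G (dec (snd (inc (snd x) (fst x), snd x)) (fst (inc (snd x) (fst x), snd x)), snd (inc (snd x) (fst x), snd x)) = G x"
      by (simp add: x dec_inc)
  next
    fix x assume "x \<in> (SIGMA K:MI (Suc k). {i. i < m \<and> K i > 0})"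
    then obtain K i where x: "x = (K, i)" "K \<in> MI (Suc k)" "i < m" "K i > 0" by auto
    have "i < r \<or> K i \<le> 1" using x(2,3) by (simp add: MI_def multi_indices_def) (meson not_le)
    then have "i < r \<or> dec i K i = 0" by (auto simp: dec_def)
    then show "(dec (snd x) (fst x), snd x) \<in> {(K, i). K \<in> MI k \<and> i < m \<and> (i < r \<or> K i = 0)}"
      using dec_MI[OF x(2-4)] x by simp
    show "(inc (snd (dec (snd x) (fst x), snd x)) (fst (dec (snd x) (fst x), snd x)), snd (dec (snd x) (fst x), snd x)) = x"
      using x by (simp add: inc_dec)
  qed
  also have "\<dots> = (\<Sum>K\<in>MI (Suc k). \<Sum>i | i < m \<and> K i > 0. G (dec i K, i))"
    by (simp add: sum.Sigma finite_MI split_def)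
  also have "\<dots> = (\<Sum>K\<in>MI (Suc k). sm (of_nat (Suc k)) (sm (1 / mi_fact r K) (f (s_map L r s X K h) (pdK K [0..<m] p))))"
    by (rule sum.cong[OF refl]) (simp only: s_map_step[OF Suc.prems] G_def prod.case)
  also have "sm (fact k) \<dots> = sm (fact k) (sm (of_nat (Suc k)) (\<Sum>K\<in>MI (Suc k). sm (1 / mi_fact r K) (f (s_map L r s X K h) (pdK K [0..<m] p))))"
    by (simp only: vm.scale_sum_right)
  also have "\<dots> = sm (fact (Suc k)) (\<Sum>K\<in>MI (Suc k). sm (1 / mi_fact r K) (f (s_map L r s X K h) (pdK K [0..<m] p)))"
    by (simp only: vm.scale_scale fact_Suc mult.commute)
  finally show ?case .
qed

end

section \<open>Symmetrisation in the free algebra and the pre-Lie module\<close>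

context graded_data begin

abbreviation "free_act \<equiv> (\<lambda>x p. gen x * p :: 'g list \<Rightarrow>\<^sub>0 'k)"
abbreviation "sgnn \<equiv> Sn scl free_act 1"

text \<open>The symmetrisation before any reduction: composed with \<open>nfU\<close> it represents
  \<open>sigma L\<close>, and composed with \<open>nfT\<close> or \<open>RS\<close> it gives the
  symmetrisation in the induced module or in the pre-Lie module.\<close>

definition "sgm = Sg scl free_act 1"

lemma free_act_right: "lin scl scl (free_act x)"
  by (rule lin_mult_left)

lemma sgm_lin: "lin scl scl sgm"
  unfolding sgm_def by (rule Sg_lin[OF pm.vector_space_axioms])

lemmas sgm_simps = lin_simps[OF sgm_lin]

lemma Sg_sum:
  assumes "vector_space sm" "\<And>x. lin sm sm (act x)" "p \<in> len_le N"
  shows "Sg sm act v p = (\<Sum>n\<le>N. Sn sm act v n p)"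
proof (rule lin_vanish_len_le[where f = "Sg sm act v" and g = "\<lambda>p. \<Sum>n\<le>N. Sn sm act v n p"])
  show "lin scl sm (\<lambda>p. \<Sum>n\<le>N. Sn sm act v n p)"
    by (intro lin_summation assms Sn_lin)
  show "lin scl sm (Sg sm act v)" by (rule Sg_lin[OF assms(1)])
  fix w :: "'g list" assume w: "length w \<le> N"
  have "(\<Sum>n\<le>N. Sn sm act v n (wd w)) = (\<Sum>n\<le>N. if n = length w then Sn sm act v n (wd w) else 0)"
    by (intro sum.cong refl) (auto intro: Sn_len[where act = act, OF assms(1,2) wd_len_span])
  also have "\<dots> = Sn sm act v (length w) (wd w)" using w by simp
  also have "\<dots> = Sg sm act v (wd w)"
    by (rule Sg_len[where act = act, OF assms(1,2) wd_len_span, symmetric])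
  finally show "Sg sm act v (wd w) = (\<Sum>n\<le>N. Sn sm act v n (wd w))" by simp
qed (rule assms)

lemma Sg_JS:
  assumes "vector_space sm" "\<And>x. lin sm sm (act x)" "p \<in> JS"
  shows "Sg sm act v p = 0"
proof -
  obtain N where "p \<in> len_le N" using len_le_exists by blast
  from Sg_sum[where act = act, OF assms(1,2) this]
  show ?thesis by (simp add: Sn_JS[where act = act, OF assms])
qed

lemma sgm_JS: "p \<in> JS \<Longrightarrow> sgm p = 0"
  unfolding sgm_def by (rule Sg_JS[OF pm.vector_space_axioms free_act_right])

lemma sgnn_FV: "sgnn n p \<in> FV"
proof (induction n arbitrary: p)
  case (Suc n)
  then show ?case
    by (auto intro!: pm.subspace_scale[OF subspace_lists_span] pm.subspace_sum[OF subspace_lists_span]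
        lists_span_mult simp: X_V)
qed (simp add: pm.subspace_scale[OF subspace_lists_span])

lemma sgm_FV: "sgm p \<in> FV"
  unfolding sgm_def Sg_def ext_def
  by (intro pm.subspace_sum[OF subspace_lists_span] pm.subspace_scale[OF subspace_lists_span] sgnn_FV)

text \<open>Left multiplication corrected by the derivation extending \<open>beta x\<close>; a representation of the negative part.\<close>

definition opS :: "'g \<Rightarrow> ('g list \<Rightarrow>\<^sub>0 'k) \<Rightarrow> ('g list \<Rightarrow>\<^sub>0 'k)" where
  "opS x p = gen x * p + (\<Sum>j<m. gen (beta x (X j)) * pd j p)"

lemma opS_lin: "lin scl scl (opS x)"
  unfolding opS_def
  by (intro lin_plus lin_summation pm.vector_space_axioms lin_mult_left lin_compose[OF pd_lin lin_mult_left])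

lemma opS_JS: "p \<in> JS \<Longrightarrow> opS x p \<in> JS"
  unfolding opS_def
  by (intro pm.subspace_add[OF qS.J_subspace] pm.subspace_sum[OF qS.J_subspace] qS.J_left pd_JS) auto

lemma opS_cong: "nfS p = nfS q \<Longrightarrow> nfS (opS x p) = nfS (opS x q)"
  using opS_JS[of "p - q" x] by (simp add: qS.nf_eq_iff lin_diff[OF opS_lin])

lemma genS_mult_lin: "lin sc scl (\<lambda>x. nfS (gen x * p))"
  by (rule qS.nf_lin_gen_left[OF genS_lin])

lemma opS_left_lin: "lin sc scl (\<lambda>x. nfS (opS x p))"
proof -
  have "lin sc scl (\<lambda>x. nfS (gen x * p) + (\<Sum>j<m. nfS (gen (beta x (X j)) * pd j p)))"
    by (intro lin_plus lin_summation pm.vector_space_axioms genS_mult_lin lin_compose[OF beta_lin_left genS_mult_lin])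
  then show ?thesis by (simp add: opS_def qS.nf_simps)
qed

lemma gen_gen_e: "i < m \<Longrightarrow> z \<in> parity L q \<Longrightarrow>
   nfS (gen y * gen (e i z) * p) = scl (koszul (pi i) q) (nfS (gen y * gen z * p))"
  using lin_scale[OF qS.nf_lin_gen[OF genS_lin], of "gen y" "koszul (pi i) q" z p]
  by (simp add: e_hom)

lemma gen_swap:
  "x \<in> parity L p \<Longrightarrow> y \<in> parity L q \<Longrightarrow> nfS (gen x * gen y * b) = scl (koszul p q) (nfS (gen y * gen x * b))"
  using genS_swap[of x p y q 1 b] by simp

text \<open>Abbreviations for two kinds of terms in the composition of two operators
  \<open>opS\<close>: both derivations differentiate the argument, or one operator multiplies while
  the other differentiates.\<close>

definition "second x y p = (\<Sum>j<m. \<Sum>i<m. nfS (gen (beta x (X i)) * gen (e i (beta y (X j))) * pd i (pd j p)))"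
definition "mixed x y p = (\<Sum>j<m. nfS (gen x * gen (beta y (X j)) * pd j p))"

text \<open>The second order part of a product of two derivations is symmetric up to sign, because
  the derivatives commute up to sign as do their coefficients; hence it disappears from the
  commutator. The four signs are compared by cases.\<close>

lemma second_swap:
  assumes x: "x \<in> parity L p" and y: "y \<in> parity L q"
  shows "second x y u = scl (koszul p q) (second y x u)"
proof -
  have "second x y u = (\<Sum>j<m. \<Sum>i<m. scl (koszul p q) (nfS (gen (beta y (X j)) * gen (e j (beta x (X i))) * pd j (pd i u))))"
    unfolding second_def
  proof (intro sum.cong refl)
    fix i j assume "i \<in> {..<m}" "j \<in> {..<m}"
    then have i: "i < m" and j: "j < m" by auto
    have bx: "beta x (X i) \<in> parity L (p + pi i)" by (rule beta_parity[OF x X_parity[OF i]])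
    have by': "beta y (X j) \<in> parity L (q + pi j)" by (rule beta_parity[OF y X_parity[OF j]])
    let ?u = "pd i (pd j u)" and ?v = "pd j (pd i u)"
    let ?k = "koszul :: bit \<Rightarrow> bit \<Rightarrow> 'k"
    have uv: "?u = scl (?k (pi i) (pi j)) ?v" by (rule pd_comm[OF i j])
    have "nfS (gen (beta x (X i)) * gen (e i (beta y (X j))) * ?u) =
        scl (?k (pi i) (q + pi j) * ?k (p + pi i) (q + pi j) * ?k (pi i) (pi j)) (nfS (gen (beta y (X j)) * gen (beta x (X i)) * ?v))"
      unfolding gen_gen_e[OF i by'] gen_swap[OF bx by'] unfolding uv
      by (simp only: scl_mult_right lin_scale[OF qS.nf_lin] pm.scale_scale mult.assoc)
    also have "?k (pi i) (q + pi j) * ?k (p + pi i) (q + pi j) * ?k (pi i) (pi j) = ?k p q * ?k (pi j) (p + pi i)"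
      unfolding koszul_def using bit_cases[of p] bit_cases[of q] bit_cases[of "pi i"] bit_cases[of "pi j"] by auto
    also have "scl (?k p q * ?k (pi j) (p + pi i)) (nfS (gen (beta y (X j)) * gen (beta x (X i)) * ?v)) =
        scl (?k p q) (nfS (gen (beta y (X j)) * gen (e j (beta x (X i))) * ?v))"
      unfolding gen_gen_e[OF j bx] by (simp only: pm.scale_scale)
    finally show "nfS (gen (beta x (X i)) * gen (e i (beta y (X j))) * ?u) =
        scl (?k p q) (nfS (gen (beta y (X j)) * gen (e j (beta x (X i))) * ?v))" .
  qed
  also have "\<dots> = scl (koszul p q) (second y x u)"
    unfolding second_def by (subst sum.swap) (simp add: pm.scale_sum_right)
  finally show ?thesis .
qed

lemma opS_opS:
  assumes x: "x \<in> parity L p" "x \<in> V" and y: "y \<in> parity L q" "y \<in> V"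
  shows "nfS (opS x (opS y u)) = nfS (gen x * gen y * u) + mixed x y u + nfS (gen (beta x y) * u)
    + scl (koszul p q) (mixed y x u) + (\<Sum>j<m. nfS (gen (beta x (beta y (X j))) * pd j u)) + second x y u"
proof -
  have 1: "nfS (\<Sum>i<m. gen (beta x (X i)) * pd i (gen y * u)) = nfS (gen (beta x y) * u) + scl (koszul p q) (mixed y x u)"
  proof -
    have "nfS (\<Sum>i<m. gen (beta x (X i)) * pd i (gen y * u)) =
      (\<Sum>i<m. nfS (gen (sc (xi i y) (beta x (X i))) * u)) + (\<Sum>i<m. nfS (gen (beta x (X i)) * gen (e i y) * pd i u))"
      by (simp only: qS.nf_simps pd_gen distrib_left sum.distrib scl_mult_right lin_scale[OF genS_mult_lin] mult.assoc)
    also have "(\<Sum>i<m. nfS (gen (sc (xi i y) (beta x (X i))) * u)) = nfS (gen (beta x (\<Sum>i<m. sc (xi i y) (X i))) * u)"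
      by (simp only: lin_sum[OF beta_lin_right] lin_scale[OF beta_lin_right] lin_sum[OF genS_mult_lin])
    also have "(\<Sum>i<m. sc (xi i y) (X i)) = y" by (simp add: xi_expand y)
    also have "(\<Sum>i<m. nfS (gen (beta x (X i)) * gen (e i y) * pd i u)) = scl (koszul p q) (mixed y x u)"
      unfolding mixed_def pm.scale_sum_right
    proof (rule sum.cong[OF refl])
      fix i assume "i \<in> {..<m}"
      then have i: "i < m" by simp
      have k: "koszul (pi i) q * koszul (p + pi i) q = (koszul p q :: 'k)"
        unfolding koszul_def using bit_cases[of p] bit_cases[of q] bit_cases[of "pi i"] by auto
      show "nfS (gen (beta x (X i)) * gen (e i y) * pd i u) = scl (koszul p q) (nfS (gen y * gen (beta x (X i)) * pd i u))"
        unfolding gen_gen_e[OF i y(1)] gen_swap[OF beta_parity[OF x(1) X_parity[OF i]] y(1)] pm.scale_scale k ..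
    qed
    finally show ?thesis .
  qed
  have 2: "nfS (\<Sum>i<m. gen (beta x (X i)) * pd i (\<Sum>j<m. gen (beta y (X j)) * pd j u)) =
    (\<Sum>j<m. nfS (gen (beta x (beta y (X j))) * pd j u)) + second x y u"
  proof -
    have "nfS (\<Sum>i<m. gen (beta x (X i)) * pd i (\<Sum>j<m. gen (beta y (X j)) * pd j u)) =
      (\<Sum>i<m. \<Sum>j<m. nfS (gen (sc (xi i (beta y (X j))) (beta x (X i))) * pd j u)
         + nfS (gen (beta x (X i)) * gen (e i (beta y (X j))) * pd i (pd j u)))"
      by (simp only: qS.nf_simps pd_simps pd_gen distrib_left sum.distrib scl_mult_right lin_scale[OF genS_mult_lin] mult.assoc sum_distrib_left)
    also have "\<dots> = (\<Sum>j<m. \<Sum>i<m. nfS (gen (sc (xi i (beta y (X j))) (beta x (X i))) * pd j u)) + second x y u"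
      unfolding second_def by (subst sum.swap) (simp only: sum.distrib)
    also have "(\<Sum>j<m. \<Sum>i<m. nfS (gen (sc (xi i (beta y (X j))) (beta x (X i))) * pd j u)) = (\<Sum>j<m. nfS (gen (beta x (beta y (X j))) * pd j u))"
    proof (rule sum.cong[OF refl])
      fix j
      have "(\<Sum>i<m. nfS (gen (sc (xi i (beta y (X j))) (beta x (X i))) * pd j u)) =
         nfS (gen (beta x (\<Sum>i<m. sc (xi i (beta y (X j))) (X i))) * pd j u)"
        by (simp only: lin_sum[OF beta_lin_right] lin_scale[OF beta_lin_right] lin_sum[OF genS_mult_lin])
      then show "(\<Sum>i<m. nfS (gen (sc (xi i (beta y (X j))) (beta x (X i))) * pd j u)) = nfS (gen (beta x (beta y (X j))) * pd j u)"
        by (simp add: xi_expand)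
    qed
    finally show ?thesis .
  qed
  have 3: "nfS (gen x * (\<Sum>j<m. gen (beta y (X j)) * pd j u)) = mixed x y u"
    by (simp add: mixed_def sum_distrib_left qS.nf_simps mult.assoc)
  have "opS x (opS y u) = gen x * (gen y * u) + gen x * (\<Sum>j<m. gen (beta y (X j)) * pd j u)
     + (\<Sum>i<m. gen (beta x (X i)) * pd i (gen y * u)) + (\<Sum>i<m. gen (beta x (X i)) * pd i (\<Sum>j<m. gen (beta y (X j)) * pd j u))"
    unfolding opS_def[of x] unfolding opS_def[of y]
    by (simp only: distrib_left pd_simps(1) sum.distrib add.assoc)
  then show ?thesis by (simp only: lin_add[OF qS.nf_lin] 1 2 3 mult.assoc add_ac)
qed

text \<open>In the commutator the products of \<open>x\<close> and \<open>y\<close>, the mixed terms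
  and the second order terms cancel. What is left is \<open>beta x y\<close> minus its exchange,
  equal to the bracket by \<open>beta_torsion_free\<close>, and the commutator of the derivations,
  which is the derivation for the bracket by \<open>beta_flat\<close>.\<close>

lemma opS_rep:
  assumes x: "x \<in> parity L p" "x \<in> V" and y: "y \<in> parity L q" "y \<in> V"
  shows "nfS (opS x (opS y u)) - scl (koszul p q) (nfS (opS y (opS x u))) = nfS (opS (br x y) u)"
proof -
  let ?k = "koszul p q :: 'k"
  have "nfS (opS (br x y) u) = nfS (gen (beta x y) * u) - scl ?k (nfS (gen (beta y x) * u))
      + (\<Sum>j<m. nfS (gen (beta x (beta y (X j))) * pd j u)) - scl ?k (\<Sum>j<m. nfS (gen (beta y (beta x (X j))) * pd j u))"
  proof -
    have "nfS (gen (br x y) * u) = nfS (gen (beta x y) * u) - scl ?k (nfS (gen (beta y x) * u))"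
      using beta_torsion_free[OF x(2) y(2) x(1) y(1)]
      by (simp flip: lin_scale[OF genS_mult_lin] lin_diff[OF genS_mult_lin])
    moreover have "(\<Sum>j<m. nfS (gen (beta (br x y) (X j)) * pd j u)) =
       (\<Sum>j<m. nfS (gen (beta x (beta y (X j))) * pd j u) - scl ?k (nfS (gen (beta y (beta x (X j))) * pd j u)))"
    proof (rule sum.cong[OF refl])
      fix j assume "j \<in> {..<m}"
      then have "X j \<in> V" by (simp add: X_V)
      from beta_flat[OF x(2) y(2) this x(1) y(1)]
      show "nfS (gen (beta (br x y) (X j)) * pd j u) = nfS (gen (beta x (beta y (X j))) * pd j u) - scl ?k (nfS (gen (beta y (beta x (X j))) * pd j u))"
        by (simp flip: lin_scale[OF genS_mult_lin] lin_diff[OF genS_mult_lin])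
    qed
    ultimately show ?thesis
      by (simp add: opS_def qS.nf_simps sum_subtractf pm.scale_sum_right)
  qed
  then show ?thesis
    unfolding opS_opS[OF x y] opS_opS[OF y x] second_swap[OF x(1) y(1)] gen_swap[OF x(1) y(1)]
    by (simp add: pm.scale_right_distrib koszul_commute[of q p])
qed

definition "RS = ext scl (\<lambda>w. foldr opS w (1 :: 'g list \<Rightarrow>\<^sub>0 'k))"

lemma RS_lin: "lin scl scl RS"
  unfolding RS_def by (rule lin_ext[OF pm.vector_space_axioms])

lemma RS_wd: "RS (wd w) = foldr opS w 1"
  by (simp add: RS_def ext_single[OF pm.vector_space_axioms])

lemma RS_gen: "RS (gen x * p) = opS x (RS p)"
proof (rule lin_eqI[where f = "\<lambda>p. RS (gen x * p)" and g = "\<lambda>p. opS x (RS p)"])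
  fix w show "RS (gen x * wd w) = opS x (RS (wd w))"
    using RS_wd[of "x # w"] by (simp only: RS_wd wd_Cons[of x w, symmetric] foldr.simps comp_apply)
qed (rule lin_compose[OF lin_mult_left RS_lin] lin_compose[OF RS_lin opS_lin])+

text \<open>As \<open>opS\<close> represents the negative part, applying a word to 1 factors through
  the enveloping algebra; \<open>RS\<close> induces a map from it to the symmetric algebra.\<close>

lemma RS_JS:
  assumes "p \<in> U.I" shows "RS p \<in> JS"
proof -
  have left: "RS (wd a * u) \<in> JS" if "RS u \<in> JS" for a u
  proof (induction a)
    case (Cons x a)
    have "wd (x # a) * u = gen x * (wd a * u)" using wd_Cons[of x a, where 'k='k] by (simp add: mult.assoc)
    then show ?case using opS_JS[OF Cons] by (simp only: RS_gen)
  qed (use that in \<open>simp add: wd_Nil\<close>)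
  have "nfS (RS p) = 0"
  proof (rule U.I_induct[where t = "\<lambda>c. scl c" and \<phi> = "\<lambda>p. nfS (RS p)"])
    show "lin scl scl (\<lambda>p. nfS (RS p))" by (rule lin_compose[OF RS_lin qS.nf_lin])
    fix a b \<rho> assume "\<rho> \<in> env_relations L V"
    then consider
      (add) x y where "x \<in> V" "y \<in> V" "\<rho> = gen (x + y) - gen x - gen y"
    | (scale) c x where "x \<in> V" "\<rho> = gen (sc c x) - scl c (gen x)"
    | (comm) x y p q where "x \<in> V" "y \<in> V" "x \<in> parity L p" "y \<in> parity L q"
        "\<rho> = gen x * gen y - scl (koszul p q) (gen y * gen x) - gen (br x y)"
      unfolding env_relations_def linear_relations_def
      by (auto simp: mult_single plus_list_def scl_single)
    then have "nfS (RS (\<rho> * wd b)) = 0"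
    proof cases
      case add
      show ?thesis unfolding add left_diff_distrib lin_diff[OF RS_lin] RS_gen qS.nf_simps
        by (simp add: lin_add[OF opS_left_lin])
    next
      case scale
      show ?thesis unfolding scale left_diff_distrib lin_diff[OF RS_lin] scl_mult_left lin_scale[OF RS_lin] RS_gen qS.nf_simps
        by (simp add: lin_scale[OF opS_left_lin])
    next
      case comm
      show ?thesis
        using opS_rep[OF comm(3,1,4,2), of "RS (wd b)"]
        unfolding comm left_diff_distrib lin_diff[OF RS_lin] scl_mult_left lin_scale[OF RS_lin] mult.assoc RS_gen qS.nf_simps
        by simp
    qed
    then show "nfS (RS (wd a * \<rho> * wd b)) = 0"
      using left[of "\<rho> * wd b" a] by (simp add: qS.nf_zero_iff mult.assoc)
  qed (rule assms)
  then show ?thesis by (simp add: qS.nf_zero_iff)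
qed

lemma X_swap: "i < m \<Longrightarrow> nfS (gen (X i) * gen (e i x) * q) = nfS (gen x * gen (X i) * q)"
proof (induction x rule: par_induct)
  case (1 x y)
  then show ?case
    using lin_add[OF qS.nf_lin_gen[OF genS_lin], of "gen (X i)" "e i x" "e i y" q]
      lin_add[OF genS_mult_lin, of x y "gen (X i) * q"]
    by (simp add: e_simps mult.assoc)
next
  case (2 x p)
  then show ?case
    using gen_swap[OF X_parity[OF 2(2)] 2(1), of q] by (simp add: gen_gen_e[OF 2(2,1)])
qed

text \<open>Euler's identity for the degree. It holds modulo the relations only, because
  \<open>X i\<close> has to be exchanged with the letters that the derivation passes.\<close>

lemma euler:
  assumes "p \<in> len_span n" shows "nfS (\<Sum>i<m. gen (X i) * pd i p) = scl (of_nat n) (nfS p)"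
proof (rule lin_eqI[where f = "\<lambda>p. nfS (\<Sum>i<m. gen (X i) * pd i p)" and g = "\<lambda>p. scl (of_nat n) (nfS p)"])
  show "lin scl scl (\<lambda>p. nfS (\<Sum>i<m. gen (X i) * pd i p))"
    by (rule lin_compose[OF _ qS.nf_lin]) (intro lin_summation pm.vector_space_axioms lin_compose[OF pd_lin lin_mult_left])
  show "lin scl scl (\<lambda>p. scl (of_nat n) (nfS p))" by (rule lin_compose[OF qS.nf_lin lin_scl])
  have *: "nfS (\<Sum>i<m. gen (X i) * pd i (wd w)) = scl (of_nat (length w)) (nfS (wd w))" for w
  proof (induction w)
    case (Cons x w)
    have 1: "wd (x # w) = (gen x * wd w :: 'g list \<Rightarrow>\<^sub>0 'k)" using wd_Cons[of x w] by simp
    have "nfS (\<Sum>i<m. gen (X i) * pd i (wd (x # w))) =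
       (\<Sum>i<m. nfS (gen (sc (xi i x) (X i)) * wd w)) + (\<Sum>i<m. nfS (gen (X i) * gen (e i x) * pd i (wd w)))"
      unfolding 1
      by (simp only: qS.nf_simps pd_gen distrib_left sum.distrib scl_mult_right lin_scale[OF genS_mult_lin] mult.assoc)
    also have "(\<Sum>i<m. nfS (gen (sc (xi i x) (X i)) * wd w)) = nfS (gen (mp x) * wd w)"
      by (simp only: lin_sum[OF genS_mult_lin, symmetric] xi_expand)
    also have "\<dots> = nfS (gen x * wd w)"
      by (rule qS.nf_cong) (simp_all only: nfS_Pr[of "gen x", symmetric] Pr_gen refl)
    also have "(\<Sum>i<m. nfS (gen (X i) * gen (e i x) * pd i (wd w))) = nfS (gen x * nfS (\<Sum>i<m. gen (X i) * pd i (wd w)))"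
      by (simp add: X_swap[unfolded mult.assoc] sum_distrib_left qS.nf_simps mult.assoc cong: sum.cong_simp)
    also have "\<dots> = scl (of_nat (length w)) (nfS (gen x * wd w))"
      unfolding Cons by (simp add: scl_mult_right qS.nf_simps)
    finally show ?case unfolding 1 by (simp add: pm.scale_left_distrib)
  qed (simp add: pd_wd qS.nf_simps)
  fix w assume "w \<in> Poly_Mapping.keys p"
  then have "length w = n" using assms by (simp add: len_span_def)
  then show "nfS (\<Sum>i<m. gen (X i) * pd i (wd w)) = scl (of_nat n) (nfS (wd w))" using * by simp
qed

lemma gen_pd_len_le: "p \<in> len_le n \<Longrightarrow> gen x * pd i p \<in> len_le n"
proof (cases n)
  case 0
  assume "p \<in> len_le n"
  then have "p \<in> len_span 0" using 0 by (simp add: len_le_def len_span_def)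
  then show ?thesis by (simp add: pd_len_span_0 pm.subspace_0[OF subspace_len_le])
next
  case (Suc n')
  assume "p \<in> len_le n"
  then show ?thesis using gen_len_le[OF pd_len_le[of p n i], of x] Suc by simp
qed

text \<open>Multiplication by a letter raises the degree by one, while the derivation in
  \<open>opS\<close> does not raise it; the top degree is thus governed by \<open>euler\<close>. The
  case \<open>n = 0\<close> is separate since the truncated \<open>n - 1\<close> would admit a
  constant as error term.\<close>

lemma Sn_opS_leading:
  "p \<in> len_span n \<Longrightarrow> \<exists>q. (n > 0 \<longrightarrow> q \<in> len_le (n - 1)) \<and> (n = 0 \<longrightarrow> q = 0) \<and> nfS (Sn scl opS 1 n p) = nfS (p + q)"
proof (induction n arbitrary: p)
  case 0
  have "p = scl (cnt p) 1"
  proof (rule poly_mapping_eqI)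
    fix w show "Poly_Mapping.lookup p w = Poly_Mapping.lookup (scl (cnt p) 1) w"
      using 0 by (cases "w = []") (auto simp: cnt_def wd_Nil[symmetric] lookup_single len_span_def in_keys_iff)
  qed
  then show ?case by (intro exI[of _ 0]) simp
next
  case (Suc n)
  have "\<forall>i. \<exists>q. (n > 0 \<longrightarrow> q \<in> len_le (n - 1)) \<and> (n = 0 \<longrightarrow> q = 0) \<and> nfS (Sn scl opS 1 n (pd i p)) = nfS (pd i p + q)"
    using Suc.IH[OF pd_len_span[OF Suc.prems]] by blast
  then obtain q where q: "\<And>i. n > 0 \<Longrightarrow> q i \<in> len_le (n - 1)" "\<And>i. n = 0 \<Longrightarrow> q i = 0"
    "\<And>i. nfS (Sn scl opS 1 n (pd i p)) = nfS (pd i p + q i)" by metis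
  define t where "t = (\<Sum>i<m. gen (X i) * q i + (\<Sum>j<m. gen (beta (X i) (X j)) * pd j (pd i p + q i)))"
  have t: "t \<in> len_le n"
    unfolding t_def
  proof (intro pm.subspace_sum[OF subspace_len_le] pm.subspace_add[OF subspace_len_le])
    fix i j
    show "gen (X i) * q i \<in> len_le n"
      using q(1)[of i, THEN gen_len_le, of "X i"] q(2)[of i] by (cases n) (auto simp: pm.subspace_0[OF subspace_len_le])
    have "q i \<in> len_le n"
      using len_le_mono[OF q(1)[of i], of n] q(2)[of i] by (cases n) (auto simp: pm.subspace_0[OF subspace_len_le])
    then have "pd i p + q i \<in> len_le n"
      by (intro pm.subspace_add[OF subspace_len_le] len_span_le[OF pd_len_span[OF Suc.prems]]) simp
    then show "gen (beta (X i) (X j)) * pd j (pd i p + q i) \<in> len_le n" by (rule gen_pd_len_le)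
  qed
  have "nfS (\<Sum>i<m. opS (X i) (Sn scl opS 1 n (pd i p))) = nfS (\<Sum>i<m. opS (X i) (pd i p + q i))"
    by (simp only: qS.nf_simps opS_cong[OF q(3)])
  also have "(\<Sum>i<m. opS (X i) (pd i p + q i)) = (\<Sum>i<m. gen (X i) * pd i p) + t"
    by (simp only: opS_def t_def distrib_left sum.distrib add.assoc)
  also have "nfS \<dots> = scl (of_nat (Suc n)) (nfS p) + nfS t"
    by (simp only: qS.nf_simps(1) euler[OF Suc.prems])
  finally have "nfS (Sn scl opS 1 (Suc n) p) = scl (1 / of_nat (Suc n)) (scl (of_nat (Suc n)) (nfS p) + nfS t)"
    by (simp only: Sn.simps lin_scale[OF qS.nf_lin])
  also have "\<dots> = nfS (p + scl (1 / of_nat (Suc n)) t)"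
    using of_nat_neq_0[of n, where 'a='k]
    by (simp add: pm.scale_right_distrib qS.nf_simps del: of_nat_Suc)
  finally show ?case
    using pm.subspace_scale[OF subspace_len_le t] by (intro exI[of _ "scl (1 / of_nat (Suc n)) t"]) simp
qed

lemma RS_sgm: "RS (sgm p) = Sg scl opS 1 p"
proof -
  have "RS 1 = 1" using RS_wd[of "[]"] by (simp add: wd_Nil)
  then show ?thesis
    unfolding sgm_def using Sg_transfer[of scl scl RS free_act opS 1 p, OF RS_lin] by (simp add: RS_gen)
qed

lemma RS_sgm_leading:
  assumes "p \<in> len_le (Suc N)" shows "\<exists>q\<in>len_le N. nfS (RS (sgm p)) = nfS (p + q)"
proof -
  let ?W = "{p. \<exists>q\<in>len_le N. nfS (RS (sgm p)) = nfS (p + q)}"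
  have "pm.subspace ?W"
  proof (rule pm.subspaceI)
    show "0 \<in> ?W"
      using pm.subspace_0[OF subspace_len_le] by (auto simp: sgm_simps lin_simps[OF RS_lin] intro!: bexI[of _ 0])
    fix p p' assume "p \<in> ?W" "p' \<in> ?W"
    then obtain q q' where "q \<in> len_le N" "nfS (RS (sgm p)) = nfS (p + q)" "q' \<in> len_le N" "nfS (RS (sgm p')) = nfS (p' + q')"
      by blast
    then have "nfS (RS (sgm (p + p'))) = nfS ((p + p') + (q + q'))" "q + q' \<in> len_le N"
      by (simp_all add: sgm_simps lin_simps[OF RS_lin] qS.nf_simps pm.subspace_add[OF subspace_len_le])
    then show "p + p' \<in> ?W" by blast
  next
    fix c p assume "p \<in> ?W"
    then obtain q where "q \<in> len_le N" "nfS (RS (sgm p)) = nfS (p + q)" by blast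
    then have "nfS (RS (sgm (scl c p))) = nfS (scl c p + scl c q)" "scl c q \<in> len_le N"
      by (simp_all add: sgm_simps lin_simps[OF RS_lin] qS.nf_simps pm.subspace_scale[OF subspace_len_le] pm.scale_right_distrib)
    then show "scl c p \<in> ?W" by blast
  qed
  then show ?thesis
  proof (rule subspace_single_induct[of ?W p, simplified mem_Collect_eq])
    fix w assume "w \<in> Poly_Mapping.keys p"
    then have w: "length w \<le> Suc N" using assms by (simp add: len_le_def)
    obtain q where q: "length w > 0 \<longrightarrow> q \<in> len_le (length w - 1)" "length w = 0 \<longrightarrow> q = 0"
        "nfS (Sn scl opS 1 (length w) (wd w)) = nfS (wd w + q)"
      using Sn_opS_leading[OF wd_len_span[of w]] by blast
    have "q \<in> len_le N"
      using q(1,2) len_le_mono[of q "length w - 1" N] w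
      by (cases "length w = 0") (auto simp: pm.subspace_0[OF subspace_len_le])
    moreover have "RS (sgm (wd w)) = Sn scl opS 1 (length w) (wd w)"
      unfolding RS_sgm by (rule Sg_len[where act = opS, OF pm.vector_space_axioms opS_lin wd_len_span])
    ultimately show "\<exists>q\<in>len_le N. nfS (RS (sgm (wd w))) = nfS (wd w + q)" using q(3) by auto
  qed
qed

text \<open>Descent on the degree: if \<open>RS (sgm p)\<close> vanishes in the symmetric algebra,
  then \<open>p\<close> equals there an element of lower degree, whose symmetrisation agrees with
  that of \<open>p\<close> and so has the same property.\<close>

lemma sgm_injective:
  assumes "sgm p \<in> JU" shows "p \<in> JS"
proof -
  have *: "p \<in> len_le N \<Longrightarrow> RS (sgm p) \<in> JS \<Longrightarrow> p \<in> JS" for N p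
  proof (induction N arbitrary: p)
    case 0
    then have "p \<in> len_span 0" by (simp add: len_le_def len_span_def)
    from Sn_opS_leading[OF this] have "nfS (Sn scl opS 1 0 p) = nfS p" by auto
    moreover have "RS (sgm p) = Sn scl opS 1 0 p"
      unfolding RS_sgm by (rule Sg_len[where act = opS, OF pm.vector_space_axioms opS_lin \<open>p \<in> len_span 0\<close>])
    ultimately show ?case using 0 by (simp flip: qS.nf_zero_iff)
  next
    case (Suc N)
    obtain q where q: "q \<in> len_le N" "nfS (RS (sgm p)) = nfS (p + q)" using RS_sgm_leading[OF Suc.prems(1)] by blast
    have pq: "p + q \<in> JS" using q(2) Suc.prems(2) by (simp flip: qS.nf_zero_iff)
    \<comment> \<open>\<open>sgm\<close> depends on its argument only modulo \<open>JS\<close>, so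
      the lower order element \<open>q\<close> inherits the hypothesis.\<close>
    then have "sgm p + sgm q = 0" using sgm_JS[OF pq] by (simp add: sgm_simps)
    then have "sgm q = - sgm p" by (simp add: eq_neg_iff_add_eq_0 add.commute)
    then have "RS (sgm q) \<in> JS" using Suc.prems(2) by (simp add: lin_neg[OF RS_lin] pm.subspace_neg[OF qS.J_subspace])
    with Suc.IH[OF q(1)] have "q \<in> JS" by blast
    then have "(p + q) - q \<in> JS" by (intro pm.subspace_diff[OF qS.J_subspace] pq)
    then show ?case by simp
  qed
  have "sgm p \<in> U.I" using assms sgm_FV JU_FV by blast
  then have "RS (sgm p) \<in> JS" by (rule RS_JS)
  then show ?thesis using * len_le_exists by blast
qed

end

section \<open>The induced module on the negative part\<close>

context graded_data begin

lemma genU_mult_lin: "lin sc scl (\<lambda>x. nfU (gen x * p))"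
  by (rule qU.nf_lin_gen_left[OF genU_lin])

lemma nfU_gen_mp: "nfU (gen (mp x) * p) = nfU (gen x * p)"
  by (rule qU.nf_cong) (simp_all only: nfU_Pr[of "gen x", symmetric] Pr_gen refl)

lemma genU_swap:
  assumes "x \<in> parity L p" "y \<in> parity L q" "x \<in> V" "y \<in> V"
  shows "nfU (gen x * (gen y * u)) = scl (koszul p q) (nfU (gen y * (gen x * u))) + nfU (gen (br x y) * u)"
proof -
  have "(gen x * gen y - scl (koszul p q) (gen y * gen x) - gen (br x y)) * u \<in> JU"
    by (rule qU.J_right[OF genU_comm[OF assms]])
  then show ?thesis
    by (simp add: qU.nf_zero_iff[symmetric] qU.nf_simps left_diff_distrib scl_mult_left mult.assoc algebra_simps)
qed

text \<open>The action of \<open>h\<close> on a word \<open>x w\<close>: either \<open>h\<close> passes \<open>x\<close> (with a sign when both are odd), or it is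
  absorbed into \<open>[h, x]\<close>, whose component outside the negative part goes on to act on \<open>w\<close>. On the empty word
  \<open>h\<close> acts by the character.\<close>

primrec Aw :: "'g list \<Rightarrow> 'g \<Rightarrow> ('g list \<Rightarrow>\<^sub>0 'k)" where
  "Aw [] h = scl (lamx h) (nfU 1)"
| "Aw (x # w) h = nfU (gen (par 0 x) * Aw w h) + nfU (gen (par 1 x) * Aw w (eps h))
     + nfU (gen (br h (mp x)) * wd w) + Aw w (kp (br h (mp x)))"

definition "Aext h = ext scl (\<lambda>w. Aw w h)"

text \<open>The action of an arbitrary element: left multiplication by its negative part plus
  \<open>Aext\<close> for the rest. The first summand may contain \<open>z\<close> itself, because
  \<open>nfU\<close> projects all letters to the negative part.\<close>

definition "Z z p = nfU (gen z * p) + Aext (kp z) p"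

lemma Aw_lin: "lin sc scl (\<lambda>h. Aw w h)"
proof (induction w)
  case Nil
  show ?case using lamx_lin by (simp add: lin_def pm.scale_left_distrib)
next
  case (Cons x w)
  have 1: "lin sc scl (\<lambda>h. nfU (y * Aw w h))" for y
    by (rule lin_compose[OF Cons lin_compose[OF lin_mult_left qU.nf_lin]])
  show ?case
    unfolding Aw.simps
    by (intro lin_plus pm.vector_space_axioms 1 lin_compose[OF eps_lin 1] lin_compose[OF lin_br_left genU_mult_lin]
        lin_compose[OF lin_compose[OF lin_br_left kp_lin] Cons])
qed

lemma Aext_lin: "lin scl scl (Aext h)"
  unfolding Aext_def by (rule lin_ext[OF pm.vector_space_axioms])

lemma Aext_wd: "Aext h (wd w) = Aw w h"
  by (simp add: Aext_def ext_single[OF pm.vector_space_axioms])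

lemma Aext_left_lin: "lin sc scl (\<lambda>h. Aext h p)"
  unfolding Aext_def ext_def by (intro lin_summation lin_scaled pm.vector_space_axioms Aw_lin)

lemma Z_lin: "lin scl scl (Z z)"
  unfolding Z_def[abs_def]
  by (intro lin_plus pm.vector_space_axioms lin_compose[OF lin_mult_left qU.nf_lin] Aext_lin)

lemma Z_left_lin: "lin sc scl (\<lambda>z. Z z p)"
  unfolding Z_def
  by (intro lin_plus pm.vector_space_axioms genU_mult_lin lin_compose[OF kp_lin Aext_left_lin])

lemmas Z_simps = lin_simps[OF Z_lin]
lemmas Z_left_simps = lin_simps[OF Z_left_lin]

lemma Z_V: "x \<in> V \<Longrightarrow> Z x p = nfU (gen x * p)"
  by (simp add: Z_def lin_zero[OF Aext_left_lin])

lemma Z_k: "h \<in> g_k L \<Longrightarrow> Z h p = Aext h p"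
  using nfU_gen_mp[of h p] by (simp add: Z_def lin_zero[OF genU_mult_lin])

lemma Aext_gen: "Aext h (gen x * p) = nfU (gen (par 0 x) * Aext h p) + nfU (gen (par 1 x) * Aext (eps h) p) + Z (br h (mp x)) p"
proof (rule lin_eqI[where f = "\<lambda>p. Aext h (gen x * p)"
    and g = "\<lambda>p. nfU (gen (par 0 x) * Aext h p) + nfU (gen (par 1 x) * Aext (eps h) p) + Z (br h (mp x)) p"])
  show "lin scl scl (\<lambda>p. Aext h (gen x * p))" by (rule lin_compose[OF lin_mult_left Aext_lin])
  show "lin scl scl (\<lambda>p. nfU (gen (par 0 x) * Aext h p) + nfU (gen (par 1 x) * Aext (eps h) p) + Z (br h (mp x)) p)"
    by (intro lin_plus pm.vector_space_axioms Z_lin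
        lin_compose[OF Aext_lin lin_compose[OF lin_mult_left qU.nf_lin]])
  fix w
  show "Aext h (gen x * wd w) = nfU (gen (par 0 x) * Aext h (wd w)) + nfU (gen (par 1 x) * Aext (eps h) (wd w)) + Z (br h (mp x)) (wd w)"
    using Aext_wd[of h "x # w"] by (simp only: Aext_wd wd_Cons[of x w, symmetric] Aw.simps Z_def add.assoc)
qed

lemma Aext_hom:
  assumes "h \<in> parity L q" "x \<in> parity L p" "x \<in> V"
  shows "Aext h (gen x * u) = scl (koszul q p) (nfU (gen x * Aext h u)) + Z (br h x) u"
proof (cases "p = 0")
  case True
  then show ?thesis using assms by (simp add: Aext_gen par_hom[of x 0] lin_zero[OF genU_mult_lin])
next
  case False
  then have "p = 1" using bit_cases[of p] by simp
  then show ?thesis using assms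
    by (simp add: Aext_gen par_hom[of x 1] lin_zero[OF genU_mult_lin] eps_hom[of h q] lin_scale[OF Aext_left_lin]
        scl_mult_right qU.nf_simps koszul_commute)
qed

text \<open>Both parts of \<open>z\<close> obey the same rule: the negative one by the commutation
  relation in the enveloping algebra, the other by the definition of \<open>Aw\<close>. Their
  brackets with \<open>x\<close> add up to the full bracket.\<close>

lemma Z_gen:
  assumes z: "z \<in> parity L q" and x: "x \<in> parity L p" "x \<in> V"
  shows "Z z (gen x * u) = scl (koszul q p) (nfU (gen x * Z z u)) + Z (br z x) u"
proof -
  have "Z z (gen x * u) = nfU (gen (mp z) * (gen x * u)) + Aext (kp z) (gen x * u)"
    by (simp add: Z_def nfU_gen_mp)
  also have "nfU (gen (mp z) * (gen x * u)) = scl (koszul q p) (nfU (gen x * (gen (mp z) * u))) + Z (br (mp z) x) u"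
    using genU_swap[OF mp_parity[OF z] x(1) mp_V x(2)] by (simp add: Z_V br_V x)
  also have "Aext (kp z) (gen x * u) = scl (koszul q p) (nfU (gen x * Aext (kp z) u)) + Z (br (kp z) x) u"
    by (rule Aext_hom[OF kp_parity[OF z] x])
  also have "nfU (gen x * (gen (mp z) * u)) = nfU (gen x * nfU (gen z * u))"
    using nfU_gen_mp[of z u] qU.nf_mult_nf by metis
  finally have "Z z (gen x * u) = scl (koszul q p) (nfU (gen x * nfU (gen z * u)) + nfU (gen x * Aext (kp z) u))
      + (Z (br (mp z) x) u + Z (br (kp z) x) u)"
    by (simp only: pm.scale_right_distrib add_ac)
  also have "Z (br (mp z) x) u + Z (br (kp z) x) u = Z (br z x) u"
    by (simp only: Z_left_simps(1)[symmetric] lin_add[OF lin_br_left, symmetric] mp_kp)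
  also have "nfU (gen x * nfU (gen z * u)) + nfU (gen x * Aext (kp z) u) = nfU (gen x * Z z u)"
    by (simp only: Z_def distrib_left qU.nf_simps)
  finally show ?thesis .
qed

lemma Aext_Pr: "Aext h (Pr p) = Aext h p"
proof (rule lin_eqI[where f = "\<lambda>p. Aext h (Pr p)" and g = "Aext h"])
  fix w
  have "Aw (map mp w) h = Aw w h"
  proof (induction w arbitrary: h)
    case (Cons x w)
    have "nfU (gen y * wd (map mp w)) = nfU (gen y * wd w)" for y
      using nfU_Pr[of "wd w"] by (intro qU.nf_cong_left) simp
    then show ?case by (simp add: Cons mp_par[symmetric] nfU_gen_mp)
  qed simp
  then show "Aext h (Pr (wd w)) = Aext h (wd w)" by (simp add: Aext_wd)
qed (rule lin_compose[OF word_map_lin Aext_lin] Aext_lin)+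

lemma Aext_gen_lin: "lin sc scl (\<lambda>x. Aext h (gen x * u))"
proof -
  have *: "lin sc scl (\<lambda>x. nfU (gen (par i x) * w))" for i w
    by (rule lin_compose[OF par_lin genU_mult_lin])
  show ?thesis
    unfolding Aext_gen
    by (intro lin_plus pm.vector_space_axioms * lin_compose[OF lin_compose[OF mp_lin lin_br_right] Z_left_lin])
qed

lemma jacobi_right:
  assumes "h \<in> parity L a" "x \<in> parity L p" "y \<in> parity L q"
  shows "br h (br x y) = br (br h x) y - sc (koszul p q) (br (br h y) x)"
proof -
  have "sc (koszul a p) (br x (br h y)) = - sc (koszul a p * koszul p (a + q)) (br (br h y) x)"
    using br_anti[OF assms(2) br_parity[OF assms(1,3)]] by (simp add: gs.scale_minus_right)
  also have "koszul a p * koszul p (a + q) = (koszul p q :: 'k)"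
    unfolding koszul_def using bit_cases[of a] bit_cases[of p] bit_cases[of q] by auto
  finally show ?thesis using br_jacobi[OF assms(1,2), of y] by simp
qed

text \<open>Compatibility of the action with the commutation relation: after two applications of
  \<open>Z_gen\<close> on each side, what remains is the Jacobi identity for \<open>h\<close>,
  \<open>x\<close>, \<open>y\<close>.\<close>

lemma Z_relation:
  assumes h: "h \<in> parity L a" and x: "x \<in> parity L p" "x \<in> V" and y: "y \<in> parity L q" "y \<in> V"
  shows "Z h (gen x * (gen y * u)) = scl (koszul p q) (Z h (gen y * (gen x * u))) + Z h (gen (br x y) * u)"
proof -
  let ?k = "koszul :: bit \<Rightarrow> bit \<Rightarrow> 'k"
  have 1: "Z h (gen x * (gen y * u)) = scl (?k a p * ?k a q) (nfU (gen x * (gen y * Z h u)))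
     + scl (?k a p) (nfU (gen x * Z (br h y) u)) + scl (?k (a + p) q) (nfU (gen y * Z (br h x) u)) + Z (br (br h x) y) u"
    if x: "x \<in> parity L p" "x \<in> V" and y: "y \<in> parity L q" "y \<in> V" for x y p q
  proof -
    have "nfU (gen x * Z h (gen y * u)) = scl (?k a q) (nfU (gen x * (gen y * Z h u))) + nfU (gen x * Z (br h y) u)"
      unfolding Z_gen[OF h y] by (simp add: distrib_left qU.nf_simps scl_mult_right)
    then show ?thesis
      unfolding Z_gen[OF h x] Z_gen[OF br_parity[OF h x(1)] y]
      by (simp add: pm.scale_right_distrib add.assoc)
  qed
  have 2: "Z h (gen (br x y) * u) = scl (?k a (p + q)) (nfU (gen (br x y) * Z h u)) + Z (br h (br x y)) u"
    by (rule Z_gen[OF h br_parity[OF x(1) y(1)] br_V[OF x(2) y(2)]])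
  have 3: "nfU (gen x * (gen y * Z h u)) = scl (?k p q) (nfU (gen y * (gen x * Z h u))) + nfU (gen (br x y) * Z h u)"
    by (rule genU_swap[OF x(1) y(1) x(2) y(2)])
  have 4: "Z (br (br h x) y) u = Z (br h (br x y)) u + scl (?k p q) (Z (br (br h y) x) u)"
    by (simp add: jacobi_right[OF h x(1) y(1)] Z_left_simps)
  have k: "?k a (p + q) = ?k a p * ?k a q" "?k (a + p) q = ?k p q * ?k a q" "?k (a + q) p = ?k p q * ?k a p"
    unfolding koszul_def using bit_cases[of a] bit_cases[of p] bit_cases[of q] by auto
  have kk: "?k p q * (?k p q * c) = c" for c by simp
  show ?thesis
    unfolding 1[OF x y] 1[OF y x] 2 3 4 k
    by (simp add: pm.scale_right_distrib mult_ac)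
qed

text \<open>Induction on the word in front of the relation, for all \<open>h\<close> at once, since
  a passed letter changes \<open>h\<close> into \<open>eps h\<close> or into the \<open>kp\<close>
  part of a bracket. The summands with a plain product vanish because they contain the relation as a
  factor.\<close>

lemma Aext_JU:
  assumes "p \<in> JU" "h \<in> g_k L" shows "Aext h p = 0"
proof -
  have *: "Aext h (wd a * \<rho> * wd b) = 0" if r: "\<rho> \<in> env_relations L V" and "h \<in> g_k L" for a b \<rho> h
    using that(2)
  proof (induction a arbitrary: h)
    case Nil
    from r consider
      (add) x y where "x \<in> V" "y \<in> V" "\<rho> = gen (x + y) - gen x - gen y"
    | (scale) c x where "x \<in> V" "\<rho> = gen (sc c x) - scl c (gen x)"
    | (comm) x y p q where "x \<in> V" "y \<in> V" "x \<in> parity L p" "y \<in> parity L q"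
        "\<rho> = gen x * gen y - scl (koszul p q) (gen y * gen x) - gen (br x y)"
      unfolding env_relations_def linear_relations_def
      by (auto simp: mult_single plus_list_def scl_single)
    then have "Aext h (\<rho> * wd b) = 0"
    proof cases
      case add
      show ?thesis unfolding add left_diff_distrib lin_diff[OF Aext_lin] by (simp add: lin_add[OF Aext_gen_lin])
    next
      case scale
      show ?thesis unfolding scale left_diff_distrib lin_diff[OF Aext_lin] scl_mult_left lin_scale[OF Aext_lin]
        by (simp add: lin_scale[OF Aext_gen_lin])
    next
      case comm
      have "Z h (\<rho> * wd b) = 0"
      proof (induction h rule: par_induct)
        case (2 h a)
        show ?case
          using Z_relation[OF 2 comm(3,1) comm(4,2), of "wd b"]
          unfolding comm left_diff_distrib lin_diff[OF Z_lin] scl_mult_left lin_scale[OF Z_lin] mult.assoc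
          by simp
      qed (simp add: Z_left_simps)
      then show ?thesis using Nil by (simp add: Z_k)
    qed
    then show ?case by (simp add: wd_Nil)
  next
    case (Cons x a)
    have 1: "wd (x # a) * \<rho> * wd b = gen x * (wd a * \<rho> * wd b)"
      using wd_Cons[of x a, where 'k='k] by (simp add: mult.assoc)
    have "\<rho> \<in> JU" using r U.R_sub_I I_JU by blast
    then have "wd a * \<rho> * wd b \<in> JU" by (intro qU.J_left qU.J_right)
    then have "gen z * (wd a * \<rho> * wd b) \<in> JU" for z by (rule qU.J_left)
    then have 2: "nfU (gen z * (wd a * \<rho> * wd b)) = 0" for z by (simp only: qU.nf_zero_iff)
    have e: "eps h \<in> g_k L" using kp_eps[of h] kp_k[of "eps h"] Cons.prems by (simp del: kp_k)
    show ?case unfolding 1 Aext_gen Z_def 2 Cons.IH[OF Cons.prems] Cons.IH[OF e] Cons.IH[OF kp_k]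
      by (simp add: qU.nf_simps)
  qed
  have "Aext h (Pr p) = 0"
    by (rule U.I_induct[where t = "\<lambda>c. scl c", OF Aext_lin *]) (use assms in \<open>simp_all add: JU_def\<close>)
  then show ?thesis by (simp add: Aext_Pr)
qed

lemma Z_JU: "p \<in> JU \<Longrightarrow> Z z p = 0"
  using qU.J_left[of p "gen z"] by (simp add: Z_def Aext_JU qU.nf_zero_iff)

lemma Z_nfU [simp]: "Z z (nfU p) = Z z p"
  using Z_JU[OF qU.nf_diff_J[of p], of z] by (simp add: Z_simps)

definition "rep_at u \<longleftrightarrow> (\<forall>z z' p q. z \<in> parity L p \<longrightarrow> z' \<in> parity L q \<longrightarrow>
  Z z (Z z' u) = scl (koszul p q) (Z z' (Z z u)) + Z (br z z') u)"

lemma Z_rep_V: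
  assumes x: "x \<in> parity L p" "x \<in> V" and z: "z \<in> parity L q"
  shows "Z x (Z z u) = scl (koszul p q) (Z z (Z x u)) + Z (br x z) u"
proof -
  have "Z z (Z x u) = scl (koszul q p) (Z x (Z z u)) + Z (br z x) u"
    using Z_gen[OF z x, of u] by (simp add: Z_V[OF x(2)])
  moreover have "Z (br x z) u = - scl (koszul p q) (Z (br z x) u)"
    using br_anti[OF x(1) z] by (simp add: Z_left_simps)
  ultimately show ?thesis
    by (simp add: pm.scale_right_distrib koszul_commute[of q p])
qed

lemma Z_rep_sym:
  assumes z: "z \<in> parity L p" "z' \<in> parity L q" and s: "Z z' (Z z u) = scl (koszul q p) (Z z (Z z' u)) + Z (br z' z) u"
  shows "Z z (Z z' u) = scl (koszul p q) (Z z' (Z z u)) + Z (br z z') u"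
proof -
  have "Z (br z z') u = - scl (koszul p q) (Z (br z' z) u)"
    using br_anti[OF z] by (simp add: Z_left_simps)
  then show ?thesis unfolding s
    by (simp add: pm.scale_right_distrib koszul_commute[of q p])
qed

text \<open>If one of the two elements lies in the negative part, the identity is
  \<open>Z_gen\<close> read backwards, and it can be exchanged by antisymmetry. By bilinearity only
  pairs from \<open>g_k L\<close> remain.\<close>

lemma rep_at_k:
  assumes "\<And>h h' p q. h \<in> parity L p \<Longrightarrow> h' \<in> parity L q \<Longrightarrow> h \<in> g_k L \<Longrightarrow> h' \<in> g_k L \<Longrightarrow>
    Z h (Z h' u) = scl (koszul p q) (Z h' (Z h u)) + Z (br h h') u"
  shows "rep_at u"
  unfolding rep_at_def
proof (intro allI impI)
  fix z z' p q assume z: "z \<in> parity L p" and z': "z' \<in> parity L q"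
  let ?R = "\<lambda>z z'. Z z (Z z' u) = scl (koszul p q) (Z z' (Z z u)) + Z (br z z') u"
  have add: "?R (y + z) z'" if "?R y z'" "?R z z'" for y z z'
    using that by (simp add: Z_left_simps Z_simps br_simps pm.scale_right_distrib add_ac)
  have add': "?R z (y + z')" if "?R z y" "?R z z'" for y z z'
    using that by (simp add: Z_left_simps Z_simps br_simps pm.scale_right_distrib add_ac)
  have "?R (mp z) z'" by (rule Z_rep_V[OF mp_parity[OF z] mp_V z'])
  moreover have "?R (kp z) (mp z')"
    by (rule Z_rep_sym[OF kp_parity[OF z] mp_parity[OF z'] Z_rep_V[OF mp_parity[OF z'] mp_V kp_parity[OF z]]])
  moreover have "?R (kp z) (kp z')"
    by (rule assms[OF kp_parity[OF z] kp_parity[OF z'] kp_k kp_k])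
  ultimately have "?R (mp z + kp z) (mp z' + kp z')" using add[of "mp z" z' "kp z"] add'[of "kp z" "mp z'" "kp z'"]
    by (simp only: mp_kp)
  then show "?R z z'" by (simp only: mp_kp)
qed

lemma Z_one: "h \<in> g_k L \<Longrightarrow> Z h (nfU 1) = scl (lamx h) (nfU 1)"
  using Aext_wd[of h "[]"] by (simp add: Z_k wd_Nil)

text \<open>On the generating vector \<open>g_k L\<close> acts by the character, which kills odd
  elements and brackets.\<close>

lemma rep_at_one: "rep_at 1"
proof (rule rep_at_k)
  fix h h' p q assume h: "h \<in> parity L p" "h' \<in> parity L q" "h \<in> g_k L" "h' \<in> g_k L"
  have 1: "Z h 1 = scl (lamx h) (nfU 1)" if "h \<in> g_k L" for h
    using Z_one[OF that] by simp
  have "koszul p q * lamx h = lamx h" by (rule lamx_koszul[OF h(1)])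
  then show "Z h (Z h' 1) = scl (koszul p q) (Z h' (Z h 1)) + Z (br h h') 1"
    using h by (simp add: 1 Z_simps br_k lamx_br mult_ac)
qed

text \<open>Passing both elements by \<open>x\<close> expresses the identity at
  \<open>gen x * u\<close> through identities at \<open>u\<close> for the pairs
  \<open>h, h'\<close>, \<open>[h, x], h'\<close> and \<open>h, [h', x]\<close>, together with the
  Jacobi identity. As \<open>[h, x]\<close> may leave \<open>g_k L\<close>, the predicate
  \<open>rep_at\<close> has to quantify over all elements.\<close>

lemma rep_at_gen:
  assumes u: "rep_at u" and x: "x \<in> parity L c" "x \<in> V"
  shows "rep_at (gen x * u)"
proof (rule rep_at_k)
  fix h h' p q assume h: "h \<in> parity L p" "h' \<in> parity L q" "h \<in> g_k L" "h' \<in> g_k L"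
  let ?k = "koszul :: bit \<Rightarrow> bit \<Rightarrow> 'k"
  have rep: "Z z (Z z' u) = scl (?k a b) (Z z' (Z z u)) + Z (br z z') u"
    if "z \<in> parity L a" "z' \<in> parity L b" for z z' a b
    using u that unfolding rep_at_def by blast
  have 1: "Z h (Z h' (gen x * u)) = scl (?k q c * ?k p c) (nfU (gen x * Z h (Z h' u)))
     + scl (?k q c) (Z (br h x) (Z h' u)) + Z h (Z (br h' x) u)"
    if h: "h \<in> parity L p" "h' \<in> parity L q" for h h' p q
    unfolding Z_gen[OF h(2) x] Z_simps Z_nfU Z_gen[OF h(1) x]
    by (simp add: pm.scale_right_distrib)
  have hx: "br h x \<in> parity L (p + c)" and h'x: "br h' x \<in> parity L (q + c)"
    by (rule br_parity[OF h(1) x(1)] br_parity[OF h(2) x(1)])+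
  have k: "?k (p + c) q = ?k p q * ?k c q" "?k p (q + c) = ?k p q * ?k p c" "?k c q = ?k q c"
    unfolding koszul_def using bit_cases[of p] bit_cases[of q] bit_cases[of c] by auto
  have j: "Z (br (br h h') x) u = scl (?k q c) (Z (br (br h x) h') u) + Z (br h (br h' x)) u"
  proof -
    have "br h (br h' x) = br (br h h') x - sc (koszul q c) (br (br h x) h')"
      by (rule jacobi_right[OF h(1,2) x(1)])
    then show ?thesis by (simp add: Z_left_simps)
  qed
  have kpq: "?k (p + q) c = ?k q c * ?k p c"
    unfolding koszul_def using bit_cases[of p] bit_cases[of q] bit_cases[of c] by auto
  have 2: "Z (br h h') (gen x * u) = scl (?k q c * ?k p c) (nfU (gen x * Z (br h h') u)) + Z (br (br h h') x) u"
    unfolding Z_gen[OF br_parity[OF h(1,2)] x] kpq ..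
  have 3: "nfU (gen x * Z h (Z h' u)) = scl (?k p q) (nfU (gen x * Z h' (Z h u))) + nfU (gen x * Z (br h h') u)"
    unfolding rep[OF h(1,2)] by (simp add: distrib_left scl_mult_right qU.nf_simps)
  have 4: "Z (br h x) (Z h' u) = scl (?k p q * ?k q c) (Z h' (Z (br h x) u)) + Z (br (br h x) h') u"
    using rep[OF hx h(2)] by (simp only: k)
  have 5: "Z h (Z (br h' x) u) = scl (?k p q * ?k p c) (Z (br h' x) (Z h u)) + Z (br h (br h' x)) u"
    using rep[OF h(1) h'x] by (simp only: k)
  have kk: "?k q c * (?k q c * d) = d" for d by simp
  show "Z h (Z h' (gen x * u)) = scl (?k p q) (Z h' (Z h (gen x * u))) + Z (br h h') (gen x * u)"
    unfolding 1[OF h(1,2)] 1[OF h(2,1)] 2 3 4 5 j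
    by (simp add: pm.scale_right_distrib mult_ac)
qed

lemma rep_at_all: "rep_at u"
proof -
  have eq_sub: "pm.subspace {u. f u = g u}" if "lin scl scl f" "lin scl scl g" for f g :: "('g list \<Rightarrow>\<^sub>0 'k) \<Rightarrow> ('g list \<Rightarrow>\<^sub>0 'k)"
    by (rule pm.subspaceI) (simp_all add: lin_zero[OF that(1)] lin_zero[OF that(2)] lin_add[OF that(1)]
        lin_add[OF that(2)] lin_scale[OF that(1)] lin_scale[OF that(2)])
  have "{u. rep_at u} = (\<Inter>(z, z', p, q) \<in> {(z, z', p, q). z \<in> parity L p \<and> z' \<in> parity L q}.
     {u. Z z (Z z' u) = scl (koszul p q) (Z z' (Z z u)) + Z (br z z') u})"
    unfolding rep_at_def by blast
  moreover have "pm.subspace {u. Z z (Z z' u) = scl (koszul p q) (Z z' (Z z u)) + Z (br z z') u}" for z z' p q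
    by (rule eq_sub)
      (intro lin_plus lin_scaled pm.vector_space_axioms Z_lin lin_compose[OF Z_lin Z_lin])+
  ultimately have sub: "pm.subspace {u. rep_at u}"
    by (simp only:) (rule pm.subspace_Inter, auto)
  have cong: "rep_at u \<longleftrightarrow> rep_at u'" if "nfU u = nfU u'" for u u'
  proof -
    have "Z z u = Z z u'" for z using that Z_nfU by metis
    then show ?thesis by (simp only: rep_at_def)
  qed
  have "rep_at (wd w)" for w
  proof (induction w)
    case Nil
    then show ?case by (simp add: wd_Nil rep_at_one)
  next
    case (Cons x w)
    \<comment> \<open>The letter is projected to the negative part and split by parity, the
      situation of \<open>rep_at_gen\<close>.\<close>
    have "nfU (wd (x # w)) = nfU (gen (par 0 (mp x)) * wd w + gen (par 1 (mp x)) * wd w)"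
    proof -
      have "nfU (wd (x # w)) = nfU (gen (mp x) * wd w)" using wd_Cons[of x w, where 'k='k] by (simp add: nfU_gen_mp)
      also have "\<dots> = nfU (gen (par 0 (mp x) + par 1 (mp x)) * wd w)" by (simp flip: par_split)
      finally show ?thesis by (simp add: lin_add[OF genU_mult_lin] qU.nf_simps)
    qed
    moreover have "rep_at (gen (par i (mp x)) * wd w)" for i
      by (rule rep_at_gen[OF Cons par_mem par_V[OF mp_V]])
    then have "rep_at (gen (par 0 (mp x)) * wd w + gen (par 1 (mp x)) * wd w)"
      using pm.subspace_add[OF sub] by simp
    ultimately show ?case using cong by blast
  qed
  then show ?thesis using subspace_single_induct[OF sub, of u] by simp
qed

text \<open>The enveloping algebra of the negative part as a module over the whole Lie superalgebra.
  It provides surjectivity of the symmetrisation and a left inverse of the natural map.\<close>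

sublocale M: graded_module L lam X r s scl Z "nfU 1"
proof unfold_locales
  fix x y p q u assume "x \<in> parity L p" "y \<in> parity L q"
  then show "Z x (Z y u) = scl (koszul p q) (Z y (Z x u)) + Z (br x y) u"
    using rep_at_all[of u] unfolding rep_at_def by blast
qed (rule Z_left_lin Z_lin)+

lemma M_SG: "M.SG p = nfU (sgm p)"
  unfolding sgm_def using Sg_transfer[of scl scl nfU free_act Z 1 p, OF qU.nf_lin] by (simp add: Z_V X_V)

lemma Sn_ad_subspace:
  assumes W: "gs.subspace W" "\<And>x i. x \<in> W \<Longrightarrow> i < m \<Longrightarrow> br x (X i) \<in> W" and "h \<in> W"
  shows "Sn sc (ad_tilde L) h n p \<in> W"
proof (induction n arbitrary: p)
  case (Suc n)
  show ?case unfolding Sn.simps ad_tilde_def[of L "X _"]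
    by (intro gs.subspace_scale[OF W(1)] gs.subspace_sum[OF W(1)] W(2) Suc) simp
qed (simp add: gs.subspace_scale[OF W(1)] assms(3))

lemma s_map_V: "x \<in> V \<Longrightarrow> K \<in> multi_indices r s \<Longrightarrow> s_map L r s X K x \<in> V"
  unfolding s_map_conv by (rule Sn_ad_subspace[OF subspace_V br_V[OF _ X_V]])

text \<open>The first formula on representatives, with \<open>N\<close> a bound for the length of
  words. Multiplication by \<open>x\<close> is the term \<open>k = 0\<close>.\<close>

definition minus_formula :: "nat \<Rightarrow> 'g \<Rightarrow> ('g list \<Rightarrow>\<^sub>0 'k) \<Rightarrow> ('g list \<Rightarrow>\<^sub>0 'k)" where
  "minus_formula N x p = (\<Sum>k\<le>N. \<Sum>K\<in>MI k.
     scl ((- 1) ^ k * bernoulli k / mi_fact r K) (gen (s_map L r s X K x) * pdK K [0..<m] p))"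

lemma pdK_FV: "p \<in> FV \<Longrightarrow> pdK K l p \<in> FV"
proof (induction l)
  case (Cons j l)
  have "(pd j ^^ k) q \<in> FV" if "q \<in> FV" for k q
    using that by (induction k) (simp_all add: pd_FV)
  then show ?case using Cons by (simp add: pdK_Cons)
qed (simp add: pdK_def)

lemma minus_formula_FV: "x \<in> V \<Longrightarrow> p \<in> FV \<Longrightarrow> minus_formula N x p \<in> FV"
  unfolding minus_formula_def
  by (intro pm.subspace_sum[OF subspace_lists_span] pm.subspace_scale[OF subspace_lists_span] lists_span_mult pdK_FV)
    (auto simp: MI_def s_map_V)

end

context graded_module begin

lemma act_SG_V:
  assumes "x \<in> V" "p \<in> len_le N"
  shows "act x (SG p) = SG (minus_formula N x p)"
proof -
  have "act x (SG p) = (\<Sum>k\<le>N. sm (gm k) ((DD ^^ k) BG x p))" by (rule act_SG[OF assms(2)])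
  also have "\<dots> = (\<Sum>k\<le>N. \<Sum>K\<in>MI k. SG (scl ((- 1) ^ k * bernoulli k / mi_fact r K) (gen (s_map L r s X K x) * pdK K [0..<m] p)))"
  proof (rule sum.cong[OF refl])
    fix k
    have "sm (gm k) ((DD ^^ k) BG x p) = sm (gm k * fact k) (\<Sum>K\<in>MI k. sm (1 / mi_fact r K) (BG (s_map L r s X K x) (pdK K [0..<m] p)))"
      by (simp add: DDk_s_map[OF bilin_BG])
    also have "gm k * fact k = (- 1) ^ k * (bernoulli k :: 'k)" by (simp add: gm_def)
    also have "sm \<dots> (\<Sum>K\<in>MI k. sm (1 / mi_fact r K) (BG (s_map L r s X K x) (pdK K [0..<m] p))) =
       (\<Sum>K\<in>MI k. SG (scl ((- 1) ^ k * bernoulli k / mi_fact r K) (gen (s_map L r s X K x) * pdK K [0..<m] p)))"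
      unfolding vm.scale_sum_right
      by (rule sum.cong[OF refl]) (auto simp: MI_def BG_of_V s_map_V assms(1) SG_simps)
    finally show "sm (gm k) ((DD ^^ k) BG x p) =
       (\<Sum>K\<in>MI k. SG (scl ((- 1) ^ k * bernoulli k / mi_fact r K) (gen (s_map L r s X K x) * pdK K [0..<m] p)))" .
  qed
  finally show ?thesis by (simp add: minus_formula_def SG_simps)
qed

end

context graded_data begin

text \<open>Induction on words: by \<open>M.act_SG_V\<close>, left multiplication of a symmetrised
  element by a letter is the symmetrisation of an explicit element.\<close>

lemma sgm_surjective: "\<exists>p\<in>FV. nfU (sgm p) = nfU u"
proof -
  let ?W = "{u. \<exists>p\<in>FV. nfU (sgm p) = nfU u}"
  have sub: "pm.subspace ?W"
  proof (rule pm.subspaceI)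
    show "0 \<in> ?W" using pm.subspace_0[OF subspace_lists_span] by (auto simp: sgm_simps intro!: bexI[of _ 0])
    fix u v assume "u \<in> ?W" "v \<in> ?W"
    then obtain p q where "p \<in> FV" "nfU (sgm p) = nfU u" "q \<in> FV" "nfU (sgm q) = nfU v" by blast
    then have "p + q \<in> FV" "nfU (sgm (p + q)) = nfU (u + v)"
      by (simp_all add: sgm_simps qU.nf_simps pm.subspace_add[OF subspace_lists_span])
    then show "u + v \<in> ?W" by blast
  next
    fix c u assume "u \<in> ?W"
    then obtain p where "p \<in> FV" "nfU (sgm p) = nfU u" by blast
    then have "scl c p \<in> FV" "nfU (sgm (scl c p)) = nfU (scl c u)"
      by (simp_all add: sgm_simps qU.nf_simps pm.subspace_scale[OF subspace_lists_span])
    then show "scl c u \<in> ?W" by blast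
  qed
  have "\<exists>p\<in>FV. nfU (sgm p) = nfU (wd w)" for w
  proof (induction w)
    case Nil
    have "sgm 1 = 1"
      unfolding sgm_def using Sg_len[of scl free_act "wd []" 0 1, OF pm.vector_space_axioms free_act_right] wd_len_span[of "[]"]
      by (simp add: wd_Nil)
    then show ?case by (intro bexI[of _ 1]) (simp_all add: wd_Nil)
  next
    case (Cons x w)
    then obtain p where p: "p \<in> FV" "nfU (sgm p) = nfU (wd w)" by blast
    obtain N where N: "p \<in> len_le N" using len_le_exists by blast
    have "nfU (wd (x # w)) = nfU (gen (mp x) * wd w)" using wd_Cons[of x w, where 'k='k] by (simp add: nfU_gen_mp)
    also have "\<dots> = Z (mp x) (nfU (sgm p))" unfolding p(2) by (simp add: Z_V)
    also have "\<dots> = nfU (sgm (minus_formula N (mp x) p))"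
      using M.act_SG_V[OF mp_V N, of x] by (simp add: M_SG)
    finally show ?case using minus_formula_FV[OF mp_V p(1)] by metis
  qed
  then show ?thesis using subspace_single_induct[OF sub, of u] by simp
qed

end

section \<open>Symmetrisation and derivations on the quotient algebras\<close>

lemma subspace_preimage:
  assumes "lin scl scl f" "pm.subspace W" shows "pm.subspace {p. f p \<in> W}"
  by (rule pm.subspaceI) (simp_all add: lin_zero[OF assms(1)] lin_add[OF assms(1)] lin_scale[OF assms(1)]
      pm.subspace_0[OF assms(2)] pm.subspace_add[OF assms(2)] pm.subspace_scale[OF assms(2)])

context graded_data begin

lemma Sym_A: "Sym L V = S.A" and Env_A: "Env L V = U.A" and Env_G: "Env L UNIV = G.A" and Env_K: "Env L (g_k L) = K.A"
  by (simp_all add: Sym_def Env_def)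

lemma sgen_cls: "sgen L V x = S.cls (gen x)" and ugen_cls: "ugen L V x = U.cls (gen x)"
  and ugen_G: "ugen L UNIV x = G.cls (gen x)"
  by (simp_all add: sgen_def ugen_def)

lemma list_prod_sgen: "w \<in> lists V \<Longrightarrow> list_prod S.A (map (sgen L V) w) = S.cls (wd w)"
  unfolding sgen_def by (rule S.list_prod_A)

lemma S_cls_nf: "p \<in> FV \<Longrightarrow> q \<in> FV \<Longrightarrow> S.cls p = S.cls q \<longleftrightarrow> nfS p = nfS q"
  using JS_FV[of "p - q"] pm.subspace_diff[OF subspace_lists_span, of p V q]
  by (simp add: S.cls_eq qS.nf_eq_iff)

lemma U_cls_nf: "p \<in> FV \<Longrightarrow> q \<in> FV \<Longrightarrow> U.cls p = U.cls q \<longleftrightarrow> nfU p = nfU q"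
  using JU_FV[of "p - q"] pm.subspace_diff[OF subspace_lists_span, of p V q]
  by (simp add: U.cls_eq qU.nf_eq_iff)

definition "repS Y = (SOME p. p \<in> FV \<and> Y = S.cls p)"
definition "repU Y = (SOME p. p \<in> FV \<and> Y = U.cls p)"

lemma repS: "Y \<in> carrier S.A \<Longrightarrow> repS Y \<in> FV \<and> S.cls (repS Y) = Y"
  unfolding repS_def S.carrier_A by (rule someI2_ex[where Q = "\<lambda>p. p \<in> FV \<and> S.cls p = Y"]) auto

lemma repU: "Y \<in> carrier U.A \<Longrightarrow> repU Y \<in> FV \<and> U.cls (repU Y) = Y"
  unfolding repU_def U.carrier_A by (rule someI2_ex[where Q = "\<lambda>p. p \<in> FV \<and> U.cls p = Y"]) auto

lemma nfS_repS: "p \<in> FV \<Longrightarrow> nfS (repS (S.cls p)) = nfS p"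
  using repS[of "S.cls p"] S_cls_nf by blast

definition "sorted_words = {es @ os | es os. es \<in> lists (V \<inter> parity L 0) \<and> os \<in> lists (V \<inter> parity L 1)}"

lemma sorted_words_lists: "w \<in> sorted_words \<Longrightarrow> w \<in> lists V"
  by (auto simp: sorted_words_def lists_eq_set)

lemma odd_past_even:
  assumes "x \<in> parity L 1" shows "es \<in> lists (parity L 0) \<Longrightarrow> nfS (gen x * (wd es * q)) = nfS (wd es * (gen x * q))"
proof (induction es)
  case (Cons y es)
  have y: "y \<in> parity L 0" and es: "es \<in> lists (parity L 0)" using Cons.prems by auto
  have w: "wd (y # es) = (gen y * wd es :: 'g list \<Rightarrow>\<^sub>0 'k)" using wd_Cons[of y es] by simp
  have "nfS (gen x * (wd (y # es) * q)) = nfS (gen y * (gen x * (wd es * q)))"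
    using gen_swap[OF assms y, of "wd es * q"] unfolding w by (simp add: mult.assoc)
  also have "\<dots> = nfS (gen y * (wd es * (gen x * q)))" by (rule qS.nf_cong_left[OF Cons.IH[OF es]])
  finally show ?case unfolding w by (simp add: mult.assoc)
qed (simp add: wd_Nil)

text \<open>The description in \<open>sigma_def\<close> prescribes values only on products whose
  even factors precede the odd ones. These must span the symmetric algebra for the map to be
  determined.\<close>

lemma sorted_spanning: "\<exists>q\<in>pm.span (wd ` sorted_words). nfS p = nfS q"
proof -
  let ?B = "pm.span (wd ` sorted_words) :: ('g list \<Rightarrow>\<^sub>0 'k) set"
  let ?W = "{p. \<exists>q\<in>?B. nfS p = nfS q}"
  have sub: "pm.subspace ?W"
  proof (rule pm.subspaceI)
    show "0 \<in> ?W" using pm.span_zero by blast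
    fix p p' assume "p \<in> ?W" "p' \<in> ?W"
    then obtain q q' where "q \<in> ?B" "nfS p = nfS q" "q' \<in> ?B" "nfS p' = nfS q'" by blast
    then have "q + q' \<in> ?B" "nfS (p + p') = nfS (q + q')" by (simp_all add: pm.span_add qS.nf_simps)
    then show "p + p' \<in> ?W" by blast
  next
    fix c p assume "p \<in> ?W"
    then obtain q where "q \<in> ?B" "nfS p = nfS q" by blast
    then have "scl c q \<in> ?B" "nfS (scl c p) = nfS (scl c q)" by (simp_all add: pm.span_scale qS.nf_simps)
    then show "scl c p \<in> ?W" by blast
  qed
  have step: "gen x * q \<in> ?W" if q: "q \<in> ?B" and x: "x \<in> V" "x \<in> parity L p" for x q p
  proof -
    have "pm.subspace {q. gen x * q \<in> ?W}"
      by (rule subspace_preimage[OF lin_mult_left sub])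
    moreover have "wd ` sorted_words \<subseteq> {q. gen x * q \<in> ?W}"
    proof (intro subsetI CollectI)
      fix t :: "'g list \<Rightarrow>\<^sub>0 'k" assume "t \<in> wd ` sorted_words"
      then obtain es os where t: "t = wd (es @ os)" and es: "es \<in> lists (V \<inter> parity L 0)" and os: "os \<in> lists (V \<inter> parity L 1)"
        unfolding sorted_words_def by blast
      show "\<exists>q\<in>?B. nfS (gen x * t) = nfS q"
      proof (cases "p = 0")
        case True
        then have "(x # es) @ os \<in> sorted_words" using x es os by (unfold sorted_words_def, intro CollectI exI[of _ "x # es"] exI[of _ os]) auto
        then have "wd (x # es @ os) \<in> ?B" by (intro pm.span_base imageI) simp
        moreover have "gen x * t = wd (x # es @ os)" unfolding t using wd_Cons[of x "es @ os", where 'k='k] by simp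
        ultimately show ?thesis by metis
      next
        case False
        then have x1: "x \<in> parity L 1" using bit_cases[of p] x by auto
        then have "es @ (x # os) \<in> sorted_words" using x es os by (unfold sorted_words_def, intro CollectI exI[of _ es] exI[of _ "x # os"]) auto
        then have "wd (es @ x # os) \<in> ?B" by (intro pm.span_base imageI) simp
        moreover have "es \<in> lists (parity L 0)" using es by auto
        then have "nfS (gen x * t) = nfS (wd es * (gen x * wd os))"
          unfolding t wd_append by (rule odd_past_even[OF x1])
        then have "nfS (gen x * t) = nfS (wd (es @ x # os))"
          using wd_Cons[of x os, where 'k='k] wd_append[of es "x # os", where 'k='k] by simp
        ultimately show ?thesis by metis
      qed
    qed
    ultimately have "?B \<subseteq> {q. gen x * q \<in> ?W}" by (rule pm.span_minimal[rotated])
    then show ?thesis using q by blast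
  qed
  have "wd w \<in> ?W" for w
  proof (induction w)
    case Nil
    have "[] \<in> sorted_words" by (force simp: sorted_words_def)
    then have "wd [] \<in> ?B" by (intro pm.span_base imageI)
    then show ?case by (intro CollectI bexI[of _ "wd []"] refl)
  next
    case (Cons x w)
    then obtain q where q: "q \<in> ?B" "nfS (wd w) = nfS q" by blast
    have "gen (par 0 (mp x)) * q + gen (par 1 (mp x)) * q \<in> ?W"
      by (intro pm.subspace_add[OF sub] step[OF q(1) par_V[OF mp_V] par_mem])
    then obtain q' where q': "q' \<in> ?B" "nfS (gen (par 0 (mp x)) * q + gen (par 1 (mp x)) * q) = nfS q'" by blast
    have "nfS (wd (x # w)) = nfS (gen (mp x) * q)"
    proof -
      have "nfS (gen x * wd w) = nfS (gen (mp x) * q)"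
        by (rule qS.nf_cong[OF _ q(2)]) (simp only: nfS_Pr[of "gen x", symmetric] Pr_gen)
      then show ?thesis using wd_Cons[of x w, where 'k='k] by simp
    qed
    also have "\<dots> = nfS (gen (par 0 (mp x)) * q + gen (par 1 (mp x)) * q)"
    proof -
      have "nfS (gen (mp x) * q) = nfS (gen (par 0 (mp x) + par 1 (mp x)) * q)" by (simp flip: par_split)
      then show ?thesis by (simp add: lin_add[OF genS_mult_lin] qS.nf_simps)
    qed
    finally show ?case using q' by auto
  qed
  then show ?thesis using subspace_single_induct[OF sub, of p] by simp
qed

lemma linear_map_S_add:
  "linear_map S.A B f \<Longrightarrow> p \<in> FV \<Longrightarrow> q \<in> FV \<Longrightarrow> f (S.cls (p + q)) = f (S.cls p) \<oplus>\<^bsub>B\<^esub> f (S.cls q)"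
  and linear_map_S_scale:
  "linear_map S.A B f \<Longrightarrow> p \<in> FV \<Longrightarrow> f (S.cls (scl c p)) = c \<odot>\<^bsub>B\<^esub> f (S.cls p)"
  by (auto simp: linear_map_def S.add_A[symmetric] S.smult_A[symmetric])

lemma linear_map_agree:
  assumes f: "linear_map S.A B f" and g: "linear_map S.A B g"
    and T: "T \<subseteq> FV" "t \<in> T" "\<And>t. t \<in> T \<Longrightarrow> f (S.cls t) = g (S.cls t)"
    and p: "p \<in> FV" "q \<in> pm.span T" "nfS p = nfS q"
  shows "f (S.cls p) = g (S.cls p)"
proof -
  let ?W = "{p \<in> FV. f (S.cls p) = g (S.cls p)}"
  have tF: "t \<in> FV" using T by blast
  \<comment> \<open>\<open>B\<close> is an arbitrary record without axioms, so the values at zero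
    are compared as multiples of the values at \<open>t\<close>.\<close>
  have z: "(0 :: 'g list \<Rightarrow>\<^sub>0 'k) = scl 0 t" by simp
  have "pm.subspace ?W"
  proof (rule pm.subspaceI)
    have "f (S.cls (scl 0 t)) = g (S.cls (scl 0 t))"
      unfolding linear_map_S_scale[OF f tF] linear_map_S_scale[OF g tF] T(3)[OF T(2)] ..
    then show "0 \<in> ?W" using pm.subspace_0[OF subspace_lists_span, of V] by simp
  qed (simp_all add: linear_map_S_add[OF f] linear_map_S_add[OF g] linear_map_S_scale[OF f] linear_map_S_scale[OF g]
      pm.subspace_add[OF subspace_lists_span] pm.subspace_scale[OF subspace_lists_span])
  moreover have "T \<subseteq> ?W" using T by blast
  ultimately have "pm.span T \<subseteq> ?W" by (rule pm.span_minimal[rotated])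
  then have "q \<in> ?W" using p(2) by (rule subsetD)
  moreover have "S.cls p = S.cls q" using S_cls_nf p(1,3) calculation by blast
  ultimately show ?thesis by simp
qed

lemma linear_map_ext:
  assumes f: "linear_map S.A B f" and g: "linear_map S.A B g"
    and "\<And>p. p \<in> FV \<Longrightarrow> f (S.cls p) = g (S.cls p)"
  shows "f = g"
proof (rule PiE_ext)
  show "f \<in> carrier S.A \<rightarrow>\<^sub>E carrier B" "g \<in> carrier S.A \<rightarrow>\<^sub>E carrier B"
    using f g by (simp_all add: linear_map_def)
  show "f Y = g Y" if "Y \<in> carrier S.A" for Y using that assms(3) by (auto simp: S.carrier_A)
qed

lemma linear_map_sorted:
  assumes f: "linear_map S.A B f" and g: "linear_map S.A B g"
    and "\<And>w. w \<in> sorted_words \<Longrightarrow> f (S.cls (wd w)) = g (S.cls (wd w))"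
  shows "f = g"
proof (rule linear_map_ext[OF f g])
  fix p assume p: "p \<in> FV"
  obtain q where q: "q \<in> pm.span (wd ` sorted_words)" "nfS p = nfS q" using sorted_spanning by blast
  have "[] \<in> sorted_words" by (force simp: sorted_words_def)
  then have t: "wd [] \<in> wd ` sorted_words" by (rule imageI)
  have T: "wd ` sorted_words \<subseteq> FV" using sorted_words_lists by auto
  show "f (S.cls p) = g (S.cls p)"
    by (rule linear_map_agree[OF f g T t _ p q]) (use assms(3) in auto)
qed

definition lift :: "(('g list \<Rightarrow>\<^sub>0 'k) \<Rightarrow> 'b) \<Rightarrow> ('g list \<Rightarrow>\<^sub>0 'k) set \<Rightarrow> 'b" where
  "lift f = (\<lambda>Y\<in>carrier S.A. f (repS Y))"

lemma lift_cls: "p \<in> FV \<Longrightarrow> (\<And>q. q \<in> FV \<Longrightarrow> nfS q = nfS p \<Longrightarrow> f q = f p) \<Longrightarrow> lift f (S.cls p) = f p"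
proof -
  assume p: "p \<in> FV" and f: "\<And>q. q \<in> FV \<Longrightarrow> nfS q = nfS p \<Longrightarrow> f q = f p"
  have "f (repS (S.cls p)) = f p" using repS[of "S.cls p"] p by (intro f nfS_repS) auto
  then show ?thesis using p by (simp add: lift_def)
qed

lemma sgm_cong: "nfS p = nfS q \<Longrightarrow> sgm p = sgm q"
  using sgm_JS[of "p - q"] by (simp add: qS.nf_eq_iff sgm_simps)

definition "sigma0 = lift (\<lambda>p. U.cls (sgm p))"

lemma sigma0_cls: "p \<in> FV \<Longrightarrow> sigma0 (S.cls p) = U.cls (sgm p)"
  unfolding sigma0_def by (rule lift_cls, assumption, drule sgm_cong, simp)

lemma linear_map_sigma0: "linear_map S.A U.A sigma0"
  unfolding linear_map_def
proof (intro conjI ballI allI)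
  show "sigma0 \<in> carrier S.A \<rightarrow>\<^sub>E carrier U.A"
    unfolding sigma0_def lift_def by (auto intro: sgm_FV)
  fix a b assume "a \<in> carrier S.A" "b \<in> carrier S.A"
  then obtain p q where "p \<in> FV" "q \<in> FV" "a = S.cls p" "b = S.cls q" by (auto simp: S.carrier_A)
  then show "sigma0 (a \<oplus>\<^bsub>S.A\<^esub> b) = sigma0 a \<oplus>\<^bsub>U.A\<^esub> sigma0 b"
    by (simp add: S.add_A sigma0_cls pm.subspace_add[OF subspace_lists_span] U.add_A sgm_FV sgm_simps)
next
  fix c a assume "a \<in> carrier S.A"
  then obtain p where "p \<in> FV" "a = S.cls p" by (auto simp: S.carrier_A)
  then show "sigma0 (c \<odot>\<^bsub>S.A\<^esub> a) = c \<odot>\<^bsub>U.A\<^esub> sigma0 a"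
    by (simp add: S.smult_A sigma0_cls pm.subspace_scale[OF subspace_lists_span] U.smult_A sgm_FV sgm_simps)
qed

lemma foldr_Z: "u \<in> lists V \<Longrightarrow> foldr Z u (nfU 1) = nfU (wd u)"
proof (induction u)
  case (Cons x u)
  then show ?case using wd_Cons[of x u, where 'k='k] by (simp add: Z_V)
qed (simp add: wd_Nil)

lemma sigma0_symmetrise:
  assumes es: "es \<in> lists (V \<inter> parity L 0)" and os: "os \<in> lists (V \<inter> parity L 1)"
  shows "sigma0 (list_prod S.A (map (sgen L V) (es @ os))) =
    symmetrise U.A (length es) (map (ugen L V) (es @ os))"
proof -
  let ?w = "es @ os"
  let ?n = "length ?w"
  let ?P = "{\<tau>. \<tau> permutes {..<?n}}"
  have w: "?w \<in> lists V" using es os by auto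
  have pw: "perm_word ?w \<tau> \<in> lists V" if "\<tau> \<in> ?P" for \<tau>
  proof -
    have "?w ! \<tau> i \<in> set ?w" if "i < ?n" for i
      using permutes_in_image[of \<tau> "{..<?n}" i] \<open>\<tau> \<in> ?P\<close> that by (intro nth_mem) (simp del: length_append)
    moreover have "set ?w \<subseteq> V" using w by (auto simp: lists_eq_set)
    ultimately show ?thesis unfolding perm_word_def lists_eq_set by fastforce
  qed
  have lp: "list_prod U.A (map (\<lambda>i. map (ugen L V) ?w ! \<tau> i) [0..<?n]) = U.cls (wd (perm_word ?w \<tau>))" if "\<tau> \<in> ?P" for \<tau>
  proof -
    have "map (\<lambda>i. map (ugen L V) ?w ! \<tau> i) [0..<?n] = map (\<lambda>x. U.cls (gen x)) (perm_word ?w \<tau>)"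
      using permutes_in_image[of \<tau> "{..<?n}"] that
      by (auto simp: perm_word_def ugen_cls simp del: length_append map_append)
    then show ?thesis using U.list_prod_A[OF pw[OF that]] by simp
  qed
  let ?f = "\<lambda>\<tau>. scl ((- 1) ^ odd_inversions (length es) ?n \<tau>) (wd (perm_word ?w \<tau>)) :: 'g list \<Rightarrow>\<^sub>0 'k"
  have fF: "?f \<tau> \<in> FV" if "\<tau> \<in> ?P" for \<tau>
    using pw[OF that] by (intro pm.subspace_scale[OF subspace_lists_span]) simp
  have sF: "(\<Sum>\<tau>\<in>?P. ?f \<tau>) \<in> FV" by (intro pm.subspace_sum[OF subspace_lists_span] fF)
  have "symmetrise U.A (length es) (map (ugen L V) ?w) =
      (1 / fact ?n) \<odot>\<^bsub>U.A\<^esub> finsum U.A (\<lambda>\<tau>. U.cls (?f \<tau>)) ?P"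
    unfolding symmetrise_def Let_def length_map
    by (intro arg_cong2[where f = "smult U.A"] refl U.qr.finsum_cong')
      (use lp pw fF in \<open>auto simp: U.smult_A simp del: length_append map_append\<close>)
  also have "\<dots> = U.cls (scl (1 / fact ?n) (\<Sum>\<tau>\<in>?P. ?f \<tau>))"
    by (subst U.finsum_A) (use fF sF in \<open>auto simp: U.smult_A simp del: length_append\<close>)
  also have "\<dots> = U.cls (sgm (wd ?w))"
  proof -
    \<comment> \<open>The permutation sum is evaluated in the module \<open>M\<close>, since
      \<open>Sn_sorted_word\<close> requires operators depending linearly on the letter, which
      multiplication in the free algebra does not.\<close>
    have "nfU (sgm (wd ?w)) = M.S ?n (wd ?w)"
      using M_SG[of "wd ?w"] M.SG_wd[of ?w] by simp
    also have "\<dots> = scl (1 / fact ?n) (\<Sum>\<tau>\<in>?P. scl ((- 1) ^ odd_inversions (length es) ?n \<tau>) (foldr Z (perm_word ?w \<tau>) (nfU 1)))"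
      by (rule Sn_sorted_word[where act = Z, OF pm.vector_space_axioms Z_left_lin Z_lin es os refl])
    also have "\<dots> = scl (1 / fact ?n) (\<Sum>\<tau>\<in>?P. scl ((- 1) ^ odd_inversions (length es) ?n \<tau>) (nfU (wd (perm_word ?w \<tau>))))"
      by (intro arg_cong[where f = "scl (1 / fact ?n)"] sum.cong refl) (simp only: foldr_Z[OF pw])
    also have "\<dots> = nfU (scl (1 / fact ?n) (\<Sum>\<tau>\<in>?P. ?f \<tau>))"
      by (simp only: qS.nf_simps qU.nf_simps)
    finally have "nfU (scl (1 / fact ?n) (\<Sum>\<tau>\<in>?P. ?f \<tau>)) = nfU (sgm (wd ?w))" ..
    then show ?thesis by (subst U_cls_nf) (simp_all only: pm.subspace_scale[OF subspace_lists_span sF] sgm_FV)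
  qed
  also have "\<dots> = sigma0 (list_prod S.A (map (sgen L V) ?w))"
    using w by (simp only: list_prod_sgen[OF w] sigma0_cls wd_lists_span)
  finally show ?thesis ..
qed

lemma sigma_eq: "sigma L = sigma0"
  unfolding sigma_def Let_def Sym_A Env_A
proof (rule the_equality)
  show "linear_map S.A U.A sigma0 \<and> (\<forall>es\<in>lists (V \<inter> parity L 0). \<forall>os\<in>lists (V \<inter> parity L 1).
     sigma0 (list_prod S.A (map (sgen L V) (es @ os))) = symmetrise U.A (length es) (map (ugen L V) (es @ os)))"
    using linear_map_sigma0 sigma0_symmetrise by blast
next
  fix f assume f: "linear_map S.A U.A f \<and> (\<forall>es\<in>lists (V \<inter> parity L 0). \<forall>os\<in>lists (V \<inter> parity L 1).
     f (list_prod S.A (map (sgen L V) (es @ os))) = symmetrise U.A (length es) (map (ugen L V) (es @ os)))"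
  show "f = sigma0"
  proof (rule linear_map_sorted[OF _ linear_map_sigma0])
    show "linear_map S.A U.A f" using f by blast
    fix w assume "w \<in> sorted_words"
    then obtain es os where w: "w = es @ os" "es \<in> lists (V \<inter> parity L 0)" "os \<in> lists (V \<inter> parity L 1)"
      by (auto simp: sorted_words_def)
    have "w \<in> lists V" using \<open>w \<in> sorted_words\<close> by (rule sorted_words_lists)
    then have "list_prod S.A (map (sgen L V) w) = S.cls (wd w)" by (rule list_prod_sgen)
    then show "f (S.cls (wd w)) = sigma0 (S.cls (wd w))"
      using f w sigma0_symmetrise[OF w(2,3)] by metis
  qed
qed

lemma sigma_cls: "p \<in> FV \<Longrightarrow> sigma L (S.cls p) = U.cls (sgm p)"
  by (simp add: sigma_eq sigma0_cls)

lemma sigma_inj: "inj_on (sigma L) (carrier S.A)"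
proof (rule inj_onI)
  fix a b assume "a \<in> carrier S.A" "b \<in> carrier S.A" and eq: "sigma L a = sigma L b"
  then obtain p q where pq: "p \<in> FV" "q \<in> FV" "a = S.cls p" "b = S.cls q" by (auto simp: S.carrier_A)
  then have "nfU (sgm p) = nfU (sgm q)" using eq by (simp add: sigma_cls U_cls_nf sgm_FV)
  then have "sgm (p - q) \<in> JU" by (simp add: qU.nf_eq_iff sgm_simps)
  then have "p - q \<in> JS" by (rule sgm_injective)
  then show "a = b" using pq by (simp add: S_cls_nf qS.nf_eq_iff)
qed

definition "sigma_inv = inv_into (carrier S.A) (sigma L)"

lemma sigma_inv_cls: "p \<in> FV \<Longrightarrow> sigma_inv (U.cls (sgm p)) = S.cls p"
  unfolding sigma_inv_def by (rule inv_into_f_eq[OF sigma_inj]) (simp_all add: sigma_cls)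

lemma U_carrier_sgm: "u \<in> carrier U.A \<Longrightarrow> \<exists>p\<in>FV. u = U.cls (sgm p)"
proof -
  assume "u \<in> carrier U.A"
  then obtain q where q: "q \<in> FV" "u = U.cls q" by (auto simp: U.carrier_A)
  obtain p where "p \<in> FV" "nfU (sgm p) = nfU q" using sgm_surjective by blast
  then show ?thesis using q by (metis U_cls_nf sgm_FV)
qed

section \<open>The super derivations of the symmetric algebra\<close>

definition hom_par :: "bit \<Rightarrow> ('g list \<Rightarrow>\<^sub>0 'k) set" where
  "hom_par q = {p. \<forall>w\<in>Poly_Mapping.keys p. \<exists>ps. list_all2 (\<lambda>x d. x \<in> parity L d) w ps \<and> sum_list ps = q}"

lemma subspace_hom_par: "pm.subspace (hom_par q)"
  unfolding hom_par_def by (rule subspace_keys)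

lemma sym_parity_eq: "sym_parity L V q = S.cls ` (FV \<inter> hom_par q)"
  by (auto simp: sym_parity_def hom_par_def free_algebra_simps)

lemma gen_hom_par:
  assumes "x \<in> parity L d" "p \<in> hom_par q" shows "gen x * p \<in> hom_par (d + q)"
  unfolding hom_par_def
proof (intro CollectI ballI)
  fix w assume "w \<in> Poly_Mapping.keys (gen x * p)"
  then obtain w' where w': "w = x # w'" "w' \<in> Poly_Mapping.keys p"
    using keys_mult[of "gen x" p] by (auto simp: plus_list_def split: if_splits)
  then obtain ps where "list_all2 (\<lambda>x d. x \<in> parity L d) w' ps" "sum_list ps = q"
    using assms(2) by (auto simp: hom_par_def)
  then show "\<exists>ps. list_all2 (\<lambda>x d. x \<in> parity L d) w ps \<and> sum_list ps = d + q"
    using assms(1) w' by (intro exI[of _ "d # ps"]) simp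
qed

lemma bit_cancel: "d + (d + q) = (q :: bit)"
  using bit_cases[of d] bit_cases[of q] by auto

lemma pdw_hom_par:
  assumes i: "i < m"
  shows "list_all2 (\<lambda>x d. x \<in> parity L d) w ps \<Longrightarrow> pdw i w \<in> hom_par (pi i + sum_list ps)"
proof (induction w arbitrary: ps)
  case Nil
  then show ?case by (simp add: pm.subspace_0[OF subspace_hom_par])
next
  case (Cons x w)
  then obtain d ps' where ps: "ps = d # ps'" "x \<in> parity L d" "list_all2 (\<lambda>x d. x \<in> parity L d) w ps'"
    by (auto simp: list_all2_Cons1)
  have a: "gen (e i x) * pdw i w \<in> hom_par (d + (pi i + sum_list ps'))"
    by (rule gen_hom_par[OF e_parity[OF ps(2)] Cons.IH[OF ps(3)]])
  have b: "d + (pi i + sum_list ps') = pi i + sum_list ps" by (simp only: ps sum_list.Cons add_ac)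
  have c: "scl (xi i x) (wd w) \<in> hom_par (pi i + sum_list ps)"
  proof (cases "pi i = d")
    case True
    have "wd w \<in> hom_par (sum_list ps')" using ps(3) by (auto simp: hom_par_def)
    then show ?thesis unfolding ps True sum_list.Cons bit_cancel by (rule pm.subspace_scale[OF subspace_hom_par])
  next
    case False
    then show ?thesis using xi_parity[OF ps(2) i] by (simp add: pm.subspace_0[OF subspace_hom_par])
  qed
  show ?case unfolding pdw.simps by (rule pm.subspace_add[OF subspace_hom_par c a[unfolded b]])
qed

lemma pd_hom_par:
  assumes "i < m" "p \<in> hom_par q" shows "pd i p \<in> hom_par (pi i + q)"
proof -
  have "pm.subspace {p. pd i p \<in> hom_par (pi i + q)}"
    by (rule pm.subspaceI) (simp_all add: pd_simps pm.subspace_0[OF subspace_hom_par]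
        pm.subspace_add[OF subspace_hom_par] pm.subspace_scale[OF subspace_hom_par])
  then have "p \<in> {p. pd i p \<in> hom_par (pi i + q)}"
  proof (rule subspace_single_induct)
    fix w assume "w \<in> Poly_Mapping.keys p"
    then obtain ps where ps: "list_all2 (\<lambda>x d. x \<in> parity L d) w ps" "sum_list ps = q" using assms(2) by (auto simp: hom_par_def)
    show "wd w \<in> {p. pd i p \<in> hom_par (pi i + q)}"
      unfolding mem_Collect_eq pd_wd using pdw_hom_par[OF assms(1) ps(1)] unfolding ps(2) .
  qed
  then show ?thesis by simp
qed

lemma em_hom_par:
  assumes "i < m" "p \<in> hom_par q" shows "nfS (em i p * u) = scl (koszul (pi i) q) (nfS (p * u))"
proof -
  have *: "nfS (em i (wd w) * u) = scl (koszul (pi i) (sum_list ps)) (nfS (wd w * u))"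
    if "list_all2 (\<lambda>x d. x \<in> parity L d) w ps" for w ps
    using that
  proof (induction w arbitrary: ps)
    case (Cons x w)
    then obtain d ps' where ps: "ps = d # ps'" "x \<in> parity L d" "list_all2 (\<lambda>x d. x \<in> parity L d) w ps'"
      by (auto simp: list_all2_Cons1)
    have "nfS (em i (wd (x # w)) * u) = nfS (gen (e i x) * (em i (wd w) * u))"
      using wd_Cons[of "e i x" "map (e i) w", where 'k='k] by (simp add: mult.assoc)
    also have "\<dots> = scl (koszul (pi i) d) (nfS (gen x * nfS (em i (wd w) * u)))"
      by (simp only: gen_e_mult[OF ps(2)] qS.nf_mult_nf)
    also have "\<dots> = scl (koszul (pi i) d * koszul (pi i) (sum_list ps')) (nfS (gen x * (wd w * u)))"
      by (simp only: Cons.IH[OF ps(3)] scl_mult_right lin_scale[OF qS.nf_lin] qS.nf_mult_nf pm.scale_scale)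
    also have "koszul (pi i) d * koszul (pi i) (sum_list ps') = (koszul (pi i) (sum_list ps) :: 'k)"
      by (simp only: ps sum_list.Cons koszul_add_right)
    also have "gen x * (wd w * u) = wd (x # w) * u"
      using wd_Cons[of x w, where 'k='k] by (simp add: mult.assoc)
    finally show ?case .
  qed (simp add: wd_Nil)
  show ?thesis
  proof (rule lin_eqI[where f = "\<lambda>p. nfS (em i p * u)" and g = "\<lambda>p. scl (koszul (pi i) q) (nfS (p * u))"])
    show "lin scl scl (\<lambda>p. nfS (em i p * u))"
      by (rule lin_compose[OF lin_compose[OF word_map_lin lin_mult_right] qS.nf_lin])
    show "lin scl scl (\<lambda>p. scl (koszul (pi i) q) (nfS (p * u)))"
      by (rule lin_compose[OF lin_compose[OF lin_mult_right qS.nf_lin] lin_scl])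
    fix w assume "w \<in> Poly_Mapping.keys p"
    then obtain ps where "list_all2 (\<lambda>x d. x \<in> parity L d) w ps" "sum_list ps = q" using assms(2) by (auto simp: hom_par_def)
    then show "nfS (em i (wd w) * u) = scl (koszul (pi i) q) (nfS (wd w * u))" using * by blast
  qed
qed

definition "partial0 i = lift (\<lambda>p. S.cls (pd i p))"

lemma pd_cong: "i < m \<Longrightarrow> nfS p = nfS q \<Longrightarrow> nfS (pd i p) = nfS (pd i q)"
  using pd_JS[of "p - q" i] by (simp add: qS.nf_eq_iff pd_simps)

lemma partial0_cls: "i < m \<Longrightarrow> p \<in> FV \<Longrightarrow> partial0 i (S.cls p) = S.cls (pd i p)"
  unfolding partial0_def by (rule lift_cls) (auto simp: S_cls_nf pd_FV intro: pd_cong)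

lemma S_carrier: "a \<in> carrier S.A \<Longrightarrow> (\<And>p. p \<in> FV \<Longrightarrow> a = S.cls p \<Longrightarrow> thesis) \<Longrightarrow> thesis"
  unfolding S.carrier_A by blast

lemma linear_map_partial0: "i < m \<Longrightarrow> linear_map S.A S.A (partial0 i)"
  unfolding linear_map_def
proof (intro conjI ballI allI)
  assume i: "i < m"
  show "partial0 i \<in> carrier S.A \<rightarrow>\<^sub>E carrier S.A"
    unfolding partial0_def lift_def using repS by (auto intro!: pd_FV)
  fix a b assume "a \<in> carrier S.A" "b \<in> carrier S.A"
  then obtain p q where "p \<in> FV" "q \<in> FV" "a = S.cls p" "b = S.cls q" by (auto simp: S.carrier_A)
  then show "partial0 i (a \<oplus>\<^bsub>S.A\<^esub> b) = partial0 i a \<oplus>\<^bsub>S.A\<^esub> partial0 i b"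
    using i by (simp add: S.add_A partial0_cls pm.subspace_add[OF subspace_lists_span] pd_FV pd_simps)
next
  fix c a assume i: "i < m" and "a \<in> carrier S.A"
  then obtain p where "p \<in> FV" "a = S.cls p" by (auto simp: S.carrier_A)
  then show "partial0 i (c \<odot>\<^bsub>S.A\<^esub> a) = c \<odot>\<^bsub>S.A\<^esub> partial0 i a"
    using i by (simp add: S.smult_A partial0_cls pm.subspace_scale[OF subspace_lists_span] pd_FV pd_simps)
qed

lemma super_derivation_partial0:
  assumes i: "i < m" shows "super_derivation S.A (sym_parity L V) (pi i) (partial0 i)"
  unfolding super_derivation_def
proof (intro conjI allI ballI)
  show "linear_map S.A S.A (partial0 i)" by (rule linear_map_partial0[OF i])
  fix q a assume "a \<in> sym_parity L V q"
  then obtain p where p: "p \<in> FV" "p \<in> hom_par q" "a = S.cls p" by (auto simp: sym_parity_eq)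
  show "partial0 i a \<in> sym_parity L V (pi i + q)"
    unfolding p(3) partial0_cls[OF i p(1)] sym_parity_eq using pd_FV[OF p(1)] pd_hom_par[OF i p(2)] by blast
  fix b assume "b \<in> carrier S.A"
  then obtain u where u: "u \<in> FV" "b = S.cls u" by (rule S_carrier)
  have eF: "em i p \<in> FV" by (rule word_map_lists_span[OF e_V p(1)])
  have "nfS (pd i (p * u)) = nfS (pd i p * u + scl (koszul (pi i) q) (p * pd i u))"
    using em_hom_par[OF i p(2), of "pd i u"] by (simp add: pd_mult qS.nf_simps)
  then have "S.cls (pd i (p * u)) = S.cls (pd i p * u + scl (koszul (pi i) q) (p * pd i u))"
    using p u by (subst S_cls_nf) (auto intro!: pd_FV lists_span_mult pm.subspace_add[OF subspace_lists_span] pm.subspace_scale[OF subspace_lists_span])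
  then show "partial0 i (a \<otimes>\<^bsub>S.A\<^esub> b) = partial0 i a \<otimes>\<^bsub>S.A\<^esub> b \<oplus>\<^bsub>S.A\<^esub> koszul (pi i) q \<odot>\<^bsub>S.A\<^esub> (a \<otimes>\<^bsub>S.A\<^esub> partial0 i b)"
    using p u i by (simp add: S.mult_A partial0_cls lists_span_mult pd_FV S.smult_A S.add_A pm.subspace_scale[OF subspace_lists_span])
qed

lemma partial0_X: "i < m \<Longrightarrow> j < m \<Longrightarrow> partial0 i (sgen L V (X j)) = (if i = j then \<one>\<^bsub>S.A\<^esub> else \<zero>\<^bsub>S.A\<^esub>)"
  by (simp add: sgen_cls partial0_cls X_V pd_gen_one xi_X S.one_A S.zero_A)

text \<open>Uniqueness: two derivations with the same values on the basis agree on letters by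
  linearity, on words with homogeneous letters by the product rule, which is stated for a
  homogeneous left factor, and hence everywhere by \<open>linear_map_sorted\<close>.\<close>

lemma partial_eq:
  assumes i: "i < m" shows "partial L r s X i = partial0 i"
  unfolding partial_def Let_def Sym_A pi_def[symmetric]
proof (rule the_equality)
  show "super_derivation S.A (sym_parity L V) (pi i) (partial0 i) \<and>
     (\<forall>j<m. partial0 i (sgen L V (X j)) = (if i = j then \<one>\<^bsub>S.A\<^esub> else \<zero>\<^bsub>S.A\<^esub>))"
    using super_derivation_partial0[OF i] partial0_X[OF i] by blast
next
  fix D assume D: "super_derivation S.A (sym_parity L V) (pi i) D \<and>
     (\<forall>j<m. D (sgen L V (X j)) = (if i = j then \<one>\<^bsub>S.A\<^esub> else \<zero>\<^bsub>S.A\<^esub>))"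
  let ?E = "partial0 i"
  have sd: "super_derivation S.A (sym_parity L V) (pi i) f \<Longrightarrow> linear_map S.A S.A f" for f
    by (simp add: super_derivation_def)
  have leib: "f (a \<otimes>\<^bsub>S.A\<^esub> b) = f a \<otimes>\<^bsub>S.A\<^esub> b \<oplus>\<^bsub>S.A\<^esub> koszul (pi i) q \<odot>\<^bsub>S.A\<^esub> (a \<otimes>\<^bsub>S.A\<^esub> f b)"
    if "super_derivation S.A (sym_parity L V) (pi i) f" "a \<in> sym_parity L V q" "b \<in> carrier S.A" for f a b q
    using that by (simp add: super_derivation_def)
  note E = super_derivation_partial0[OF i]
  note D' = conjunct1[OF D]
  have fc: "f a \<in> carrier S.A" if "linear_map S.A S.A f" "a \<in> carrier S.A" for f a
    using that by (auto simp: linear_map_def)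
  \<comment> \<open>The product rule for one times one makes the value at one equal to its own
    double.\<close>
  have one: "f \<one>\<^bsub>S.A\<^esub> = \<zero>\<^bsub>S.A\<^esub>" if f: "super_derivation S.A (sym_parity L V) (pi i) f" for f
  proof -
    have "\<one>\<^bsub>S.A\<^esub> \<in> sym_parity L V 0"
      unfolding S.one_A sym_parity_eq
      by (rule imageI) (simp add: hom_par_def wd_Nil[symmetric])
    from leib[OF f this, of "\<one>\<^bsub>S.A\<^esub>"]
    have "f \<one>\<^bsub>S.A\<^esub> = f \<one>\<^bsub>S.A\<^esub> \<oplus>\<^bsub>S.A\<^esub> 1 \<odot>\<^bsub>S.A\<^esub> f \<one>\<^bsub>S.A\<^esub>"
      using fc[OF sd[OF f], of "\<one>\<^bsub>S.A\<^esub>"] by simp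
    moreover have oc: "f \<one>\<^bsub>S.A\<^esub> \<in> carrier S.A" by (rule fc[OF sd[OF f] S.qr.one_closed])
    from oc obtain p where "p \<in> FV" "f \<one>\<^bsub>S.A\<^esub> = S.cls p" by (rule S_carrier)
    ultimately have "f \<one>\<^bsub>S.A\<^esub> \<oplus>\<^bsub>S.A\<^esub> f \<one>\<^bsub>S.A\<^esub> = f \<one>\<^bsub>S.A\<^esub>" by (simp add: S.smult_A)
    then show ?thesis using oc by (simp add: S.qr.add.l_cancel_one)
  qed
  have gens: "D (S.cls (gen x)) = ?E (S.cls (gen x))" if x: "x \<in> V" for x
  proof (cases "m = 0")
    case True
    then show ?thesis using i by simp
  next
    case False
    show ?thesis
    proof (rule linear_map_agree[OF sd[OF D'] sd[OF E]])
      show "(\<lambda>j. gen (X j)) ` {..<m} \<subseteq> FV" using X_V by auto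
      show "gen (X 0) \<in> (\<lambda>j. gen (X j)) ` {..<m}" using False by auto
      show "D (S.cls t) = ?E (S.cls t)" if "t \<in> (\<lambda>j. gen (X j)) ` {..<m}" for t
        using that D partial0_X[OF i] by (auto simp: sgen_cls)
      show "gen x \<in> FV" using x by simp
      show "(\<Sum>j<m. scl (xi j x) (gen (X j))) \<in> pm.span ((\<lambda>j. gen (X j)) ` {..<m})"
        by (intro pm.span_sum pm.span_scale pm.span_base) auto
      have "nfS (gen x) = nfS (gen (\<Sum>j<m. sc (xi j x) (X j)))" using x by (simp add: xi_expand)
      then show "nfS (gen x) = nfS (\<Sum>j<m. scl (xi j x) (gen (X j)))"
        by (simp add: lin_sum[OF genS_lin] lin_scale[OF genS_lin] qS.nf_simps)
    qed
  qed
  have words: "D (S.cls (wd w)) = ?E (S.cls (wd w))"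
    if "w \<in> lists V" "\<And>x. x \<in> set w \<Longrightarrow> \<exists>q. x \<in> parity L q" for w
    using that
  proof (induction w rule: list.induct)
    case Nil
    then show ?case using one[OF D'] one[OF E] by (simp add: wd_Nil S.one_A)
  next
    case (Cons x w)
    obtain q where q: "x \<in> parity L q" using Cons.prems(2)[of x] by auto
    have xV: "x \<in> V" and wV: "w \<in> lists V" using Cons.prems(1) by simp_all
    have a: "S.cls (gen x) \<in> sym_parity L V q"
      unfolding sym_parity_eq using xV q by (intro imageI) (auto simp: hom_par_def intro!: exI[of _ "[q]"])
    have b: "S.cls (wd w) \<in> carrier S.A" using wV by auto
    have c: "S.cls (wd (x # w)) = S.cls (gen x) \<otimes>\<^bsub>S.A\<^esub> S.cls (wd w)"
      using xV wV wd_Cons[of x w, where 'k='k] by (simp add: S.mult_A)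
    have d: "D (S.cls (wd w)) = ?E (S.cls (wd w))"
      by (rule Cons.IH[OF wV]) (use Cons.prems(2) in simp)
    show ?case unfolding c leib[OF D' a b] leib[OF E a b] gens[OF xV] d ..
  qed
  show "D = ?E"
  proof (rule linear_map_sorted[OF sd[OF D'] sd[OF E]])
    fix w assume "w \<in> sorted_words"
    then show "D (S.cls (wd w)) = ?E (S.cls (wd w))"
    proof (intro words sorted_words_lists)
      fix x assume "x \<in> set w"
      then have "x \<in> parity L 0 \<or> x \<in> parity L 1"
        using \<open>w \<in> sorted_words\<close> unfolding sorted_words_def lists_eq_set by auto
      then show "\<exists>q. x \<in> parity L q" by blast
    qed
  qed
qed

lemma partial_cls: "i < m \<Longrightarrow> p \<in> FV \<Longrightarrow> partial L r s X i (S.cls p) = S.cls (pd i p)"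
  by (simp add: partial_eq partial0_cls)

lemma partial_pow_cls:
  assumes "p \<in> FV" shows "partial_pow L r s X K (S.cls p) = S.cls (pdK K [0..<m] p)"
proof -
  have pw: "(partial L r s X i ^^ k) (S.cls q) = S.cls ((pd i ^^ k) q) \<and> (pd i ^^ k) q \<in> FV" if "i < m" "q \<in> FV" for i k q
    using that by (induction k) (simp_all add: partial_cls pd_FV)
  have *: "set l \<subseteq> {..<m} \<Longrightarrow> foldr (\<lambda>i f. (partial L r s X i ^^ K i) \<circ> f) l id (S.cls p) = S.cls (pdK K l p)" for l
  proof (induction l)
    case (Cons j l)
    then show ?case using pw[of j "pdK K l p" "K j"] pdK_FV[OF assms] by (simp add: pdK_Cons)
  qed (simp add: pdK_def)
  have "set [0..<m] \<subseteq> {..<m}" by auto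
  from *[OF this] show ?thesis unfolding partial_pow_def .
qed

definition "pdL i Ks p = fold (\<lambda>K. pdK K [0..<m]) Ks (pd i p)"

lemma pdL_FV: "p \<in> FV \<Longrightarrow> pdL i Ks p \<in> FV"
proof -
  have "q \<in> FV \<Longrightarrow> fold (\<lambda>K. pdK K [0..<m]) Ks q \<in> FV" for q
    by (induction Ks arbitrary: q) (simp_all add: pdK_FV)
  then show "p \<in> FV \<Longrightarrow> pdL i Ks p \<in> FV" by (simp add: pdL_def pd_FV)
qed

lemma partial_list_cls:
  assumes "i < m" "p \<in> FV" shows "partial_list L r s X i Ks (S.cls p) = S.cls (pdL i Ks p)"
proof -
  have "q \<in> FV \<Longrightarrow> fold (partial_pow L r s X) Ks (S.cls q) = S.cls (fold (\<lambda>K. pdK K [0..<m]) Ks q)" for q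
    by (induction Ks arbitrary: q) (simp_all add: partial_pow_cls pdK_FV)
  then show ?thesis by (simp add: partial_list_def pdL_def partial_cls assms pd_FV)
qed

end

section \<open>The action as computed in the tensor product\<close>

definition tensor_generators ::
    "('k::field, 'a) module \<Rightarrow> (('a \<Rightarrow> 'a) \<times> ('k \<Rightarrow> 'k)) set \<Rightarrow> (('a \<times> 'k) \<Rightarrow>\<^sub>0 'k) set" where
  "tensor_generators M T =
     {Poly_Mapping.single (u \<oplus>\<^bsub>M\<^esub> u', a) 1 - Poly_Mapping.single (u, a) 1 - Poly_Mapping.single (u', a) 1
         | u u' a. u \<in> carrier M \<and> u' \<in> carrier M} \<union>
      {Poly_Mapping.single (u, a + a') 1 - Poly_Mapping.single (u, a) 1 - Poly_Mapping.single (u, a') 1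
         | u a a'. u \<in> carrier M} \<union>
      {Poly_Mapping.single (c \<odot>\<^bsub>M\<^esub> u, a) 1 - Poly_Mapping.single (u, a) c | c u a. u \<in> carrier M} \<union>
      {Poly_Mapping.single (u, c * a) 1 - Poly_Mapping.single (u, a) c | c u a. u \<in> carrier M} \<union>
      {Poly_Mapping.single (\<rho> u, a) 1 - Poly_Mapping.single (u, \<phi> a) 1
         | \<rho> \<phi> u a. (\<rho>, \<phi>) \<in> T \<and> u \<in> carrier M}"

lemma tensor_null_eq: "tensor_null M T = pm.span (tensor_generators M T)"
  by (simp add: tensor_null_def tensor_generators_def)

lemma subspace_tensor_null: "pm.subspace (tensor_null M T)"
  by (simp add: tensor_null_eq)

lemma tensor_generators_cases:
  assumes "t \<in> tensor_generators M T"
  obtains (add) u u' a where "u \<in> carrier M" "u' \<in> carrier M"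
      "t = Poly_Mapping.single (u \<oplus>\<^bsub>M\<^esub> u', a) 1 - Poly_Mapping.single (u, a) 1 - Poly_Mapping.single (u', a) 1"
  | (add') u a a' where "u \<in> carrier M"
      "t = Poly_Mapping.single (u, a + a') 1 - Poly_Mapping.single (u, a) 1 - Poly_Mapping.single (u, a') 1"
  | (scale) c u a where "u \<in> carrier M" "t = Poly_Mapping.single (c \<odot>\<^bsub>M\<^esub> u, a) 1 - scl c (Poly_Mapping.single (u, a) 1)"
  | (scale') c u a where "u \<in> carrier M" "t = Poly_Mapping.single (u, c * a) 1 - scl c (Poly_Mapping.single (u, a) 1)"
  | (balance) \<rho> \<phi> u a where "(\<rho>, \<phi>) \<in> T" "u \<in> carrier M"
      "t = Poly_Mapping.single (\<rho> u, a) 1 - Poly_Mapping.single (u, \<phi> a) 1"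
  using assms unfolding tensor_generators_def
proof (elim UnE)
  assume "t \<in> {Poly_Mapping.single (u \<oplus>\<^bsub>M\<^esub> u', a) 1 - Poly_Mapping.single (u, a) 1 - Poly_Mapping.single (u', a) 1
         | u u' a. u \<in> carrier M \<and> u' \<in> carrier M}"
  then show thesis using add by blast
next
  assume "t \<in> {Poly_Mapping.single (u, a + a') 1 - Poly_Mapping.single (u, a) 1 - Poly_Mapping.single (u, a') 1
         | u a a'. u \<in> carrier M}"
  then show thesis using add' by blast
next
  assume "t \<in> {Poly_Mapping.single (c \<odot>\<^bsub>M\<^esub> u, a) 1 - Poly_Mapping.single (u, a) c | c u a. u \<in> carrier M}"
  then show thesis using scale unfolding scl_single mult_1_right by blast
next
  assume "t \<in> {Poly_Mapping.single (u, c * a) 1 - Poly_Mapping.single (u, a) c | c u a. u \<in> carrier M}"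
  then show thesis using scale' unfolding scl_single mult_1_right by blast
next
  assume "t \<in> {Poly_Mapping.single (\<rho> u, a) 1 - Poly_Mapping.single (u, \<phi> a) 1
         | \<rho> \<phi> u a. (\<rho>, \<phi>) \<in> T \<and> u \<in> carrier M}"
  then show thesis using balance by blast
qed

lemma tensor_generators_mem:
  "u \<in> carrier M \<Longrightarrow> u' \<in> carrier M \<Longrightarrow>
     Poly_Mapping.single (u \<oplus>\<^bsub>M\<^esub> u', a) 1 - Poly_Mapping.single (u, a) 1 - Poly_Mapping.single (u', a) 1 \<in> tensor_null M T"
  "u \<in> carrier M \<Longrightarrow>
     Poly_Mapping.single (u, b + b') 1 - Poly_Mapping.single (u, b) 1 - Poly_Mapping.single (u, b') 1 \<in> tensor_null M T"
  "u \<in> carrier M \<Longrightarrow> Poly_Mapping.single (c \<odot>\<^bsub>M\<^esub> u, a) 1 - scl c (Poly_Mapping.single (u, a) 1) \<in> tensor_null M T"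
  "u \<in> carrier M \<Longrightarrow> Poly_Mapping.single (u, c * a) 1 - scl c (Poly_Mapping.single (u, a) 1) \<in> tensor_null M T"
  "(\<rho>, \<phi>) \<in> T \<Longrightarrow> u \<in> carrier M \<Longrightarrow> Poly_Mapping.single (\<rho> u, a) 1 - Poly_Mapping.single (u, \<phi> a) 1 \<in> tensor_null M T"
  unfolding tensor_null_eq scl_single mult_1_right
proof -
  show "u \<in> carrier M \<Longrightarrow> u' \<in> carrier M \<Longrightarrow>
     Poly_Mapping.single (u \<oplus>\<^bsub>M\<^esub> u', a) 1 - Poly_Mapping.single (u, a) 1 - Poly_Mapping.single (u', a) 1 \<in> pm.span (tensor_generators M T)"
    by (rule pm.span_base, unfold tensor_generators_def, rule UnI1, rule UnI1, rule UnI1, rule UnI1, blast)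
  show "u \<in> carrier M \<Longrightarrow>
     Poly_Mapping.single (u, b + b') 1 - Poly_Mapping.single (u, b) 1 - Poly_Mapping.single (u, b') 1 \<in> pm.span (tensor_generators M T)"
    by (rule pm.span_base, unfold tensor_generators_def, rule UnI1, rule UnI1, rule UnI1, rule UnI2, blast)
  show "u \<in> carrier M \<Longrightarrow> Poly_Mapping.single (c \<odot>\<^bsub>M\<^esub> u, a) 1 - Poly_Mapping.single (u, a) c \<in> pm.span (tensor_generators M T)"
    by (rule pm.span_base, unfold tensor_generators_def, rule UnI1, rule UnI1, rule UnI2, blast)
  show "u \<in> carrier M \<Longrightarrow> Poly_Mapping.single (u, c * a) 1 - Poly_Mapping.single (u, a) c \<in> pm.span (tensor_generators M T)"
    by (rule pm.span_base, unfold tensor_generators_def, rule UnI1, rule UnI2, blast)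
  show "(\<rho>, \<phi>) \<in> T \<Longrightarrow> u \<in> carrier M \<Longrightarrow>
     Poly_Mapping.single (\<rho> u, a) 1 - Poly_Mapping.single (u, \<phi> a) 1 \<in> pm.span (tensor_generators M T)"
    by (rule pm.span_base, unfold tensor_generators_def, rule UnI2, blast)
qed

lemma tensor_null_vanish:
  assumes f: "lin scl s f" and p: "p \<in> tensor_null M T"
    and "\<And>u u' a. u \<in> carrier M \<Longrightarrow> u' \<in> carrier M \<Longrightarrow>
      f (Poly_Mapping.single (u \<oplus>\<^bsub>M\<^esub> u', a) 1) = f (Poly_Mapping.single (u, a) 1) + f (Poly_Mapping.single (u', a) 1)"
    and "\<And>u a a'. u \<in> carrier M \<Longrightarrow>
      f (Poly_Mapping.single (u, a + a') 1) = f (Poly_Mapping.single (u, a) 1) + f (Poly_Mapping.single (u, a') 1)"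
    and "\<And>c u a. u \<in> carrier M \<Longrightarrow> f (Poly_Mapping.single (c \<odot>\<^bsub>M\<^esub> u, a) 1) = s c (f (Poly_Mapping.single (u, a) 1))"
    and "\<And>c u a. u \<in> carrier M \<Longrightarrow> f (Poly_Mapping.single (u, c * a) 1) = s c (f (Poly_Mapping.single (u, a) 1))"
    and "\<And>\<rho> \<phi> u a. (\<rho>, \<phi>) \<in> T \<Longrightarrow> u \<in> carrier M \<Longrightarrow> f (Poly_Mapping.single (\<rho> u, a) 1) = f (Poly_Mapping.single (u, \<phi> a) 1)"
  shows "f p = 0"
proof -
  have s0: "s c 0 = 0" for c using lin_scale[OF f, of c 0] lin_zero[OF f] by simp
  have "pm.subspace {p. f p = 0}"
    by (rule pm.subspaceI) (simp_all add: lin_zero[OF f] lin_add[OF f] lin_scale[OF f] s0)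
  moreover have "tensor_generators M T \<subseteq> {p. f p = 0}"
  proof (intro subsetI CollectI)
    fix t assume "t \<in> tensor_generators M T"
    then show "f t = 0"
      by (cases rule: tensor_generators_cases) (simp_all add: lin_diff[OF f] lin_scale[OF f] assms(3-7))
  qed
  ultimately have "tensor_null M T \<subseteq> {p. f p = 0}" unfolding tensor_null_eq by (rule pm.span_minimal[rotated])
  then show ?thesis using p by blast
qed

definition push :: "('a \<Rightarrow> 'b) \<Rightarrow> (('a \<times> 'k::field) \<Rightarrow>\<^sub>0 'k) \<Rightarrow> (('b \<times> 'k) \<Rightarrow>\<^sub>0 'k)" where
  "push f = ext scl (\<lambda>x. Poly_Mapping.single (f (fst x), snd x) 1)"

lemma push_lin: "lin scl scl (push f)"
  unfolding push_def by (rule lin_ext[OF pm.vector_space_axioms])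

lemma push_single [simp]: "push f (Poly_Mapping.single (u, a) 1) = Poly_Mapping.single (f u, a) 1"
  by (simp add: push_def ext_single[OF pm.vector_space_axioms])

lemma push_eq: "(\<Sum>(u, a)\<in>Poly_Mapping.keys p. Poly_Mapping.single (f u, a) (Poly_Mapping.lookup p (u, a))) = push f p"
  by (simp add: push_def ext_def scl_single split_def)

lemma coset_eq:
  fixes W :: "('a \<Rightarrow>\<^sub>0 'k::field) set"
  assumes "pm.subspace W" shows "p +o W = q +o W \<longleftrightarrow> p - q \<in> W"
proof
  assume "p +o W = q +o W"
  moreover have "p \<in> p +o W" using pm.subspace_0[OF assms] by (force simp: elt_set_plus_def)
  ultimately obtain w where "w \<in> W" "p = q + w" by (auto simp: elt_set_plus_def)
  then show "p - q \<in> W" by simp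
next
  assume d: "p - q \<in> W"
  have "x \<in> p +o W \<longleftrightarrow> x \<in> q +o W" for x
  proof -
    have "x \<in> y +o W \<longleftrightarrow> x - y \<in> W" for y
      by (auto simp: elt_set_plus_def) (metis add.commute diff_add_cancel)
    moreover have "x - p \<in> W \<longleftrightarrow> x - q \<in> W"
    proof
      assume "x - p \<in> W"
      then have "(x - p) + (p - q) \<in> W" using d by (rule pm.subspace_add[OF assms])
      then show "x - q \<in> W" by simp
    next
      assume "x - q \<in> W"
      then have "(x - q) - (p - q) \<in> W" using d by (rule pm.subspace_diff[OF assms])
      then show "x - p \<in> W" by simp
    qed
    ultimately show ?thesis by simp
  qed
  then show "p +o W = q +o W" by blast
qed

lemma coset_mem: 
  fixes W :: "('a \<Rightarrow>\<^sub>0 'k::field) set"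
  shows "x \<in> p +o W \<longleftrightarrow> x - p \<in> W"
  by (auto simp: elt_set_plus_def) (metis add.commute diff_add_cancel)

text \<open>\<open>tensor_map\<close> is a union over all representatives. It collapses to a single
  coset once \<open>push f\<close> respects the null spaces.\<close>

lemma tensor_map_coset:
  assumes "\<And>t. t \<in> W \<Longrightarrow> push f t \<in> tensor_null M T" "pm.subspace W"
  shows "tensor_map M T f (p +o W) = push f p +o tensor_null M T"
proof -
  have "push f q +o tensor_null M T = push f p +o tensor_null M T" if "q \<in> p +o W" for q
    unfolding coset_eq[OF subspace_tensor_null]
    using assms(1)[of "q - p"] that by (simp add: coset_mem lin_diff[OF push_lin])
  moreover have "p \<in> p +o W" using pm.subspace_0[OF assms(2)] by (simp add: coset_mem)
  ultimately show ?thesis unfolding tensor_map_def push_eq by blast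
qed

lemma push_tensor_null:
  assumes "f \<in> carrier M \<rightarrow> carrier M'"
    and "\<And>u u'. u \<in> carrier M \<Longrightarrow> u' \<in> carrier M \<Longrightarrow> f (u \<oplus>\<^bsub>M\<^esub> u') = f u \<oplus>\<^bsub>M'\<^esub> f u'"
    and "\<And>c u. u \<in> carrier M \<Longrightarrow> f (c \<odot>\<^bsub>M\<^esub> u) = c \<odot>\<^bsub>M'\<^esub> f u"
    and "\<And>\<rho> \<phi> u. (\<rho>, \<phi>) \<in> T \<Longrightarrow> u \<in> carrier M \<Longrightarrow> (\<rho>, \<phi>) \<in> T' \<and> f (\<rho> u) = \<rho> (f u)"
    and p: "p \<in> tensor_null M T"
  shows "push f p \<in> tensor_null M' T'"
proof -
  have "pm.subspace {p. push f p \<in> tensor_null M' T'}"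
    by (rule subspace_preimage[OF push_lin subspace_tensor_null])
  moreover have "tensor_generators M T \<subseteq> {p. push f p \<in> tensor_null M' T'}"
  proof (intro subsetI CollectI)
    fix t assume "t \<in> tensor_generators M T"
    then show "push f t \<in> tensor_null M' T'"
    proof (cases rule: tensor_generators_cases)
      case (balance \<rho> \<phi> u a)
      then show ?thesis
        using assms(1,4) tensor_generators_mem(5)[of \<rho> \<phi> T' "f u" M' a] by (auto simp: lin_diff[OF push_lin])
    qed (use assms(1-3) in \<open>auto simp: lin_diff[OF push_lin] lin_scale[OF push_lin] intro!: tensor_generators_mem\<close>)
  qed
  ultimately have "tensor_null M T \<subseteq> {p. push f p \<in> tensor_null M' T'}"
    unfolding tensor_null_eq[of M T] by (rule pm.span_minimal[rotated])
  then show ?thesis using p by blast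
qed

section \<open>The maps of the tensor construction on representatives\<close>

context graded_data begin

abbreviation "NU \<equiv> tensor_null U.A {}"
abbreviation "NS \<equiv> tensor_null S.A {}"
abbreviation "kb \<equiv> k_balance L lam"
abbreviation "NG \<equiv> tensor_null G.A kb"
abbreviation "pt u a \<equiv> Poly_Mapping.single (u, a) (1 :: 'k)"

lemma env_relations_mono: "W \<subseteq> W' \<Longrightarrow> env_relations L W \<subseteq> env_relations L W'"
  unfolding env_relations_def linear_relations_def by blast

text \<open>\<open>I_induct\<close> proves that linear maps vanish; membership in \<open>G.I\<close>
  is put into this form by a projection with kernel \<open>G.I\<close>.\<close>

lemma UI_GI: "p \<in> U.I \<Longrightarrow> p \<in> G.I"
proof -
  assume p: "p \<in> U.I"
  have "nf_of G.I p = 0"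
  proof -
    interpret left_quotient "nf_of G.I" G.I
      by (rule left_quotient_nf_of[OF G.subspace_I]) (rule G.I_left, auto)
    show ?thesis
    proof (rule U.I_induct[OF nf_lin _ p])
      fix a b \<rho> assume "\<rho> \<in> env_relations L V"
      then have "\<rho> \<in> G.I" using env_relations_mono[of V UNIV] G.R_sub_I by blast
      then show "nf_of G.I (wd a * \<rho> * wd b) = 0" by (simp add: nf_zero_iff G.I_left G.I_right)
    qed
  qed
  interpret left_quotient "nf_of G.I" G.I
    by (rule left_quotient_nf_of[OF G.subspace_I]) (rule G.I_left, auto)
  show ?thesis using \<open>nf_of G.I p = 0\<close> by (simp add: nf_zero_iff)
qed

lemma KI_GI: "p \<in> K.I \<Longrightarrow> p \<in> G.I"
proof -
  assume p: "p \<in> K.I"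
  interpret left_quotient "nf_of G.I" G.I
    by (rule left_quotient_nf_of[OF G.subspace_I]) (rule G.I_left, auto)
  have "nf_of G.I p = 0"
  proof (rule K.I_induct[OF nf_lin _ p])
    fix a b \<rho> assume "\<rho> \<in> env_relations L (g_k L)"
    then have "\<rho> \<in> G.I" using env_relations_mono[of "g_k L" UNIV] G.R_sub_I by blast
    then show "nf_of G.I (wd a * \<rho> * wd b) = 0" by (simp add: nf_zero_iff G.I_left G.I_right)
  qed
  then show ?thesis by (simp add: nf_zero_iff)
qed

lemma env_incl_U: "env_incl L (U.cls p) = G.cls p"
proof -
  have "G.cls q = G.cls p" if "q \<in> U.cls p" for q
    using that UI_GI by (simp add: U.cls_mem G.cls_eq)
  moreover have "p \<in> U.cls p" by (simp add: U.cls_mem U.I_zero)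
  ultimately show ?thesis unfolding env_incl_def by blast
qed

lemma env_incl_K: "env_incl L (K.cls p) = G.cls p"
proof -
  have "G.cls q = G.cls p" if "q \<in> K.cls p" for q
    using that KI_GI by (simp add: K.cls_mem G.cls_eq)
  moreover have "p \<in> K.cls p" by (simp add: K.cls_mem K.I_zero)
  ultimately show ?thesis unfolding env_incl_def by blast
qed

definition "chi = ext (*) (\<lambda>w. prod_list (map lamx w))"

lemma chi_lin: "lin scl (*) chi"
  unfolding chi_def by (rule lin_ext[OF vector_space_field])

lemma chi_wd: "chi (wd w) = prod_list (map lamx w)"
  by (simp add: chi_def ext_single[OF vector_space_field])

lemma chi_mult: "chi (p * q) = chi p * chi q"
proof (rule lin_eqI[where f = "\<lambda>p. chi (p * q)" and g = "\<lambda>p. chi p * chi q"])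
  show "lin scl (*) (\<lambda>p. chi (p * q))" by (rule lin_compose[OF lin_mult_right chi_lin])
  show "lin scl (*) (\<lambda>p. chi p * chi q)"
    by (simp add: lin_def lin_add[OF chi_lin] lin_scale[OF chi_lin] distrib_right mult.assoc)
  fix w :: "'g list"
  show "chi (wd w * q) = chi (wd w) * chi q"
  proof (rule lin_eqI[where f = "\<lambda>q. chi (wd w * q)" and g = "\<lambda>q. chi (wd w) * chi q"])
    show "lin scl (*) (\<lambda>q. chi (wd w * q))" by (rule lin_compose[OF lin_mult_left chi_lin])
    show "lin scl (*) (\<lambda>q. chi (wd w) * chi q)"
      by (simp add: lin_def lin_add[OF chi_lin] lin_scale[OF chi_lin] distrib_left mult.left_commute)
    fix v :: "'g list"
    show "chi (wd w * wd v) = chi (wd w) * chi (wd v)"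
      unfolding wd_append[symmetric] chi_wd by simp
  qed
qed

lemma chi_gen: "chi (gen x) = lamx x"
  by (simp add: chi_wd)

lemma chi_KI: "p \<in> K.I \<Longrightarrow> chi p = 0"
proof (rule K.I_induct[OF chi_lin])
  fix a b \<rho> assume "\<rho> \<in> env_relations L (g_k L)"
  then consider
    (add) x y where "\<rho> = gen (x + y) - gen x - gen y"
  | (scale) c x where "\<rho> = gen (sc c x) - scl c (gen x)"
  | (comm) x y p q where "x \<in> g_k L" "y \<in> g_k L" "x \<in> parity L p" "y \<in> parity L q"
      "\<rho> = gen x * gen y - scl (koszul p q) (gen y * gen x) - gen (br x y)"
    unfolding env_relations_def linear_relations_def
    by (auto simp: mult_single plus_list_def scl_single)
  then have "chi \<rho> = 0"
  proof cases
    case comm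
    have "koszul p q * (lamx y * lamx x) = (koszul p q * lamx x) * lamx y" by (simp only: mult_ac)
    then have "koszul p q * (lamx y * lamx x) = lamx x * lamx y" unfolding lamx_koszul[OF comm(3)] .
    then show ?thesis
      unfolding comm lin_diff[OF chi_lin] lin_scale[OF chi_lin] chi_mult chi_gen
      by (simp only: lamx_br comm(1,2) diff_self)
  qed (simp_all add: lin_diff[OF chi_lin] lin_scale[OF chi_lin] chi_gen lamx_simps)
  then show "chi (wd a * \<rho> * wd b) = 0" by (simp add: chi_mult)
qed

lemma env_character_K: "env_character L lam (K.cls p) = chi p"
  unfolding env_character_def
proof (rule the_equality)
  have e: "(\<Sum>w\<in>Poly_Mapping.keys p. Poly_Mapping.lookup p w * prod_list (map lamx w)) = chi p" for p
    by (simp add: chi_def ext_def)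
  have m: "p \<in> K.cls p" by (simp add: K.cls_mem K.I_zero)
  show "\<exists>q\<in>K.cls p. chi p = (\<Sum>w\<in>Poly_Mapping.keys q. Poly_Mapping.lookup q w * prod_list (map lamx w))"
    using m e by metis
  fix c assume "\<exists>q\<in>K.cls p. c = (\<Sum>w\<in>Poly_Mapping.keys q. Poly_Mapping.lookup q w * prod_list (map lamx w))"
  then obtain q where "q \<in> K.cls p" "c = chi q" unfolding e by blast
  then have "q - p \<in> K.I" "c = chi q" by (simp_all add: K.cls_mem)
  then show "c = chi p" using chi_KI[of "q - p"] by (simp add: lin_diff[OF chi_lin])
qed

lemma kb_eq: "kb = {(\<lambda>u. u \<otimes>\<^bsub>G.A\<^esub> G.cls q, \<lambda>a. chi q * a) | q. q \<in> lists_span (g_k L)}"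
proof -
  have "kb = {(\<lambda>u. u \<otimes>\<^bsub>G.A\<^esub> env_incl L h, \<lambda>a. env_character L lam h * a) | h. h \<in> K.cls ` lists_span (g_k L)}"
    unfolding k_balance_def Env_G Env_K K.carrier_A ..
  also have "\<dots> = {(\<lambda>u. u \<otimes>\<^bsub>G.A\<^esub> env_incl L (K.cls q), \<lambda>a. env_character L lam (K.cls q) * a) | q. q \<in> lists_span (g_k L)}"
    by blast
  finally show ?thesis unfolding env_incl_K env_character_K .
qed

lemma push_incl_null: "t \<in> NU \<Longrightarrow> push (env_incl L) t \<in> NG"
proof (rule push_tensor_null)
  show "env_incl L \<in> carrier U.A \<rightarrow> carrier G.A"
    by (auto simp: U.carrier_A env_incl_U)
  fix u u' assume "u \<in> carrier U.A" "u' \<in> carrier U.A"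
  then obtain p q where "p \<in> FV" "q \<in> FV" "u = U.cls p" "u' = U.cls q" unfolding U.carrier_A by blast
  then show "env_incl L (u \<oplus>\<^bsub>U.A\<^esub> u') = env_incl L u \<oplus>\<^bsub>G.A\<^esub> env_incl L u'"
    by (simp add: U.add_A env_incl_U G.add_A)
next
  fix c u assume "u \<in> carrier U.A"
  then obtain p where "p \<in> FV" "u = U.cls p" unfolding U.carrier_A by blast
  then show "env_incl L (c \<odot>\<^bsub>U.A\<^esub> u) = c \<odot>\<^bsub>G.A\<^esub> env_incl L u"
    by (simp add: U.smult_A env_incl_U G.smult_A)
qed auto

lemma push_left_null: "t \<in> NG \<Longrightarrow> push (\<lambda>u. G.cls p \<otimes>\<^bsub>G.A\<^esub> u) t \<in> NG"
proof (rule push_tensor_null)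
  show "(\<lambda>u. G.cls p \<otimes>\<^bsub>G.A\<^esub> u) \<in> carrier G.A \<rightarrow> carrier G.A"
    by (auto intro: G.qr.m_closed)
  fix u u' assume "u \<in> carrier G.A" "u' \<in> carrier G.A"
  then show "G.cls p \<otimes>\<^bsub>G.A\<^esub> (u \<oplus>\<^bsub>G.A\<^esub> u') = G.cls p \<otimes>\<^bsub>G.A\<^esub> u \<oplus>\<^bsub>G.A\<^esub> G.cls p \<otimes>\<^bsub>G.A\<^esub> u'"
    by (intro G.qr.r_distr) auto
next
  fix c u assume "u \<in> carrier G.A"
  then obtain q where "u = G.cls q" unfolding G.carrier_A by blast
  then show "G.cls p \<otimes>\<^bsub>G.A\<^esub> (c \<odot>\<^bsub>G.A\<^esub> u) = c \<odot>\<^bsub>G.A\<^esub> (G.cls p \<otimes>\<^bsub>G.A\<^esub> u)"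
    by (simp add: G.smult_A G.mult_A scl_mult_right)
next
  fix \<rho> \<phi> u assume b: "(\<rho>, \<phi>) \<in> kb" and u: "u \<in> carrier G.A"
  then obtain q where q: "\<rho> = (\<lambda>u. u \<otimes>\<^bsub>G.A\<^esub> G.cls q)" unfolding kb_eq by blast
  show "(\<rho>, \<phi>) \<in> kb \<and> G.cls p \<otimes>\<^bsub>G.A\<^esub> \<rho> u = \<rho> (G.cls p \<otimes>\<^bsub>G.A\<^esub> u)"
    using b u G.qr.m_assoc[of "G.cls p" u "G.cls q"] by (simp add: q)
qed

lemma sigma_inv_carrier:
  assumes "u \<in> carrier U.A" obtains p where "p \<in> FV" "u = U.cls (sgm p)" "sigma_inv u = S.cls p"
  using U_carrier_sgm[OF assms] sigma_inv_cls by metis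

lemma push_sigma_inv_null: "t \<in> NU \<Longrightarrow> push sigma_inv t \<in> NS"
proof (rule push_tensor_null)
  show "sigma_inv \<in> carrier U.A \<rightarrow> carrier S.A"
  proof
    fix u assume "u \<in> carrier U.A"
    then show "sigma_inv u \<in> carrier S.A" by (rule sigma_inv_carrier) auto
  qed
  fix u u' assume "u \<in> carrier U.A" "u' \<in> carrier U.A"
  then obtain p q where "p \<in> FV" "u = U.cls (sgm p)" "sigma_inv u = S.cls p" "q \<in> FV" "u' = U.cls (sgm q)" "sigma_inv u' = S.cls q"
    by (metis sigma_inv_carrier)
  then show "sigma_inv (u \<oplus>\<^bsub>U.A\<^esub> u') = sigma_inv u \<oplus>\<^bsub>S.A\<^esub> sigma_inv u'"
    using sigma_inv_cls[of "p + q"] by (simp add: U.add_A sgm_FV sgm_simps S.add_A pm.subspace_add[OF subspace_lists_span])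
next
  fix c u assume "u \<in> carrier U.A"
  then obtain p where "p \<in> FV" "u = U.cls (sgm p)" "sigma_inv u = S.cls p" by (rule sigma_inv_carrier)
  then show "sigma_inv (c \<odot>\<^bsub>U.A\<^esub> u) = c \<odot>\<^bsub>S.A\<^esub> sigma_inv u"
    using sigma_inv_cls[of "scl c p"] by (simp add: U.smult_A sgm_FV sgm_simps S.smult_A pm.subspace_scale[OF subspace_lists_span])
qed auto

definition "muS = ext scl (\<lambda>x. scl (snd x) (repS (fst x)))"
definition "muU = ext scl (\<lambda>x. scl (snd x) (repU (fst x)))"

lemma muS_lin: "lin scl scl muS" and muU_lin: "lin scl scl muU"
  unfolding muS_def muU_def by (rule lin_ext[OF pm.vector_space_axioms])+

lemma muS_pt: "muS (pt u a) = scl a (repS u)" and muU_pt: "muU (pt u a) = scl a (repU u)"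
  by (simp_all add: muS_def muU_def ext_single[OF pm.vector_space_axioms])

lemma repS_add: "u \<in> carrier S.A \<Longrightarrow> u' \<in> carrier S.A \<Longrightarrow> nfS (repS (u \<oplus>\<^bsub>S.A\<^esub> u')) = nfS (repS u) + nfS (repS u')"
  and repS_scale: "u \<in> carrier S.A \<Longrightarrow> nfS (repS (c \<odot>\<^bsub>S.A\<^esub> u)) = scl c (nfS (repS u))"
proof -
  assume u: "u \<in> carrier S.A"
  then obtain p where p: "p \<in> FV" "u = S.cls p" by (rule S_carrier)
  then show "nfS (repS (c \<odot>\<^bsub>S.A\<^esub> u)) = scl c (nfS (repS u))"
    by (simp add: S.smult_A nfS_repS pm.subspace_scale[OF subspace_lists_span] qS.nf_simps)
  assume "u' \<in> carrier S.A"
  then obtain q where "q \<in> FV" "u' = S.cls q" by (rule S_carrier)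
  with p show "nfS (repS (u \<oplus>\<^bsub>S.A\<^esub> u')) = nfS (repS u) + nfS (repS u')"
    by (simp add: S.add_A nfS_repS pm.subspace_add[OF subspace_lists_span] qS.nf_simps)
qed

lemma muS_null: "t \<in> NS \<Longrightarrow> nfS (muS t) = 0"
  by (rule tensor_null_vanish[where f = "\<lambda>t. nfS (muS t)" and s = scl and M = S.A and T = "{}", OF lin_compose[OF muS_lin qS.nf_lin]])
    (simp_all add: muS_pt qS.nf_simps repS_add repS_scale pm.scale_right_distrib pm.scale_left_distrib mult.commute)

text \<open>\<open>tensor_mu\<close> sums over the keys of an arbitrary representative of its coset.
  For the sum to be meaningful the keys have to stay in the carrier when null elements are
  added.\<close>

lemma carrier_keys_null: "p \<in> tensor_null M {} \<Longrightarrow> (\<And>u u'. u \<in> carrier M \<Longrightarrow> u' \<in> carrier M \<Longrightarrow> u \<oplus>\<^bsub>M\<^esub> u' \<in> carrier M) \<Longrightarrow>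
   (\<And>c u. u \<in> carrier M \<Longrightarrow> c \<odot>\<^bsub>M\<^esub> u \<in> carrier M) \<Longrightarrow> \<forall>x\<in>Poly_Mapping.keys p. fst x \<in> carrier M"
proof -
  assume p: "p \<in> tensor_null M {}" and add: "\<And>u u'. u \<in> carrier M \<Longrightarrow> u' \<in> carrier M \<Longrightarrow> u \<oplus>\<^bsub>M\<^esub> u' \<in> carrier M"
    and sm: "\<And>c u. u \<in> carrier M \<Longrightarrow> c \<odot>\<^bsub>M\<^esub> u \<in> carrier M"
  let ?W = "{p. \<forall>x\<in>Poly_Mapping.keys p. fst x \<in> carrier M}"
  have sub: "pm.subspace ?W" by (rule subspace_keys)
  have s: "Poly_Mapping.single (u, a) c \<in> ?W" if "u \<in> carrier M" for u a c using that by simp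
  have "tensor_generators M {} \<subseteq> ?W"
  proof
    fix t assume "t \<in> tensor_generators M {}"
    then show "t \<in> ?W"
      by (cases rule: tensor_generators_cases)
        (simp_all only: scl_single empty_iff, (intro pm.subspace_diff[OF sub] s add sm; assumption)+)
  qed
  then have "tensor_null M {} \<subseteq> ?W" unfolding tensor_null_eq using sub by (rule pm.span_minimal)
  then show ?thesis using p by blast
qed

lemma tensor_mu_S:
  assumes z: "z \<in> FV" shows "tensor_mu S.A (pt (S.cls z) 1 +o NS) = S.cls z"
  unfolding tensor_mu_def
proof (rule the_equality)
  have fs: "finsum S.A (\<lambda>(u, a). (Poly_Mapping.lookup p (u, a) * a) \<odot>\<^bsub>S.A\<^esub> u) (Poly_Mapping.keys p) = S.cls (muS p)"
    if c: "\<forall>x\<in>Poly_Mapping.keys p. fst x \<in> carrier S.A" for p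
  proof -
    let ?f = "\<lambda>x. scl (Poly_Mapping.lookup p x) (scl (snd x) (repS (fst x)))"
    have F: "?f x \<in> FV" if "x \<in> Poly_Mapping.keys p" for x
      using c that repS by (intro pm.subspace_scale[OF subspace_lists_span]) blast
    have "finsum S.A (\<lambda>(u, a). (Poly_Mapping.lookup p (u, a) * a) \<odot>\<^bsub>S.A\<^esub> u) (Poly_Mapping.keys p) = finsum S.A (\<lambda>x. S.cls (?f x)) (Poly_Mapping.keys p)"
    proof (rule S.qr.finsum_cong')
      fix x assume x: "x \<in> Poly_Mapping.keys p"
      obtain u a where ua: "x = (u, a)" by (cases x)
      then have u: "repS u \<in> FV" "S.cls (repS u) = u" using c x repS by force+
      show "(case x of (u, a) \<Rightarrow> (Poly_Mapping.lookup p (u, a) * a) \<odot>\<^bsub>S.A\<^esub> u) = S.cls (?f x)"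
        using S.smult_A[OF u(1), of "Poly_Mapping.lookup p (u, a) * a"] by (simp add: ua u)
    qed (use F in auto)
    also have "\<dots> = S.cls (muS p)" unfolding muS_def ext_def by (rule S.finsum_A[OF F])
    finally show ?thesis .
  qed
  have z1: "\<forall>x\<in>Poly_Mapping.keys (pt (S.cls z) 1). fst x \<in> carrier S.A" using z by simp
  have Fm: "muS p \<in> FV" if "\<forall>x\<in>Poly_Mapping.keys p. fst x \<in> carrier S.A" for p
    unfolding muS_def ext_def using that repS
    by (intro pm.subspace_sum[OF subspace_lists_span] pm.subspace_scale[OF subspace_lists_span]) blast
  have mz: "S.cls (muS (pt (S.cls z) 1)) = S.cls z"
    using repS[of "S.cls z"] z by (simp add: muS_pt)
  have mem: "pt (S.cls z) 1 \<in> pt (S.cls z) 1 +o NS"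
    by (simp add: coset_mem pm.subspace_0[OF subspace_tensor_null])
  show "\<exists>p\<in>pt (S.cls z) 1 +o NS. S.cls z = finsum S.A (\<lambda>(u, a). (Poly_Mapping.lookup p (u, a) * a) \<odot>\<^bsub>S.A\<^esub> u) (Poly_Mapping.keys p)"
    by (rule bexI[OF _ mem]) (simp only: fs[OF z1] mz)
  fix y assume "\<exists>p\<in>pt (S.cls z) 1 +o NS. y = finsum S.A (\<lambda>(u, a). (Poly_Mapping.lookup p (u, a) * a) \<odot>\<^bsub>S.A\<^esub> u) (Poly_Mapping.keys p)"
  then obtain p where p: "p - pt (S.cls z) 1 \<in> NS" "y = finsum S.A (\<lambda>(u, a). (Poly_Mapping.lookup p (u, a) * a) \<odot>\<^bsub>S.A\<^esub> u) (Poly_Mapping.keys p)"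
    using coset_mem by blast
  have "\<forall>x\<in>Poly_Mapping.keys (p - pt (S.cls z) 1). fst x \<in> carrier S.A"
  proof (rule carrier_keys_null[OF p(1)])
    show "u \<oplus>\<^bsub>S.A\<^esub> u' \<in> carrier S.A" if "u \<in> carrier S.A" "u' \<in> carrier S.A" for u u'
      by (rule S.qr.a_closed[OF that])
    show "c \<odot>\<^bsub>S.A\<^esub> u \<in> carrier S.A" if u: "u \<in> carrier S.A" for c u
    proof -
      obtain q where "q \<in> FV" "u = S.cls q" using u by (rule S_carrier)
      then show ?thesis by (auto simp: S.smult_A pm.subspace_scale[OF subspace_lists_span])
    qed
  qed
  then have k: "\<forall>x\<in>Poly_Mapping.keys p. fst x \<in> carrier S.A"
    using pm.subspace_add[OF subspace_keys[of "\<lambda>x. fst x \<in> carrier S.A"], of "p - pt (S.cls z) 1" "pt (S.cls z) 1"] z1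
    by simp
  have "nfS (muS p) = nfS (muS (pt (S.cls z) 1))"
    using muS_null[OF p(1)] by (simp add: lin_diff[OF muS_lin] qS.nf_simps)
  then have "S.cls (muS p) = S.cls (muS (pt (S.cls z) 1))" using S_cls_nf Fm[OF k] Fm[OF z1] by blast
  then show "y = S.cls z" using p(2) fs[OF k] mz by simp
qed

text \<open>The action \<open>Z\<close> extended to the free algebra; by \<open>actF_GI\<close> it
  factors through the enveloping algebra of the whole Lie superalgebra.\<close>

definition "actF p u = ext scl (\<lambda>w. foldr Z w u) p"

lemma actF_lin: "lin scl scl (\<lambda>p. actF p u)"
  unfolding actF_def[abs_def] by (rule lin_ext[OF pm.vector_space_axioms])

lemma actF_wd: "actF (wd w) u = foldr Z w u"
  by (simp add: actF_def ext_single[OF pm.vector_space_axioms])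

lemma foldr_Z_lin: "lin scl scl (foldr Z w)"
proof (induction w)
  case (Cons x w)
  then show ?case using lin_compose[OF Cons Z_lin[of x]] by (simp add: comp_def)
qed (simp add: lin_def)

lemma actF_right_lin: "lin scl scl (actF p)"
  unfolding actF_def[abs_def] ext_def
  by (intro lin_summation lin_scaled pm.vector_space_axioms foldr_Z_lin)

lemma actF_gen: "actF (gen x) u = Z x u"
  by (simp add: actF_wd)

lemma actF_mult: "actF (p * q) u = actF p (actF q u)"
proof (rule lin_eqI[where f = "\<lambda>p. actF (p * q) u" and g = "\<lambda>p. actF p (actF q u)"])
  show "lin scl scl (\<lambda>p. actF (p * q) u)" by (rule lin_compose[OF lin_mult_right actF_lin])
  fix w
  show "actF (wd w * q) u = actF (wd w) (actF q u)"
  proof (rule lin_eqI[where f = "\<lambda>q. actF (wd w * q) u" and g = "\<lambda>q. actF (wd w) (actF q u)"])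
    show "lin scl scl (\<lambda>q. actF (wd w * q) u)" by (rule lin_compose[OF lin_mult_left actF_lin])
    show "lin scl scl (\<lambda>q. actF (wd w) (actF q u))" by (rule lin_compose[OF actF_lin actF_right_lin])
    fix v show "actF (wd w * wd v) u = actF (wd w) (actF (wd v) u)"
      unfolding wd_append[symmetric] actF_wd by simp
  qed
qed (rule actF_lin)

lemma actF_GI: "p \<in> G.I \<Longrightarrow> actF p u = 0"
proof (rule G.I_induct[OF actF_lin])
  fix a b \<rho> assume "\<rho> \<in> env_relations L UNIV"
  then consider
    (add) x y where "\<rho> = gen (x + y) - gen x - gen y"
  | (scale) c x where "\<rho> = gen (sc c x) - scl c (gen x)"
  | (comm) x y p q where "x \<in> parity L p" "y \<in> parity L q"
      "\<rho> = gen x * gen y - scl (koszul p q) (gen y * gen x) - gen (br x y)"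
    unfolding env_relations_def linear_relations_def
    by (auto simp: mult_single plus_list_def scl_single)
  then have "actF \<rho> t = 0" for t
  proof cases
    case comm
    have "Z x (Z y t) = scl (koszul p q) (Z y (Z x t)) + Z (br x y) t" by (rule M.act_rep[OF comm(1,2)])
    then show ?thesis unfolding comm lin_diff[OF actF_lin] lin_scale[OF actF_lin] actF_mult actF_gen by simp
  qed (simp_all add: lin_diff[OF actF_lin] lin_scale[OF actF_lin] actF_gen Z_left_simps)
  then show "actF (wd a * \<rho> * wd b) u = 0" by (simp add: actF_mult lin_zero[OF actF_right_lin])
qed

lemma actF_FV: "p \<in> FV \<Longrightarrow> actF p (nfU 1) = nfU p"
proof (rule lin_eqI[where f = "\<lambda>p. actF p (nfU 1)" and g = nfU, OF actF_lin qU.nf_lin])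
  fix w assume "p \<in> FV" "w \<in> Poly_Mapping.keys p"
  then show "actF (wd w) (nfU 1) = nfU (wd w)" by (auto simp: actF_wd lists_span_def intro: foldr_Z)
qed

lemma actF_k: "q \<in> lists_span (g_k L) \<Longrightarrow> actF q (nfU 1) = scl (chi q) (nfU 1)"
proof (rule lin_eqI[where f = "\<lambda>q. actF q (nfU 1)" and g = "\<lambda>q. scl (chi q) (nfU 1)", OF actF_lin])
  show "lin scl scl (\<lambda>q. scl (chi q) (nfU 1))"
    by (simp add: lin_def lin_add[OF chi_lin] lin_scale[OF chi_lin] pm.scale_left_distrib)
  fix w assume "q \<in> lists_span (g_k L)" "w \<in> Poly_Mapping.keys q"
  then have "w \<in> lists (g_k L)" by (auto simp: lists_span_def)
  then have "foldr Z w (nfU 1) = scl (prod_list (map lamx w)) (nfU 1)"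
  proof (induction w rule: lists.induct)
    case (Cons x w)
    have "Z x (nfU 1) = scl (lamx x) (nfU 1)" by (rule Z_one[OF Cons(1)])
    then show ?case using Cons by (simp add: Z_simps mult.commute[of "lamx x"] del: Z_nfU)
  qed simp
  then show "actF (wd w) (nfU 1) = scl (chi (wd w)) (nfU 1)" by (simp add: actF_wd chi_wd)
qed

definition "repG C = (SOME p. C = G.cls p)"

lemma repG: "C \<in> carrier G.A \<Longrightarrow> G.cls (repG C) = C"
  unfolding repG_def G.carrier_A by (rule someI2_ex[where Q = "\<lambda>p. G.cls p = C"]) auto

lemma actF_repG: "actF (repG (G.cls p)) u = actF p u"
  using repG[of "G.cls p"] actF_GI[of "repG (G.cls p) - p" u] by (simp add: G.cls_eq lin_diff[OF actF_lin])

text \<open>Induces a left inverse of the natural isomorphism.\<close>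

definition "PsiG = ext scl (\<lambda>x. scl (snd x) (actF (repG (fst x)) (nfU 1)))"

lemma PsiG_lin: "lin scl scl PsiG"
  unfolding PsiG_def by (rule lin_ext[OF pm.vector_space_axioms])

lemma PsiG_pt: "PsiG (pt (G.cls p) a) = scl a (actF p (nfU 1))"
  by (simp add: PsiG_def ext_single[OF pm.vector_space_axioms] actF_repG)

text \<open>The balancing relations are respected because an element of the enveloping algebra of
  \<open>g_k L\<close> multiplies the vector \<open>nfU 1\<close> by its character value, see
  \<open>actF_k\<close>.\<close>

lemma PsiG_null: "t \<in> NG \<Longrightarrow> PsiG t = 0"
proof (rule tensor_null_vanish[OF PsiG_lin])
  fix \<rho> \<phi> u a assume b: "(\<rho>, \<phi>) \<in> kb" and u: "u \<in> carrier G.A"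
  then obtain q where q: "\<rho> = (\<lambda>u. u \<otimes>\<^bsub>G.A\<^esub> G.cls q)" "\<phi> = (\<lambda>a. chi q * a)" "q \<in> lists_span (g_k L)" unfolding kb_eq by blast
  obtain p where p: "u = G.cls p" using u unfolding G.carrier_A by blast
  show "PsiG (pt (\<rho> u) a) = PsiG (pt u (\<phi> a))"
    by (simp add: q p G.mult_A PsiG_pt actF_mult actF_k[OF q(3)] lin_scale[OF actF_right_lin] mult.commute)
next
  fix u u' a assume "u \<in> carrier G.A" "u' \<in> carrier G.A"
  then obtain p q where "u = G.cls p" "u' = G.cls q" unfolding G.carrier_A by blast
  then show "PsiG (pt (u \<oplus>\<^bsub>G.A\<^esub> u') a) = PsiG (pt u a) + PsiG (pt u' a)"
    by (simp add: G.add_A PsiG_pt lin_add[OF actF_lin] pm.scale_right_distrib)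
next
  fix u a a' assume "u \<in> carrier G.A"
  then obtain p where "u = G.cls p" unfolding G.carrier_A by blast
  then show "PsiG (pt u (a + a')) = PsiG (pt u a) + PsiG (pt u a')"
    by (simp add: PsiG_pt pm.scale_left_distrib)
next
  fix c u a assume "u \<in> carrier G.A"
  then obtain p where "u = G.cls p" unfolding G.carrier_A by blast
  then show "PsiG (pt (c \<odot>\<^bsub>G.A\<^esub> u) a) = scl c (PsiG (pt u a))" "PsiG (pt u (c * a)) = scl c (PsiG (pt u a))"
    by (simp_all add: G.smult_A PsiG_pt lin_scale[OF actF_lin] mult.commute)
qed

text \<open>Over the ground field every tensor equals a pure tensor with second factor 1.\<close>

lemma muU_reduce:
  assumes "\<forall>x\<in>Poly_Mapping.keys p. fst x \<in> carrier U.A"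
  shows "p - pt (U.cls (muU p)) 1 \<in> NU" "muU p \<in> FV"
proof -
  let ?W = "{p. muU p \<in> FV \<and> p - pt (U.cls (muU p)) 1 \<in> NU}"
  have "pm.subspace ?W"
  proof (rule pm.subspaceI)
    show "0 \<in> ?W"
      using pm.subspace_neg[OF subspace_tensor_null tensor_generators_mem(3)[of "U.cls 0" U.A 0 1 "{}"]]
      by (simp add: lin_zero[OF muU_lin] pm.subspace_0[OF subspace_lists_span] U.smult_A)
    fix p q assume p: "p \<in> ?W" and q: "q \<in> ?W"
    have "pt (U.cls (muU p + muU q)) 1 - pt (U.cls (muU p)) 1 - pt (U.cls (muU q)) 1 \<in> NU"
      using tensor_generators_mem(1)[of "U.cls (muU p)" U.A "U.cls (muU q)" 1 "{}"] p q by (simp add: U.add_A)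
    then have "(p - pt (U.cls (muU p)) 1) + (q - pt (U.cls (muU q)) 1) -
        (pt (U.cls (muU p + muU q)) 1 - pt (U.cls (muU p)) 1 - pt (U.cls (muU q)) 1) \<in> NU"
      using p q by (intro pm.subspace_diff[OF subspace_tensor_null pm.subspace_add[OF subspace_tensor_null]]) blast+
    then show "p + q \<in> ?W" using p q
      by (simp add: lin_add[OF muU_lin] pm.subspace_add[OF subspace_lists_span] algebra_simps)
  next
    fix c p assume p: "p \<in> ?W"
    have "pt (U.cls (scl c (muU p))) 1 - scl c (pt (U.cls (muU p)) 1) \<in> NU"
      using tensor_generators_mem(3)[of "U.cls (muU p)" U.A c 1 "{}"] p by (simp add: U.smult_A)
    then have "scl c (p - pt (U.cls (muU p)) 1) - (pt (U.cls (scl c (muU p))) 1 - scl c (pt (U.cls (muU p)) 1)) \<in> NU"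
      using p by (intro pm.subspace_diff[OF subspace_tensor_null pm.subspace_scale[OF subspace_tensor_null]]) blast+
    then show "scl c p \<in> ?W" using p
      by (simp add: lin_scale[OF muU_lin] pm.subspace_scale[OF subspace_lists_span] pm.scale_right_diff_distrib)
  qed
  moreover have "Poly_Mapping.single x 1 \<in> ?W" if "x \<in> Poly_Mapping.keys p" for x
  proof -
    obtain u a where x: "x = (u, a)" by (cases x)
    then have u: "u \<in> carrier U.A" using assms that by force
    have r: "repU u \<in> FV" "U.cls (repU u) = u" using repU[OF u] by auto
    have "pt u (a * 1) - scl a (pt u 1) \<in> NU" by (rule tensor_generators_mem(4)[OF u])
    moreover have "pt (U.cls (scl a (repU u))) 1 - scl a (pt u 1) \<in> NU"
      using tensor_generators_mem(3)[OF u, of a 1 "{}"] r U.smult_A[OF r(1), of a] by simp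
    ultimately have "(pt u (a * 1) - scl a (pt u 1)) - (pt (U.cls (scl a (repU u))) 1 - scl a (pt u 1)) \<in> NU"
      by (rule pm.subspace_diff[OF subspace_tensor_null])
    then show ?thesis using r by (simp add: x muU_pt pm.subspace_scale[OF subspace_lists_span])
  qed
  ultimately have "p \<in> ?W" by (rule subspace_single_induct)
  then show "p - pt (U.cls (muU p)) 1 \<in> NU" "muU p \<in> FV" by auto
qed

lemma PsiG_push:
  assumes "\<forall>x\<in>Poly_Mapping.keys p. fst x \<in> carrier U.A"
  shows "PsiG (push (env_incl L) p) = nfU (muU p)"
proof (rule lin_eqI[where f = "\<lambda>p. PsiG (push (env_incl L) p)" and g = "\<lambda>p. nfU (muU p)"])
  show "lin scl scl (\<lambda>p. PsiG (push (env_incl L) p))" by (rule lin_compose[OF push_lin PsiG_lin])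
  show "lin scl scl (\<lambda>p. nfU (muU p))" by (rule lin_compose[OF muU_lin qU.nf_lin])
  fix x assume "x \<in> Poly_Mapping.keys p"
  obtain u a where x: "x = (u, a)" by (cases x)
  then have u: "u \<in> carrier U.A" using assms \<open>x \<in> _\<close> by force
  then have r: "repU u \<in> FV" "U.cls (repU u) = u" using repU by auto
  have "env_incl L u = G.cls (repU u)" using env_incl_U[of "repU u"] r by simp
  then show "PsiG (push (env_incl L) (Poly_Mapping.single x 1)) = nfU (muU (Poly_Mapping.single x 1))"
    by (simp add: x PsiG_pt muU_pt actF_FV r qU.nf_simps)
qed

abbreviation "Phi \<equiv> natural_iso L lam"

lemma Phi_coset: "Phi (p +o NU) = push (env_incl L) p +o NG"
  unfolding natural_iso_def Env_G by (rule tensor_map_coset[OF push_incl_null subspace_tensor_null])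

text \<open>\<open>PsiG\<close> recovers \<open>muU p\<close> from the image of \<open>p\<close> in
  the induced module, and \<open>muU p\<close> determines the tensor by
  \<open>muU_reduce\<close>.\<close>

lemma Phi_inj: "inj_on Phi (tensor_carrier U.A {})"
proof (rule inj_onI)
  fix C C' assume "C \<in> tensor_carrier U.A {}" "C' \<in> tensor_carrier U.A {}" and eq: "Phi C = Phi C'"
  then obtain p q where p: "C = p +o NU" "Poly_Mapping.keys p \<subseteq> carrier U.A \<times> UNIV"
    and q: "C' = q +o NU" "Poly_Mapping.keys q \<subseteq> carrier U.A \<times> UNIV"
    unfolding tensor_carrier_def by blast
  have kpq: "\<forall>x\<in>Poly_Mapping.keys p. fst x \<in> carrier U.A" "\<forall>x\<in>Poly_Mapping.keys q. fst x \<in> carrier U.A"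
    using p(2) q(2) by auto
  have k: "\<forall>x\<in>Poly_Mapping.keys (p - q). fst x \<in> carrier U.A"
    using pm.subspace_diff[OF subspace_keys[of "\<lambda>x. fst x \<in> carrier U.A"], of p q] kpq by blast
  have "push (env_incl L) (p - q) \<in> NG"
    using eq unfolding p q Phi_coset coset_eq[OF subspace_tensor_null] by (simp add: lin_diff[OF push_lin])
  then have "nfU (muU (p - q)) = 0" using PsiG_null PsiG_push[OF k] by simp
  then have "U.cls (muU (p - q)) = U.cls 0"
    using muU_reduce(2)[OF k] pm.subspace_0[OF subspace_lists_span] by (subst U_cls_nf) (auto simp: qU.nf_simps)
  moreover have "pt (U.cls 0) 1 \<in> NU"
  proof -
    have z: "0 \<in> FV" by (rule pm.subspace_0[OF subspace_lists_span])
    then have "U.cls 0 \<in> carrier U.A" unfolding U.carrier_A by blast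
    from tensor_generators_mem(3)[OF this, of 0 1 "{}"] show ?thesis by (simp add: U.smult_A[OF z])
  qed
  ultimately have "p - q \<in> NU"
    using muU_reduce(1)[OF k] pm.subspace_add[OF subspace_tensor_null, of "p - q - pt (U.cls 0) 1" U.A "{}" "pt (U.cls 0) 1"]
    by simp
  then show "C = C'" unfolding p q coset_eq[OF subspace_tensor_null] .
qed

text \<open>The annihilator of the generating vector of the induced module, pulled back to the free
  algebra. The elements \<open>u \<otimes> 1\<close> are thereby described by the free algebra
  modulo a left ideal, where the projection \<open>nfT\<close> is available.\<close>

definition "JT = {p. pt (G.cls p) 1 \<in> NG}"

lemma JT_subspace: "pm.subspace JT"
proof (rule pm.subspaceI)
  show "0 \<in> JT"
    using tensor_generators_mem(3)[of "G.cls 0" G.A 0 1 kb] by (simp add: JT_def G.smult_A)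
  fix p q assume "p \<in> JT" "q \<in> JT"
  moreover have "pt (G.cls (p + q)) 1 - pt (G.cls p) 1 - pt (G.cls q) 1 \<in> NG"
    using tensor_generators_mem(1)[of "G.cls p" G.A "G.cls q" 1 kb] by (simp add: G.add_A)
  ultimately have "(pt (G.cls (p + q)) 1 - pt (G.cls p) 1 - pt (G.cls q) 1) + (pt (G.cls p) 1 + pt (G.cls q) 1) \<in> NG"
    unfolding JT_def by (intro pm.subspace_add[OF subspace_tensor_null]) auto
  then show "p + q \<in> JT" by (simp add: JT_def)
next
  fix c p assume "p \<in> JT"
  moreover have "pt (G.cls (scl c p)) 1 - scl c (pt (G.cls p) 1) \<in> NG"
    using tensor_generators_mem(3)[of "G.cls p" G.A c 1 kb] by (simp add: G.smult_A)
  ultimately have "(pt (G.cls (scl c p)) 1 - scl c (pt (G.cls p) 1)) + scl c (pt (G.cls p) 1) \<in> NG"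
    unfolding JT_def by (intro pm.subspace_add[OF subspace_tensor_null] pm.subspace_scale[OF subspace_tensor_null]) auto
  then show "scl c p \<in> JT" by (simp add: JT_def)
qed

lemma JT_left: "p \<in> JT \<Longrightarrow> q * p \<in> JT"
  using push_left_null[of "pt (G.cls p) 1" q] by (simp add: JT_def G.mult_A)

lemma JT_GI: "p \<in> G.I \<Longrightarrow> p \<in> JT"
proof -
  assume "p \<in> G.I"
  then have "G.cls p = G.cls 0" by (simp add: G.cls_eq)
  then show ?thesis using pm.subspace_0[OF JT_subspace] by (simp add: JT_def)
qed

text \<open>Balancing moves \<open>h\<close> through the tensor sign, where it becomes the scalar
  \<open>lamx h\<close>; the other generators of the null space bring the scalar back to the first
  factor.\<close>

lemma JT_weight: "h \<in> g_k L \<Longrightarrow> gen h - scl (lamx h) 1 \<in> JT"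
proof -
  assume h: "h \<in> g_k L"
  let ?a = "pt (G.cls (gen h)) 1" and ?b = "pt (G.cls (scl (lamx h) 1)) 1" and ?o = "pt (G.cls 1) 1"
  have "gen h \<in> lists_span (g_k L)" using h by simp
  then have kbm: "(\<lambda>u. u \<otimes>\<^bsub>G.A\<^esub> G.cls (gen h), \<lambda>a. chi (gen h) * a) \<in> kb" unfolding kb_eq by blast
  have 1: "?a - pt (G.cls 1) (lamx h) \<in> NG"
    using tensor_generators_mem(5)[OF kbm G.cls_carrier[of 1], of 1] by (simp add: G.mult_A chi_gen)
  have 2: "pt (G.cls 1) (lamx h) - scl (lamx h) ?o \<in> NG"
    using tensor_generators_mem(4)[of "G.cls 1" G.A "lamx h" 1 kb] by simp
  have 3: "?b - scl (lamx h) ?o \<in> NG"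
    using tensor_generators_mem(3)[of "G.cls 1" G.A "lamx h" 1 kb] by (simp add: G.smult_A)
  have "?a - ?b \<in> NG"
    using pm.subspace_diff[OF subspace_tensor_null pm.subspace_add[OF subspace_tensor_null 1 2] 3] by simp
  moreover have 4: "?a - pt (G.cls (gen h - scl (lamx h) 1)) 1 - ?b \<in> NG"
    using tensor_generators_mem(1)[of "G.cls (gen h - scl (lamx h) 1)" G.A "G.cls (scl (lamx h) 1)" 1 kb] by (simp add: G.add_A)
  ultimately have "(?a - ?b) - (?a - pt (G.cls (gen h - scl (lamx h) 1)) 1 - ?b) \<in> NG"
    by (rule pm.subspace_diff[OF subspace_tensor_null])
  then show ?thesis by (simp add: JT_def)
qed

definition "nfT = nf_of JT"

sublocale qT: left_quotient nfT JT
  unfolding nfT_def by (rule left_quotient_nf_of[OF JT_subspace JT_left])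

abbreviation "actT \<equiv> (\<lambda>x u. nfT (gen x * u))"

lemma nfT_GI: "p \<in> G.I \<Longrightarrow> nfT (p * q) = 0"
  using JT_GI[OF G.I_right[of p q]] by (simp add: qT.nf_zero_iff)

text \<open>The induced module in the form needed for the recursions. The relations of the
  enveloping algebra act by zero because \<open>JT\<close> contains the right multiples of elements
  of \<open>G.I\<close>.\<close>

sublocale T: graded_module L lam X r s scl actT "nfT 1"
proof unfold_locales
  have "nfT (gen (x + y) * u) = nfT (gen x * u) + nfT (gen y * u)" for x y u
  proof -
    have "gen (x + y) - gen x - gen y \<in> G.I"
      using linear_relations_mem(1)[of UNIV UNIV x y] linear_in_GI by blast
    from nfT_GI[OF this, of u] show ?thesis by (simp add: left_diff_distrib qT.nf_simps diff_eq_eq add.commute)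
  qed
  moreover have "nfT (gen (sc c x) * u) = scl c (nfT (gen x * u))" for c x u
  proof -
    have "gen (sc c x) - Poly_Mapping.single [x] c \<in> G.I"
      using linear_relations_mem(2)[of UNIV UNIV x c] linear_in_GI by blast
    then have "gen (sc c x) - scl c (gen x) \<in> G.I" by (simp add: scl_single)
    from nfT_GI[OF this, of u] show ?thesis by (simp add: left_diff_distrib qT.nf_simps scl_mult_left)
  qed
  ultimately show "lin sc scl (\<lambda>x. nfT (gen x * u))" for u by (simp add: lin_def)
  show "lin scl scl (actT x)" for x by (rule lin_compose[OF lin_mult_left qT.nf_lin])
  fix x y p q u assume xy: "x \<in> parity L p" "y \<in> parity L q"
  have "gen x * gen y - scl (koszul p q) (gen y * gen x) - gen (br x y) \<in> G.I"
  proof -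
    have "wd [x, y] - Poly_Mapping.single [y, x] (koszul p q) - gen (br x y) \<in> env_relations L UNIV"
      unfolding env_relations_def using xy by fastforce
    then show ?thesis using G.R_sub_I by (auto simp: mult_single plus_list_def scl_single)
  qed
  from nfT_GI[OF this, of u]
  show "nfT (gen x * nfT (gen y * u)) = scl (koszul p q) (nfT (gen y * nfT (gen x * u))) + nfT (gen (br x y) * u)"
    by (simp add: left_diff_distrib qT.nf_simps scl_mult_left mult.assoc algebra_simps)
qed

lemma T_SG: "T.SG p = nfT (sgm p)"
  unfolding sgm_def using Sg_transfer[of scl scl nfT free_act actT 1 p, OF qT.nf_lin] by simp

lemma T_weight: "h \<in> g_k L \<Longrightarrow> actT h (nfT 1) = scl (lamx h) (nfT 1)"
proof -
  assume "h \<in> g_k L"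
  then have "nfT (gen h) = nfT (scl (lamx h) 1)" using JT_weight by (simp add: qT.nf_eq_iff)
  then show ?thesis by (simp add: qT.nf_simps)
qed

text \<open>Reduces the action to one equation in the induced module. The hypothesis exhibits the
  result as image of the pure tensor of \<open>sigma L (S.cls z)\<close> with 1, so both inverses in
  \<open>pi_action\<close> can be evaluated by injectivity.\<close>

lemma pi_cls:
  assumes p: "p \<in> FV" and z: "z \<in> FV" and eq: "nfT (gen x * sgm p) = nfT (sgm z)"
  shows "pi_action L lam x (S.cls p) = S.cls z"
proof -
  have pure: "pure_tensor U.A {} u 1 = pt u 1 +o NU" for u
    by (simp add: pure_tensor_def)
  have Phi_pt: "Phi (pure_tensor U.A {} (U.cls q) 1) = pt (G.cls q) 1 +o NG" for q
    by (simp add: pure Phi_coset env_incl_U)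
  have ind: "induced_action L lam x (pt (G.cls q) 1 +o NG) = pt (G.cls (gen x * q)) 1 +o NG" for q
    unfolding induced_action_def Env_G ugen_G
    by (subst tensor_map_coset[OF push_left_null subspace_tensor_null]) (simp_all add: G.mult_A)
  have "pt (G.cls (gen x * sgm p)) 1 +o NG = pt (G.cls (sgm z)) 1 +o NG"
  proof -
    have "gen x * sgm p - sgm z \<in> JT" using eq by (simp add: qT.nf_eq_iff)
    moreover have "pt (G.cls (gen x * sgm p)) 1 - pt (G.cls (gen x * sgm p - sgm z)) 1 - pt (G.cls (sgm z)) 1 \<in> NG"
      using tensor_generators_mem(1)[of "G.cls (gen x * sgm p - sgm z)" G.A "G.cls (sgm z)" 1 kb] by (simp add: G.add_A)
    ultimately have "(pt (G.cls (gen x * sgm p)) 1 - pt (G.cls (gen x * sgm p - sgm z)) 1 - pt (G.cls (sgm z)) 1)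
        + pt (G.cls (gen x * sgm p - sgm z)) 1 \<in> NG"
      unfolding JT_def by (intro pm.subspace_add[OF subspace_tensor_null]) auto
    then show ?thesis unfolding coset_eq[OF subspace_tensor_null] by simp
  qed
  then have 1: "induced_action L lam x (Phi (pure_tensor U.A {} (U.cls (sgm p)) 1)) = Phi (pure_tensor U.A {} (U.cls (sgm z)) 1)"
    unfolding Phi_pt ind .
  have "pure_tensor U.A {} (U.cls (sgm z)) 1 \<in> tensor_carrier U.A {}"
    unfolding pure tensor_carrier_def using sgm_FV[of z] by (intro CollectI exI[of _ "pt (U.cls (sgm z)) 1"]) simp
  then have 2: "inv_into (tensor_carrier U.A {}) Phi (Phi (pure_tensor U.A {} (U.cls (sgm z)) 1)) = pt (U.cls (sgm z)) 1 +o NU"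
    unfolding pure by (rule inv_into_f_f[OF Phi_inj])
  have 3: "tensor_map S.A {} sigma_inv (pt (U.cls (sgm z)) 1 +o NU) = pt (S.cls z) 1 +o NS"
    by (subst tensor_map_coset[OF push_sigma_inv_null subspace_tensor_null]) (simp_all add: sigma_inv_cls[OF z])
  show ?thesis
    unfolding pi_action_def Let_def Sym_A Env_A sigma_cls[OF p] 1 2
    using 3 tensor_mu_S[OF z] unfolding sigma_inv_def by simp
qed

end

section \<open>The formulas\<close>

context graded_data begin

lemma pd_pow_len:
  "p \<in> len_le n \<Longrightarrow> (if k \<le> n then (pd i ^^ k) p \<in> len_le (n - k) else (pd i ^^ k) p = 0)"
proof (induction k)
  case (Suc k)
  consider "Suc k \<le> n" | "n = k" | "n < k" by linarith
  then show ?case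
  proof cases
    case 1
    then show ?thesis using Suc pd_len_le[of "(pd i ^^ k) p" "n - k" i] by simp
  next
    case 2
    then have "(pd i ^^ k) p \<in> len_span 0" using Suc by (simp add: len_le_def len_span_def)
    then show ?thesis using 2 pd_len_span_0 by simp
  next
    case 3
    then show ?thesis using Suc by (simp add: pd_simps)
  qed
qed simp

lemma pdK_len:
  "p \<in> len_le n \<Longrightarrow> (if (\<Sum>j\<leftarrow>l. K j) \<le> n then pdK K l p \<in> len_le (n - (\<Sum>j\<leftarrow>l. K j)) else pdK K l p = 0)"
proof (induction l)
  case (Cons j l)
  show ?case
  proof (cases "(\<Sum>j\<leftarrow>l. K j) \<le> n")
    case True
    then have "pdK K l p \<in> len_le (n - (\<Sum>j\<leftarrow>l. K j))" using Cons by simp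
    from pd_pow_len[OF this, of "K j" j] True show ?thesis by (auto simp: pdK_Cons add.commute split: if_splits)
  next
    case False
    have "(pd j ^^ k) 0 = 0" for k by (rule lin_zero[OF pd_pow_lin])
    then show ?thesis using Cons False by (simp add: pdK_Cons)
  qed
qed (simp add: pdK_def)

lemma mi_size_sum_list: "(\<Sum>j\<leftarrow>[0..<m]. K j) = mi_size r s K"
  by (simp add: mi_size_def interv_sum_list_conv_sum_set_nat atLeast0LessThan)

text \<open>With this the sums over all multi-indices have only finitely many nonzero terms on a
  given element.\<close>

lemma pdK_vanish: "p \<in> len_le n \<Longrightarrow> n < mi_size r s K \<Longrightarrow> pdK K [0..<m] p = 0"
  using pdK_len[of p n K "[0..<m]"] by (simp add: mi_size_sum_list)

lemma pdK_len_le: "p \<in> len_le n \<Longrightarrow> pdK K [0..<m] p \<in> len_le n"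
  using pdK_len[of p n K "[0..<m]"] by (auto simp: pm.subspace_0[OF subspace_len_le] split: if_splits intro: len_le_mono)

lemma fold_pdK_len_le: "p \<in> len_le n \<Longrightarrow> fold (\<lambda>K. pdK K [0..<m]) Ks p \<in> len_le n"
  by (induction Ks arbitrary: p) (simp_all add: pdK_len_le)

lemma fold_pdK_zero: "fold (\<lambda>K. pdK K [0..<m]) Ks 0 = 0"
  by (induction Ks) (simp_all add: lin_zero[OF pdK_lin])

lemma fold_pdK_vanish:
  "p \<in> len_le n \<Longrightarrow> K \<in> set Ks \<Longrightarrow> n < mi_size r s K \<Longrightarrow> fold (\<lambda>K. pdK K [0..<m]) Ks p = 0"
proof (induction Ks arbitrary: p)
  case (Cons K' Ks)
  show ?case
  proof (cases "K = K'")
    case True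
    then show ?thesis using pdK_vanish[OF Cons.prems(1)] Cons.prems(3) by (simp add: fold_pdK_zero)
  next
    case False
    then show ?thesis using Cons.IH[OF pdK_len_le[OF Cons.prems(1)]] Cons.prems by simp
  qed
qed simp

lemma pdL_len_le: "p \<in> len_le n \<Longrightarrow> pdL i Ks p \<in> len_le n"
  unfolding pdL_def by (rule fold_pdK_len_le) (simp_all add: len_le_mono[OF pd_len_le diff_le_self])

lemma pdL_vanish: "p \<in> len_le n \<Longrightarrow> K \<in> set Ks \<Longrightarrow> n < mi_size r s K \<Longrightarrow> pdL i Ks p = 0"
  unfolding pdL_def by (rule fold_pdK_vanish) (simp_all add: len_le_mono[OF pd_len_le diff_le_self])

lemma pdL_snoc: "pdL i (Ks @ [K]) p = pdK K [0..<m] (pdL i Ks p)"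
  by (simp add: pdL_def)

section \<open>Finite ranges of multi-indices and the coefficients W and H\<close>

definition "PI N = (\<Union>k\<in>{1..N}. MI k)"

lemma finite_PI: "finite (PI N)"
  by (simp add: PI_def finite_MI)

lemma MI_pos: "k \<ge> 1 \<Longrightarrow> MI k \<subseteq> pos_indices r s"
  by (auto simp: MI_def pos_indices_def mi_size_def)

lemma PI_pos: "PI N \<subseteq> pos_indices r s"
  unfolding PI_def by (rule UN_least) (rule MI_pos, simp)

lemma not_PI: "K \<in> pos_indices r s \<Longrightarrow> K \<notin> PI N \<Longrightarrow> N < mi_size r s K"
proof (rule ccontr)
  assume K: "K \<in> pos_indices r s" "K \<notin> PI N" "\<not> N < mi_size r s K"
  have mem: "K \<in> MI (mi_size r s K)" and "K \<noteq> (\<lambda>_. 0)"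
    using K(1) by (simp_all add: MI_def pos_indices_def)
  then have "mi_size r s K \<noteq> 0" by (metis MI_0 singletonD)
  then have "mi_size r s K \<in> {1..N}" using K(3) by simp
  then have "K \<in> PI N" unfolding PI_def using mem by (rule UN_I)
  then show False using K(2) by simp
qed

lemma sum_PI:
  fixes f :: "(nat \<Rightarrow> nat) \<Rightarrow> 'b::comm_monoid_add"
  shows "(\<Sum>K\<in>PI N. f K) = (\<Sum>k=1..N. \<Sum>K\<in>MI k. f K)"
  unfolding PI_def by (rule sum.UNION_disjoint) (simp_all add: finite_MI, auto simp: MI_def)

definition "PL N j = {Ks. length Ks = j \<and> set Ks \<subseteq> PI N}"

lemma finite_PL: "finite (PL N j)"
  using finite_lists_length_eq[OF finite_PI, of N j] by (simp add: PL_def conj_commute)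

lemma PL_0: "PL N 0 = {[]}"
  by (auto simp: PL_def)

lemma PL_index: "PL N j \<subseteq> index_lists r s j"
  using PI_pos[of N] unfolding PL_def index_lists_def by blast

lemma not_PL: "Ks \<in> index_lists r s j \<Longrightarrow> Ks \<notin> PL N j \<Longrightarrow> \<exists>K\<in>set Ks. N < mi_size r s K"
  using not_PI unfolding PL_def index_lists_def by blast

text \<open>Lists grow at their end, as the recursion for \<open>H_coeff\<close> continues from the
  last multi-index and the newest derivative is applied last.\<close>

lemma sum_PL_Suc:
  fixes f :: "(nat \<Rightarrow> nat) list \<Rightarrow> 'b::comm_monoid_add"
  shows "(\<Sum>Ks\<in>PL N (Suc j). f Ks) = (\<Sum>Ks\<in>PL N j. \<Sum>K\<in>PI N. f (Ks @ [K]))"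
proof -
  have "(\<Sum>Ks\<in>PL N (Suc j). f Ks) = (\<Sum>(Ks, K)\<in>PL N j \<times> PI N. f (Ks @ [K]))"
  proof (rule sum.reindex_bij_witness[where i = "\<lambda>(Ks, K). Ks @ [K]" and j = "\<lambda>Ks. (butlast Ks, last Ks)"])
    fix Ks assume "Ks \<in> PL N (Suc j)"
    then have Ks: "length Ks = Suc j" "set Ks \<subseteq> PI N" by (simp_all add: PL_def)
    then have ne: "Ks \<noteq> []" by auto
    then show "(case (butlast Ks, last Ks) of (Ks, K) \<Rightarrow> Ks @ [K]) = Ks"
      "(case (butlast Ks, last Ks) of (Ks, K) \<Rightarrow> f (Ks @ [K])) = f Ks" by simp_all
    have "set (butlast Ks) \<subseteq> set Ks" by (auto dest: in_set_butlastD)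
    then show "(butlast Ks, last Ks) \<in> PL N j \<times> PI N"
      using Ks ne last_in_set[OF ne] unfolding PL_def by (simp add: subset_iff)
  qed (auto simp: PL_def)
  then show ?thesis by (simp add: sum.cartesian_product)
qed

lemma H_coeff_Nil: "H_coeff L r s X i [] x = kp (br x (X i))"
  and H_coeff_snoc: "H_coeff L r s X i (Ks @ [K]) x = kp (WH_step L r s X K (H_coeff L r s X i Ks x))"
  and W_coeff_Nil: "W_coeff L r s X i [] x = mp (br x (X i))"
  and W_coeff_snoc: "W_coeff L r s X i (Ks @ [K]) x = mp (WH_step L r s X K (H_coeff L r s X i Ks x))"
  by (simp_all add: H_coeff_def W_coeff_def)

lemma H_coeff_k: "H_coeff L r s X i Ks x \<in> g_k L"
  by (cases Ks rule: rev_cases) (simp_all add: H_coeff_Nil H_coeff_snoc)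

lemma W_coeff_V: "W_coeff L r s X i Ks x \<in> V"
  by (simp add: W_coeff_def)

definition plus_summand :: "nat \<Rightarrow> nat \<Rightarrow> 'g \<Rightarrow> ('g list \<Rightarrow>\<^sub>0 'k) \<Rightarrow> nat \<Rightarrow> 'g list \<Rightarrow>\<^sub>0 'k" where
  "plus_summand N l x p i =
     (\<Sum>j\<in>{0..l}. \<Sum>Ks\<in>PL N j. gen (W_coeff L r s X i Ks x) * pdL i Ks p) +
     (\<Sum>j\<in>{0..<l}. \<Sum>Ks\<in>PL N j. scl (lamx (H_coeff L r s X i Ks x)) (pdL i Ks p))"

lemma subspace_gr_le: "gs.subspace {y. \<forall>d>n. gr d y = 0}"
  by (auto intro!: gs.subspaceI simp: gr_simps)

lemma br_lowers:
  assumes "\<forall>d>n. gr d y = 0" "i < m" shows "\<forall>d>n - 1. gr d (br y (X i)) = 0"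
proof (intro allI impI, rule ccontr)
  fix d assume d: "d > n - 1" "gr d (br y (X i)) \<noteq> 0"
  from d(2) obtain a b where ab: "gr a y \<noteq> 0" "gr b (X i) \<noteq> 0" "d = a + b" by (rule gr_br_nonzero)
  have "a \<le> n" using ab(1) assms(1) by (meson not_le)
  moreover have "b < 0" using ab(2) X_V[OF assms(2)] unfolding g_minus_iff by (meson not_le)
  ultimately show False using d(1) ab(3) by linarith
qed

text \<open>A positive multi-index gives at least one bracket with some \<open>X i\<close>, and such
  a bracket lowers the top degree; the inner brackets do not raise it.\<close>

lemma s_map_lowers:
  assumes "\<forall>d>n. gr d h = 0" "K \<in> pos_indices r s" shows "\<forall>d>n - 1. gr d (s_map L r s X K h) = 0"
proof -
  let ?W = "\<lambda>n. {y. \<forall>d>n. gr d y = 0}"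
  have K: "K \<in> multi_indices r s" using assms(2) by (simp add: pos_indices_def)
  obtain k where k: "mi_size r s K = Suc k"
    using not_PI[OF assms(2), of 0] by (cases "mi_size r s K") (simp_all add: PI_def)
  have *: "Sn sc (ad_tilde L) h k q \<in> ?W n" for q
  proof (rule Sn_ad_subspace[OF subspace_gr_le])
    fix x i assume "x \<in> ?W n" "i < m"
    then have "\<forall>d>n - 1. gr d (br x (X i)) = 0" using br_lowers[of n x i] by blast
    then show "br x (X i) \<in> ?W n" by simp
  qed (use assms in simp)
  have "Sn sc (ad_tilde L) h (Suc k) q \<in> ?W (n - 1)" for q
    unfolding Sn.simps ad_tilde_def[of L "X _"]
  proof (intro gs.subspace_scale[OF subspace_gr_le] gs.subspace_sum[OF subspace_gr_le] CollectI)
    fix i assume "i \<in> {..<m}"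
    then show "\<forall>d>n - 1. gr d (br (Sn sc (ad_tilde L) h k (pd i q)) (X i)) = 0"
      using *[of "pd i q"] by (intro br_lowers) auto
  qed
  then show ?thesis unfolding s_map_conv[OF K] k by blast
qed

lemma gr_kp: "gr d v = 0 \<Longrightarrow> gr d (kp v) = 0"
proof (cases "d < 0")
  case True
  then show ?thesis using kp_k[of v] by (simp add: g_k_iff del: kp_k)
next
  case False
  assume "gr d v = 0"
  moreover have "gr d (mp v) = 0" using False mp_V[of v] by (simp add: g_minus_iff del: mp_V)
  ultimately show ?thesis by (simp add: kp_eq gr_simps)
qed

lemma H_coeff_lowers:
  assumes "\<forall>d>n. gr d x = 0" "i < m" "set Ks \<subseteq> pos_indices r s"
  shows "\<forall>d>n - 1 - int (length Ks). gr d (H_coeff L r s X i Ks x) = 0"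
  using assms(3)
proof (induction Ks rule: rev_induct)
  case Nil
  then show ?case using br_lowers[OF assms(1,2)] by (simp add: H_coeff_Nil gr_kp)
next
  case (snoc K Ks)
  have "\<forall>d>n - 1 - int (length Ks) - 1. gr d (s_map L r s X K (H_coeff L r s X i Ks x)) = 0"
    by (rule s_map_lowers) (use snoc in auto)
  then show ?case by (simp add: H_coeff_snoc WH_step_def gr_kp gr_simps)
qed

lemma H_vanish_exists: "\<exists>l\<ge>1. H_vanish L r s X x l"
proof -
  \<comment> \<open>\<open>b\<close> bounds all degrees that occur. After \<open>nat b + 1\<close>
    steps the top degree of \<open>H_coeff\<close> has become negative, while its values lie in
    \<open>g_k L\<close>.\<close>
  obtain b where b: "\<And>d. d \<in> D \<Longrightarrow> d \<le> b" using finite_D by (intro that[of "Max D"]) simp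
  then have x: "\<forall>d>b. gr d x = 0" using gr_outside[of _ x] by (meson not_le)
  have "H_coeff L r s X i Ks x = 0" if "i < m" "Ks \<in> index_lists r s (nat b + 1)" for i Ks
  proof (rule gr_ext)
    fix d
    have l: "length Ks = nat b + 1" "set Ks \<subseteq> pos_indices r s" using that by (auto simp: index_lists_def)
    show "gr d (H_coeff L r s X i Ks x) = gr d 0"
    proof (cases "d < 0")
      case True
      then show ?thesis using H_coeff_k[of i Ks x] by (simp add: g_k_iff gr_simps)
    next
      case False
      then have "d > b - 1 - int (length Ks)" using l(1) by simp
      then show ?thesis using H_coeff_lowers[OF x that(1) l(2)] by (simp add: gr_simps)
    qed
  qed
  then show ?thesis by (intro exI[of _ "nat b + 1"]) (simp add: H_vanish_def)
qed

end

context graded_module begin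

text \<open>In \<open>BG_weight\<close> the powers of D are written with \<open>s_map\<close>, and
  each coefficient is split. Its negative part turns into an honest product by
  \<open>BG_of_V\<close>; its part in \<open>g_k L\<close> leaves a term of the original
  kind.\<close>

lemma BG_step:
  assumes w: "\<And>h. h \<in> g_k L \<Longrightarrow> act h v = sm (lamx h) v" and h: "h \<in> g_k L" and q: "q \<in> len_le N"
  shows "BG h q = sm (lamx h) (SG q) + (\<Sum>K\<in>PI N. SG (gen (mp (WH_step L r s X K h)) * pdK K [0..<m] q)
      + BG (kp (WH_step L r s X K h)) (pdK K [0..<m] q))"
proof -
  have BGadd: "BG y u = SG (gen (mp y) * u) + BG (kp y) u" for y u
    using bilinD(3)[OF bilin_BG, of "mp y" "kp y" u] by (simp add: mp_kp BG_of_V)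
  have "(\<Sum>k=1..N. sm ((- 1) ^ k * C_coeff k / fact k) ((DD ^^ k) BG h q)) =
      (\<Sum>k=1..N. \<Sum>K\<in>MI k. BG (WH_step L r s X K h) (pdK K [0..<m] q))"
  proof (rule sum.cong[OF refl])
    fix k
    have "sm ((- 1) ^ k * C_coeff k / fact k) ((DD ^^ k) BG h q) =
       sm ((- 1) ^ k * C_coeff k) (\<Sum>K\<in>MI k. sm (1 / mi_fact r K) (BG (s_map L r s X K h) (pdK K [0..<m] q)))"
      by (simp add: DDk_s_map[OF bilin_BG])
    also have "\<dots> = (\<Sum>K\<in>MI k. BG (WH_step L r s X K h) (pdK K [0..<m] q))"
      unfolding vm.scale_sum_right
      by (rule sum.cong[OF refl]) (simp add: MI_def WH_step_def bilinD(1)[OF bilin_BG])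
    finally show "sm ((- 1) ^ k * C_coeff k / fact k) ((DD ^^ k) BG h q) =
       (\<Sum>K\<in>MI k. BG (WH_step L r s X K h) (pdK K [0..<m] q))" .
  qed
  also have "\<dots> = (\<Sum>K\<in>PI N. BG (WH_step L r s X K h) (pdK K [0..<m] q))" by (simp only: sum_PI)
  also have "\<dots> = (\<Sum>K\<in>PI N. SG (gen (mp (WH_step L r s X K h)) * pdK K [0..<m] q)
      + BG (kp (WH_step L r s X K h)) (pdK K [0..<m] q))"
    by (rule sum.cong[OF refl]) (rule BGadd)
  finally show ?thesis
    by (intro trans[OF BG_weight[OF w h q]] arg_cong[where f = "\<lambda>t. sm (lamx h) (SG q) + t"])
qed

text \<open>\<open>BG_step\<close> applied \<open>l\<close> times to the part in
  \<open>g_k L\<close>. Each application releases one layer of W terms and one layer of character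
  terms, so the W terms are one layer ahead, starting with the split of \<open>[x, X i]\<close>
  itself.\<close>

lemma BG_iterate:
  assumes w: "\<And>h. h \<in> g_k L \<Longrightarrow> act h v = sm (lamx h) v" and p: "p \<in> len_le N"
  shows "BG (br x (X i)) (pd i p) = SG (plus_summand N l x p i) +
    (\<Sum>Ks\<in>PL N l. BG (H_coeff L r s X i Ks x) (pdL i Ks p))"
proof (induction l)
  case 0
  have "BG (br x (X i)) (pd i p) = BG (mp (br x (X i))) (pd i p) + BG (kp (br x (X i))) (pd i p)"
    using bilinD(3)[OF bilin_BG, of "mp (br x (X i))" "kp (br x (X i))" "pd i p"] by (simp add: mp_kp)
  then show ?case
    by (simp add: plus_summand_def PL_0 W_coeff_Nil H_coeff_Nil pdL_def BG_of_V)
next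
  case (Suc l)
  let ?H = "\<lambda>Ks. H_coeff L r s X i Ks x" and ?W = "\<lambda>Ks. W_coeff L r s X i Ks x"
  have "(\<Sum>Ks\<in>PL N l. BG (?H Ks) (pdL i Ks p)) =
      (\<Sum>Ks\<in>PL N l. sm (lamx (?H Ks)) (SG (pdL i Ks p)) + (\<Sum>K\<in>PI N. SG (gen (?W (Ks @ [K])) * pdL i (Ks @ [K]) p)
      + BG (?H (Ks @ [K])) (pdL i (Ks @ [K]) p)))"
    by (rule sum.cong[OF refl]) (simp only: H_coeff_snoc W_coeff_snoc pdL_snoc BG_step[OF w H_coeff_k pdL_len_le[OF p]])
  also have "\<dots> = (\<Sum>Ks\<in>PL N l. sm (lamx (?H Ks)) (SG (pdL i Ks p))) + ((\<Sum>Ks\<in>PL N (Suc l). SG (gen (?W Ks) * pdL i Ks p))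
      + (\<Sum>Ks\<in>PL N (Suc l). BG (?H Ks) (pdL i Ks p)))"
    by (simp only: sum.distrib sum_PL_Suc)
  finally show ?case
    unfolding Suc by (simp add: plus_summand_def SG_simps lin_sum[OF SG_lin] add_ac)
qed

end

section \<open>Evaluation of the action on the three parts of the Lie superalgebra\<close>

context graded_data begin

text \<open>The theorem has the Bernoulli coefficient inside the generator, the computation has it
  outside.\<close>

lemma gen_scale_cls:
  assumes "y \<in> V" "q \<in> FV" shows "S.cls (gen (sc c y) * q) = S.cls (scl c (gen y * q))"
proof -
  have "nfS (gen (sc c y) * q) = nfS (scl c (gen y) * q)"
    by (rule qS.nf_cong) (simp_all add: lin_scale[OF genS_lin] qS.nf_simps)
  then show ?thesis
    using assms by (subst S_cls_nf)
      (auto simp: scl_mult_left intro!: lists_span_mult pm.subspace_scale[OF subspace_lists_span] gs.subspace_scale[OF subspace_V])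
qed

lemma plus_summand_FV: "p \<in> FV \<Longrightarrow> plus_summand N l x p i \<in> FV"
  unfolding plus_summand_def
  by (intro pm.subspace_add[OF subspace_lists_span] pm.subspace_sum[OF subspace_lists_span]
      pm.subspace_scale[OF subspace_lists_span] lists_span_mult pdL_FV) (simp_all add: W_coeff_V)

lemma pi_action_minus:
  assumes x: "x \<in> V" and p: "p \<in> FV"
  shows "pi_action L lam x (S.cls p) = sgen L V x \<otimes>\<^bsub>S.A\<^esub> S.cls p \<oplus>\<^bsub>S.A\<^esub>
     supp_finsum S.A
       (\<lambda>K. sgen L V (sc ((- 1) ^ mi_size r s K * bernoulli (mi_size r s K) / mi_fact r K) (s_map L r s X K x))
            \<otimes>\<^bsub>S.A\<^esub> partial_pow L r s X K (S.cls p))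
       (pos_indices r s)"
proof -
  obtain N where N: "p \<in> len_le N" using len_le_exists by blast
  define c where "c K = ((- 1) ^ mi_size r s K * bernoulli (mi_size r s K) / mi_fact r K :: 'k)" for K
  let ?f = "\<lambda>K. scl (c K) (gen (s_map L r s X K x) * pdK K [0..<m] p)"
  have sV: "s_map L r s X K x \<in> V" if "K \<in> pos_indices r s" for K
    using that x by (intro s_map_V) (auto simp: pos_indices_def)
  have F: "?f K \<in> FV" if "K \<in> pos_indices r s" for K
    using sV[OF that] p by (intro pm.subspace_scale[OF subspace_lists_span] lists_span_mult pdK_FV) auto
  have xp: "gen x * p \<in> FV" using x p by (intro lists_span_mult) auto
  have "nfT (gen x * sgm p) = nfT (sgm (minus_formula N x p))"
    using T.act_SG_V[OF x N] unfolding T_SG by simp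
  from pi_cls[OF p minus_formula_FV[OF x p] this]
  have "pi_action L lam x (S.cls p) = S.cls (minus_formula N x p)" .
  also have "minus_formula N x p = gen x * p + (\<Sum>K\<in>PI N. ?f K)"
  proof -
    have "minus_formula N x p = (\<Sum>k\<le>N. \<Sum>K\<in>MI k. ?f K)"
      unfolding minus_formula_def by (intro sum.cong refl) (simp add: MI_def c_def)
    \<comment> \<open>The only multi-index of size zero has coefficient 1 and yields the product
      with \<open>x\<close>, which the formula lists separately.\<close>
    also have "\<dots> = (\<Sum>K\<in>MI 0. ?f K) + (\<Sum>k=1..N. \<Sum>K\<in>MI k. ?f K)"
      unfolding atMost_atLeast0 by (simp add: sum.atLeast_Suc_atMost)
    also have "(\<Sum>K\<in>MI 0. ?f K) = gen x * p"
      by (simp add: MI_0 c_def s_map_zero pdK_zero mi_size_def mi_fact_def)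
    finally show ?thesis by (simp only: sum_PI)
  qed
  also have "S.cls \<dots> = S.cls (gen x * p) \<oplus>\<^bsub>S.A\<^esub> S.cls (\<Sum>K\<in>PI N. ?f K)"
    by (rule S.add_A[symmetric, OF xp pm.subspace_sum[OF subspace_lists_span]]) (use F PI_pos[of N] in blast)
  also have "S.cls (gen x * p) = sgen L V x \<otimes>\<^bsub>S.A\<^esub> S.cls p"
    using x p by (simp add: sgen_cls S.mult_A)
  also have "S.cls (\<Sum>K\<in>PI N. ?f K) = supp_finsum S.A
       (\<lambda>K. sgen L V (sc (c K) (s_map L r s X K x)) \<otimes>\<^bsub>S.A\<^esub> partial_pow L r s X K (S.cls p)) (pos_indices r s)"
  proof (rule S.supp_finsum_A[symmetric])
    fix K assume K: "K \<in> pos_indices r s"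
    show "?f K \<in> FV" by (rule F[OF K])
    have "sgen L V (sc (c K) (s_map L r s X K x)) \<otimes>\<^bsub>S.A\<^esub> partial_pow L r s X K (S.cls p) =
        S.cls (gen (sc (c K) (s_map L r s X K x)) * pdK K [0..<m] p)"
      unfolding sgen_cls partial_pow_cls[OF p]
      using gs.subspace_scale[OF subspace_V sV[OF K]] pdK_FV[OF p] by (intro S.mult_A) auto
    also have "\<dots> = S.cls (?f K)" by (rule gen_scale_cls[OF sV[OF K] pdK_FV[OF p]])
    finally show "sgen L V (sc (c K) (s_map L r s X K x)) \<otimes>\<^bsub>S.A\<^esub> partial_pow L r s X K (S.cls p) = S.cls (?f K)" .
    show "?f K \<in> S.I" if "K \<notin> PI N"
      using pdK_vanish[OF N not_PI[OF K that]] by (simp add: S.I_zero)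
  qed (simp_all add: finite_PI PI_pos)
  finally show ?thesis unfolding c_def .
qed

text \<open>Brackets with an element of degree zero keep \<open>X i\<close> in the negative part, so
  the terms of D \<open>BG\<close> are products and no iteration occurs.\<close>

lemma pi_action_zero:
  assumes x: "x \<in> grade L 0" and p: "p \<in> FV"
  shows "pi_action L lam x (S.cls p) = lam x \<odot>\<^bsub>S.A\<^esub> S.cls p \<oplus>\<^bsub>S.A\<^esub>
     finsum S.A (\<lambda>i. sgen L V (br x (X i)) \<otimes>\<^bsub>S.A\<^esub> partial L r s X i (S.cls p)) {..<m}"
proof -
  have bV: "br x (X i) \<in> V" if "i < m" for i
    unfolding g_minus_iff
  proof (intro allI impI, rule ccontr)
    fix k :: int assume k: "0 \<le> k" "gr k (br x (X i)) \<noteq> 0"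
    from k(2) obtain a b where ab: "gr a x \<noteq> 0" "gr b (X i) \<noteq> 0" "k = a + b" by (rule gr_br_nonzero)
    have "a = 0" using ab(1) gr_hom[OF x, of a] by (simp split: if_splits)
    moreover have "b < 0" using ab(2) X_V[OF that] unfolding g_minus_iff by (meson not_le)
    ultimately show False using k(1) ab(3) by simp
  qed
  let ?f = "\<lambda>i. gen (br x (X i)) * pd i p"
  have F: "?f i \<in> FV" if "i < m" for i using bV[OF that] p by (intro lists_span_mult pd_FV) auto
  have F1: "scl (lam x) p \<in> FV" and F2: "(\<Sum>i<m. ?f i) \<in> FV"
    using p F by (auto intro!: pm.subspace_scale[OF subspace_lists_span] pm.subspace_sum[OF subspace_lists_span])
  have "actT x (T.SG p) = scl (lamx x) (T.SG p) + T.DD T.BG x p"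
    by (rule T.act_SG_weight[OF T_weight grade_0_k[OF x]])
  also have "\<dots> = T.SG (scl (lam x) p + (\<Sum>i<m. ?f i))"
    using T.DD_apply[of T.BG x p] bV by (simp add: T.BG_of_V T.SG_simps lin_sum[OF T.SG_lin] lamx_grade_0[OF x])
  finally have "nfT (gen x * sgm p) = nfT (sgm (scl (lam x) p + (\<Sum>i<m. ?f i)))" unfolding T_SG by simp
  from pi_cls[OF p pm.subspace_add[OF subspace_lists_span F1 F2] this]
  have "pi_action L lam x (S.cls p) = S.cls (scl (lam x) p) \<oplus>\<^bsub>S.A\<^esub> S.cls (\<Sum>i<m. ?f i)"
    using F1 F2 by (simp add: S.add_A)
  also have "S.cls (\<Sum>i<m. ?f i) =
      finsum S.A (\<lambda>i. sgen L V (br x (X i)) \<otimes>\<^bsub>S.A\<^esub> partial L r s X i (S.cls p)) {..<m}"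
  proof (rule S.finsum_eq_cls[symmetric])
    fix i assume i: "i \<in> {..<m}"
    then show "?f i \<in> FV" using F by simp
    have "gen (br x (X i)) \<in> FV" using bV i by simp
    then show "sgen L V (br x (X i)) \<otimes>\<^bsub>S.A\<^esub> partial L r s X i (S.cls p) = S.cls (?f i)"
      using i p by (simp add: sgen_cls partial_cls S.mult_A pd_FV)
  qed
  finally show ?thesis using p by (simp add: S.smult_A)
qed

lemma pi_action_plus:
  assumes x: "x \<in> g_plus L" and p: "p \<in> FV" and l: "l \<ge> 1" "H_vanish L r s X x l"
  shows "pi_action L lam x (S.cls p) =
      finsum S.A (\<lambda>i. finsum S.A (\<lambda>j. supp_finsum S.A
          (\<lambda>Ks. sgen L V (W_coeff L r s X i Ks x) \<otimes>\<^bsub>S.A\<^esub> partial_list L r s X i Ks (S.cls p))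
          (index_lists r s j)) {0..l}) {..<m}
      \<oplus>\<^bsub>S.A\<^esub>
      finsum S.A (\<lambda>i. finsum S.A (\<lambda>j. supp_finsum S.A
          (\<lambda>Ks. lamx (H_coeff L r s X i Ks x) \<odot>\<^bsub>S.A\<^esub> partial_list L r s X i Ks (S.cls p))
          (index_lists r s j)) {0..l - 1}) {..<m}"
proof -
  obtain N where N: "p \<in> len_le N" using len_le_exists by blast
  let ?W = "\<lambda>i Ks. gen (W_coeff L r s X i Ks x) * pdL i Ks p"
  let ?H = "\<lambda>i Ks. scl (lamx (H_coeff L r s X i Ks x)) (pdL i Ks p)"
  have FW: "?W i Ks \<in> FV" for i Ks using p by (intro lists_span_mult pdL_FV) (auto simp: W_coeff_V)
  have FH: "?H i Ks \<in> FV" for i Ks using p by (intro pm.subspace_scale[OF subspace_lists_span] pdL_FV)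
  \<comment> \<open>This is where \<open>l \<ge> 1\<close> enters: subtraction truncates, and for
    \<open>l = 0\<close> the right-hand side would still contain 0.\<close>
  have ix: "{0..<l} = {0..l - 1}" using l(1) by auto
  have van: "pdL i Ks p = 0" if Ks: "Ks \<in> index_lists r s j" "Ks \<notin> PL N j" for i j Ks
  proof -
    obtain K where "K \<in> set Ks" "N < mi_size r s K" using not_PL[OF Ks] by blast
    then show ?thesis by (rule pdL_vanish[OF N])
  qed
  \<comment> \<open>The choice of \<open>l\<close> makes the remainder after \<open>l\<close>
    iterations vanish.\<close>
  have "(\<Sum>Ks\<in>PL N l. T.BG (H_coeff L r s X i Ks x) (pdL i Ks p)) = 0" if "i < m" for i
  proof (rule sum.neutral, rule ballI)
    fix Ks assume "Ks \<in> PL N l"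
    then have "H_coeff L r s X i Ks x = 0" using l(2) PL_index[of N l] that unfolding H_vanish_def by blast
    then show "T.BG (H_coeff L r s X i Ks x) (pdL i Ks p) = 0" by (simp add: T.bilinD(5)[OF T.bilin_BG])
  qed
  then have it: "T.BG (br x (X i)) (pd i p) = T.SG (plus_summand N l x p i)" if "i < m" for i
    using T.BG_iterate[where l = l and x = x and i = i, OF T_weight N] that by simp
  have "actT x (T.SG p) = scl (lamx x) (T.SG p) + T.DD T.BG x p"
    by (rule T.act_SG_weight[OF T_weight g_plus_k[OF x]])
  \<comment> \<open>The extended character is zero on \<open>g_plus L\<close>, which removes the
    scalar term; the bracket terms are replaced by their iterated expansion.\<close>
  also have "\<dots> = T.SG (\<Sum>i<m. plus_summand N l x p i)"
    using T.DD_apply[of T.BG x p] by (simp add: it lin_sum[OF T.SG_lin] lamx_plus[OF x])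
  finally have "nfT (gen x * sgm p) = nfT (sgm (\<Sum>i<m. plus_summand N l x p i))" unfolding T_SG by simp
  from pi_cls[OF p _ this]
  have "pi_action L lam x (S.cls p) = S.cls (\<Sum>i<m. plus_summand N l x p i)"
    using plus_summand_FV[OF p] by (simp add: pm.subspace_sum[OF subspace_lists_span])
  also have "\<dots> = S.cls ((\<Sum>i<m. \<Sum>j\<in>{0..l}. \<Sum>Ks\<in>PL N j. ?W i Ks) + (\<Sum>i<m. \<Sum>j\<in>{0..l - 1}. \<Sum>Ks\<in>PL N j. ?H i Ks))"
    unfolding plus_summand_def sum.distrib ix ..
  also have "\<dots> = S.cls (\<Sum>i<m. \<Sum>j\<in>{0..l}. \<Sum>Ks\<in>PL N j. ?W i Ks) \<oplus>\<^bsub>S.A\<^esub>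
      S.cls (\<Sum>i<m. \<Sum>j\<in>{0..l - 1}. \<Sum>Ks\<in>PL N j. ?H i Ks)"
    by (rule S.add_A[symmetric]) (intro pm.subspace_sum[OF subspace_lists_span] FW FH)+
  also have "S.cls (\<Sum>i<m. \<Sum>j\<in>{0..l}. \<Sum>Ks\<in>PL N j. ?W i Ks) =
      finsum S.A (\<lambda>i. finsum S.A (\<lambda>j. supp_finsum S.A
          (\<lambda>Ks. sgen L V (W_coeff L r s X i Ks x) \<otimes>\<^bsub>S.A\<^esub> partial_list L r s X i Ks (S.cls p))
          (index_lists r s j)) {0..l}) {..<m}"
  proof (rule sym, intro S.finsum_eq_cls S.supp_finsum_A pm.subspace_sum[OF subspace_lists_span] FW finite_PL PL_index)
    fix i j Ks assume i: "i \<in> {..<m}" and Ks: "Ks \<in> index_lists r s j"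
    show "sgen L V (W_coeff L r s X i Ks x) \<otimes>\<^bsub>S.A\<^esub> partial_list L r s X i Ks (S.cls p) = S.cls (?W i Ks)"
      using i p by (simp add: sgen_cls partial_list_cls S.mult_A pdL_FV W_coeff_V)
    show "?W i Ks \<in> S.I" if "Ks \<notin> PL N j" using van[OF Ks that] by (simp add: S.I_zero)
  qed
  also have "S.cls (\<Sum>i<m. \<Sum>j\<in>{0..l - 1}. \<Sum>Ks\<in>PL N j. ?H i Ks) =
      finsum S.A (\<lambda>i. finsum S.A (\<lambda>j. supp_finsum S.A
          (\<lambda>Ks. lamx (H_coeff L r s X i Ks x) \<odot>\<^bsub>S.A\<^esub> partial_list L r s X i Ks (S.cls p))
          (index_lists r s j)) {0..l - 1}) {..<m}"
  proof (rule sym, intro S.finsum_eq_cls S.supp_finsum_A pm.subspace_sum[OF subspace_lists_span] FH finite_PL PL_index)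
    fix i j Ks assume i: "i \<in> {..<m}" and Ks: "Ks \<in> index_lists r s j"
    show "lamx (H_coeff L r s X i Ks x) \<odot>\<^bsub>S.A\<^esub> partial_list L r s X i Ks (S.cls p) = S.cls (?H i Ks)"
      using i p by (simp add: partial_list_cls S.smult_A pdL_FV)
    show "?H i Ks \<in> S.I" if "Ks \<notin> PL N j" using van[OF Ks that] by (simp add: S.I_zero)
  qed
  finally show ?thesis .
qed

end

theorem theorem3p4:
  fixes L :: "('k::real_or_complex, 'g::ab_group_add) lsa"
    and lam :: "'g \<Rightarrow> 'k"
    and X :: "nat \<Rightarrow> 'g"
    and r s :: nat
  assumes "graded_lie_superalgebra L"
    and "finite_dimensional L"
    and "homogeneous_basis L r s X"
    and "lsa_character L lam"
  shows
    "let V = g_minus L; S = Sym L V in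
    (\<forall>x\<in>g_minus L. \<forall>Y\<in>carrier S.
       pi_action L lam x Y =
         sgen L V x \<otimes>\<^bsub>S\<^esub> Y \<oplus>\<^bsub>S\<^esub>
         supp_finsum S
           (\<lambda>K. sgen L V (lscale L ((- 1) ^ mi_size r s K * bernoulli (mi_size r s K) / mi_fact r K)
                            (s_map L r s X K x))
                \<otimes>\<^bsub>S\<^esub> partial_pow L r s X K Y)
           (pos_indices r s)) \<and>
    (\<forall>x\<in>grade L 0. \<forall>Y\<in>carrier S.
       pi_action L lam x Y =
         lam x \<odot>\<^bsub>S\<^esub> Y \<oplus>\<^bsub>S\<^esub>
         finsum S (\<lambda>i. sgen L V (lbracket L x (X i)) \<otimes>\<^bsub>S\<^esub> partial L r s X i Y) {..<r + s}) \<and>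
    (\<forall>x\<in>g_plus L.
       (\<exists>l\<ge>1. H_vanish L r s X x l) \<and>
       (\<forall>l\<ge>1. H_vanish L r s X x l \<longrightarrow>
         (\<forall>Y\<in>carrier S.
            pi_action L lam x Y =
              finsum S (\<lambda>i. finsum S (\<lambda>j.
                  supp_finsum S
                    (\<lambda>Ks. sgen L V (W_coeff L r s X i Ks x) \<otimes>\<^bsub>S\<^esub> partial_list L r s X i Ks Y)
                    (index_lists r s j)) {0..l}) {..<r + s}
              \<oplus>\<^bsub>S\<^esub>
              finsum S (\<lambda>i. finsum S (\<lambda>j.
                  supp_finsum S
                    (\<lambda>Ks. extend_character L lam (H_coeff L r s X i Ks x) \<odot>\<^bsub>S\<^esub> partial_list L r s X i Ks Y)
                    (index_lists r s j)) {0..l - 1}) {..<r + s})))"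
proof -
  interpret graded_data L lam X r s
    by unfold_locales (rule assms)+
  have cases: "P Y" if "Y \<in> carrier S.A" "\<And>p. p \<in> FV \<Longrightarrow> P (S.cls p)" for P Y
    using that by (blast elim: S_carrier)
  show ?thesis
    unfolding Let_def Sym_A
    by (intro conjI ballI allI impI H_vanish_exists; erule cases)
      (rule pi_action_minus pi_action_zero pi_action_plus; assumption)+
qed

end
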